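(* Let $Y$ be a smooth projective curve over $k$, let $\mathfrak{D}$ be a smooth $\sigma$-polyhedral divisor on $Y$ with $N=\mathbb Z$ and $\sigma=\mathbb{Q}_{\ge0}$, and let $X=\operatorname{Spec} A[Y,\mathfrak{D}]$ be the associated surface. Write $\mathfrak{D}_1=\mathfrak{D}(1)=\sum_{i=1}^{\ell}\frac{p_i}{q_i}z_i$ with distinct points $z_i\in Y$, $\gcd(p_i,q_i)=1$ and $q_i>0$, and let $$m_G=\frac{1}{\deg\mathfrak{D}_1}\left(\deg K_Y+\sum_{i=1}^{\ell}\frac{q_i-1}{q_i}\right),\qquad D_G=\sum_{i=1}^{\ell}d_iz_i,\quad d_i=\frac{p_im_G+1}{q_i}-1 .$$ Then $X$ has Gorenstein singularities if and only if $m_G$ is integral and $D_G-K_Y$ is a principal divisor on $Y$.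
   Context: Let $k$ be an algebraically closed field of characteristic $0$. Take $N=\mathbb{Z}$, $M=\operatorname{Hom}(N,\mathbb Z)\simeq\mathbb{Z}$, $\sigma=\mathbb{Q}_{\ge0}\subseteq N_{\mathbb{Q}}=\mathbb Q$, so $\sigma^\vee_M=\mathbb{Z}_{\ge0}$. A $\sigma$-polyhedral divisor on the smooth projective curve $Y$ is a formal finite sum $\mathfrak{D}=\sum_z\Delta_z\cdot z$ over points $z\in Y$, where each $\Delta_z\subseteq\mathbb Q$ is the Minkowski sum of a compact polyhedron and $\sigma$, and $\Delta_z=\sigma$ for all but finitely many $z$; for $m\in\sigma^\vee$ put $\mathfrak{D}(m)=\sum_z\min(m\,\Delta_z)\,z$, so $\mathfrak{D}(m)=m\mathfrak{D}(1)$ and $\mathfrak{D}$ is determined by the $\mathbb{Q}$-divisor $\mathfrak{D}_1:=\mathfrak{D}(1)$. $\mathfrak{D}$ is proper if $\mathfrak{D}(m)$ is a semiample $\mathbb Q$-divisor for all $m\in\mathbb Z_{\ge0}$ and is big for all $m>0$ (in the present case: $\deg\mathfrak{D}_1>0$). A $\sigma$-polyhedral divisor is smooth if $Y$ is smooth, $\mathfrak D$ is proper and its support is SNC; on a smooth curve every proper one is smooth. For a $\mathbb{Q}$-divisor $E$ on $Y$, $\mathcal{O}_Y(E):=\mathcal{O}_Y(\lfloor E\rfloor)$, and $A[Y,\mathfrak{D}]=\bigoplus_{m\ge0}H^0(Y,\mathcal{O}_Y(m\mathfrak{D}_1))\chi^m$, with multiplication induced from $k(Y)$. $X=\operatorname{Spec}A[Y,\mathfrak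 D]$ is a normal affine surface with a $k^*$-action. $K_Y$ denotes a canonical divisor of $Y$. A variety is Gorenstein if it is Cohen-Macaulay and its canonical divisor is Cartier. A $\mathbb Q$-divisor is principal if it equals $\operatorname{div}(f)$ for some nonzero rational function $f$ (in particular it has integer coefficients). *)

theory Defs
  imports
    "HOL-Algebra.Algebraic_Closure_Type"
    "HOL-Algebra.Generated_Rings"
    "HOL-Library.Extended_Nat"
    "Jordan_Normal_Form.Determinant"
begin

section \<open>Subrings of a field, given by their carrier sets\<close>

text \<open>All integral domains below are subrings of a field which is a type; the ideal-theoretic notions
  of HOL-Algebra are applied to the induced ring record.\<close>

definition ring_on :: "'a::field set \<Rightarrow> 'a ring"
  where "ring_on A = ring_of_type_algebra\<lparr>carrier := A\<rparr>"

definition spec :: "'a::field set \<Rightarrow> 'a set set"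
  where "spec A = {P. primeideal P (ring_on A)}"

definition frac_field :: "'a::field set \<Rightarrow> 'a set"
  where "frac_field A = {a / b | a b. a \<in> A \<and> b \<in> A \<and> b \<noteq> 0}"

definition localize :: "'a::field set \<Rightarrow> 'a set \<Rightarrow> 'a set"
  where "localize A P = {a / b | a b. a \<in> A \<and> b \<in> A \<and> b \<notin> P}"

definition krull_dim :: "'a::field set \<Rightarrow> enat"
  where "krull_dim A = Sup {enat n | n.
    \<exists>P. (\<forall>i\<le>n. P i \<in> spec A) \<and> (\<forall>i<n. P i \<subset> P (Suc i))}"

definition height :: "'a::field set \<Rightarrow> 'a set \<Rightarrow> enat"
  where "height A P = krull_dim (localize A P)"

subsection \<open>Local rings\<close>

text \<open>The set of non-units, i.e. the maximal ideal when the ring is local (recall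
  \<open>inverse 0 = 0\<close>).\<close>

definition max_ideal :: "'a::field set \<Rightarrow> 'a set"
  where "max_ideal R = {x \<in> R. x = 0 \<or> inverse x \<notin> R}"

definition regular_local_ring :: "'a::field set \<Rightarrow> bool"
  where "regular_local_ring R \<longleftrightarrow>
    (\<exists>S. finite S \<and> enat (card S) = krull_dim R \<and> S \<subseteq> R \<and> max_ideal R = genideal (ring_on R) S)"

definition regular_sequence :: "'a::field set \<Rightarrow> 'a list \<Rightarrow> bool"
  where "regular_sequence R xs \<longleftrightarrow> set xs \<subseteq> R \<and>
    (\<forall>i<length xs. \<forall>a\<in>R. xs ! i * a \<in> genideal (ring_on R) (set (take i xs)) \<longrightarrow>
       a \<in> genideal (ring_on R) (set (take i xs))) \<and>
    genideal (ring_on R) (set xs) \<noteq> R"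

definition depth :: "'a::field set \<Rightarrow> enat"
  where "depth R = Sup {enat (length xs) | xs. regular_sequence R xs \<and> set xs \<subseteq> max_ideal R}"

definition cohen_macaulay_local :: "'a::field set \<Rightarrow> bool"
  where "cohen_macaulay_local R \<longleftrightarrow> depth R = krull_dim R"

text \<open>Order of a non-zero element of the fraction field with respect to a discrete valuation ring.\<close>

definition uniformizer :: "'a::field set \<Rightarrow> 'a \<Rightarrow> bool"
  where "uniformizer R t \<longleftrightarrow> t \<noteq> 0 \<and> max_ideal R = (*) t ` R"

definition ord_at :: "'a::field set \<Rightarrow> 'a \<Rightarrow> int"
  where "ord_at R f = (THE e. \<exists>t u. uniformizer R t \<and> u \<noteq> 0 \<and> u \<in> R \<and> inverse u \<in> R \<and>
    f = u * t powi e)"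

section \<open>Rational differential forms of top degree\<close>

definition derivations :: "'a::field set \<Rightarrow> 'a set \<Rightarrow> ('a \<Rightarrow> 'a) set"
  where "derivations C F = {D. D ` F \<subseteq> F \<and> (\<forall>c\<in>C. D c = 0) \<and>
    (\<forall>x\<in>F. \<forall>y\<in>F. D (x + y) = D x + D y \<and> D (x * y) = x * D y + y * D x)}"

text \<open>Let \<open>F\<close> be a function field of transcendence degree \<open>n\<close> over a field \<open>C\<close> of characteristic 0.
  Kaehler \<open>n\<close>-forms of \<open>F\<close> over \<open>C\<close> are represented by alternating \<open>n\<close>-linear functions on the
  \<open>C\<close>-derivations of \<open>F\<close>, so that \<open>dx\<^sub>0 \<and> \<dots> \<and> dx\<^sub>n\<^sub>-\<^sub>1\<close> becomes
  \<open>(D\<^sub>0, \<dots>, D\<^sub>n\<^sub>-\<^sub>1) \<mapsto> det (D\<^sub>i x\<^sub>j)\<close>. The value is 0 at tuples that do not consist of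
  derivations, so that equality of forms is equality of functions.\<close>

definition wedge_d ::
    "'a::field set \<Rightarrow> 'a set \<Rightarrow> nat \<Rightarrow> (nat \<Rightarrow> 'a) \<Rightarrow> (nat \<Rightarrow> 'a \<Rightarrow> 'a) \<Rightarrow> 'a"
  where "wedge_d C F n x D =
    (if \<forall>i<n. D i \<in> derivations C F then det (mat n n (\<lambda>(i, j). D i (x j))) else 0)"

text \<open>The \<open>R\<close>-module generated by \<open>dx\<^sub>0 \<and> \<dots> \<and> dx\<^sub>n\<^sub>-\<^sub>1\<close>, \<open>x\<^sub>j \<in> R\<close>: the image of the
  \<open>n\<close>-forms of \<open>R\<close> in the \<open>n\<close>-forms of its fraction field.\<close>

definition forms :: "'a::field set \<Rightarrow> nat \<Rightarrow> 'a set \<Rightarrow> ((nat \<Rightarrow> 'a \<Rightarrow> 'a) \<Rightarrow> 'a) set"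
  where "forms C n R = {\<lambda>D. \<Sum>i<r. a i * wedge_d C (frac_field R) n (x i) D | (r::nat) a x.
    \<forall>i<r. a i \<in> R \<and> (\<forall>j<n. x i j \<in> R)}"

text \<open>For a discrete valuation ring \<open>R\<close>, the order of \<open>g \<cdot> \<eta>\<close> where \<open>\<eta>\<close> generates the
  \<open>n\<close>-forms of \<open>R\<close>.\<close>

definition ord_form ::
    "'a::field set \<Rightarrow> nat \<Rightarrow> 'a set \<Rightarrow> ((nat \<Rightarrow> 'a \<Rightarrow> 'a) \<Rightarrow> 'a) \<Rightarrow> int"
  where "ord_form C n R \<omega> = (THE e. \<exists>\<eta> g. forms C n R = {\<lambda>D. a * \<eta> D | a. a \<in> R} \<and>
    \<omega> = (\<lambda>D. g * \<eta> D) \<and> e = ord_at R g)"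

section \<open>Gorenstein affine varieties\<close>

text \<open>\<open>A\<close> is the coordinate ring of a normal affine variety over the field \<open>C\<close> of characteristic 0.
  Weil divisors on \<open>Spec A\<close> are given by their coefficients at the primes of height one.\<close>

definition affine_canonical_divisor :: "'a::field set \<Rightarrow> 'a set \<Rightarrow> ('a set \<Rightarrow> int) \<Rightarrow> bool"
  where "affine_canonical_divisor C A W \<longleftrightarrow>
    (\<exists>\<omega> \<in> forms C (the_enat (krull_dim A)) (frac_field A). \<omega> \<noteq> (\<lambda>_. 0) \<and>
      (\<forall>Q\<in>spec A. height A Q = 1 \<longrightarrow>
         W Q = ord_form C (the_enat (krull_dim A)) (localize A Q) \<omega>))"

definition cartier :: "'a::field set \<Rightarrow> ('a set \<Rightarrow> int) \<Rightarrow> bool"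
  where "cartier A W \<longleftrightarrow>
    (\<forall>P\<in>spec A. \<exists>h\<in>A - P. \<exists>f\<in>frac_field A - {0}.
      \<forall>Q\<in>spec A. height A Q = 1 \<and> h \<notin> Q \<longrightarrow> W Q = ord_at (localize A Q) f)"

definition gorenstein :: "'a::field set \<Rightarrow> 'a set \<Rightarrow> bool"
  where "gorenstein C A \<longleftrightarrow> (\<forall>P\<in>spec A. cohen_macaulay_local (localize A P)) \<and>
    (\<exists>W. affine_canonical_divisor C A W \<and> cartier A W)"

section \<open>Smooth projective curves\<close>

text \<open>An integral projective variety over \<open>k\<close> with function field \<open>K\<close> is Proj of \<open>k[f\<^sub>0 T, \<dots>, f\<^sub>n T]\<close>
  with \<open>f\<^sub>0, \<dots>, f\<^sub>n\<close> in \<open>K\<close>; its standard affine charts are the spectra of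
  \<open>k[f\<^sub>0/g, \<dots>, f\<^sub>n/g]\<close>, where \<open>g\<close> is a non-zero \<open>f\<^sub>i\<close>. Being separated, the variety is
  determined by the set of local rings of its closed points inside \<open>K\<close>, and a closed point is
  identified with its local ring. The embedding of \<open>k\<close> in \<open>K\<close> is \<open>\<iota>\<close>. As \<open>k\<close> is algebraically closed,
  smoothness is regularity of the local rings of the closed points.\<close>

definition proj_chart :: "('k \<Rightarrow> 'a::field) \<Rightarrow> 'a list \<Rightarrow> 'a \<Rightarrow> 'a set"
  where "proj_chart \<iota> fs g =
    generate_ring ring_of_type_algebra (range \<iota> \<union> (\<lambda>f. f / g) ` set fs)"

definition projective_variety :: "('k \<Rightarrow> 'a::field) \<Rightarrow> 'a set set \<Rightarrow> bool"
  where "projective_variety \<iota> Y \<longleftrightarrow>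
    (\<exists>fs. (\<exists>g\<in>set fs. g \<noteq> 0) \<and>
      (\<forall>g\<in>set fs - {0}. frac_field (proj_chart \<iota> fs g) = UNIV) \<and>
      Y = (\<Union>g\<in>set fs - {0}. {localize (proj_chart \<iota> fs g) \<mm> | \<mm>.
             maximalideal \<mm> (ring_on (proj_chart \<iota> fs g))}))"

locale smooth_projective_curve =
  fixes \<iota> :: "'k::{alg_closed_field, field_char_0} \<Rightarrow> 'a::field"
    and Y :: "'a set set"
  assumes \<iota>_one: "\<iota> 1 = 1"
    and \<iota>_add: "\<iota> (a + b) = \<iota> a + \<iota> b"
    and \<iota>_mult: "\<iota> (a * b) = \<iota> a * \<iota> b"
    and projective: "projective_variety \<iota> Y"
    and curve: "y \<in> Y \<Longrightarrow> krull_dim y = 1"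
    and smooth: "y \<in> Y \<Longrightarrow> regular_local_ring y"

text \<open>A \<open>\<rat>\<close>-divisor on \<open>Y\<close> is given by its coefficients; only the values at points of \<open>Y\<close> matter.\<close>

type_synonym 'a qdiv = "'a set \<Rightarrow> rat"

definition degree_div :: "'a set set \<Rightarrow> 'a qdiv \<Rightarrow> rat"
  where "degree_div Y E = (\<Sum>y | y \<in> Y \<and> E y \<noteq> 0. E y)"

definition principal :: "'a::field set set \<Rightarrow> 'a qdiv \<Rightarrow> bool"
  where "principal Y E \<longleftrightarrow> (\<exists>f. f \<noteq> 0 \<and> (\<forall>y\<in>Y. E y = of_int (ord_at y f)))"

definition canonical_divisor :: "('k \<Rightarrow> 'a::field) \<Rightarrow> 'a set set \<Rightarrow> 'a qdiv \<Rightarrow> bool"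
  where "canonical_divisor \<iota> Y K \<longleftrightarrow>
    (\<exists>\<omega> \<in> forms (range \<iota>) 1 UNIV. \<omega> \<noteq> (\<lambda>_. 0) \<and>
      (\<forall>y\<in>Y. K y = of_int (ord_form (range \<iota>) 1 y \<omega>)))"

text \<open>\<open>H\<^sup>0(Y, O(\<lfloor>E\<rfloor>))\<close>\<close>

definition sections :: "'a::field set set \<Rightarrow> 'a qdiv \<Rightarrow> 'a set"
  where "sections Y E = {f. f \<noteq> 0 \<longrightarrow> (\<forall>y\<in>Y. ord_at y f + \<lfloor>E y\<rfloor> \<ge> 0)}"

definition h0 :: "('k::field \<Rightarrow> 'a::field) \<Rightarrow> 'a set set \<Rightarrow> 'a qdiv \<Rightarrow> nat"
  where "h0 \<iota> Y E = vector_space.dim (\<lambda>c f. \<iota> c * f) (sections Y E)"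

text \<open>Some positive multiple is an integral, base point free divisor.\<close>

definition semiample :: "'a::field set set \<Rightarrow> 'a qdiv \<Rightarrow> bool"
  where "semiample Y E \<longleftrightarrow>
    (\<exists>r::nat. r > 0 \<and> (\<forall>y\<in>Y. of_nat r * E y \<in> \<int>) \<and>
      (\<forall>y\<in>Y. \<exists>s\<in>sections Y (\<lambda>y. of_nat r * E y).
         s \<noteq> 0 \<and> of_int (ord_at y s) + of_nat r * E y = 0))"

text \<open>Bigness on a curve: some positive integral multiple \<open>r E\<close> has maximal, i.e. linear, growth of
  \<open>h\<^sup>0(n r E)\<close>.\<close>

definition big :: "('k::field \<Rightarrow> 'a::field) \<Rightarrow> 'a set set \<Rightarrow> 'a qdiv \<Rightarrow> bool"
  where "big \<iota> Y E \<longleftrightarrow>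
    (\<exists>r::nat. r > 0 \<and> (\<forall>y\<in>Y. of_nat r * E y \<in> \<int>) \<and>
      (\<exists>c::rat. c > 0 \<and>
        (\<forall>\<^sub>F n in sequentially. of_nat (h0 \<iota> Y (\<lambda>y. of_nat n * (of_nat r * E y))) \<ge> c * of_nat n)))"

section \<open>Polyhedral divisors with tail cone the non-negative rationals\<close>

text \<open>A compact polyhedron in \<open>\<rat>\<close> is an interval \<open>{a..b}\<close> with \<open>a \<le> b\<close>.\<close>

definition polyhedral_divisor :: "'a set set \<Rightarrow> ('a set \<Rightarrow> rat set) \<Rightarrow> bool"
  where "polyhedral_divisor Y \<DD> \<longleftrightarrow>
    (\<forall>z\<in>Y. \<exists>a b. a \<le> b \<and> \<DD> z = {u + v | u v. u \<in> {a..b} \<and> v \<in> {0..}}) \<and>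
    finite {z \<in> Y. \<DD> z \<noteq> {0..}}"

definition eval_pdiv :: "('a set \<Rightarrow> rat set) \<Rightarrow> rat \<Rightarrow> 'a qdiv"
  where "eval_pdiv \<DD> m z = (LEAST x. x \<in> (*) m ` \<DD> z)"

definition proper :: "('k::field \<Rightarrow> 'a::field) \<Rightarrow> 'a set set \<Rightarrow> ('a set \<Rightarrow> rat set) \<Rightarrow> bool"
  where "proper \<iota> Y \<DD> \<longleftrightarrow> (\<forall>m::nat. semiample Y (eval_pdiv \<DD> (of_nat m)) \<and>
    (m > 0 \<longrightarrow> big \<iota> Y (eval_pdiv \<DD> (of_nat m))))"

text \<open>The support of a divisor on a smooth curve is a finite set of points, hence automatically SNC;
  smoothness of \<open>\<DD>\<close> on a smooth curve \<open>Y\<close> is therefore properness.\<close>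

definition smooth_polyhedral_divisor ::
    "('k::field \<Rightarrow> 'a::field) \<Rightarrow> 'a set set \<Rightarrow> ('a set \<Rightarrow> rat set) \<Rightarrow> bool"
  where "smooth_polyhedral_divisor \<iota> Y \<DD> \<longleftrightarrow> polyhedral_divisor Y \<DD> \<and> proper \<iota> Y \<DD>"

text \<open>The ring \<open>A[Y, \<DD>] = \<Oplus>\<^sub>m H\<^sup>0(Y, O(\<DD>(m))) \<chi>\<^sup>m\<close> inside \<open>K(\<chi>)\<close>, and the ground field inside
  \<open>K(\<chi>)\<close>.\<close>

definition A_ring :: "'a::field set set \<Rightarrow> ('a set \<Rightarrow> rat set) \<Rightarrow> 'a poly fract set"
  where "A_ring Y \<DD> = {to_fract p | p.
    \<forall>m. poly.coeff p m \<in> sections Y (eval_pdiv \<DD> (of_nat m))}"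

definition const_field :: "('k \<Rightarrow> 'a::field) \<Rightarrow> 'a poly fract set"
  where "const_field \<iota> = range (\<lambda>c. to_fract [:\<iota> c:])"

end

theory Submission
  imports Defs
begin

text \<open>Let \<open>w\<^sub>y\<close> be the valuation of \<open>K(\<chi>)\<close> with \<open>w\<^sub>y(f \<chi>\<^sup>m) = q ord\<^sub>y f + p m\<close>, where \<open>p/q\<close> is the coefficient of
  \<open>D\<^sub>1\<close> at \<open>y\<close>. The ring \<open>A\<close> is the intersection of \<open>K[\<chi>]\<close> with the valuation rings of all \<open>w\<^sub>y\<close>. Its primes of
  height one are the centers of the \<open>w\<^sub>y\<close> and of the primes \<open>\<pi>\<close> of \<open>K[\<chi>]\<close> other than \<open>\<chi>\<close>; at all other nonzero
  primes \<open>A\<close> has depth two. If \<open>g dt\<close> is a rational form on \<open>Y\<close> with divisor \<open>K\<^sub>Y\<close>, then \<open>(g/\<chi>) dt \<and> d\<chi>\<close> has order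
  \<open>q K\<^sub>Y(y) + q - 1\<close> along \<open>w\<^sub>y\<close> and 0 along \<open>\<pi>\<close>.

  If the divisor of this form is Cartier up to a principal divisor, then a local equation at the ideal of elements
  of positive degree has order 0 along every \<open>\<pi>\<close> that does not divide some \<open>h\<close> with nonzero constant term. All the
  \<open>w\<^sub>y\<close> of a factor of \<open>h\<close> agree with those of its constant term, so the local equation has the same \<open>w\<^sub>y\<close> as a monomial
  \<open>x \<chi>\<^sup>n\<close>, whence \<open>q K\<^sub>Y + q - 1 = q ord x + p n\<close> at all points. Taking degrees gives \<open>n = m\<^sub>G\<close>, and then
  \<open>D\<^sub>G - K\<^sub>Y = div(1/x)\<close>. Conversely, such a monomial is a global equation.

  Bigness only enters through \<open>deg D\<^sub>1 > 0\<close>, and Riemann's theorem provides homogeneous elements with prescribed \<open>w\<^sub>y\<close>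
  at one point and large values at the others.\<close>

text \<open>One local equation suffices because every center of a \<open>w y\<close> lies in the
  ideal of positive degree: an h outside that ideal lies outside all these centers, so the equation
  at this single maximal ideal controls the whole part of the canonical divisor that comes from Y.
  The factor 1/\<chi> in the form removes the weight p from its order along \<open>w y\<close>; the
  surplus q - 1 remains because \<open>w y\<close> restricts to q ord_y on K. Depth two matches the
  dimension of the surface, so the Cohen-Macaulay half of the definition always holds. The obstacle
  is the form of the data: a curve is a set of regular local rings of dimension one cut out of a
  field by charts. Finiteness of zeros and poles, constancy of global functions, transcendence
  degree one and the vanishing of the degree of principal divisors have to be derived from this.
  Zariski's lemma is the entry point, as it makes all residue fields equal to k. Transcendence
  degree one then makes the derivations of K over k a space of dimension at most one, and this
  determines the forms on the curve and on the surface.\<close>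

definition subdom :: "'a::field set \<Rightarrow> bool"
  where "subdom R \<longleftrightarrow> 1 \<in> R \<and> (\<forall>a\<in>R. \<forall>b\<in>R. a - b \<in> R \<and> a * b \<in> R)"

text \<open>Ideals and primes are handled as plain sets with closure conditions;
  \<open>ideal_ring_on\<close> and \<open>primeideal_ring_on\<close> identify these with the
  HOL-Algebra notions behind \<open>spec\<close>.\<close>

definition ideal_in :: "'a::field set \<Rightarrow> 'a set \<Rightarrow> bool"
  where "ideal_in I R \<longleftrightarrow> I \<subseteq> R \<and> 0 \<in> I \<and> (\<forall>a\<in>I. \<forall>b\<in>I. a + b \<in> I) \<and> (\<forall>r\<in>R. \<forall>a\<in>I. r * a \<in> I)"

definition prime_in :: "'a::field set \<Rightarrow> 'a set \<Rightarrow> bool"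
  where "prime_in P R \<longleftrightarrow> ideal_in P R \<and> 1 \<notin> P \<and> (\<forall>a\<in>R. \<forall>b\<in>R. a * b \<in> P \<longrightarrow> a \<in> P \<or> b \<in> P)"

lemma subdomI:
  assumes "1 \<in> R" "\<And>a b. a \<in> R \<Longrightarrow> b \<in> R \<Longrightarrow> a - b \<in> R" "\<And>a b. a \<in> R \<Longrightarrow> b \<in> R \<Longrightarrow> a * b \<in> R"
  shows "subdom R"
  using assms by (auto simp: subdom_def)

context
  fixes R :: "'a::field set"
  assumes R: "subdom R"
begin

lemma subdom_one [simp]: "1 \<in> R" using R by (auto simp: subdom_def)
lemma subdom_diff [intro]: "a \<in> R \<Longrightarrow> b \<in> R \<Longrightarrow> a - b \<in> R" using R by (auto simp: subdom_def)
lemma subdom_mult [intro]: "a \<in> R \<Longrightarrow> b \<in> R \<Longrightarrow> a * b \<in> R" using R by (auto simp: subdom_def)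
lemma subdom_zero [simp]: "0 \<in> R" using subdom_diff[of 1 1] by simp
lemma subdom_minus [intro]: "a \<in> R \<Longrightarrow> - a \<in> R" using subdom_diff[of 0 a] by simp
lemma subdom_add [intro]: "a \<in> R \<Longrightarrow> b \<in> R \<Longrightarrow> a + b \<in> R"
  using subdom_diff[of a "- b"] by auto
lemma subdom_power [intro]: "a \<in> R \<Longrightarrow> a ^ n \<in> R" by (induction n) auto
lemma subdom_sum [intro]: "(\<And>i. i \<in> A \<Longrightarrow> f i \<in> R) \<Longrightarrow> sum f A \<in> R"
  by (induction A rule: infinite_finite_induct) auto
lemma subdom_prod [intro]: "(\<And>i. i \<in> A \<Longrightarrow> f i \<in> R) \<Longrightarrow> prod f A \<in> R"
  by (induction A rule: infinite_finite_induct) auto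
lemma subdom_poly: "(\<And>i. coeff p i \<in> R) \<Longrightarrow> x \<in> R \<Longrightarrow> poly p x \<in> R"
  unfolding poly_altdef by auto

end

lemma subdom_UNIV [simp]: "subdom UNIV" by (auto simp: subdom_def)

lemma ideal_inD:
  assumes "ideal_in I R"
  shows "I \<subseteq> R" "0 \<in> I" "a \<in> I \<Longrightarrow> b \<in> I \<Longrightarrow> a + b \<in> I" "r \<in> R \<Longrightarrow> a \<in> I \<Longrightarrow> r * a \<in> I"
    "r \<in> R \<Longrightarrow> a \<in> I \<Longrightarrow> a * r \<in> I" "a \<in> I \<Longrightarrow> a \<in> R"
  using assms by (auto simp: ideal_in_def mult.commute)

lemma ideal_in_minus:
  assumes "ideal_in I R" "subdom R" "a \<in> I"
  shows "- a \<in> I"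
proof -
  have "-1 \<in> R" using assms(2) by (metis subdom_minus subdom_one)
  thus ?thesis using ideal_inD(4)[OF assms(1), of "-1" a] assms(3) by simp
qed

lemma ideal_in_diff:
  assumes "ideal_in I R" "subdom R" "a \<in> I" "b \<in> I"
  shows "a - b \<in> I"
  using ideal_inD(3)[OF assms(1,3), of "-b"] ideal_in_minus[OF assms(1,2,4)] by simp

lemmas subdom_closed = subdom_one subdom_zero subdom_add subdom_diff subdom_minus subdom_mult
  subdom_power subdom_sum subdom_prod

lemma ideal_in_power_diff:
  assumes I: "ideal_in I R" and R: "subdom R" and ab: "a \<in> R" "b \<in> R" "a - b \<in> I"
  shows "a ^ n - b ^ n \<in> I"
proof (induction n)
  case (Suc n)
  have "a * (a ^ n - b ^ n) + b ^ n * (a - b) \<in> I"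
    by (intro ideal_inD(3,4)[OF I] Suc ab subdom_closed[OF R])
  thus ?case by (simp add: algebra_simps)
qed (use ideal_inD(2)[OF I] in simp)

lemma ideal_in_cong_add:
  assumes I: "ideal_in I R" and R: "subdom R" and a: "a - b \<in> I"
  shows "a \<in> I \<longleftrightarrow> b \<in> I"
proof
  assume "a \<in> I" hence "a - (a - b) \<in> I" by (intro ideal_in_diff[OF I R] a)
  thus "b \<in> I" by simp
next
  assume "b \<in> I" hence "(a - b) + b \<in> I" by (intro ideal_inD(3)[OF I] a)
  thus "a \<in> I" by simp
qed

lemma ideal_in_sum:
  assumes "ideal_in I R" "\<And>i. i \<in> A \<Longrightarrow> f i \<in> I"
  shows "sum f A \<in> I"
  using assms(2)
  by (induction A rule: infinite_finite_induct) (auto intro: ideal_inD[OF assms(1)])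

lemma prime_inD:
  assumes "prime_in P R"
  shows "ideal_in P R" "1 \<notin> P" "a \<in> R \<Longrightarrow> b \<in> R \<Longrightarrow> a * b \<in> P \<Longrightarrow> a \<in> P \<or> b \<in> P"
  using assms by (auto simp: prime_in_def)

lemma prime_in_power:
  assumes "prime_in P R" "subdom R" "a \<in> R" "a ^ n \<in> P"
  shows "a \<in> P"
  using assms(4)
proof (induction n)
  case 0 thus ?case using prime_inD(2)[OF assms(1)] by simp
next
  case (Suc n)
  thus ?case using prime_inD(3)[OF assms(1,3), of "a^n"] subdom_power[OF assms(2,3)] by auto
qed

lemma prime_in_prod:
  assumes "prime_in P R" "subdom R" "\<And>i. i \<in> A \<Longrightarrow> f i \<in> R" "\<And>i. i \<in> A \<Longrightarrow> f i \<notin> P"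
  shows "prod f A \<notin> P"
  using assms(3,4)
proof (induction A rule: infinite_finite_induct)
  case (insert x F)
  hence "prod f F \<in> R" by (intro subdom_prod[OF assms(2)]) auto
  thus ?case using prime_inD(3)[OF assms(1), of "f x" "prod f F"] insert by auto
qed (use prime_inD[OF assms(1)] in auto)

lemma prime_in_Int:
  assumes "prime_in P R" "subdom D" "D \<subseteq> R"
  shows "prime_in (P \<inter> D) D"
proof -
  note PI = prime_inD(1)[OF assms(1)]
  show ?thesis unfolding prime_in_def ideal_in_def
  proof (intro conjI ballI impI)
    show "1 \<notin> P \<inter> D" using prime_inD(2)[OF assms(1)] by blast
    show "0 \<in> P \<inter> D" using ideal_inD(2)[OF PI] subdom_zero[OF assms(2)] by blast
    fix a b assume "a \<in> P \<inter> D" "b \<in> P \<inter> D"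
    thus "a + b \<in> P \<inter> D" using ideal_inD(3)[OF PI] subdom_add[OF assms(2)] by simp
  next
    fix a b assume "a \<in> D" "b \<in> P \<inter> D"
    thus "a * b \<in> P \<inter> D" using ideal_inD(4)[OF PI] subdom_mult[OF assms(2)] assms(3) by auto
  next
    fix a b assume "a \<in> D" "b \<in> D" "a * b \<in> P \<inter> D"
    thus "a \<in> P \<inter> D \<or> b \<in> P \<inter> D" using prime_inD(3)[OF assms(1)] assms(3) by blast
  qed simp
qed

lemma ideal_in_extend:
  assumes R: "subdom R" and M: "ideal_in M R" and a: "a \<in> R"
  defines "J \<equiv> {m + r * a | m r. m \<in> M \<and> r \<in> R}"
  shows "ideal_in J R" "M \<subseteq> J" "a \<in> J"
proof -
  show "ideal_in J R" unfolding ideal_in_def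
  proof (intro conjI ballI subsetI)
    fix x assume "x \<in> J" thus "x \<in> R" using ideal_inD[OF M] a R by (auto simp: J_def)
  next
    show "0 \<in> J" unfolding J_def using ideal_inD(2)[OF M] subdom_zero[OF R] by force
  next
    fix x y assume "x \<in> J" "y \<in> J"
    then obtain m r m' r' where "x = m + r * a" "y = m' + r' * a" "m \<in> M" "m' \<in> M" "r \<in> R" "r' \<in> R"
      by (auto simp: J_def)
    thus "x + y \<in> J" unfolding J_def using ideal_inD(3)[OF M] subdom_add[OF R]
      by (intro CollectI exI[of _ "m + m'"] exI[of _ "r + r'"]) (auto simp: algebra_simps)
  next
    fix s x assume "s \<in> R" "x \<in> J"
    then obtain m r where "x = m + r * a" "m \<in> M" "r \<in> R" by (auto simp: J_def)
    thus "s * x \<in> J" unfolding J_def using ideal_inD(4)[OF M \<open>s \<in> R\<close>] subdom_mult[OF R] \<open>s \<in> R\<close>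
      by (intro CollectI exI[of _ "s * m"] exI[of _ "s * r"]) (auto simp: algebra_simps)
  qed
  show "M \<subseteq> J" unfolding J_def using subdom_zero[OF R] by force
  show "a \<in> J" unfolding J_def using ideal_inD(2)[OF M] subdom_one[OF R] by force
qed

lemma ring_on_simps [simp]:
  "carrier (ring_on R) = R" "Group.monoid.mult (ring_on R) = (*)" "Group.monoid.one (ring_on R) = 1"
  "Ring.ring.zero (ring_on R) = 0" "Ring.ring.add (ring_on R) = (+)"
  by (auto simp: ring_on_def ring_of_type_algebra_def)

lemma cring_ring_on: assumes "subdom R" shows "cring (ring_on R)"
proof (intro cringI abelian_groupI comm_monoidI)
  fix x assume "x \<in> carrier (ring_on R)"
  thus "\<exists>y\<in>carrier (ring_on R). y \<oplus>\<^bsub>ring_on R\<^esub> x = \<zero>\<^bsub>ring_on R\<^esub>"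
    using assms by (intro bexI[of _ "-x"]) auto
qed (use assms in \<open>auto simp: algebra_simps\<close>)

lemma a_inv_ring_on: assumes "subdom R" "x \<in> R" shows "\<ominus>\<^bsub>ring_on R\<^esub> x = - x"
proof -
  interpret cring "ring_on R" by (rule cring_ring_on[OF assms(1)])
  have "- x \<in> R" using assms by (rule subdom_minus)
  thus ?thesis using add.inv_equality[of "-x" x] assms by simp
qed

lemma ideal_ring_on: assumes "subdom R" shows "ideal I (ring_on R) \<longleftrightarrow> ideal_in I R"
proof
  assume "ideal I (ring_on R)"
  then interpret ideal I "ring_on R" .
  show "ideal_in I R" unfolding ideal_in_def
    using a_subset additive_subgroup.zero_closed[OF additive_subgroup_axioms] I_l_closed
      additive_subgroup.a_closed[OF additive_subgroup_axioms]
    by auto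
next
  assume I: "ideal_in I R"
  interpret cring "ring_on R" by (rule cring_ring_on[OF assms])
  note inv = a_inv_ring_on[OF assms]
  show "ideal I (ring_on R)"
  proof (rule idealI)
    show "subgroup I (add_monoid (ring_on R))"
    proof (rule add.subgroupI)
      fix a assume "a \<in> I"
      thus "\<ominus>\<^bsub>ring_on R\<^esub> a \<in> I" using inv ideal_in_minus[OF I assms] ideal_inD(6)[OF I] by simp
    qed (use ideal_inD[OF I] in auto)
    show "ring (ring_on R)" by unfold_locales
  qed (use ideal_inD(4,5)[OF I] in simp_all)
qed

lemma primeideal_ring_on: assumes "subdom R" shows "primeideal P (ring_on R) \<longleftrightarrow> prime_in P R"
proof
  assume "primeideal P (ring_on R)"
  then interpret primeideal P "ring_on R" .
  have I: "ideal_in P R" using is_ideal ideal_ring_on[OF assms] by blast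
  moreover have "1 \<notin> P" using I I_notcarr ideal_inD(5)[OF I, of _ 1] ideal_inD(1)[OF I] by fastforce
  ultimately show "prime_in P R" using I_prime by (auto simp: prime_in_def)
next
  assume P: "prime_in P R"
  hence "ideal P (ring_on R)" using ideal_ring_on[OF assms] by (auto simp: prime_in_def)
  thus "primeideal P (ring_on R)"
    using P assms cring_ring_on[OF assms] by (intro primeidealI) (auto simp: prime_in_def)
qed

lemma maximalideal_ring_onD:
  assumes "subdom R" "maximalideal M (ring_on R)"
  shows "prime_in M R" "a \<in> R \<Longrightarrow> a \<notin> M \<Longrightarrow> \<exists>r\<in>R. 1 - r * a \<in> M"
proof -
  interpret maximalideal M "ring_on R" by (rule assms(2))
  interpret R: cring "ring_on R" by (rule cring_ring_on[OF assms(1)])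
  have "primeideal M (ring_on R)" using R.maximalideal_prime assms(2) by blast
  thus "prime_in M R" using primeideal_ring_on[OF assms(1)] by blast
  then have M: "ideal_in M R" by (rule prime_inD)
  assume a: "a \<in> R" "a \<notin> M"
  define J where "J = {m + r * a | m r. m \<in> M \<and> r \<in> R}"
  note J = ideal_in_extend[OF assms(1) M a(1), folded J_def]
  have "J = M \<or> J = R"
    using I_maximal[of J] J(1,2) ideal_ring_on[OF assms(1)] ideal_inD(1)[OF J(1)] by auto
  hence "1 \<in> J" using a J(3) assms(1) by auto
  then obtain m r where mr: "1 = m + r * a" "m \<in> M" "r \<in> R" by (auto simp: J_def)
  from mr(1) have "1 - r * a = m" by (metis add_diff_cancel_right')
  thus "\<exists>r\<in>R. 1 - r * a \<in> M" using mr by (intro bexI[of _ r]) auto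
qed

lemma maximalideal_ring_onI:
  assumes "subdom R" "prime_in M R" "\<And>a. a \<in> R \<Longrightarrow> a \<notin> M \<Longrightarrow> \<exists>r\<in>R. 1 - r * a \<in> M"
  shows "maximalideal M (ring_on R)"
proof (rule maximalidealI)
  show "ideal M (ring_on R)" using ideal_ring_on[OF assms(1)] prime_inD(1)[OF assms(2)] by blast
  show "carrier (ring_on R) \<noteq> M" using prime_inD(2)[OF assms(2)] subdom_one[OF assms(1)] by auto
next
  fix J assume J: "ideal J (ring_on R)" "M \<subseteq> J" "J \<subseteq> carrier (ring_on R)"
  then have J': "ideal_in J R" using ideal_ring_on[OF assms(1)] by blast
  show "J = M \<or> J = carrier (ring_on R)"
  proof (cases "J = M")
    case False
    then obtain a where a: "a \<in> J" "a \<notin> M" using J by auto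
    then obtain r where r: "r \<in> R" "1 - r * a \<in> M" using assms(3) ideal_inD(6)[OF J'] by blast
    have "r * a + (1 - r * a) \<in> J" by (intro ideal_inD(3)[OF J'] ideal_inD(4)[OF J']) (use r a J in auto)
    hence "1 \<in> J" by simp
    hence "x \<in> J" if "x \<in> R" for x using ideal_inD(4)[OF J' that] by fastforce
    thus ?thesis using J by auto
  qed simp
qed

lemma spec_iff: "subdom R \<Longrightarrow> P \<in> spec R \<longleftrightarrow> prime_in P R"
  by (simp add: spec_def primeideal_ring_on)

lemma ideal_in_principal: "subdom R \<Longrightarrow> x \<in> R \<Longrightarrow> ideal_in ((*) x ` R) R"
  unfolding ideal_in_def
proof (intro conjI ballI)
  assume R: "subdom R" "x \<in> R"
  show "(*) x ` R \<subseteq> R" using R by auto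
  show "0 \<in> (*) x ` R" using subdom_zero[OF R(1)] by (intro image_eqI[of _ _ 0]) auto
  fix a b assume "a \<in> (*) x ` R" "b \<in> (*) x ` R"
  then obtain a' b' where "a = x * a'" "b = x * b'" "a' \<in> R" "b' \<in> R" by auto
  thus "a + b \<in> (*) x ` R" using subdom_add[OF R(1)]
    by (intro image_eqI[of _ _ "a' + b'"]) (auto simp: algebra_simps)
next
  fix r a assume R: "subdom R" "x \<in> R" "r \<in> R" "a \<in> (*) x ` R"
  then obtain a' where "a = x * a'" "a' \<in> R" by auto
  thus "r * a \<in> (*) x ` R" using subdom_mult[OF R(1,3)]
    by (intro image_eqI[of _ _ "r * a'"]) (auto simp: algebra_simps)
qed

lemma genideal_ring_on:
  assumes "subdom R"
  shows "genideal (ring_on R) S = \<Inter>{I. ideal_in I R \<and> S \<subseteq> I}"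
  by (simp add: genideal_def ideal_ring_on[OF assms])

lemma ideal_in_genideal:
  assumes "subdom R" "S \<subseteq> R"
  shows "ideal_in (genideal (ring_on R) S) R"
proof -
  have "ideal_in R R" using assms by (auto simp: ideal_in_def)
  hence "R \<in> {I. ideal_in I R \<and> S \<subseteq> I}" using assms(2) by simp
  hence sub: "\<Inter>{I. ideal_in I R \<and> S \<subseteq> I} \<subseteq> R" by blast
  show ?thesis unfolding genideal_ring_on[OF assms(1)] ideal_in_def[of "\<Inter>_"]
  proof (intro conjI ballI sub InterI)
    fix a b I assume "a \<in> \<Inter>{I. ideal_in I R \<and> S \<subseteq> I}" "b \<in> \<Inter>{I. ideal_in I R \<and> S \<subseteq> I}"
      and I: "I \<in> {I. ideal_in I R \<and> S \<subseteq> I}"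
    hence "a \<in> I" "b \<in> I" by blast+
    thus "a + b \<in> I" using I ideal_inD(3) by blast
  next
    fix r a I assume "r \<in> R" "a \<in> \<Inter>{I. ideal_in I R \<and> S \<subseteq> I}" "I \<in> {I. ideal_in I R \<and> S \<subseteq> I}"
    thus "r * a \<in> I" using ideal_inD(4) by blast
  qed (use ideal_inD(2) in blast)
qed

lemma genideal_ring_on_singleton:
  assumes "subdom R" "x \<in> R"
  shows "genideal (ring_on R) {x} = (*) x ` R"
proof
  have "x \<in> (*) x ` R" using subdom_one[OF assms(1)] by (intro image_eqI[of _ _ 1]) auto
  thus "genideal (ring_on R) {x} \<subseteq> (*) x ` R"
    unfolding genideal_ring_on[OF assms(1)] using ideal_in_principal[OF assms] by blast
  show "(*) x ` R \<subseteq> genideal (ring_on R) {x}"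
    unfolding genideal_ring_on[OF assms(1)] by (auto dest: ideal_inD)
qed

lemma genideal_ring_on_empty:
  assumes "subdom R"
  shows "genideal (ring_on R) {} = {0}"
proof -
  have "ideal_in {0} R" using assms by (auto simp: ideal_in_def)
  thus ?thesis unfolding genideal_ring_on[OF assms] by (auto dest: ideal_inD)
qed

section \<open>Existence of prime and maximal ideals\<close>

lemma prime_in_zero: "subdom R \<Longrightarrow> prime_in {0} R"
  by (auto simp: prime_in_def ideal_in_def)

text \<open>Krull's argument: an ideal maximal among those that contain I and miss the
  multiplicative set S is prime. Maximality is kept as the last conjunct, because for S = {1} it
  says that every element outside P is invertible modulo P.\<close>

lemma exists_maximal_avoiding:
  assumes R: "subdom R" and I: "ideal_in I R"
    and S: "S \<subseteq> R" "1 \<in> S" "\<And>a b. a \<in> S \<Longrightarrow> b \<in> S \<Longrightarrow> a * b \<in> S" "S \<inter> I = {}"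
  shows "\<exists>P. prime_in P R \<and> I \<subseteq> P \<and> P \<inter> S = {} \<and> (\<forall>a\<in>R. a \<notin> P \<longrightarrow> (\<exists>m\<in>P. \<exists>r\<in>R. m + r * a \<in> S))"
proof -
  define Fam where "Fam = {J. ideal_in J R \<and> I \<subseteq> J \<and> J \<inter> S = {}}"
  have "\<exists>M\<in>Fam. \<forall>Z\<in>Fam. M \<subseteq> Z \<longrightarrow> Z = M"
  proof (rule subset_Zorn_nonempty)
    show "Fam \<noteq> {}" using I S(4) by (auto simp: Fam_def)
  next
    fix C assume C: "C \<noteq> {}" "subset.chain Fam C"
    have sub: "Z \<in> Fam" if "Z \<in> C" for Z using C(2) that by (auto simp: subset_chain_def)
    have idl: "ideal_in Z R" if "Z \<in> C" for Z using sub[OF that] by (simp add: Fam_def)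
    have "ideal_in (\<Union>C) R" unfolding ideal_in_def
    proof (intro conjI ballI)
      show "\<Union>C \<subseteq> R" using ideal_inD(1)[OF idl] by blast
      show "0 \<in> \<Union>C" using ideal_inD(2)[OF idl] C(1) by blast
    next
      fix a b assume "a \<in> \<Union>C" "b \<in> \<Union>C"
      then obtain U V where UV: "U \<in> C" "V \<in> C" "a \<in> U" "b \<in> V" by auto
      moreover have "U \<subseteq> V \<or> V \<subseteq> U" using C(2) UV by (auto simp: subset_chain_def)
      ultimately obtain Z where "Z \<in> C" "a \<in> Z" "b \<in> Z" by blast
      thus "a + b \<in> \<Union>C" using ideal_inD(3)[OF idl] by blast
    next
      fix r a assume "r \<in> R" "a \<in> \<Union>C"
      thus "r * a \<in> \<Union>C" using ideal_inD(4)[OF idl] by blast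
    qed
    thus "\<Union>C \<in> Fam" using sub C(1) by (auto simp: Fam_def)
  qed
  then obtain P where P: "P \<in> Fam" "\<And>Z. Z \<in> Fam \<Longrightarrow> P \<subseteq> Z \<Longrightarrow> Z = P" by blast
  have PI: "ideal_in P R" "I \<subseteq> P" "P \<inter> S = {}" using P(1) by (auto simp: Fam_def)
  have ext: "\<exists>m\<in>P. \<exists>r\<in>R. m + r * a \<in> S" if a: "a \<in> R" "a \<notin> P" for a
  proof (rule ccontr)
    assume no: "\<not> ?thesis"
    define J where "J = {m + r * a | m r. m \<in> P \<and> r \<in> R}"
    note J = ideal_in_extend[OF R PI(1) a(1), folded J_def]
    have "J \<inter> S = {}" using no by (auto simp: J_def)
    hence "J \<in> Fam" using J(1,2) PI by (auto simp: Fam_def)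
    thus False using P(2)[of J] J(2,3) a by auto
  qed
  have "prime_in P R" unfolding prime_in_def
  proof (intro conjI ballI impI)
    show "1 \<notin> P" using PI S(2) by auto
    fix a b assume ab: "a \<in> R" "b \<in> R" "a * b \<in> P"
    show "a \<in> P \<or> b \<in> P"
    proof (rule ccontr)
      assume "\<not> ?thesis"
      then obtain m r m' r' where *: "m \<in> P" "r \<in> R" "m + r * a \<in> S" "m' \<in> P" "r' \<in> R" "m' + r' * b \<in> S"
        using ext[OF ab(1)] ext[OF ab(2)] by blast
      have "(m + r * a) * (m' + r' * b) = (m' + r' * b) * m + (r * a) * m' + (r * r') * (a * b)"
        by (simp add: algebra_simps)
      moreover have "m' + r' * b \<in> R" "r * a \<in> R" "r * r' \<in> R" using * ab S(1) R by auto
      ultimately have "(m + r * a) * (m' + r' * b) \<in> P"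
        by (simp only:) (intro ideal_inD(3,4)[OF PI(1)] * ab)
      thus False using S(3)[OF *(3,6)] PI by auto
    qed
  qed (use PI in auto)
  thus ?thesis using PI ext by (intro exI[of _ P] conjI ballI impI) simp_all
qed

lemma exists_prime_avoiding:
  assumes "subdom R" "ideal_in I R" "S \<subseteq> R" "1 \<in> S" "\<And>a b. a \<in> S \<Longrightarrow> b \<in> S \<Longrightarrow> a * b \<in> S" "S \<inter> I = {}"
  shows "\<exists>P. prime_in P R \<and> I \<subseteq> P \<and> P \<inter> S = {}"
proof -
  have "\<exists>P. prime_in P R \<and> I \<subseteq> P \<and> P \<inter> S = {} \<and> (\<forall>a\<in>R. a \<notin> P \<longrightarrow> (\<exists>m\<in>P. \<exists>r\<in>R. m + r * a \<in> S))"
    by (rule exists_maximal_avoiding) (fact assms)+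
  then obtain P where "prime_in P R" "I \<subseteq> P" "P \<inter> S = {}" by (elim exE conjE)
  thus ?thesis by (intro exI conjI)
qed

text \<open>The quotient by M is a field, expressed through inverses modulo M so that no quotient
  ring has to be formed.\<close>

definition maximal_in :: "'a::field set \<Rightarrow> 'a set \<Rightarrow> bool"
  where "maximal_in M R \<longleftrightarrow> prime_in M R \<and> (\<forall>a\<in>R. a \<notin> M \<longrightarrow> (\<exists>r\<in>R. 1 - r * a \<in> M))"

lemma maximalideal_ring_on:
  assumes R: "subdom R"
  shows "maximalideal M (ring_on R) \<longleftrightarrow> maximal_in M R"
proof
  assume M: "maximalideal M (ring_on R)"
  show "maximal_in M R" unfolding maximal_in_def
    using maximalideal_ring_onD(1)[OF R M] maximalideal_ring_onD(2)[OF R M] by blast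
next
  assume "maximal_in M R"
  hence "prime_in M R" "\<And>a. a \<in> R \<Longrightarrow> a \<notin> M \<Longrightarrow> \<exists>r\<in>R. 1 - r * a \<in> M" by (auto simp: maximal_in_def)
  thus "maximalideal M (ring_on R)" by (rule maximalideal_ring_onI[OF R])
qed

lemma exists_maximal_in:
  assumes R: "subdom R" and I: "ideal_in I R" "1 \<notin> I"
  shows "\<exists>M. maximal_in M R \<and> I \<subseteq> M"
proof -
  have "\<exists>P. prime_in P R \<and> I \<subseteq> P \<and> P \<inter> {1} = {} \<and> (\<forall>a\<in>R. a \<notin> P \<longrightarrow> (\<exists>m\<in>P. \<exists>r\<in>R. m + r * a \<in> {1}))"
    by (rule exists_maximal_avoiding[OF R I(1)]) (simp_all add: I(2) R)
  then obtain P where P: "prime_in P R" "I \<subseteq> P" "\<forall>a\<in>R. a \<notin> P \<longrightarrow> (\<exists>m\<in>P. \<exists>r\<in>R. m + r * a \<in> {1})" by (elim exE conjE)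
  have "\<exists>r\<in>R. 1 - r * a \<in> P" if a: "a \<in> R" "a \<notin> P" for a
  proof -
    obtain m r where mr: "m \<in> P" "r \<in> R" "m + r * a \<in> {1}" using P(3) a by blast
    have "m = 1 - r * a" unfolding eq_diff_eq using mr(3) by blast
    thus ?thesis using mr(1,2) by blast
  qed
  hence "maximal_in P R" using P(1) by (simp add: maximal_in_def)
  thus ?thesis using P(2) by blast
qed

lemma genideal_ring_on_mono:
  assumes "subdom R" "S \<subseteq> T"
  shows "genideal (ring_on R) S \<subseteq> genideal (ring_on R) T"
  unfolding genideal_ring_on[OF assms(1)] using assms(2) by blast

lemma genideal_ring_on_subset:
  assumes "subdom R" "ideal_in I R" "S \<subseteq> I"
  shows "genideal (ring_on R) S \<subseteq> I"
  unfolding genideal_ring_on[OF assms(1)] using assms(2,3) by blast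

lemma subset_genideal_ring_on: "subdom R \<Longrightarrow> S \<subseteq> genideal (ring_on R) S"
  unfolding genideal_ring_on by blast

section \<open>Chains of primes, Krull dimension and depth\<close>

definition prime_chain :: "'a::field set \<Rightarrow> nat \<Rightarrow> (nat \<Rightarrow> 'a set) \<Rightarrow> bool"
  where "prime_chain R n P \<longleftrightarrow> (\<forall>i\<le>n. P i \<in> spec R) \<and> (\<forall>i<n. P i \<subset> P (Suc i))"

lemma krull_dim_geI: "prime_chain R n P \<Longrightarrow> enat n \<le> krull_dim R"
  unfolding krull_dim_def prime_chain_def by (rule Sup_upper) blast

lemma krull_dim_leI:
  assumes "\<And>P. \<not> prime_chain R (Suc n) P"
  shows "krull_dim R \<le> enat n"
  unfolding krull_dim_def
proof (rule Sup_least, safe)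
  fix m P assume *: "\<forall>i\<le>m. P i \<in> spec R" "\<forall>i<m. P i \<subset> P (Suc i)"
  have "\<not> Suc n \<le> m"
  proof
    assume "Suc n \<le> m"
    hence "prime_chain R (Suc n) P" using * unfolding prime_chain_def by (meson order_trans less_le_trans)
    thus False using assms by blast
  qed
  thus "enat m \<le> enat n" by simp
qed

lemma krull_dim_geD:
  assumes "enat (Suc n) \<le> krull_dim R"
  shows "\<exists>P. prime_chain R (Suc n) P"
proof (rule ccontr)
  assume "\<not> ?thesis"
  hence "krull_dim R \<le> enat n" by (intro krull_dim_leI) blast
  with assms have "enat (Suc n) \<le> enat n" by (rule order_trans)
  thus False by simp
qed

lemma prime_chain_mono_less:
  assumes "prime_chain R n P" "i < j" "j \<le> n"
  shows "P i \<subset> P j"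
  using assms(2,3)
proof (induction j)
  case (Suc j)
  have "P j \<subset> P (Suc j)" using assms(1) Suc.prems by (auto simp: prime_chain_def)
  thus ?case using Suc by (cases "i = j") auto
qed simp

lemma prime_subset_max_ideal:
  assumes "prime_in P R" "subdom R"
  shows "P \<subseteq> max_ideal R"
proof
  fix x assume x: "x \<in> P"
  have PI: "ideal_in P R" using assms(1) by (rule prime_inD)
  show "x \<in> max_ideal R"
  proof (rule ccontr)
    assume "x \<notin> max_ideal R"
    hence "x \<noteq> 0" "inverse x \<in> R" using ideal_inD(6)[OF PI x] by (auto simp: max_ideal_def)
    hence "inverse x * x \<in> P" using ideal_inD(4)[OF PI] x by blast
    thus False using \<open>x \<noteq> 0\<close> prime_inD(2)[OF assms(1)] by simp
  qed
qed

lemma one_notin_max_ideal [simp]: "subdom R \<Longrightarrow> 1 \<notin> max_ideal R"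
  by (auto simp: max_ideal_def)

text \<open>A regular sequence lifts to a strict chain of primes, from the top down: if \<open>x\<close> is regular
  modulo \<open>I\<close> and \<open>I + (x) \<subseteq> P\<close>, then no \<open>s x\<^sup>j\<close> with \<open>s \<notin> P\<close> lies in \<open>I\<close>, so some prime between
  \<open>I\<close> and \<open>P\<close> avoids \<open>x\<close>.\<close>

lemma depth_le_krull_dim:
  assumes R: "subdom R" and M: "prime_in (max_ideal R) R"
  shows "depth R \<le> krull_dim R"
  unfolding depth_def
proof (rule Sup_least, safe)
  fix xs assume reg: "regular_sequence R xs" and xs: "set xs \<subseteq> max_ideal R"
  define n where "n = length xs"
  define I where "I = (\<lambda>i. genideal (ring_on R) (set (take i xs)))"
  have xsR: "set xs \<subseteq> R" using reg by (simp add: regular_sequence_def)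
  have I: "ideal_in (I i) R" for i unfolding I_def
    by (rule ideal_in_genideal[OF R]) (use xsR set_take_subset in fast)
  have regI: "a \<in> I i" if "i < n" "a \<in> R" "xs ! i * a \<in> I i" for i a
    using reg that unfolding regular_sequence_def I_def n_def by blast
  have "\<exists>P. (\<forall>i\<le>j. prime_in (P i) R) \<and> (\<forall>i<j. P i \<subset> P (Suc i)) \<and> I (n - j) \<subseteq> P 0" if "j \<le> n" for j
    using that
  proof (induction j)
    case 0
    have "I n \<subseteq> max_ideal R" unfolding I_def n_def
      by (rule genideal_ring_on_subset[OF R prime_inD(1)[OF M]]) (use xs in simp)
    thus ?case using M by (intro exI[of _ "\<lambda>_. max_ideal R"]) auto
  next
    case (Suc j)
    then obtain P where P: "\<And>i. i \<le> j \<Longrightarrow> prime_in (P i) R" "\<And>i. i < j \<Longrightarrow> P i \<subset> P (Suc i)" "I (n - j) \<subseteq> P 0"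
      by auto
    define m x where "m = n - Suc j" and "x = xs ! m"
    have m: "m < n" "n - j = Suc m" using Suc.prems by (auto simp: m_def)
    have "x \<in> set (take (Suc m) xs)" using m unfolding x_def n_def by (simp add: take_Suc_conv_app_nth)
    hence "x \<in> I (n - j)" unfolding m(2) I_def using subset_genideal_ring_on[OF R] by blast
    hence xP: "x \<in> P 0" using P(3) by blast
    have "I m \<subseteq> I (n - j)" unfolding m(2) I_def
      by (rule genideal_ring_on_mono[OF R]) (use m in \<open>simp add: n_def take_Suc_conv_app_nth subset_insertI\<close>)
    hence ImP: "I m \<subseteq> P 0" using P(3) by blast
    have P0: "prime_in (P 0) R" using P(1) by simp
    have xR: "x \<in> R" using xP ideal_inD(6)[OF prime_inD(1)[OF P0]] by blast
    define S where "S = {s * x ^ k | s k. s \<in> R \<and> s \<notin> P 0}"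
    have cancel: "s \<in> I m" if "s \<in> R" "s * x ^ k \<in> I m" for s k
      using that(2)
    proof (induction k)
      case (Suc k)
      have "x * (s * x ^ k) \<in> I m" using Suc.prems by (simp add: mult_ac)
      moreover have "s * x ^ k \<in> R" using that(1) xR R by blast
      ultimately have "s * x ^ k \<in> I m" using regI[OF m(1), of "s * x ^ k"] by (simp add: x_def)
      thus ?case by (rule Suc.IH)
    qed simp
    have "\<exists>Q. prime_in Q R \<and> I m \<subseteq> Q \<and> Q \<inter> S = {}"
    proof (rule exists_prime_avoiding[OF R I])
      show "S \<subseteq> R" using xR R by (auto simp: S_def)
      show "1 \<in> S" unfolding S_def using prime_inD(2)[OF P0] subdom_one[OF R]
        by (intro CollectI exI[of _ 1] exI[of _ 0]) auto
      show "S \<inter> I m = {}" using cancel ImP by (auto simp: S_def)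
    next
      fix a b assume "a \<in> S" "b \<in> S"
      then obtain s k s' k' where *: "a = s * x ^ k" "b = s' * x ^ k'" "s \<in> R" "s' \<in> R" "s \<notin> P 0" "s' \<notin> P 0"
        by (auto simp: S_def)
      hence "s * s' \<in> R" "s * s' \<notin> P 0" using prime_inD(3)[OF P0] R by auto
      thus "a * b \<in> S" unfolding S_def using *
        by (intro CollectI exI[of _ "s * s'"] exI[of _ "k + k'"]) (auto simp: power_add mult_ac)
    qed
    then obtain Q where Q: "prime_in Q R" "I m \<subseteq> Q" "Q \<inter> S = {}" by blast
    have "s \<in> S" if "s \<in> R" "s \<notin> P 0" for s unfolding S_def using that
      by (intro CollectI exI[of _ s] exI[of _ 0]) auto
    hence "Q \<subseteq> P 0" using Q ideal_inD(6)[OF prime_inD(1)[OF Q(1)]] by blast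
    moreover have "x \<in> S" unfolding S_def using prime_inD(2)[OF P0] subdom_one[OF R]
      by (intro CollectI exI[of _ 1] exI[of _ 1]) auto
    hence "x \<notin> Q" using Q(3) by blast
    ultimately have "Q \<subset> P 0" using xP by blast
    hence "(\<forall>i\<le>Suc j. prime_in (case_nat Q P i) R) \<and> (\<forall>i<Suc j. case_nat Q P i \<subset> case_nat Q P (Suc i)) \<and>
        I (n - Suc j) \<subseteq> case_nat Q P 0"
      using Q P by (auto split: nat.splits simp: m_def)
    thus ?case by blast
  qed
  from this[of n] obtain P where "\<forall>i\<le>n. prime_in (P i) R" "\<forall>i<n. P i \<subset> P (Suc i)" by auto
  hence "prime_chain R n P" by (simp add: prime_chain_def spec_iff[OF R])
  thus "enat (length xs) \<le> krull_dim R" using krull_dim_geI n_def by blast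
qed

lemma depth_ge1:
  assumes R: "subdom R" and x: "x \<in> max_ideal R" "x \<noteq> 0" and M: "ideal_in (max_ideal R) R"
  shows "1 \<le> depth R"
proof -
  have xR: "x \<in> R" using x by (simp add: max_ideal_def)
  have "genideal (ring_on R) {x} \<subseteq> max_ideal R"
    by (rule genideal_ring_on_subset[OF R M]) (use x in simp)
  hence "genideal (ring_on R) {x} \<noteq> R" using R one_notin_max_ideal[OF R] subdom_one[OF R] by blast
  hence "regular_sequence R [x]" unfolding regular_sequence_def
    using xR x by (auto simp: genideal_ring_on_empty[OF R])
  hence "enat (length [x]) \<le> depth R" unfolding depth_def using x
    by (intro Sup_upper CollectI exI[of _ "[x]"]) auto
  thus ?thesis by (simp add: one_enat_def)
qed

text \<open>The last hypothesis is regularity of y modulo x, spelled out as divisibility in R. In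
  this form it can be checked by comparing valuations, which is how both applications
  proceed.\<close>

lemma depth_ge2:
  assumes R: "subdom R" and x: "x \<in> max_ideal R" "x \<noteq> 0" and y: "y \<in> max_ideal R"
    and M: "ideal_in (max_ideal R) R"
    and reg: "\<And>a b. a \<in> R \<Longrightarrow> b \<in> R \<Longrightarrow> y * a = x * b \<Longrightarrow> \<exists>c\<in>R. a = x * c"
  shows "2 \<le> depth R"
proof -
  have xR: "x \<in> R" "y \<in> R" using x y by (simp_all add: max_ideal_def)
  have "genideal (ring_on R) {x, y} \<subseteq> max_ideal R"
    by (rule genideal_ring_on_subset[OF R M]) (use x y in simp)
  hence ne: "genideal (ring_on R) {x, y} \<noteq> R" using R one_notin_max_ideal[OF R] subdom_one[OF R] by blast
  have "regular_sequence R [x, y]" unfolding regular_sequence_def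
  proof (intro conjI allI ballI impI)
    fix i a assume i: "i < length [x, y]" and a: "a \<in> R"
      and *: "[x, y] ! i * a \<in> genideal (ring_on R) (set (take i [x, y]))"
    from i consider "i = 0" | "i = 1" by fastforce
    thus "a \<in> genideal (ring_on R) (set (take i [x, y]))"
    proof cases
      case 1 thus ?thesis using * x by (simp add: genideal_ring_on_empty[OF R])
    next
      case 2
      with * have "y * a \<in> (*) x ` R" by (simp add: genideal_ring_on_singleton[OF R xR(1)])
      hence "a \<in> (*) x ` R" using reg[OF a] by blast
      thus ?thesis using 2 by (simp add: genideal_ring_on_singleton[OF R xR(1)])
    qed
  qed (use xR ne in auto)
  hence "enat (length [x, y]) \<le> depth R" unfolding depth_def using x y
    by (intro Sup_upper CollectI exI[of _ "[x, y]"]) auto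
  thus ?thesis by (simp add: numeral_eq_enat numeral_2_eq_2)
qed


section \<open>Localization\<close>

context
  fixes A P :: "'a::field set"
  assumes A: "subdom A" and P: "prime_in P A"
begin

lemma zero_in_prime: "0 \<in> P"
  using P by (auto simp: prime_in_def ideal_in_def)

lemma localizeI: "a \<in> A \<Longrightarrow> b \<in> A \<Longrightarrow> b \<notin> P \<Longrightarrow> a / b \<in> localize A P"
  by (auto simp: localize_def)

lemma subset_localize: "A \<subseteq> localize A P"
  using localizeI[of _ 1] prime_inD(2)[OF P] subdom_one[OF A] by fastforce

lemma inverse_in_localize: "b \<in> A \<Longrightarrow> b \<notin> P \<Longrightarrow> inverse b \<in> localize A P"
  using localizeI[of 1 b] subdom_one[OF A] by (simp add: field_simps)

lemma subdom_localize: "subdom (localize A P)"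
proof (rule subdomI)
  show "1 \<in> localize A P" using subset_localize subdom_one[OF A] by blast
  fix x y assume "x \<in> localize A P" "y \<in> localize A P"
  then obtain a b c d where *: "x = a / b" "y = c / d" "a \<in> A" "b \<in> A" "c \<in> A" "d \<in> A" "b \<notin> P" "d \<notin> P"
    by (auto simp: localize_def)
  have bd: "b * d \<in> A" "b * d \<notin> P" "b \<noteq> 0" "d \<noteq> 0"
    using * prime_inD(3)[OF P] A zero_in_prime by auto
  have "x - y = (a * d - c * b) / (b * d)" using * bd by (simp add: field_simps)
  thus "x - y \<in> localize A P" using * bd A by (auto intro!: localizeI)
  have "x * y = (a * c) / (b * d)" using * bd by (simp add: field_simps)
  thus "x * y \<in> localize A P" using * bd A by (auto intro!: localizeI)
qed

lemma max_ideal_localize: "max_ideal (localize A P) = {a / b | a b. a \<in> P \<and> b \<in> A \<and> b \<notin> P}"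
proof (intro Set.set_eqI iffI)
  fix x assume x: "x \<in> max_ideal (localize A P)"
  then obtain a b where *: "x = a / b" "a \<in> A" "b \<in> A" "b \<notin> P" by (auto simp: max_ideal_def localize_def)
  have "a \<in> P"
  proof (rule ccontr)
    assume "a \<notin> P"
    hence "inverse x \<in> localize A P" using localizeI[of b a] * by simp
    moreover have "x \<noteq> 0" using \<open>a \<notin> P\<close> * zero_in_prime by auto
    ultimately show False using x by (auto simp: max_ideal_def)
  qed
  thus "x \<in> {a / b | a b. a \<in> P \<and> b \<in> A \<and> b \<notin> P}" using * by blast
next
  fix x assume "x \<in> {a / b | a b. a \<in> P \<and> b \<in> A \<and> b \<notin> P}"
  then obtain a b where *: "x = a / b" "a \<in> P" "b \<in> A" "b \<notin> P" by blast
  have PA: "P \<subseteq> A" using P by (auto simp: prime_in_def ideal_in_def)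
  have "inverse x \<notin> localize A P" if "x \<noteq> 0"
  proof
    assume "inverse x \<in> localize A P"
    then obtain c d where cd: "inverse x = c / d" "c \<in> A" "d \<in> A" "d \<notin> P" by (auto simp: localize_def)
    have "b \<noteq> 0" "d \<noteq> 0" "a \<noteq> 0" using * cd zero_in_prime that by auto
    hence "c * a = b * d" using cd(1) * by (simp add: field_simps)
    moreover have "c * a \<in> P" using ideal_inD(4)[OF prime_inD(1)[OF P]] cd * by blast
    ultimately show False using prime_inD(3)[OF P, of b d] * cd by auto
  qed
  thus "x \<in> max_ideal (localize A P)" using * PA localizeI by (auto simp: max_ideal_def)
qed

lemma max_ideal_localize_Int: "max_ideal (localize A P) \<inter> A = P"
proof
  show "max_ideal (localize A P) \<inter> A \<subseteq> P"
  proof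
    fix x assume "x \<in> max_ideal (localize A P) \<inter> A"
    then obtain a b where *: "x = a / b" "a \<in> P" "b \<in> A" "b \<notin> P" "x \<in> A" by (auto simp: max_ideal_localize)
    hence "b * x \<in> P" using zero_in_prime by auto
    thus "x \<in> P" using prime_inD(3)[OF P] * by blast
  qed
  have "x \<in> max_ideal (localize A P)" if "x \<in> P" for x
    unfolding max_ideal_localize using that prime_inD(2)[OF P] subdom_one[OF A]
    by (intro CollectI exI[of _ x] exI[of _ 1]) auto
  thus "P \<subseteq> max_ideal (localize A P) \<inter> A" using P by (auto simp: prime_in_def ideal_in_def)
qed

lemma prime_max_ideal_localize: "prime_in (max_ideal (localize A P)) (localize A P)"
  unfolding prime_in_def
proof (intro conjI ballI impI)
  have PI: "ideal_in P A" using P by (rule prime_inD)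
  show "ideal_in (max_ideal (localize A P)) (localize A P)" unfolding ideal_in_def
  proof (intro conjI ballI)
    show "max_ideal (localize A P) \<subseteq> localize A P" by (auto simp: max_ideal_def)
    show "0 \<in> max_ideal (localize A P)" using subdom_zero[OF subdom_localize] by (simp add: max_ideal_def)
  next
    fix x y assume "x \<in> max_ideal (localize A P)" "y \<in> max_ideal (localize A P)"
    then obtain a b c d where *: "x = a / b" "y = c / d" "a \<in> P" "b \<in> A" "c \<in> P" "d \<in> A" "b \<notin> P" "d \<notin> P"
      by (auto simp: max_ideal_localize)
    have bd: "b * d \<in> A" "b * d \<notin> P" "b \<noteq> 0" "d \<noteq> 0"
      using * prime_inD(3)[OF P] A zero_in_prime by auto
    have "x + y = (d * a + b * c) / (b * d)" using * bd by (simp add: field_simps)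
    moreover have "d * a + b * c \<in> P" using * by (intro ideal_inD(3)[OF PI] ideal_inD(4)[OF PI])
    ultimately show "x + y \<in> max_ideal (localize A P)" using bd by (auto simp: max_ideal_localize)
  next
    fix x y assume "x \<in> localize A P" "y \<in> max_ideal (localize A P)"
    then obtain a b c d where *: "x = a / b" "y = c / d" "a \<in> A" "b \<in> A" "c \<in> P" "d \<in> A" "b \<notin> P" "d \<notin> P"
      unfolding max_ideal_localize by (auto simp: localize_def)
    have bd: "b * d \<in> A" "b * d \<notin> P" "a * c \<in> P" "x * y = (a * c) / (b * d)"
      using * prime_inD(3)[OF P] A zero_in_prime ideal_inD(4)[OF PI] by auto
    thus "x * y \<in> max_ideal (localize A P)" by (auto simp: max_ideal_localize)
  qed
  show "1 \<notin> max_ideal (localize A P)" using subdom_localize by simp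
next
  fix x y assume xy: "x \<in> localize A P" "y \<in> localize A P" "x * y \<in> max_ideal (localize A P)"
  show "x \<in> max_ideal (localize A P) \<or> y \<in> max_ideal (localize A P)"
  proof (rule ccontr)
    assume "\<not> ?thesis"
    hence "x \<noteq> 0" "y \<noteq> 0" "inverse x \<in> localize A P" "inverse y \<in> localize A P"
      using xy by (auto simp: max_ideal_def)
    hence "inverse (x * y) \<in> localize A P" "x * y \<noteq> 0"
      using subdom_mult[OF subdom_localize, of "inverse x" "inverse y"] by (auto simp: mult.commute)
    thus False using xy(3) by (auto simp: max_ideal_def)
  qed
qed

lemma prime_contract:
  assumes Q: "prime_in Q (localize A P)"
  shows "prime_in (Q \<inter> A) A" "Q \<inter> A \<subseteq> P"
proof -
  have QI: "ideal_in Q (localize A P)" using Q by (rule prime_inD)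
  have sub: "a \<in> localize A P" if "a \<in> A" for a using subset_localize that by blast
  show "prime_in (Q \<inter> A) A" by (rule prime_in_Int[OF Q A subset_localize])
  show "Q \<inter> A \<subseteq> P" using prime_subset_max_ideal[OF Q subdom_localize] max_ideal_localize_Int by blast
qed

text \<open>A prime of the localization is recovered from its trace on A by multiplying with
  denominators; hence strict chains stay strict under contraction.\<close>

lemma prime_contract_subset:
  assumes Q: "prime_in Q (localize A P)" and Q': "prime_in Q' (localize A P)" and sub: "Q \<inter> A \<subseteq> Q'"
  shows "Q \<subseteq> Q'"
proof
  fix x assume x: "x \<in> Q"
  have QI: "ideal_in Q (localize A P)" using Q by (rule prime_inD)
  have QI': "ideal_in Q' (localize A P)" using Q' by (rule prime_inD)
  from x ideal_inD(6)[OF QI] obtain a b where *: "x = a / b" "a \<in> A" "b \<in> A" "b \<notin> P"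
    by (fastforce simp: localize_def)
  have "b * x \<in> Q" using ideal_inD(4)[OF QI _ x] * subset_localize by blast
  moreover have "b * x = a" using * zero_in_prime by auto
  ultimately have "a \<in> Q'" using sub * by auto
  hence "inverse b * a \<in> Q'" using ideal_inD(4)[OF QI'] inverse_in_localize * by blast
  thus "x \<in> Q'" using * by (simp add: field_simps)
qed

lemma krull_dim_localize_le: "krull_dim (localize A P) \<le> krull_dim A"
  unfolding krull_dim_def[of "localize A P"]
proof (rule Sup_least, safe)
  fix n Q assume *: "\<forall>i\<le>n. Q i \<in> spec (localize A P)" "\<forall>i<n. Q i \<subset> Q (Suc i)"
  have pr: "prime_in (Q i) (localize A P)" if "i \<le> n" for i using *(1) that by (simp add: spec_iff subdom_localize)
  have "prime_chain A n (\<lambda>i. Q i \<inter> A)" unfolding prime_chain_def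
  proof (intro conjI allI impI)
    fix i assume "i \<le> n" thus "Q i \<inter> A \<in> spec A" using prime_contract(1)[OF pr] by (simp add: spec_iff A)
  next
    fix i assume i: "i < n"
    hence "\<not> Q (Suc i) \<subseteq> Q i" using * by auto
    hence "\<not> Q (Suc i) \<inter> A \<subseteq> Q i" using prime_contract_subset[OF pr pr, of "Suc i" i] i by auto
    thus "Q i \<inter> A \<subset> Q (Suc i) \<inter> A" using * i by auto
  qed
  thus "enat n \<le> krull_dim A" by (rule krull_dim_geI)
qed

lemma depth_localize_le: "depth (localize A P) \<le> krull_dim (localize A P)"
  by (rule depth_le_krull_dim[OF subdom_localize prime_max_ideal_localize])

end

lemma cohen_macaulay_localI:
  assumes "subdom A" "prime_in P A" "krull_dim (localize A P) \<le> depth (localize A P)"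
  shows "cohen_macaulay_local (localize A P)"
  using depth_localize_le[OF assms(1,2)] assms(3) by (simp add: cohen_macaulay_local_def)

section \<open>Discrete valuations\<close>

text \<open>The value at 0 is left open, so the axioms speak of nonzero elements only and
  \<open>vge\<close> adds 0 by hand. The last axiom normalizes the value group to \<int>; this makes
  v determined by its valuation ring.\<close>

locale dval =
  fixes v :: "'a::field \<Rightarrow> int"
  assumes mult: "x \<noteq> 0 \<Longrightarrow> y \<noteq> 0 \<Longrightarrow> v (x * y) = v x + v y"
    and add: "x \<noteq> 0 \<Longrightarrow> y \<noteq> 0 \<Longrightarrow> x + y \<noteq> 0 \<Longrightarrow> min (v x) (v y) \<le> v (x + y)"
    and uniformizer: "\<exists>t. t \<noteq> 0 \<and> v t = 1"

definition vge :: "('a::field \<Rightarrow> int) \<Rightarrow> int \<Rightarrow> 'a set"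
  where "vge v n = {x. x = 0 \<or> n \<le> v x}"

abbreviation vring :: "('a::field \<Rightarrow> int) \<Rightarrow> 'a set"
  where "vring v \<equiv> vge v 0"

context dval
begin

lemma v_one [simp]: "v 1 = 0" using mult[of 1 1] by simp

lemma v_minus [simp]: "v (- x) = v x"
proof (cases "x = 0")
  case False
  have "v (- 1) = 0" using mult[of "-1" "-1"] by simp
  thus ?thesis using mult[of "-1" x] False by simp
qed simp

lemma v_inverse: "x \<noteq> 0 \<Longrightarrow> v (inverse x) = - v x" using mult[of x "inverse x"] by simp

lemma v_divide: "x \<noteq> 0 \<Longrightarrow> y \<noteq> 0 \<Longrightarrow> v (x / y) = v x - v y"
  using mult[of x "inverse y"] v_inverse by (simp add: field_simps)

lemma v_power: "x \<noteq> 0 \<Longrightarrow> v (x ^ n) = int n * v x" by (induction n) (auto simp: mult algebra_simps)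

lemma v_powi: "x \<noteq> 0 \<Longrightarrow> v (x powi n) = n * v x"
  by (cases n rule: int_cases4) (auto simp: power_int_minus v_inverse v_power)

lemma v_prod: "(\<And>i. i \<in> A \<Longrightarrow> f i \<noteq> 0) \<Longrightarrow> v (prod f A) = (\<Sum>i\<in>A. v (f i))"
  by (induction A rule: infinite_finite_induct) (auto simp: mult)

lemma vge_zero [simp]: "0 \<in> vge v n" by (simp add: vge_def)

lemma vge_add: "x \<in> vge v n \<Longrightarrow> y \<in> vge v n \<Longrightarrow> x + y \<in> vge v n"
  using add[of x y] by (cases "x = 0 \<or> y = 0 \<or> x + y = 0") (auto simp: vge_def)

lemma vge_minus: "x \<in> vge v n \<Longrightarrow> - x \<in> vge v n" by (auto simp: vge_def)

lemma vge_diff: "x \<in> vge v n \<Longrightarrow> y \<in> vge v n \<Longrightarrow> x - y \<in> vge v n"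
  using vge_add[of x n "-y"] vge_minus[of y n] by simp

lemma vge_sum: "(\<And>i. i \<in> A \<Longrightarrow> f i \<in> vge v n) \<Longrightarrow> sum f A \<in> vge v n"
  by (induction A rule: infinite_finite_induct) (auto intro: vge_add)

lemma vge_mult: "x \<in> vge v m \<Longrightarrow> y \<in> vge v n \<Longrightarrow> x * y \<in> vge v (m + n)"
  using mult[of x y] by (cases "x = 0 \<or> y = 0") (auto simp: vge_def)

lemma vge_mult_nonzero_iff: "x \<noteq> 0 \<Longrightarrow> x * y \<in> vge v n \<longleftrightarrow> y \<in> vge v (n - v x)"
  using mult[of x y] by (cases "y = 0") (auto simp: vge_def)

lemma vge_mono: "x \<in> vge v m \<Longrightarrow> n \<le> m \<Longrightarrow> x \<in> vge v n" by (auto simp: vge_def)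

lemma vgeI: "v x \<ge> n \<Longrightarrow> x \<in> vge v n" by (auto simp: vge_def)

lemma v_add_eq:
  assumes "x \<noteq> 0" "y \<in> vge v (v x + 1)"
  shows "x + y \<noteq> 0" "v (x + y) = v x"
proof -
  show ne: "x + y \<noteq> 0"
  proof
    assume "x + y = 0" hence "y = - x" by (simp add: eq_neg_iff_add_eq_0 add.commute)
    thus False using assms by (auto simp: vge_def)
  qed
  have "x + y \<in> vge v (v x)" using assms by (intro vge_add) (auto simp: vge_def)
  moreover have "\<not> v (x + y) > v x"
  proof
    assume "v (x + y) > v x"
    hence "x + y - y \<in> vge v (v x + 1)" using assms by (intro vge_diff) (auto simp: vge_def)
    thus False using assms by (simp add: vge_def)
  qed
  ultimately show "v (x + y) = v x" using ne by (auto simp: vge_def)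
qed

lemma subdom_vring: "subdom (vring v)"
proof (rule subdomI)
  fix a b assume "a \<in> vring v" "b \<in> vring v"
  thus "a - b \<in> vring v" "a * b \<in> vring v" using vge_diff vge_mult[of a 0 b 0] by auto
qed (simp add: vge_def)

lemma max_ideal_vring: "max_ideal (vring v) = vge v 1"
  by (auto simp: max_ideal_def vge_def v_inverse)

lemma inverse_in_vring_iff: "x \<noteq> 0 \<Longrightarrow> x \<in> vring v \<and> inverse x \<in> vring v \<longleftrightarrow> v x = 0"
  by (auto simp: vge_def v_inverse)

lemma uniformizer_vring: "uniformizer (vring v) t \<longleftrightarrow> t \<noteq> 0 \<and> v t = 1"
proof
  assume "uniformizer (vring v) t"
  hence t: "t \<noteq> 0" "vge v 1 = (*) t ` vring v" by (auto simp: Defs.uniformizer_def max_ideal_vring)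
  obtain s where s: "s \<noteq> 0" "v s = 1" using uniformizer by blast
  hence "s \<in> (*) t ` vring v" using t by (auto simp: vge_def)
  then obtain r where "s = t * r" "r \<in> vring v" by auto
  moreover have "t \<in> vge v 1" using t subdom_one[OF subdom_vring] by (metis imageI mult.right_neutral)
  ultimately show "t \<noteq> 0 \<and> v t = 1" using s t mult[of t r] by (cases "r = 0") (auto simp: vge_def)
next
  assume t: "t \<noteq> 0 \<and> v t = 1"
  have "vge v 1 = (*) t ` vring v"
  proof (intro Set.set_eqI iffI)
    fix x assume x: "x \<in> vge v 1"
    hence "x / t \<in> vring v" using t v_divide[of x t] by (cases "x = 0") (auto simp: vge_def)
    thus "x \<in> (*) t ` vring v" using t by (intro image_eqI[of _ _ "x / t"]) auto
  next
    fix x assume "x \<in> (*) t ` vring v"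
    thus "x \<in> vge v 1" using t by (auto simp: vge_mult_nonzero_iff)
  qed
  thus "uniformizer (vring v) t" using t by (simp add: Defs.uniformizer_def max_ideal_vring)
qed

lemma ord_at_vring:
  assumes "f \<noteq> 0"
  shows "ord_at (vring v) f = v f"
  unfolding ord_at_def
proof (rule the_equality)
  obtain t where t: "t \<noteq> 0" "v t = 1" using uniformizer by blast
  define u where "u = f * t powi (- v f)"
  have u: "u \<noteq> 0" "v u = 0" using assms t by (auto simp: u_def mult v_powi)
  have "f = u * t powi v f" using t by (simp add: u_def power_int_minus)
  thus "\<exists>t u. Defs.uniformizer (vring v) t \<and> u \<noteq> 0 \<and> u \<in> vring v \<and> inverse u \<in> vring v \<and> f = u * t powi v f"
    using t u inverse_in_vring_iff[of u] uniformizer_vring by blast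
next
  fix e assume "\<exists>t u. Defs.uniformizer (vring v) t \<and> u \<noteq> 0 \<and> u \<in> vring v \<and> inverse u \<in> vring v \<and> f = u * t powi e"
  then obtain t u where "t \<noteq> 0" "v t = 1" "u \<noteq> 0" "v u = 0" "f = u * t powi e"
    using inverse_in_vring_iff uniformizer_vring by blast
  thus "e = v f" by (simp add: mult v_powi)
qed

lemma frac_field_vring: "frac_field (vring v) = UNIV"
proof -
  have "x \<in> frac_field (vring v)" for x
  proof (cases "x \<in> vring v")
    case True thus ?thesis unfolding frac_field_def using subdom_one[OF subdom_vring]
      by (intro CollectI exI[of _ x] exI[of _ 1]) auto
  next
    case False
    hence "inverse x \<in> vring v" "inverse x \<noteq> 0" by (auto simp: vge_def v_inverse)
    thus ?thesis unfolding frac_field_def using subdom_one[OF subdom_vring]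
      by (intro CollectI exI[of _ 1] exI[of _ "inverse x"]) (auto simp: field_simps)
  qed
  thus ?thesis by blast
qed

lemma prime_in_vring:
  assumes P: "prime_in P (vring v)" "P \<noteq> {0}"
  shows "P = vge v 1"
proof
  have PI: "ideal_in P (vring v)" using P(1) by (rule prime_inD)
  show "P \<subseteq> vge v 1" using prime_subset_max_ideal[OF P(1) subdom_vring] max_ideal_vring by simp
  obtain a where a: "a \<in> P" "a \<noteq> 0" using P(2) ideal_inD(2)[OF PI] by auto
  show "vge v 1 \<subseteq> P"
  proof
    fix x assume x: "x \<in> vge v 1"
    show "x \<in> P"
    proof (cases "x = 0")
      case True thus ?thesis using ideal_inD(2)[OF PI] by simp
    next
      case False
      \<comment> \<open>Since v x is at least 1, the n-th power of x has at least the value of a and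
        is a multiple of a.\<close>
      define n where "n = nat (v a)"
      have va: "v a \<ge> 0" using a ideal_inD(6)[OF PI, of a] by (auto simp: vge_def)
      have "v x \<ge> 1" using x False by (auto simp: vge_def)
      hence "int n * v x \<ge> int n * 1" by (intro mult_left_mono) auto
      hence "v (x ^ n / a) \<ge> 0" using False a va by (simp add: v_divide v_power n_def)
      hence "x ^ n / a \<in> vring v" by (rule vgeI)
      hence "(x ^ n / a) * a \<in> P" using ideal_inD(4)[OF PI] a by blast
      hence "x ^ n \<in> P" using a by simp
      moreover have "x \<in> vring v" using x by (rule vge_mono) simp
      ultimately show ?thesis using prime_in_power[OF P(1) subdom_vring] by blast
    qed
  qed
qed

lemma prime_in_vge_1: "prime_in (vge v 1) (vring v)"
  unfolding prime_in_def ideal_in_def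
proof (intro conjI ballI impI)
  fix a b assume "a \<in> vring v" "b \<in> vring v" "a * b \<in> vge v 1"
  thus "a \<in> vge v 1 \<or> b \<in> vge v 1" using mult[of a b] by (cases "a = 0 \<or> b = 0") (auto simp: vge_def)
next
  fix a b assume "a \<in> vring v" "b \<in> vge v 1"
  thus "a * b \<in> vge v 1" using vge_mult[of a 0 b 1] by simp
qed (auto simp: vge_add intro: vge_mono, auto simp: vge_def)

lemma vge_1_neq_0: "vge v 1 \<noteq> {0}"
proof -
  obtain t where "t \<noteq> 0" "v t = 1" using uniformizer by blast
  hence "t \<in> vge v 1" "t \<notin> {0}" by (auto intro: vgeI)
  thus ?thesis by blast
qed

lemma krull_dim_vring: "krull_dim (vring v) = 1"
proof (rule antisym)
  have "prime_chain (vring v) 1 (\<lambda>i. if i = 0 then {0} else vge v 1)"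
    unfolding prime_chain_def using vge_1_neq_0
    by (auto simp: spec_iff[OF subdom_vring] prime_in_zero subdom_vring prime_in_vge_1)
  from krull_dim_geI[OF this] show "1 \<le> krull_dim (vring v)" by (simp add: one_enat_def)
  have "krull_dim (vring v) \<le> enat 1"
  proof (rule krull_dim_leI, rule notI)
    fix P assume ch: "prime_chain (vring v) (Suc 1) P"
    have pr: "prime_in (P i) (vring v)" if "i \<le> 2" for i
      using ch that by (simp add: prime_chain_def spec_iff[OF subdom_vring] numeral_2_eq_2)
    have "P 0 \<subset> P 1" "P 1 \<subset> P 2" using prime_chain_mono_less[OF ch] by auto
    moreover have "0 \<in> P 0" "0 \<in> P 1" using pr[of 0] pr[of 1] by (auto simp: prime_in_def ideal_in_def)
    ultimately have "P 1 \<noteq> {0}" "P 2 \<noteq> {0}" by auto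
    hence "P 1 = P 2" using prime_in_vring[OF pr[of 1]] prime_in_vring[OF pr[of 2]] by simp
    thus False using \<open>P 1 \<subset> P 2\<close> by auto
  qed
  thus "krull_dim (vring v) \<le> 1" by (simp add: one_enat_def)
qed

lemma one_le_depth_vring: "1 \<le> depth (vring v)"
proof -
  obtain t where "t \<noteq> 0" "v t = 1" using uniformizer by blast
  moreover from this have "t \<in> vge v 1" by (simp add: vgeI)
  ultimately show ?thesis using depth_ge1[OF subdom_vring, of t] prime_inD(1)[OF prime_in_vge_1]
    by (simp add: max_ideal_vring)
qed

end

text \<open>Units of the first ring are units of the second, so w is the multiple \<open>w t\<close>
  of v. This factor is nonnegative, and it is 1 because w also attains the value 1.\<close>

lemma vring_eq_imp_eq:
  assumes "dval v" "dval w" "vring v \<subseteq> vring w" "x \<noteq> 0"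
  shows "v x = w x"
proof -
  interpret v: dval v by fact
  interpret w: dval w by fact
  have sub: "w x \<ge> 0" if "v x \<ge> 0" "x \<noteq> 0" for x using assms(3) that by (auto simp: vge_def)
  have unit: "w x = 0" if "v x = 0" "x \<noteq> 0" for x
    using sub[of x] sub[of "inverse x"] that by (simp add: v.v_inverse w.v_inverse)
  obtain t where t: "t \<noteq> 0" "v t = 1" using v.uniformizer by blast
  have w: "w x = v x * w t" if "x \<noteq> 0" for x
  proof -
    have "w (x * t powi (- v x)) = 0" using t that by (intro unit) (auto simp: v.mult v.v_powi)
    thus ?thesis using t that by (simp add: w.mult w.v_powi)
  qed
  have "w t \<ge> 0" using sub[of t] t by simp
  moreover obtain s where "s \<noteq> 0" "w s = 1" using w.uniformizer by blast
  hence "v s * w t = 1" using w[of s] by simp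
  ultimately have "w t = 1" using zmult_eq_1_iff by auto
  thus ?thesis using w[OF assms(4)] by simp
qed

text \<open>Krull's intersection theorem is replaced by a dimension argument: if a nonzero a were
  divisible by all powers of t, a prime containing a and avoiding these powers would lie strictly
  between 0 and the maximal ideal. So each nonzero element is a power of t times a unit.\<close>

lemma dval_of_regular_local_ring:
  assumes R: "subdom R" and M: "prime_in (max_ideal R) R" and frac: "frac_field R = UNIV"
    and dim: "krull_dim R = 1" and reg: "regular_local_ring R"
  shows "dval (ord_at R) \<and> vring (ord_at R) = R"
proof -
  from reg dim obtain S where "finite S" "enat (card S) = 1" and S: "S \<subseteq> R" "max_ideal R = genideal (ring_on R) S"
    by (auto simp: regular_local_ring_def)
  hence "card S = 1" by (simp add: one_enat_def)
  then obtain t where "S = {t}" by (rule card_1_singletonE)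
  with S have tR: "t \<in> R" and mt: "max_ideal R = (*) t ` R"
    using genideal_ring_on_singleton[OF R] by auto
  have unit: "inverse x \<in> R" "x \<noteq> 0" if "x \<in> R" "x \<notin> (*) t ` R" for x
    using that unfolding mt[symmetric] by (auto simp: max_ideal_def)
  have tM: "t \<in> max_ideal R" unfolding mt using subdom_one[OF R] by (intro image_eqI[of _ _ 1]) auto
  have t0: "t \<noteq> 0"
  proof
    assume "t = 0"
    hence m0: "max_ideal R = {0}" using mt subdom_one[OF R] by auto
    have "\<exists>P. prime_chain R (Suc 0) P"
      by (rule krull_dim_geD) (simp add: dim one_enat_def)
    then obtain P where P: "prime_chain R 1 P" by auto
    hence "P 0 \<subset> P 1" "prime_in (P 0) R" "prime_in (P 1) R" by (auto simp: prime_chain_def spec_iff[OF R])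
    thus False using prime_subset_max_ideal[of _ R] R m0 by (auto simp: prime_in_def ideal_in_def)
  qed
  have tnu: "\<not> (u \<in> R \<and> t ^ n * u = 1)" if "n > 0" for n u
  proof
    assume *: "u \<in> R \<and> t ^ n * u = 1"
    have "t ^ n * u = t * (t ^ (n - 1) * u)" using that by (cases n) (auto simp: mult_ac)
    hence "t * (t ^ (n - 1) * u) = 1" using * by simp
    hence "inverse t = t ^ (n - 1) * u" by (rule inverse_unique)
    hence "inverse t \<in> R" using * tR R by (simp add: subdom_mult subdom_power)
    thus False using tM t0 by (auto simp: max_ideal_def)
  qed
  have J0: "a = 0" if a: "a \<in> R" "\<And>n. a \<in> (*) (t ^ n) ` R" for a
  proof (rule ccontr)
    assume a0: "a \<noteq> 0"
    have "\<exists>n. t ^ n \<in> (*) a ` R"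
    proof (rule ccontr)
      assume "\<not> ?thesis"
      hence "range ((^) t) \<inter> (*) a ` R = {}" by auto
      moreover have "x * y \<in> range ((^) t)" if "x \<in> range ((^) t)" "y \<in> range ((^) t)" for x y
        using that by (auto simp flip: power_add)
      moreover have "1 \<in> range ((^) t)" by (rule range_eqI[of _ _ 0]) simp
      ultimately have "\<exists>P. prime_in P R \<and> (*) a ` R \<subseteq> P \<and> P \<inter> range ((^) t) = {}"
        using tR R by (intro exists_prime_avoiding ideal_in_principal a) auto
      then obtain P where P: "prime_in P R" "(*) a ` R \<subseteq> P" "P \<inter> range ((^) t) = {}" by blast
      have "a \<in> P" using P(2) subdom_one[OF R] by force
      hence "{0} \<subset> P" using ideal_inD(2)[OF prime_inD(1)[OF P(1)]] a0 by blast
      moreover have "t \<notin> P" using P(3) range_eqI[of t "(^) t" 1] by auto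
      hence "P \<subset> max_ideal R" using prime_subset_max_ideal[OF P(1) R] tM by blast
      ultimately have "prime_chain R 2 (\<lambda>i. if i = 0 then {0} else if i = 1 then P else max_ideal R)"
        using P(1) M prime_in_zero[OF R] by (auto simp: prime_chain_def spec_iff[OF R] less_2_cases_iff)
      hence "enat 2 \<le> 1" using krull_dim_geI dim by metis
      thus False by (simp add: one_enat_def)
    qed
    then obtain n r where r: "t ^ n = a * r" "r \<in> R" by blast
    \<comment> \<open>Now a divides t^n and t^(n+1) divides a, so t would be a unit.\<close>
    obtain s where s: "a = t ^ Suc n * s" "s \<in> R" using a(2)[of "Suc n"] by blast
    have "t ^ n * (t * (s * r)) = t ^ n * 1" using r(1) by (simp add: s(1) mult_ac)
    hence "t ^ 1 * (s * r) = 1" using t0 by simp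
    thus False using tnu[of 1 "s * r"] subdom_mult[OF R s(2) r(2)] by simp
  qed
  have outJ: "\<exists>n u. a = t ^ n * u \<and> u \<in> R \<and> inverse u \<in> R \<and> u \<noteq> 0" if a: "a \<in> R" "a \<noteq> 0" for a
  proof -
    from J0[OF a(1)] a(2) have ex: "\<exists>n. a \<notin> (*) (t ^ n) ` R" by blast
    define n where "n = (LEAST n. a \<notin> (*) (t ^ n) ` R)"
    have n: "a \<notin> (*) (t ^ n) ` R" unfolding n_def by (rule LeastI_ex[OF ex])
    have "n \<noteq> 0" using n a(1) by (intro notI) auto
    then obtain m where m: "n = Suc m" by (cases n) auto
    have "a \<in> (*) (t ^ m) ` R" using not_less_Least[of m "\<lambda>n. a \<notin> (*) (t ^ n) ` R"] m unfolding n_def by auto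
    then obtain u where u: "a = t ^ m * u" "u \<in> R" by auto
    have "u \<notin> (*) t ` R" using n u unfolding m by (auto simp: mult_ac)
    thus ?thesis using u unit by blast
  qed
  define U where "U = {u. u \<noteq> 0 \<and> u \<in> R \<and> inverse u \<in> R}"
  have U_mult: "u * w \<in> U" "inverse u \<in> U" if "u \<in> U" "w \<in> U" for u w
    using that R by (auto simp: U_def)
  have dec: "\<exists>u\<in>U. \<exists>e. x = u * t powi e" if "x \<noteq> 0" for x
  proof -
    from frac obtain a b where ab: "x = a / b" "a \<in> R" "b \<in> R" "b \<noteq> 0" by (force simp: frac_field_def)
    have "a \<noteq> 0" using ab that by auto
    then obtain n u m w where uw: "a = t ^ n * u" "u \<in> U" "b = t ^ m * w" "w \<in> U"
      using outJ[OF ab(2)] outJ[OF ab(3,4)] unfolding U_def by blast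
    hence "u * inverse w \<in> U" "w \<noteq> 0" using U_mult by (auto simp: U_def)
    moreover have "x = (u * inverse w) * t powi (int n - int m)"
      using ab uw t0 \<open>w \<noteq> 0\<close> by (simp add: power_int_diff field_simps)
    ultimately show ?thesis by blast
  qed
  have uniq: "e = 0" if "t powi e \<in> U" for e
  proof (rule ccontr)
    assume "e \<noteq> 0"
    define n where "n = nat \<bar>e\<bar>"
    have "t ^ n \<in> U"
    proof (cases "e \<ge> 0")
      case True thus ?thesis using that by (simp add: n_def power_int_def)
    next
      case False
      hence "inverse (t powi e) = t ^ n" by (simp add: n_def power_int_def power_inverse)
      thus ?thesis using U_mult(2)[OF that that] by simp
    qed
    hence "inverse (t ^ n) \<in> R" "t ^ n * inverse (t ^ n) = 1" using t0 unfolding U_def by auto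
    thus False using tnu[of n "inverse (t ^ n)"] \<open>e \<noteq> 0\<close> by (auto simp: n_def)
  qed
  \<comment> \<open>An auxiliary valuation: once the axioms are verified for it,
    \<open>ord_at_vring\<close> identifies it with \<open>ord_at R\<close> away from 0.\<close>
  define v where "v = (\<lambda>x. SOME e. \<exists>u\<in>U. x = u * t powi e)"
  have v: "\<exists>u\<in>U. x = u * t powi v x" if "x \<noteq> 0" for x
    unfolding v_def by (rule someI_ex) (use dec[OF that] in blast)
  have vI: "v (u * t powi e) = e" if "u \<in> U" for u e
  proof -
    have "u * t powi e \<noteq> 0" using that t0 by (auto simp: U_def)
    from v[OF this] obtain w where w: "w \<in> U" "u * t powi e = w * t powi v (u * t powi e)" by blast
    hence "t powi (e - v (u * t powi e)) = w * inverse u"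
      using that t0 by (auto simp: power_int_diff field_simps U_def)
    moreover have "w * inverse u \<in> U" using U_mult w that by blast
    ultimately have "e - v (u * t powi e) = 0" using uniq by metis
    thus ?thesis by simp
  qed
  have dec': "\<exists>u i. u \<in> U \<and> x = u * t powi i \<and> v x = i" if "x \<noteq> 0" for x
    using dec[OF that] vI by blast
  have vR: "x \<in> R \<longleftrightarrow> v x \<ge> 0" if x0: "x \<noteq> 0" for x
  proof
    assume "x \<in> R"
    then obtain n u where "x = t ^ n * u" "u \<in> U" using outJ[of x] x0 by (auto simp: U_def)
    thus "v x \<ge> 0" using vI[of u "int n"] by (simp add: mult.commute)
  next
    assume "v x \<ge> 0"
    moreover obtain u i where u: "u \<in> U" "x = u * t powi i" "v x = i" using dec'[OF x0] by blast
    ultimately have "x = u * t ^ nat i" by (simp add: power_int_def)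
    thus "x \<in> R" using R tR u by (auto simp: U_def)
  qed
  have v_mult: "v (x * y) = v x + v y" if xy: "x \<noteq> 0" "y \<noteq> 0" for x y
  proof -
    obtain u i where u: "u \<in> U" "x = u * t powi i" "v x = i" using dec'[OF xy(1)] by blast
    obtain w j where w: "w \<in> U" "y = w * t powi j" "v y = j" using dec'[OF xy(2)] by blast
    have "x * y = (u * w) * t powi (i + j)"
      using t0 by (simp add: u(2) w(2) power_int_add mult_ac)
    thus "v (x * y) = v x + v y" using vI[OF U_mult(1)[OF u(1) w(1)]] u(3) w(3) by metis
  qed
  have "dval v"
  proof
    show "v (x * y) = v x + v y" if "x \<noteq> 0" "y \<noteq> 0" for x y by (rule v_mult[OF that])
  next
    fix x y :: 'a assume xy: "x \<noteq> 0" "y \<noteq> 0" "x + y \<noteq> 0"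
    have *: "v x \<le> v (x + y)" if a: "v x \<le> v y" "x \<noteq> 0" "y \<noteq> 0" "x + y \<noteq> 0" for x y
    proof -
      have "v y = v x + v (y / x)" using v_mult[of x "y / x"] a(2,3) by simp
      hence "y / x \<in> R" using vR[of "y / x"] a(1-3) by simp
      hence "1 + y / x \<in> R" using subdom_add[OF R subdom_one[OF R]] by simp
      moreover have xy: "x * (1 + y / x) = x + y" using a(2) by (simp add: field_simps)
      hence nz: "1 + y / x \<noteq> 0" using a(4) by force
      ultimately show ?thesis using vR[OF nz] v_mult[OF a(2) nz] unfolding xy by simp
    qed
    show "min (v x) (v y) \<le> v (x + y)"
      using *[of x y] *[of y x] xy by (cases "v x \<le> v y") (auto simp: add.commute)
  next
    have "1 \<in> U" using subdom_one[OF R] by (simp add: U_def)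
    hence "v t = 1" using vI[of 1 1] by simp
    thus "\<exists>t. t \<noteq> 0 \<and> v t = 1" using t0 by blast
  qed
  then interpret v: dval v .
  have Rv: "R = vring v"
  proof (rule Set.set_eqI)
    fix x show "x \<in> R \<longleftrightarrow> x \<in> vring v" using vR[of x] subdom_zero[OF R] by (cases "x = 0") (auto simp: vge_def)
  qed
  have eq: "ord_at R x = v x" if "x \<noteq> 0" for x using v.ord_at_vring[OF that] Rv by simp
  have "dval (ord_at R)"
    by unfold_locales (use eq v.mult v.add v.uniformizer in auto)
  moreover have "vring (ord_at R) = vring v"
  proof (rule Set.set_eqI)
    fix x show "x \<in> vring (ord_at R) \<longleftrightarrow> x \<in> vring v" using eq[of x] by (cases "x = 0") (auto simp: vge_def)
  qed
  hence "vring (ord_at R) = R" using Rv by simp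
  ultimately show ?thesis by blast
qed

text \<open>If \<open>a \<in> Q - P\<close> and \<open>0 \<noteq> b \<in> P\<close>, then \<open>a\<^sup>n / b\<close> is in the valuation ring for large \<open>n\<close>, so that a
  multiple of \<open>a\<^sup>n\<close> by an element outside \<open>Q\<close> is in \<open>P\<close>.\<close>

lemma (in dval) no_prime_below_center:
  assumes A: "subdom A" "prime_in P A" "prime_in Q A" and loc: "localize A Q = vring v" and sub: "P \<subset> Q"
  shows "P = {0}"
proof (rule ccontr)
  assume "P \<noteq> {0}"
  then obtain b where b: "b \<in> P" "b \<noteq> 0" using ideal_inD(2)[OF prime_inD(1)[OF A(2)]] by blast
  obtain a where a: "a \<in> Q" "a \<notin> P" using sub by blast
  note PI = prime_inD(1)[OF A(2)]
  have aA: "a \<in> A" using a(1) ideal_inD(1)[OF prime_inD(1)[OF A(3)]] by blast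
  have bA: "b \<in> A" using b(1) ideal_inD(1)[OF PI] by blast
  have a0: "a \<noteq> 0" using a(2) ideal_inD(2)[OF PI] by blast
  have "a \<in> max_ideal (localize A Q)" using a(1) max_ideal_localize_Int[OF A(1,3)] by blast
  hence va: "v a \<ge> 1" using a0 unfolding loc max_ideal_vring by (simp add: vge_def)
  have "b \<in> localize A Q" using bA subset_localize[OF A(1,3)] by blast
  hence vb: "v b \<ge> 0" using b(2) unfolding loc by (simp add: vge_def)
  define n where "n = nat (v b)"
  have "int n * 1 \<le> int n * v a" using va by (intro mult_left_mono) auto
  hence "v (a ^ n / b) \<ge> 0" using a0 b(2) vb by (simp add: v_divide v_power n_def)
  hence "a ^ n / b \<in> localize A Q" unfolding loc by (rule vgeI)
  then obtain c d where cd: "a ^ n / b = c / d" "c \<in> A" "d \<in> A" "d \<notin> Q" unfolding localize_def by blast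
  have "d \<noteq> 0" using cd(4) zero_in_prime[OF A(1,3)] by blast
  hence "d * a ^ n = c * b" using cd(1) b(2) by (simp add: field_simps)
  hence "d * a ^ n \<in> P" using ideal_inD(4)[OF PI cd(2) b(1)] by simp
  moreover have "d \<notin> P" using cd(4) sub by blast
  ultimately have "a ^ n \<in> P" using prime_inD(3)[OF A(2) cd(3) subdom_power[OF A(1) aA]] by blast
  thus False using prime_in_power[OF A(2,1) aA] a(2) by blast
qed


section \<open>Algebraicity of generators of a residue field\<close>

definition coeffs_in :: "'a::field set \<Rightarrow> 'a poly \<Rightarrow> bool"
  where "coeffs_in D p \<longleftrightarrow> (\<forall>i. coeff p i \<in> D)"

definition adjoin :: "'a::field set \<Rightarrow> 'a \<Rightarrow> 'a set"
  where "adjoin D x = {poly p x | p. coeffs_in D p}"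

text \<open>The image of x modulo m is algebraic over the image of D; the relation counts as nonzero
  if some coefficient survives modulo m.\<close>

definition alg_mod :: "'a::field set \<Rightarrow> 'a set \<Rightarrow> 'a \<Rightarrow> bool"
  where "alg_mod D m x \<longleftrightarrow> (\<exists>p. coeffs_in D p \<and> (\<exists>i. coeff p i \<notin> m) \<and> poly p x \<in> m)"

text \<open>\<open>D / (m \<inter> D)\<close> becomes a field when a single element is inverted (a Goldman domain).\<close>

definition goldman :: "'a::field set \<Rightarrow> 'a set \<Rightarrow> bool"
  where "goldman D m \<longleftrightarrow> (\<exists>d\<in>D. d \<notin> m \<and> (\<forall>e\<in>D. e \<notin> m \<longrightarrow> (\<exists>r\<in>D. \<exists>N. e * r - d ^ N \<in> m)))"

context
  fixes D :: "'a::field set"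
  assumes D: "subdom D"
begin

lemma coeffs_in_0 [simp]: "coeffs_in D 0" by (simp add: coeffs_in_def D)
lemma coeffs_in_pCons [simp]: "coeffs_in D (pCons a p) \<longleftrightarrow> a \<in> D \<and> coeffs_in D p"
  by (auto simp: coeffs_in_def coeff_pCons split: nat.splits)
lemma coeffs_in_1 [simp]: "coeffs_in D 1" using D by (simp add: one_pCons)
lemma coeffs_in_diff: "coeffs_in D p \<Longrightarrow> coeffs_in D q \<Longrightarrow> coeffs_in D (p - q)"
  using D by (auto simp: coeffs_in_def)
lemma coeffs_in_add: "coeffs_in D p \<Longrightarrow> coeffs_in D q \<Longrightarrow> coeffs_in D (p + q)"
  using D by (auto simp: coeffs_in_def)
lemma coeffs_in_mult: "coeffs_in D p \<Longrightarrow> coeffs_in D q \<Longrightarrow> coeffs_in D (p * q)"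
  using D by (auto simp: coeffs_in_def coeff_mult)
lemma coeffs_in_smult: "a \<in> D \<Longrightarrow> coeffs_in D q \<Longrightarrow> coeffs_in D (smult a q)"
  using D by (auto simp: coeffs_in_def)
lemma coeffs_in_monom: "a \<in> D \<Longrightarrow> coeffs_in D (monom a n)"
  using D by (auto simp: coeffs_in_def)

lemma subdom_adjoin: "subdom (adjoin D x)"
proof (rule subdomI)
  show "1 \<in> adjoin D x" unfolding adjoin_def using coeffs_in_1 by (intro CollectI exI[of _ 1]) auto
  fix a b assume "a \<in> adjoin D x" "b \<in> adjoin D x"
  then obtain p q where "a = poly p x" "b = poly q x" "coeffs_in D p" "coeffs_in D q" by (auto simp: adjoin_def)
  hence "coeffs_in D (p - q)" "a - b = poly (p - q) x" "coeffs_in D (p * q)" "a * b = poly (p * q) x"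
    using coeffs_in_diff[of p q] coeffs_in_mult[of p q] by auto
  thus "a - b \<in> adjoin D x" "a * b \<in> adjoin D x" unfolding adjoin_def by blast+
qed

lemma subset_adjoin: "D \<subseteq> adjoin D x"
proof
  fix a assume "a \<in> D"
  thus "a \<in> adjoin D x" unfolding adjoin_def using D by (intro CollectI exI[of _ "[:a:]"]) auto
qed

lemma in_adjoin: "x \<in> adjoin D x"
  unfolding adjoin_def using D by (intro CollectI exI[of _ "[:0, 1:]"]) auto

lemma adjoin_subset:
  assumes "subdom T" "D \<subseteq> T" "x \<in> T"
  shows "adjoin D x \<subseteq> T"
proof
  fix y assume "y \<in> adjoin D x"
  then obtain p where "y = poly p x" "coeffs_in D p" by (auto simp: adjoin_def)
  thus "y \<in> T" using assms subdom_poly[OF assms(1), of p x] by (auto simp: coeffs_in_def)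
qed

text \<open>Division with remainder when the leading coefficient b of g is not invertible: every
  reduction of the degree costs one factor b.\<close>

lemma pseudo_division:
  assumes g: "coeffs_in D g" "degree g = j" "j > 0" and q: "coeffs_in D q"
  shows "\<exists>K s r. coeffs_in D s \<and> coeffs_in D r \<and> degree r < j \<and>
           smult (coeff g j ^ K) q = s * g + r"
  using q
proof (induction q)
  case 0
  show ?case using g(3) by (intro exI[of _ 0]) auto
next
  case (pCons c q)
  define b where "b = coeff g j"
  have bD: "b \<in> D" using g by (auto simp: b_def coeffs_in_def)
  from pCons obtain K s r where K: "coeffs_in D s" "coeffs_in D r" "degree r < j"
    "smult (b ^ K) q = s * g + r" unfolding b_def by auto
  define r' where "r' = pCons (b ^ K * c) r"
  have r': "coeffs_in D r'" using pCons.prems K bD D by (auto simp: r'_def)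
  have eq: "smult (b ^ K) (pCons c q) = pCons 0 s * g + r'" by (simp add: r'_def K(4) algebra_simps)
  have deg: "degree r' \<le> j" using K(3) by (auto simp: r'_def degree_pCons_le le_trans[OF degree_pCons_le])
  define e where "e = coeff r' j"
  have eD: "e \<in> D" using r' by (auto simp: e_def coeffs_in_def)
  define r'' where "r'' = smult b r' - smult e g"
  have "coeff r'' i = 0" if "i \<ge> j" for i
    using that deg g(2) by (cases "i = j") (auto simp: r''_def e_def b_def coeff_eq_0)
  hence "degree r'' < j"
    using g(3) by (metis degree_0 leading_coeff_0_iff not_le)
  moreover have "coeffs_in D r''" unfolding r''_def using r' g eD bD by (intro coeffs_in_diff coeffs_in_smult)
  moreover have "coeffs_in D (smult b (pCons 0 s) + [:e:])"
    using K eD bD D by (intro coeffs_in_add coeffs_in_smult) auto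
  moreover have "smult (b ^ Suc K) (pCons c q) = (smult b (pCons 0 s) + [:e:]) * g + r''"
  proof -
    have "smult (b ^ Suc K) (pCons c q) = smult b (smult (b ^ K) (pCons c q))" by simp
    also have "\<dots> = smult b (pCons 0 s * g + r')" by (simp only: eq)
    also have "\<dots> = (smult b (pCons 0 s) + [:e:]) * g + r''" by (simp add: r''_def smult_add_right algebra_simps)
    finally show ?thesis .
  qed
  ultimately show ?case unfolding b_def by blast
qed

end

lemma coeffs_in_mono: "D \<subseteq> E \<Longrightarrow> coeffs_in D p \<Longrightarrow> coeffs_in E p"
  by (auto simp: coeffs_in_def)

lemma poly_in_ideal:
  assumes "subdom R" "ideal_in m R" "coeffs_in m p" "x \<in> R"
  shows "poly p x \<in> m"
  unfolding poly_altdef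
proof (rule ideal_in_sum[OF assms(2)])
  fix i show "coeff p i * x ^ i \<in> m"
    using ideal_inD(5)[OF assms(2), of "x^i"] assms by (auto simp: coeffs_in_def)
qed

text \<open>The degree of p modulo m. The lower bound \<open>i0\<close> is kept because it later
  shows that this degree is positive.\<close>

lemma obtain_top_coeff:
  assumes "0 \<in> m" "coeff p i0 \<notin> m"
  obtains i where "i \<ge> i0" "coeff p i \<notin> m" "\<And>j. j > i \<Longrightarrow> coeff p j \<in> m"
proof -
  define S where "S = {i. coeff p i \<notin> m}"
  have "S \<subseteq> {..degree p}"
  proof
    fix i assume "i \<in> S"
    hence "coeff p i \<noteq> 0" using assms(1) by (auto simp: S_def)
    thus "i \<in> {..degree p}" by (simp add: le_degree)
  qed
  hence fin: "finite S" by (rule finite_subset) simp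
  have "i0 \<in> S" using assms by (simp add: S_def)
  hence "Max S \<in> S" "Max S \<ge> i0" using Max_in[OF fin] Max_ge[OF fin] by blast+
  moreover have "coeff p j \<in> m" if "j > Max S" for j
  proof (rule ccontr)
    assume "coeff p j \<notin> m"
    hence "j \<le> Max S" by (intro Max_ge[OF fin]) (simp add: S_def)
    thus False using that by simp
  qed
  ultimately show ?thesis using that[of "Max S"] unfolding S_def by blast
qed

text \<open>Leading coefficients modulo the prime m multiply: every other term of the coefficient at
  i + j has a factor of index beyond i or beyond j, which lies in m.\<close>

lemma coeff_mult_top_notin:
  assumes R: "subdom R" and m: "prime_in m R" and p: "coeffs_in R p" and q: "coeffs_in R q"
    and i: "coeff p i \<notin> m" "\<And>k. k > i \<Longrightarrow> coeff p k \<in> m"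
    and j: "coeff q j \<notin> m" "\<And>k. k > j \<Longrightarrow> coeff q k \<in> m"
  shows "coeff (p * q) (i + j) \<notin> m"
proof
  assume *: "coeff (p * q) (i + j) \<in> m"
  have mI: "ideal_in m R" using m by (rule prime_inD)
  have s: "(\<Sum>k\<in>{..i+j} - {i}. coeff p k * coeff q (i + j - k)) \<in> m"
  proof (rule ideal_in_sum[OF mI])
    fix k assume "k \<in> {..i+j} - {i}"
    hence "k > i \<or> i + j - k > j" by auto
    moreover have "coeff p k \<in> R" "coeff q (i + j - k) \<in> R" using p q by (simp_all add: coeffs_in_def)
    ultimately show "coeff p k * coeff q (i + j - k) \<in> m"
      using i(2)[of k] j(2)[of "i + j - k"] ideal_inD(4,5)[OF mI] by blast
  qed
  have "coeff (p * q) (i + j) = coeff p i * coeff q j +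
     (\<Sum>k\<in>{..i+j} - {i}. coeff p k * coeff q (i + j - k))"
    by (subst coeff_mult, subst sum.remove[of _ i]) auto
  hence "coeff p i * coeff q j =
      coeff (p * q) (i + j) - (\<Sum>k\<in>{..i+j} - {i}. coeff p k * coeff q (i + j - k))" by simp
  moreover have "\<dots> \<in> m" by (rule ideal_in_diff[OF mI R * s])
  ultimately have "coeff p i * coeff q j \<in> m" by (simp only:)
  moreover have "coeff p i \<in> R" "coeff q j \<in> R" using p q by (simp_all add: coeffs_in_def)
  ultimately show False using prime_inD(3)[OF m] i(1) j(1) by blast
qed

context
  fixes R m D :: "'a::field set" and x :: 'a
  assumes R: "subdom R" and m: "prime_in m R" and D: "subdom D" and DR: "D \<subseteq> R" and xR: "x \<in> R"
    and G: "goldman (adjoin D x) m"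
begin

private lemma mI: "ideal_in m R" using m by (rule prime_inD)

private lemma adjR: "y \<in> adjoin D x \<Longrightarrow> y \<in> R"
  using adjoin_subset[OF D R DR xR] by blast

private lemma cong_mult: "a - b \<in> m \<Longrightarrow> c \<in> R \<Longrightarrow> c * a - c * b \<in> m"
  using ideal_inD(4)[OF mI, of c "a - b"] by (simp add: algebra_simps)

private lemma cong_trans: "a - b \<in> m \<Longrightarrow> b - c \<in> m \<Longrightarrow> a - c \<in> m"
  using ideal_inD(3)[OF mI, of "a - b" "b - c"] by simp

private lemmas cong_power = ideal_in_power_diff[OF mI R] and cong_in = ideal_in_cong_add[OF mI R]

private lemma cong_sym: "a - b \<in> m \<Longrightarrow> b - a \<in> m"
  using ideal_in_minus[OF mI R, of "a - b"] by simp

private lemma power_minus_one: "e \<in> adjoin D x \<Longrightarrow> \<exists>s\<in>adjoin D x. (e - 1) ^ n = e * s + (-1) ^ n"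
proof (induction n)
  case 0 thus ?case using subdom_zero[OF subdom_adjoin[OF D]] by (intro bexI[of _ 0]) auto
next
  case (Suc n)
  then obtain s where s: "s \<in> adjoin D x" "(e - 1) ^ n = e * s + (-1) ^ n" by blast
  have "(e - 1) ^ Suc n = e * ((e - 1) * s + (-1) ^ n) + (-1) ^ Suc n" by (simp add: s(2) algebra_simps)
  moreover have "(e - 1) * s + (-1) ^ n \<in> adjoin D x"
    using s Suc.prems subdom_adjoin[OF D] subdom_minus[OF subdom_adjoin[OF D], of 1]
    by (intro subdom_add subdom_mult subdom_diff subdom_power) auto
  ultimately show ?case by blast
qed

text \<open>If x were transcendental modulo m, consider e = 1 + x d. It divides a power of d modulo
  m, while x d is -1 modulo e; hence e is a unit modulo m. Its inverse is a polynomial H in x, and E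
  H = 1 would hold coefficientwise modulo m although E has positive degree there.\<close>

lemma goldman_imp_alg_mod: "alg_mod D m x"
proof (rule ccontr)
  assume "\<not> alg_mod D m x"
  hence na: "coeff p i \<in> m" if "coeffs_in D p" "poly p x \<in> m" for p i
    using that by (auto simp: alg_mod_def)
  have S: "subdom (adjoin D x)" by (rule subdom_adjoin[OF D])
  from G obtain d where d: "d \<in> adjoin D x" "d \<notin> m"
    "\<And>e. e \<in> adjoin D x \<Longrightarrow> e \<notin> m \<Longrightarrow> \<exists>r\<in>adjoin D x. \<exists>N. e * r - d ^ N \<in> m"
    by (auto simp: goldman_def)
  obtain f where f: "d = poly f x" "coeffs_in D f" using d(1) by (auto simp: adjoin_def)
  define E where "E = 1 + pCons 0 f"
  have E: "coeffs_in D E" unfolding E_def using f D by (intro coeffs_in_add) auto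
  define e where "e = poly E x"
  have eD: "e \<in> adjoin D x" unfolding e_def adjoin_def using E by blast
  have "coeff E 0 = 1" by (simp add: E_def)
  hence "e \<notin> m" using na[OF E, of 0] prime_inD(2)[OF m] by (auto simp: e_def)
  then obtain r N where r: "r \<in> adjoin D x" "e * r - d ^ N \<in> m" using d(3) eD by blast
  obtain s where s: "s \<in> adjoin D x" "(e - 1) ^ N = e * s + (-1) ^ N" using power_minus_one[OF eD] by blast
  have "x ^ N * (e * r - d ^ N) \<in> m" using ideal_inD(4)[OF mI _ r(2)] xR R by blast
  moreover have "x ^ N * d ^ N = (e - 1) ^ N" by (simp add: e_def E_def f(1) power_mult_distrib)
  ultimately have "e * (x ^ N * r) - (e * s + (-1) ^ N) \<in> m" by (simp add: s(2)[symmetric] algebra_simps)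
  hence "(-1) ^ N * (e * (x ^ N * r) - (e * s + (-1) ^ N)) \<in> m"
    using ideal_inD(4)[OF mI, of "(-1)^N"] R by (meson subdom_minus subdom_one subdom_power)
  hence "- (1 - e * ((-1) ^ N * (x ^ N * r - s))) \<in> m"
    by (simp add: algebra_simps power_mult_distrib[symmetric])
  hence h1: "1 - e * ((-1) ^ N * (x ^ N * r - s)) \<in> m" using ideal_in_minus[OF mI R] by fastforce
  have "(-1) ^ N * (x ^ N * r - s) \<in> adjoin D x"
    using in_adjoin[OF D, of x] r s S by (meson subdom_diff subdom_minus subdom_mult subdom_one subdom_power)
  then obtain H where H: "coeffs_in D H" "(-1) ^ N * (x ^ N * r - s) = poly H x" by (auto simp: adjoin_def)
  have "poly (1 - E * H) x \<in> m" using h1 H(2) by (simp add: e_def)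
  moreover have EH: "coeffs_in D (1 - E * H)"
    using E H D by (intro coeffs_in_diff coeffs_in_mult) auto
  ultimately have all: "coeff (1 - E * H) i \<in> m" for i using na by blast
  have m0: "0 \<in> m" by (rule ideal_inD(2)[OF mI])
  have "\<exists>i. coeff f i \<notin> m"
  proof (rule ccontr)
    assume "\<not> ?thesis"
    hence "coeffs_in m f" by (auto simp: coeffs_in_def)
    thus False using poly_in_ideal[OF R mI _ xR] d(2) f(1) by blast
  qed
  then obtain i0 where "coeff E (Suc i0) \<notin> m" by (auto simp: E_def)
  from obtain_top_coeff[OF m0 this] obtain i where i: "i \<ge> Suc i0" "coeff E i \<notin> m"
    "\<And>j. j > i \<Longrightarrow> coeff E j \<in> m" by blast
  have "\<exists>j. coeff H j \<notin> m"
  proof (rule ccontr)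
    assume "\<not> ?thesis"
    moreover have "coeff E 0 \<in> R" using E DR by (auto simp: coeffs_in_def)
    ultimately have "coeff E 0 * coeff H 0 \<in> m" using ideal_inD(4)[OF mI] by blast
    hence "coeff (1 - E * H) 0 + coeff E 0 * coeff H 0 \<in> m" using all ideal_inD(3)[OF mI] by blast
    thus False using prime_inD(2)[OF m] by (simp add: coeff_mult)
  qed
  then obtain j0 where "coeff H j0 \<notin> m" by blast
  from obtain_top_coeff[OF m0 this] obtain j where j: "coeff H j \<notin> m"
    "\<And>k. k > j \<Longrightarrow> coeff H k \<in> m" by blast
  have "coeff (E * H) (i + j) \<notin> m"
    by (rule coeff_mult_top_notin[OF R m]) (use E H DR i j coeffs_in_mono in auto)
  moreover have "coeff (1 - E * H) (i + j) = - coeff (E * H) (i + j)" using i(1) by simp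
  ultimately show False using all[of "i + j"] ideal_in_minus[OF mI R] by fastforce
qed

text \<open>With \<open>p\<close> a relation of minimal degree for \<open>x\<close>, two relations of smaller degree agree
  coefficientwise modulo \<open>m\<close>; comparing constant coefficients brings inverses down from \<open>D[x]\<close> to \<open>D\<close>.\<close>

lemma goldman_descend: "goldman D m"
proof -
  have S: "subdom (adjoin D x)" by (rule subdom_adjoin[OF D])
  have m0: "0 \<in> m" by (rule ideal_inD(2)[OF mI])
  have polyD: "poly q x \<in> adjoin D x" if "coeffs_in D q" for q using that by (auto simp: adjoin_def)
  have polyR: "poly q x \<in> R" if "coeffs_in D q" for q using that polyD adjR by blast
  define Rel where "Rel = (\<lambda>p. coeffs_in D p \<and> (\<exists>i. coeff p i \<notin> m) \<and> poly p x \<in> m)"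
  have ex: "\<exists>p. Rel p" using goldman_imp_alg_mod by (auto simp: alg_mod_def Rel_def)
  \<comment> \<open>Top coefficients in m may be discarded without changing the value modulo m.
    Polynomials of minimal degree therefore have leading coefficients outside m.\<close>
  have drop: "\<exists>q. coeffs_in D q \<and> coeff q i \<notin> m \<and> degree q < degree p \<and> poly p x - poly q x \<in> m"
    if "coeffs_in D p" "coeff p i \<notin> m" "coeff p (degree p) \<in> m" for p i
  proof -
    define n q where "n = degree p" and "q = p - monom (coeff p n) n"
    have "i \<noteq> n" using that by (auto simp: n_def)
    moreover have "i \<le> n" using that(2) m0 by (metis le_degree n_def)
    ultimately have "n > 0" by simp
    have "coeff q j = 0" if "j \<ge> n" for j using that by (auto simp: q_def n_def coeff_eq_0)
    hence "degree q < n" using \<open>n > 0\<close> by (metis degree_0 leading_coeff_0_iff not_le)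
    moreover have "coeffs_in D q" unfolding q_def using that D
      by (intro coeffs_in_diff coeffs_in_monom) (auto simp: coeffs_in_def)
    moreover have "coeff q i \<notin> m" using that \<open>i \<noteq> n\<close> by (simp add: q_def)
    moreover have "poly p x - poly q x \<in> m" using that xR R ideal_inD(5)[OF mI]
      by (auto simp: q_def poly_monom n_def)
    ultimately show ?thesis unfolding n_def by blast
  qed
  define p where "p = (ARG_MIN degree p. Rel p)"
  have p: "Rel p" and pmin: "\<And>q. Rel q \<Longrightarrow> degree p \<le> degree q"
    using arg_min_nat_lemma[of Rel _ degree] ex unfolding p_def by blast+
  define n a where "n = degree p" and "a = coeff p n"
  have pD: "coeffs_in D p" "poly p x \<in> m" using p by (auto simp: Rel_def)
  have small: "coeff q i \<in> m" if "coeffs_in D q" "degree q < n" "poly q x \<in> m" for q i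
    using pmin[of q] that by (force simp: Rel_def n_def)
  have am: "a \<notin> m"
  proof
    assume "a \<in> m"
    obtain i where "coeff p i \<notin> m" using p by (auto simp: Rel_def)
    from drop[OF pD(1) this] \<open>a \<in> m\<close> obtain q where q: "coeffs_in D q" "coeff q i \<notin> m"
      "degree q < n" "poly p x - poly q x \<in> m" by (auto simp: a_def n_def)
    thus False using small[OF q(1,3), of i] cong_in[OF q(4)] pD(2) by blast
  qed
  have n0: "n > 0"
  proof (rule ccontr)
    assume "\<not> n > 0"
    then obtain c where "p = [:c:]" using degree_eq_zeroE[of p] by (auto simp: n_def)
    thus False using am pD(2) by (simp add: a_def n_def)
  qed
  have aD: "a \<in> D" using pD by (auto simp: a_def coeffs_in_def)
  have aR: "a \<in> R" using aD DR by blast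
  have reduce: "\<exists>K r. coeffs_in D r \<and> degree r < n \<and> a ^ K * y - poly r x \<in> m"
    if "y \<in> adjoin D x" for y
  proof -
    obtain q where q: "y = poly q x" "coeffs_in D q" using \<open>y \<in> adjoin D x\<close> by (auto simp: adjoin_def)
    obtain K s r where K: "coeffs_in D s" "coeffs_in D r" "degree r < n"
      "smult (a ^ K) q = s * p + r"
      using pseudo_division[OF D pD(1) n_def[symmetric] n0 q(2)] unfolding a_def by blast
    have "a ^ K * y = poly (smult (a ^ K) q) x" by (simp add: q)
    also have "\<dots> = poly s x * poly p x + poly r x" unfolding K(4) by simp
    finally have "a ^ K * y - poly r x = poly s x * poly p x" by simp
    thus ?thesis using K ideal_inD(4)[OF mI polyR pD(2)] by metis
  qed
  from G obtain d where d: "d \<in> adjoin D x" "d \<notin> m"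
    "\<And>e. e \<in> adjoin D x \<Longrightarrow> e \<notin> m \<Longrightarrow> \<exists>r\<in>adjoin D x. \<exists>N. e * r - d ^ N \<in> m"
    by (auto simp: goldman_def)
  \<comment> \<open>Multiples of d modulo m that are represented in degree below n. A representative
    of least degree turns out to be a constant, which brings d down into D.\<close>
  define Mul where "Mul = (\<lambda>g. coeffs_in D g \<and> degree g < n \<and> (\<exists>i. coeff g i \<notin> m) \<and>
    (\<exists>w\<in>adjoin D x. d * w - poly g x \<in> m))"
  have notin_ex: "\<exists>i. coeff q i \<notin> m" if "coeffs_in D q" "poly q x \<notin> m" for q
    using that poly_in_ideal[OF R mI _ xR, of q] by (auto simp: coeffs_in_def)
  have "\<exists>g. Mul g"
  proof -
    obtain K r where r: "coeffs_in D r" "degree r < n" "a ^ K * d - poly r x \<in> m"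
      using reduce[OF d(1)] by blast
    have "a ^ K * d \<notin> m" using prime_inD(3)[OF m, of "a^K" d] prime_in_power[OF m R aR] am d aR R adjR by auto
    hence "poly r x \<notin> m" using cong_in[OF r(3)] by simp
    moreover have "a ^ K \<in> adjoin D x" using aD subset_adjoin[OF D] S by blast
    ultimately show ?thesis unfolding Mul_def using r notin_ex
      by (intro exI[of _ r]) (auto simp: mult.commute intro!: bexI[of _ "a ^ K"])
  qed
  then obtain g where g: "Mul g" and gmin: "\<And>h. Mul h \<Longrightarrow> degree g \<le> degree h"
    using arg_min_nat_lemma[of Mul _ degree] by blast
  obtain w where w: "w \<in> adjoin D x" "d * w - poly g x \<in> m" using g by (auto simp: Mul_def)
  have gD: "coeffs_in D g" "degree g < n" using g by (auto simp: Mul_def)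
  define j b where "j = degree g" and "b = coeff g j"
  have bm: "b \<notin> m"
  proof
    assume "b \<in> m"
    obtain i where "coeff g i \<notin> m" using g by (auto simp: Mul_def)
    from drop[OF gD(1) this] \<open>b \<in> m\<close> obtain q where q: "coeffs_in D q" "coeff q i \<notin> m"
      "degree q < j" "poly g x - poly q x \<in> m" by (auto simp: b_def j_def)
    have "d * w - poly q x \<in> m" using cong_trans[OF w(2) q(4)] .
    hence "Mul q" unfolding Mul_def using q gD w by (auto simp: j_def)
    thus False using gmin[of q] q(3) by (simp add: j_def)
  qed
  have bD: "b \<in> D" using gD by (auto simp: b_def coeffs_in_def)
  \<comment> \<open>Division of p by g leaves a remainder that is again a multiple of d, of smaller
    degree, so it vanishes modulo m. Then s(x) g(x) lies in m with s of degree below n, which kills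
    s modulo m and with it the leading coefficient of b^K p.\<close>
  have "j = 0"
  proof (rule ccontr)
    assume "j \<noteq> 0"
    then obtain K s r where K: "coeffs_in D s" "coeffs_in D r" "degree r < j"
      "smult (b ^ K) p = s * g + r"
      using pseudo_division[OF D gD(1) j_def[symmetric] _ pD(1)] unfolding b_def by blast
    have "poly (smult (b ^ K) p) x = poly s x * poly g x + poly r x" unfolding K(4) by simp
    hence *: "b ^ K * poly p x = poly s x * poly g x + poly r x" by simp
    have bp: "b ^ K * poly p x \<in> m" using ideal_inD(4)[OF mI _ pD(2)] bD DR R by blast
    have "poly s x * (d * w) - poly s x * poly g x \<in> m" using cong_mult[OF w(2) polyR[OF K(1)]] .
    hence "(poly s x * (d * w) - poly s x * poly g x) + (poly s x * poly g x + poly r x) \<in> m"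
      using ideal_inD(3)[OF mI] bp unfolding * by blast
    hence "- (poly s x * (d * w) + poly r x) \<in> m" by (intro ideal_in_minus[OF mI R]) simp
    moreover have "d * (- (poly s x) * w) - poly r x = - (poly s x * (d * w) + poly r x)"
      by (simp add: algebra_simps)
    ultimately have "d * (- (poly s x) * w) - poly r x \<in> m" by (simp only:)
    moreover have "- (poly s x) * w \<in> adjoin D x" using S polyD[OF K(1)] w(1) by blast
    ultimately have "\<not> (\<exists>i. coeff r i \<notin> m)"
      using gmin[of r] K gD unfolding Mul_def j_def by (meson leD less_trans)
    hence rm: "coeffs_in m r" by (auto simp: coeffs_in_def)
    have "poly s x * poly g x \<in> m"
      using ideal_in_diff[OF mI R bp poly_in_ideal[OF R mI rm xR]] * by simp
    moreover have "poly g x \<notin> m" using small[OF gD] bm b_def by blast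
    ultimately have sm: "poly s x \<in> m" using prime_inD(3)[OF m polyR[OF K(1)] polyR[OF gD(1)]] by blast
    have "degree s < n"
    proof (cases "s = 0")
      case False
      have "g \<noteq> 0" using \<open>j \<noteq> 0\<close> by (auto simp: j_def)
      have "degree (s * g) = degree (smult (b ^ K) p - r)" using K(4) by simp
      also have "\<dots> \<le> n" using K(3) gD(2) by (intro degree_diff_le) (auto simp: n_def j_def intro: order_trans[OF degree_smult_le])
      finally show ?thesis using False \<open>g \<noteq> 0\<close> \<open>j \<noteq> 0\<close> by (simp add: degree_mult_eq j_def)
    qed (use n0 in simp)
    hence s_in: "coeff s i \<in> m" for i using small[OF K(1) _ sm] by blast
    have "coeff (s * g) n \<in> m" unfolding coeff_mult
      using s_in gD DR by (intro ideal_in_sum[OF mI] ideal_inD(5)[OF mI]) (auto simp: coeffs_in_def)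
    hence "coeff (s * g + r) n \<in> m" using rm ideal_inD(3)[OF mI] by (simp add: coeffs_in_def)
    hence "b ^ K * a \<in> m" unfolding K(4)[symmetric] by (simp add: a_def)
    thus False using prime_inD(3)[OF m, of "b^K" a] prime_in_power[OF m R, of b K] am bm aR bD DR R by blast
  qed
  then obtain c where c: "g = [:c:]" using degree_eq_zeroE[of g] by (auto simp: j_def)
  have cm: "c \<notin> m" and cD: "c \<in> D" using bm bD by (simp_all add: b_def j_def c)
  have dw: "d * w - c \<in> m" using w(2) c by simp
  \<comment> \<open>In the witness a c, the factor a pays for the pseudo-divisions by p, and c
    replaces d because d w = c modulo m.\<close>
  show ?thesis unfolding goldman_def
  proof (rule bexI[of _ "a * c"], intro conjI ballI impI)
    show "a * c \<notin> m" using prime_inD(3)[OF m, of a c] am cm aR cD DR by blast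
    show "a * c \<in> D" using aD cD D by blast
  next
    fix e assume e: "e \<in> D" "e \<notin> m"
    have eR: "e \<in> R" using e DR by blast
    obtain r N where r: "r \<in> adjoin D x" "e * r - d ^ N \<in> m" using d(3)[of e] e subset_adjoin[OF D] by blast
    define \<rho> where "\<rho> = r * w ^ N"
    have \<rho>: "\<rho> \<in> adjoin D x" unfolding \<rho>_def using r w S by blast
    have wR: "w \<in> R" "d \<in> R" "c \<in> R" using w d cD adjR DR by blast+
    have "w ^ N * (e * r) - w ^ N * d ^ N \<in> m" using cong_mult[OF r(2)] wR R by blast
    moreover have "(d * w) ^ N - c ^ N \<in> m" using wR R by (intro cong_power dw) auto
    ultimately have e1: "e * \<rho> - c ^ N \<in> m"
      using cong_trans[of "e * \<rho>" "w ^ N * d ^ N" "c ^ N"] by (simp add: \<rho>_def power_mult_distrib mult_ac)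
    obtain K s where s: "coeffs_in D s" "degree s < n" "a ^ K * \<rho> - poly s x \<in> m"
      using reduce[OF \<rho>] by blast
    have "a ^ K * (e * \<rho>) - a ^ K * c ^ N \<in> m" using cong_mult[OF e1] aR R by blast
    moreover have "e * (a ^ K * \<rho>) - e * poly s x \<in> m" using cong_mult[OF s(3) eR] .
    ultimately have "e * poly s x - a ^ K * c ^ N \<in> m"
      using cong_trans[OF cong_sym, of "e * (a ^ K * \<rho>)" "e * poly s x" "a ^ K * c ^ N"] by (simp add: mult_ac)
    hence "poly (smult e s - [:a ^ K * c ^ N:]) x \<in> m" by simp
    moreover have "coeffs_in D (smult e s - [:a ^ K * c ^ N:])"
      using s e aD cD D by (intro coeffs_in_diff coeffs_in_smult) auto
    moreover have "degree (smult e s - [:a ^ K * c ^ N:]) < n"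
      using s(2) n0 by (intro degree_diff_less) (auto intro: le_less_trans[OF degree_smult_le])
    ultimately have "coeff (smult e s - [:a ^ K * c ^ N:]) 0 \<in> m" using small by blast
    hence "e * coeff s 0 - a ^ K * c ^ N \<in> m" by simp
    \<comment> \<open>This factor makes both exponents equal to N + K, so that a power of a c
      appears.\<close>
    moreover have "a ^ N * c ^ K \<in> R" using aR wR R by blast
    ultimately have "(a ^ N * c ^ K) * (e * coeff s 0) - (a ^ N * c ^ K) * (a ^ K * c ^ N) \<in> m"
      using cong_mult by blast
    hence "e * (coeff s 0 * (a ^ N * c ^ K)) - (a * c) ^ (N + K) \<in> m"
      by (simp add: power_mult_distrib power_add mult_ac)
    moreover have "coeff s 0 * (a ^ N * c ^ K) \<in> D" using s aD cD D by (auto simp: coeffs_in_def)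
    ultimately show "\<exists>r\<in>D. \<exists>N. e * r - (a * c) ^ N \<in> m" by blast
  qed
qed

end

fun adjoin_list :: "'a::field set \<Rightarrow> 'a list \<Rightarrow> 'a set" where
  "adjoin_list D [] = D"
| "adjoin_list D (x # xs) = adjoin_list (adjoin D x) xs"

lemma subdom_adjoin_list: "subdom D \<Longrightarrow> subdom (adjoin_list D xs)"
  by (induction xs arbitrary: D) (auto simp: subdom_adjoin)

lemma subset_adjoin_list: "subdom D \<Longrightarrow> D \<union> set xs \<subseteq> adjoin_list D xs"
proof (induction xs arbitrary: D)
  case (Cons x xs)
  show ?case using Cons.IH[OF subdom_adjoin[OF Cons.prems, of x]] subset_adjoin[OF Cons.prems, of x]
      in_adjoin[OF Cons.prems, of x] by auto
qed simp

lemma adjoin_list_subset: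
  "subdom D \<Longrightarrow> subdom T \<Longrightarrow> D \<subseteq> T \<Longrightarrow> set xs \<subseteq> T \<Longrightarrow> adjoin_list D xs \<subseteq> T"
proof (induction xs arbitrary: D)
  case (Cons x xs)
  thus ?case using Cons.IH[OF subdom_adjoin[OF Cons.prems(1), of x]] adjoin_subset[OF Cons.prems(1,2), of x]
    by simp
qed simp

text \<open>A form of Zariski's lemma.\<close>

theorem alg_mod_of_adjoin_list:
  assumes D: "subdom D" and R: "R = adjoin_list D (x # xs)" and m: "prime_in m R"
    and field: "\<And>a. a \<in> R \<Longrightarrow> a \<notin> m \<Longrightarrow> \<exists>r\<in>R. 1 - r * a \<in> m"
  shows "alg_mod D m x"
proof -
  have SR: "subdom R" unfolding R by (rule subdom_adjoin_list[OF D])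
  have mI: "ideal_in m R" using m by (rule prime_inD)
  have "goldman R m" unfolding goldman_def
  proof (rule bexI[of _ 1], intro conjI ballI impI)
    fix e assume "e \<in> R" "e \<notin> m"
    then obtain r where "r \<in> R" "1 - r * e \<in> m" using field by blast
    hence "e * r - 1 ^ 1 \<in> m" using ideal_in_minus[OF mI SR, of "1 - r * e"] by (simp add: mult.commute)
    thus "\<exists>r\<in>R. \<exists>N. e * r - 1 ^ N \<in> m" using \<open>r \<in> R\<close> by blast
  qed (use prime_inD(2)[OF m] SR in auto)
  \<comment> \<open>The property holds for R with d = 1, as R modulo m is a field, and descends
    generator by generator until D[x] is reached.\<close>
  have "goldman E m" if "subdom E" "adjoin_list E ys = R" for E ys
    using that
  proof (induction ys arbitrary: E)
    case (Cons y ys)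
    have sub: "E \<subseteq> R" "y \<in> R" using subset_adjoin_list[OF Cons.prems(1), of "y # ys"] Cons.prems(2) by auto
    have "goldman (adjoin E y) m" using Cons.IH[OF subdom_adjoin[OF Cons.prems(1)]] Cons.prems(2) by simp
    thus ?case by (rule goldman_descend[OF SR m Cons.prems(1) sub])
  qed (use \<open>goldman R m\<close> in simp)
  from this[OF subdom_adjoin[OF D], of x xs] have G: "goldman (adjoin D x) m" using R by simp
  have "D \<subseteq> R" "x \<in> R" using subset_adjoin_list[OF D, of "x # xs"] R by auto
  thus ?thesis using goldman_imp_alg_mod[OF SR m D _ _ G] by blast
qed


section \<open>Local rings of a smooth projective curve\<close>

lemma generate_ring_type_algebra:
  fixes H :: "'a::field set"
  shows "subdom (generate_ring ring_of_type_algebra H)" "H \<subseteq> generate_ring ring_of_type_algebra H"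
    "subdom T \<Longrightarrow> H \<subseteq> T \<Longrightarrow> generate_ring ring_of_type_algebra H \<subseteq> T"
proof -
  have U: "ring_of_type_algebra = ring_on (UNIV :: 'a set)"
    by (simp add: ring_on_def ring_of_type_algebra_def)
  let ?G = "generate_ring (ring_on (UNIV :: 'a set)) H"
  have inv: "\<ominus>\<^bsub>ring_on (UNIV :: 'a set)\<^esub> x = - x" for x by (rule a_inv_ring_on) auto
  show "H \<subseteq> generate_ring ring_of_type_algebra H" by (auto intro: generate_ring.incl)
  show "subdom (generate_ring ring_of_type_algebra H)" unfolding U
  proof (rule subdomI)
    show "1 \<in> ?G" using generate_ring.one[of "ring_on (UNIV :: 'a set)"] by simp
    fix a b assume ab: "a \<in> ?G" "b \<in> ?G"
    show "a - b \<in> ?G" using generate_ring.eng_add[OF ab(1) generate_ring.a_inv[OF ab(2)]] by (simp add: inv)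
    show "a * b \<in> ?G" using generate_ring.eng_mult[OF ab] by simp
  qed
  assume T: "subdom T" "H \<subseteq> T"
  show "generate_ring ring_of_type_algebra H \<subseteq> T" unfolding U
  proof
    fix x assume "x \<in> ?G"
    thus "x \<in> T" by induction (use T inv in auto)
  qed
qed

lemma subdom_frac_field:
  assumes "subdom D"
  shows "subdom (frac_field D)" "D \<subseteq> frac_field D"
    "x \<in> frac_field D \<Longrightarrow> x \<noteq> 0 \<Longrightarrow> inverse x \<in> frac_field D"
proof -
  show "subdom (frac_field D)"
  proof (rule subdomI)
    show "1 \<in> frac_field D" unfolding frac_field_def using subdom_one[OF assms]
      by (intro CollectI exI[of _ 1]) auto
    fix x y assume "x \<in> frac_field D" "y \<in> frac_field D"
    then obtain a b c d where *: "x = a / b" "y = c / d" "a \<in> D" "b \<in> D" "c \<in> D" "d \<in> D" "b \<noteq> 0" "d \<noteq> 0"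
      unfolding frac_field_def by blast
    have "x - y = (a * d - c * b) / (b * d)" "x * y = (a * c) / (b * d)" using * by (auto simp: field_simps)
    moreover have "a * d - c * b \<in> D" "a * c \<in> D" "b * d \<in> D" "b * d \<noteq> 0" using * assms by auto
    ultimately show "x - y \<in> frac_field D" "x * y \<in> frac_field D" unfolding frac_field_def by blast+
  qed
  show "D \<subseteq> frac_field D"
  proof
    fix x assume "x \<in> D" thus "x \<in> frac_field D" unfolding frac_field_def using subdom_one[OF assms]
      by (intro CollectI exI[of _ x] exI[of _ 1]) auto
  qed
  assume "x \<in> frac_field D" "x \<noteq> 0"
  then obtain a b where *: "x = a / b" "a \<in> D" "b \<in> D" "b \<noteq> 0" unfolding frac_field_def by blast
  hence "inverse x = b / a" "a \<noteq> 0" using \<open>x \<noteq> 0\<close> by auto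
  thus "inverse x \<in> frac_field D" unfolding frac_field_def using * by blast
qed

text \<open>A discrete valuation ring is a maximal proper subring of its field: powers of an element
  of negative value absorb every pole.\<close>

lemma (in dval) overring_eq_UNIV:
  assumes "subdom W" "vring v \<subseteq> W" "w \<in> W" "w \<notin> vring v"
  shows "W = UNIV"
proof -
  have w: "w \<noteq> 0" "v w < 0" using assms(4) by (auto simp: vge_def)
  have "x \<in> W" for x
  proof (cases "x = 0")
    case False
    define n where "n = nat \<bar>v x\<bar>"
    have "int n * v w \<le> int n * (- 1)" using w by (intro mult_left_mono) auto
    hence "x / w ^ n \<in> vring v" using False w by (intro vgeI) (auto simp: v_divide v_power n_def)
    hence "x / w ^ n * w ^ n \<in> W" using assms by (intro subdom_mult subdom_power) auto
    thus ?thesis using w by simp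
  qed (use assms in simp)
  thus ?thesis by blast
qed

text \<open>Kept apart from the curve because it is interpreted twice: for k inside the function
  field and, under the name \<open>E\<close>, for k inside K(\<chi>).\<close>

locale alg_closed_embedding =
  fixes \<iota> :: "'k::{alg_closed_field, field_char_0} \<Rightarrow> 'a::field"
  assumes \<iota>_one: "\<iota> 1 = 1"
    and \<iota>_add: "\<iota> (a + b) = \<iota> a + \<iota> b"
    and \<iota>_mult: "\<iota> (a * b) = \<iota> a * \<iota> b"
begin

abbreviation k where "k \<equiv> range \<iota>"

lemma \<iota>_zero [simp]: "\<iota> 0 = 0" by (metis \<iota>_add add.right_neutral add_left_cancel)
lemma \<iota>_minus: "\<iota> (- a) = - \<iota> a" using \<iota>_add[of a "-a"] by (simp add: eq_neg_iff_add_eq_0 add.commute)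
lemma \<iota>_diff: "\<iota> (a - b) = \<iota> a - \<iota> b" using \<iota>_add[of a "-b"] by (simp add: \<iota>_minus)
lemma \<iota>_eq_0_iff [simp]: "\<iota> a = 0 \<longleftrightarrow> a = 0"
proof
  assume "\<iota> a = 0"
  hence "\<iota> (a * inverse a) = 0" by (simp only: \<iota>_mult) simp
  thus "a = 0" using \<iota>_one by (cases "a = 0") auto
qed simp
lemma \<iota>_inject [simp]: "\<iota> a = \<iota> b \<longleftrightarrow> a = b" using \<iota>_eq_0_iff[of "a - b"] by (auto simp: \<iota>_diff)
lemma \<iota>_inverse: "\<iota> (inverse a) = inverse (\<iota> a)"
proof (cases "a = 0")
  case False
  hence "\<iota> a * \<iota> (inverse a) = 1" by (simp add: \<iota>_mult[symmetric] \<iota>_one)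
  thus ?thesis by (simp add: inverse_unique)
qed simp
lemma \<iota>_power: "\<iota> (a ^ n) = \<iota> a ^ n" by (induction n) (auto simp: \<iota>_one \<iota>_mult)
lemma \<iota>_sum: "\<iota> (sum f A) = (\<Sum>i\<in>A. \<iota> (f i))"
  by (induction A rule: infinite_finite_induct) (auto simp: \<iota>_add)

lemma subdom_k: "subdom k"
  by (rule subdomI) (auto simp: image_iff \<iota>_one[symmetric] \<iota>_diff[symmetric] \<iota>_mult[symmetric] intro: exI[of _ 1])

definition keval :: "'k poly \<Rightarrow> 'a \<Rightarrow> 'a" where "keval P x = poly (map_poly \<iota> P) x"

lemma coeff_map_\<iota> [simp]: "coeff (map_poly \<iota> P) i = \<iota> (coeff P i)"
  by (simp add: coeff_map_poly)

lemma keval_0 [simp]: "keval 0 x = 0" by (simp add: keval_def)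
lemma keval_pCons [simp]: "keval (pCons a P) x = \<iota> a + x * keval P x"
  by (simp add: keval_def map_poly_pCons)
lemma keval_add: "keval (P + Q) x = keval P x + keval Q x"
proof -
  have "map_poly \<iota> (P + Q) = map_poly \<iota> P + map_poly \<iota> Q" by (rule poly_eqI) (simp add: \<iota>_add)
  thus ?thesis by (simp add: keval_def)
qed
lemma keval_smult: "keval (smult c P) x = \<iota> c * keval P x"
proof -
  have "map_poly \<iota> (smult c P) = smult (\<iota> c) (map_poly \<iota> P)" by (rule poly_eqI) (simp add: \<iota>_mult)
  thus ?thesis by (simp add: keval_def)
qed
lemma keval_mult: "keval (P * Q) x = keval P x * keval Q x"
  by (induction P) (auto simp: keval_add keval_smult algebra_simps)
lemma coeffs_in_kE:
  assumes "coeffs_in k p"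
  obtains P where "p = map_poly \<iota> P"
proof -
  have inj: "inj \<iota>" by (auto intro: injI)
  have "inv_into UNIV \<iota> 0 = 0" by (rule inv_f_eq[OF inj]) simp
  hence "p = map_poly \<iota> (map_poly (inv_into UNIV \<iota>) p)"
    using assms by (intro poly_eqI) (auto simp: coeff_map_poly coeffs_in_def f_inv_into_f)
  thus ?thesis using that by blast
qed

lemma adjoin_kE:
  assumes "y \<in> adjoin k x"
  obtains P where "y = keval P x"
  using assms by (auto simp: adjoin_def keval_def elim!: coeffs_in_kE)

lemma keval_in_adjoin: "keval P x \<in> adjoin k x"
  by (auto simp: adjoin_def keval_def coeffs_in_def)

lemma keval_in: "subdom R \<Longrightarrow> k \<subseteq> R \<Longrightarrow> x \<in> R \<Longrightarrow> keval P x \<in> R"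
  using adjoin_subset[OF subdom_k, of R x] keval_in_adjoin by blast

text \<open>P splits into linear factors over the algebraically closed field, and the prime m
  contains the value of one of them; a nonzero constant cannot lie in m.\<close>

lemma keval_prime_root:
  assumes m: "prime_in m R" and R: "subdom R" "k \<subseteq> R" "x \<in> R" and P: "P \<noteq> 0" "keval P x \<in> m"
  shows "\<exists>c. x - \<iota> c \<in> m \<and> poly P c = 0"
  using P
proof (induction "degree P" arbitrary: P rule: less_induct)
  case less
  show ?case
  proof (cases "degree P = 0")
    case True
    then obtain a where a: "P = [:a:]" by (rule degree_eq_zeroE)
    hence "\<iota> a \<in> m" "a \<noteq> 0" using less.prems by auto
    hence "\<iota> (inverse a) * \<iota> a \<in> m" using ideal_inD(4)[OF prime_inD(1)[OF m]] R(2) by blast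
    hence "1 \<in> m" using \<open>a \<noteq> 0\<close> by (simp add: \<iota>_mult[symmetric] \<iota>_one)
    thus ?thesis using prime_inD(2)[OF m] by simp
  next
    case False
    then obtain c where c: "poly P c = 0" using alg_closed_imp_poly_has_root[of P] by auto
    then obtain Q where Q: "P = [:-c, 1:] * Q" unfolding poly_eq_0_iff_dvd by (rule dvdE)
    have "Q \<noteq> 0" using less.prems Q by auto
    have "degree P = Suc (degree Q)" unfolding Q using \<open>Q \<noteq> 0\<close> by (subst degree_mult_eq) auto
    have "keval P x = (x - \<iota> c) * keval Q x" unfolding Q by (simp only: keval_mult) (simp add: \<iota>_minus \<iota>_one)
    hence "x - \<iota> c \<in> m \<or> keval Q x \<in> m" using prime_inD(3)[OF m, of "x - \<iota> c" "keval Q x"] R less.prems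
        keval_in[OF R] by auto
    thus ?thesis
    proof
      assume "keval Q x \<in> m"
      then obtain c' where "x - \<iota> c' \<in> m" "poly Q c' = 0"
        using less.hyps[of Q] \<open>Q \<noteq> 0\<close> \<open>degree P = Suc (degree Q)\<close> by auto
      thus ?thesis unfolding Q by auto
    qed (use c in blast)
  qed
qed

lemma keval_eq_0_imp_in_k: "P \<noteq> 0 \<Longrightarrow> keval P x = 0 \<Longrightarrow> x \<in> k"
  using keval_prime_root[of "{0}" UNIV x P] by (auto simp: prime_in_zero)

lemma keval_monom: "keval (monom c n) x = \<iota> c * x ^ n"
  by (induction n) (simp_all add: monom_0 monom_Suc mult_ac)

lemma keval_sum: "keval (\<Sum>i\<in>I. F i) x = (\<Sum>i\<in>I. keval (F i) x)"
  by (induction I rule: infinite_finite_induct) (simp_all add: keval_add)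

lemma maximal_in_of_residues:
  assumes R: "subdom R" "k \<subseteq> R" and P: "prime_in P R" and res: "\<And>a. a \<in> R \<Longrightarrow> \<exists>c. a - \<iota> c \<in> P"
  shows "maximal_in P R"
  unfolding maximal_in_def
proof (intro conjI ballI impI P)
  fix a assume a: "a \<in> R" "a \<notin> P"
  obtain c where c: "a - \<iota> c \<in> P" using res[OF a(1)] by blast
  have "c \<noteq> 0" using c a(2) by (intro notI) (simp add: \<iota>_zero)
  have icR: "\<iota> (inverse c) \<in> R" using R(2) by blast
  have "- \<iota> (inverse c) * (a - \<iota> c) \<in> P"
    by (rule ideal_inD(4)[OF prime_inD(1)[OF P] subdom_minus[OF R(1) icR] c])
  moreover have "\<iota> (inverse c) * \<iota> c = 1" using \<open>c \<noteq> 0\<close> by (simp add: \<iota>_mult[symmetric] \<iota>_one)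
  ultimately have "1 - \<iota> (inverse c) * a \<in> P" by (simp add: algebra_simps)
  thus "\<exists>r\<in>R. 1 - r * a \<in> P" using icR by (rule bexI)
qed

lemma k_notin_prime:
  assumes "prime_in m R" "k \<subseteq> R" "\<iota> c \<in> m"
  shows "c = 0"
proof (rule ccontr)
  assume c: "c \<noteq> 0"
  have "\<iota> (inverse c) * \<iota> c \<in> m" by (rule ideal_inD(4)[OF prime_inD(1)[OF assms(1)] _ assms(3)]) (use assms(2) in blast)
  moreover have "\<iota> (inverse c) * \<iota> c = 1" using c by (simp add: \<iota>_mult[symmetric] \<iota>_one)
  ultimately show False using prime_inD(2)[OF assms(1)] by simp
qed

end

sublocale smooth_projective_curve \<subseteq> alg_closed_embedding
  by unfold_locales (rule \<iota>_one \<iota>_add \<iota>_mult)+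

context smooth_projective_curve
begin

lemma residue_adjoin_list:
  assumes R: "R = adjoin_list k xs" and m: "maximal_in m R" and f: "f \<in> R"
  shows "\<exists>c. f - \<iota> c \<in> m"
proof -
  \<comment> \<open>The algebraicity theorem concerns the first generator, so f is put at the head
    of the list.\<close>
  have R': "R = adjoin_list k (f # xs)"
  proof
    show "R \<subseteq> adjoin_list k (f # xs)" unfolding R
      by (rule adjoin_list_subset[OF subdom_k subdom_adjoin_list[OF subdom_k]])
        (use subset_adjoin_list[OF subdom_k, of "f # xs"] in auto)
    show "adjoin_list k (f # xs) \<subseteq> R"
      by (rule adjoin_list_subset[OF subdom_k])
        (use f subdom_adjoin_list[OF subdom_k] subset_adjoin_list[OF subdom_k, of xs] R in auto)
  qed
  have SR: "subdom R" "k \<subseteq> R" unfolding R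
    using subdom_adjoin_list[OF subdom_k] subset_adjoin_list[OF subdom_k] by auto
  have "alg_mod k m f"
    using alg_mod_of_adjoin_list[OF subdom_k R'] m by (auto simp: maximal_in_def)
  then obtain p where p: "coeffs_in k p" "\<exists>i. coeff p i \<notin> m" "poly p f \<in> m" by (auto simp: alg_mod_def)
  obtain P where P: "p = map_poly \<iota> P" using coeffs_in_kE[OF p(1)] .
  have m': "prime_in m R" using m by (simp add: maximal_in_def)
  have "0 \<in> m" using ideal_inD(2)[OF prime_inD(1)[OF m']] .
  hence "P \<noteq> 0" using p P by auto
  thus ?thesis using keval_prime_root[OF m' SR f, of P] p P by (auto simp: keval_def)
qed

lemma proj_chart_eq: "proj_chart \<iota> fs g = adjoin_list k (map (\<lambda>f. f / g) fs)"
proof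
  show "proj_chart \<iota> fs g \<subseteq> adjoin_list k (map (\<lambda>f. f / g) fs)" unfolding proj_chart_def
    using subset_adjoin_list[OF subdom_k, of "map (\<lambda>f. f / g) fs"]
    by (intro generate_ring_type_algebra(3) subdom_adjoin_list[OF subdom_k]) auto
  show "adjoin_list k (map (\<lambda>f. f / g) fs) \<subseteq> proj_chart \<iota> fs g" unfolding proj_chart_def
    by (rule adjoin_list_subset[OF subdom_k generate_ring_type_algebra(1)])
      (use generate_ring_type_algebra(2) in force)+
qed

text \<open>The same ring as \<open>proj_chart\<close>, with its generators listed so that the
  algebraicity theorem applies.\<close>

definition chart :: "'a list \<Rightarrow> 'a \<Rightarrow> 'a set" where "chart fs g = adjoin_list k (map (\<lambda>f. f / g) fs)"

lemma subdom_chart: "subdom (chart fs g)" "k \<subseteq> chart fs g" "f \<in> set fs \<Longrightarrow> f / g \<in> chart fs g"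
  unfolding chart_def using subdom_adjoin_list[OF subdom_k]
    subset_adjoin_list[OF subdom_k, of "map (\<lambda>f. f / g) fs"] by auto

definition projective_charts :: "'a list \<Rightarrow> bool"
  where "projective_charts fs \<longleftrightarrow> (\<exists>g\<in>set fs. g \<noteq> 0) \<and>
    (\<forall>g\<in>set fs - {0}. frac_field (chart fs g) = UNIV) \<and>
    Y = (\<Union>g\<in>set fs - {0}. {localize (chart fs g) m | m. maximal_in m (chart fs g)})"

lemma ex_projective_charts: "\<exists>fs. projective_charts fs"
proof -
  have pc: "proj_chart \<iota> fs g = chart fs g" for fs g by (simp add: proj_chart_eq chart_def)
  from projective show ?thesis
    unfolding projective_variety_def projective_charts_def pc maximalideal_ring_on[OF subdom_chart(1)] by simp
qed

lemma projective_chartsD: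
  assumes "projective_charts fs"
  shows "\<exists>g\<in>set fs. g \<noteq> 0" "g \<in> set fs \<Longrightarrow> g \<noteq> 0 \<Longrightarrow> frac_field (chart fs g) = UNIV"
    "g \<in> set fs \<Longrightarrow> g \<noteq> 0 \<Longrightarrow> maximal_in m (chart fs g) \<Longrightarrow> localize (chart fs g) m \<in> Y"
    "y \<in> Y \<Longrightarrow> \<exists>g\<in>set fs. g \<noteq> 0 \<and> (\<exists>m. maximal_in m (chart fs g) \<and> y = localize (chart fs g) m)"
  using assms unfolding projective_charts_def by blast+

lemma pointE:
  assumes "y \<in> Y"
  obtains xs R m where "R = adjoin_list k xs" "frac_field R = UNIV" "maximal_in m R" "y = localize R m"
    "prime_in m R" "subdom R" "k \<subseteq> R"
proof -
  obtain fs where fs: "projective_charts fs" using ex_projective_charts by blast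
  from projective_chartsD(4)[OF fs assms] obtain g m where g: "g \<in> set fs" "g \<noteq> 0" "maximal_in m (chart fs g)" "y = localize (chart fs g) m"
    by blast
  show ?thesis
    using that[of "chart fs g", OF chart_def projective_chartsD(2)[OF fs g(1,2)] g(3,4)] g(3) subdom_chart[where fs = fs and g = g]
    by (auto simp: maximal_in_def)
qed

text \<open>Regularity and dimension of the local rings are converted here into valuations; points
  are used through their valuations from now on.\<close>

lemma dval_point: "y \<in> Y \<Longrightarrow> dval (ord_at y)" and vring_point: "y \<in> Y \<Longrightarrow> vring (ord_at y) = y"
proof -
  assume y: "y \<in> Y"
  obtain xs R m where R: "R = adjoin_list k xs" "frac_field R = UNIV" "maximal_in m R" "y = localize R m"
    "prime_in m R" "subdom R" "k \<subseteq> R" by (rule pointE[OF y])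
  have sub: "R \<subseteq> y" unfolding R(4) by (rule subset_localize[OF R(6,5)])
  have "frac_field R \<subseteq> frac_field y" using sub unfolding frac_field_def by blast
  hence "frac_field y = UNIV" using R(2) by auto
  hence "dval (ord_at y) \<and> vring (ord_at y) = y"
    using dval_of_regular_local_ring[of y] subdom_localize[OF R(6,5)] prime_max_ideal_localize[OF R(6,5)]
      curve[OF y] smooth[OF y] R(4) by blast
  thus "dval (ord_at y)" "vring (ord_at y) = y" by auto
qed

lemma k_subset_point: "y \<in> Y \<Longrightarrow> k \<subseteq> y"
  by (metis pointE subset_localize order_trans)

lemma ord_\<iota>: assumes "y \<in> Y" "c \<noteq> 0" shows "ord_at y (\<iota> c) = 0"
proof -
  interpret dval "ord_at y" using assms(1) by (rule dval_point)
  have "\<iota> c \<in> vring (ord_at y)" "inverse (\<iota> c) \<in> vring (ord_at y)"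
    using k_subset_point[OF assms(1)] vring_point[OF assms(1)] by (auto simp: \<iota>_inverse[symmetric])
  thus ?thesis using inverse_in_vring_iff[of "\<iota> c"] assms(2) by simp
qed

text \<open>Numerator and denominator have residues in k by Zariski's lemma, and the residue of the
  denominator is nonzero, so the residues can be divided.\<close>

lemma residue_point:
  assumes y: "y \<in> Y" and f: "f \<in> y"
  shows "\<exists>c. f - \<iota> c \<in> vge (ord_at y) 1"
proof -
  obtain xs R m where R: "R = adjoin_list k xs" "frac_field R = UNIV" "maximal_in m R" "y = localize R m"
    "prime_in m R" "subdom R" "k \<subseteq> R" by (rule pointE[OF y])
  have mI: "ideal_in m R" using R(5) by (rule prime_inD)
  from f R obtain a b where ab: "f = a / b" "a \<in> R" "b \<in> R" "b \<notin> m" by (auto simp: localize_def)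
  obtain c d where cd: "a - \<iota> c \<in> m" "b - \<iota> d \<in> m" using residue_adjoin_list[OF R(1,3)] ab by metis
  have "d \<noteq> 0" using cd ab by auto
  have b0: "b \<noteq> 0" using ab ideal_inD(2)[OF mI] by auto
  define e where "e = c / d"
  have e: "\<iota> c = \<iota> e * \<iota> d" using \<open>d \<noteq> 0\<close> by (simp add: e_def \<iota>_mult[symmetric])
  have "(a - \<iota> c) - \<iota> e * (b - \<iota> d) \<in> m"
    using ideal_in_diff[OF mI R(6) cd(1) ideal_inD(4)[OF mI _ cd(2), of "\<iota> e"]] R(7) by blast
  hence "((a - \<iota> c) - \<iota> e * (b - \<iota> d)) / b \<in> max_ideal y"
    unfolding R(4) max_ideal_localize[OF R(6,5)] using ab by blast
  moreover have "((a - \<iota> c) - \<iota> e * (b - \<iota> d)) / b = f - \<iota> e" using b0 by (simp add: ab(1) e field_simps)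
  moreover have "max_ideal y = vge (ord_at y) 1"
    using dval.max_ideal_vring[OF dval_point[OF y]] vring_point[OF y] by simp
  ultimately show ?thesis by metis
qed

text \<open>Transcendence degree one, read off from the dimension of the local rings. Add a and b to
  a chart ring. If every nonzero ideal meets k[a] - {0}, then K is a finitely generated algebra over
  k(a) and Zariski's lemma applies. Otherwise some nonzero prime P misses this set; P turns out to
  be maximal, and the residue c of a puts the nonzero element a - c of k[a] into P.\<close>

lemma algebraic_over_adjoin_frac:
  assumes a: "a \<notin> k"
  shows "\<exists>p. p \<noteq> 0 \<and> coeffs_in (frac_field (adjoin k a)) p \<and> poly p b = 0"
proof -
  obtain fs where fs: "projective_charts fs" using ex_projective_charts by blast
  from projective_chartsD(1)[OF fs] obtain g where g: "g \<in> set fs" "g \<noteq> 0" by blast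
  define xs R where "xs = map (\<lambda>f. f / g) fs" and "R = chart fs g"
  define R' where "R' = adjoin_list k (a # b # xs)"
  define S where "S = adjoin k a - {0}"
  have SR: "subdom R" "k \<subseteq> R" and R_alt: "R = adjoin_list k xs" using subdom_chart[where fs = fs and g = g]
    by (auto simp: R_def xs_def chart_def)
  have SR': "subdom R'" "k \<subseteq> R'" "a \<in> R'" "b \<in> R'" "set xs \<subseteq> R'"
    using subdom_adjoin_list[OF subdom_k, of "a # b # xs"] subset_adjoin_list[OF subdom_k, of "a # b # xs"]
    by (auto simp: R'_def)
  have RR': "R \<subseteq> R'" unfolding R_alt by (rule adjoin_list_subset[OF subdom_k SR'(1,2,5)])
  have frac: "frac_field R = UNIV" using projective_chartsD(2)[OF fs] g by (simp add: R_def)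
  have Ssub: "adjoin k a \<subseteq> R'" by (rule adjoin_subset[OF subdom_k SR'(1,2,3)])
  have Sad: "subdom (adjoin k a)" by (rule subdom_adjoin[OF subdom_k])
  show ?thesis
  proof (cases "\<exists>x\<in>R'. x \<noteq> 0 \<and> (*) x ` R' \<inter> S = {}")
    case True
    then obtain x where x: "x \<in> R'" "x \<noteq> 0" "(*) x ` R' \<inter> S = {}" by blast
    have xI: "ideal_in ((*) x ` R') R'" by (rule ideal_in_principal[OF SR'(1) x(1)])
    have "\<exists>P. prime_in P R' \<and> (*) x ` R' \<subseteq> P \<and> P \<inter> S = {}"
      by (rule exists_prime_avoiding[OF SR'(1) xI]) (use Ssub x(3) Sad in \<open>auto simp: S_def\<close>)
    then obtain P where P: "prime_in P R'" "(*) x ` R' \<subseteq> P" "P \<inter> S = {}" by blast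
    have PI: "ideal_in P R'" using P(1) by (rule prime_inD)
    have xP: "x \<in> P" using P(2) subdom_one[OF SR'(1)] by force
    obtain M where M: "maximal_in M R'" "P \<subseteq> M"
      using exists_maximal_in[OF SR'(1) PI prime_inD(2)[OF P(1)]] by blast
    have Mp: "prime_in M R'" using M(1) by (simp add: maximal_in_def)
    have MI: "ideal_in M R'" using Mp by (rule prime_inD)
    have res: "\<exists>c. f - \<iota> c \<in> M" if "f \<in> R'" for f using residue_adjoin_list[OF R'_def M(1) that] .
    define m where "m = M \<inter> R"
    have mp: "prime_in m R" unfolding m_def by (rule prime_in_Int[OF Mp SR(1) RR'])
    have "maximal_in m (chart fs g)" unfolding R_def[symmetric]
    proof (rule maximal_in_of_residues[OF SR mp])
      fix u assume u: "u \<in> R"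
      then obtain c where c: "u - \<iota> c \<in> M" using res RR' by blast
      have "\<iota> c \<in> R" using SR(2) by blast
      hence "u - \<iota> c \<in> m" unfolding m_def using c subdom_diff[OF SR(1) u] by blast
      thus "\<exists>c. u - \<iota> c \<in> m" by (rule exI)
    qed
    hence y: "localize R m \<in> Y" unfolding R_def by (rule projective_chartsD(3)[OF fs g])
    define v where "v = ord_at (localize R m)"
    interpret dval v unfolding v_def by (rule dval_point[OF y])
    have vr: "vring v = localize R m" unfolding v_def by (rule vring_point[OF y])
    \<comment> \<open>The localization of the enlarged ring at M contains the local ring of a point
      of the curve and is not the whole field, so both are equal. Hence no prime lies strictly
      between 0 and M.\<close>
    define W where "W = localize R' M"
    have subW: "vring v \<subseteq> W" unfolding vr W_def localize_def m_def using RR' by blast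
    have W: "subdom W" unfolding W_def by (rule subdom_localize[OF SR'(1) Mp])
    have "x \<in> max_ideal W" using max_ideal_localize_Int[OF SR'(1) Mp] xP M(2) W_def by blast
    hence "inverse x \<notin> W" using x(2) by (simp add: max_ideal_def)
    hence "W \<noteq> UNIV" by blast
    hence "W \<subseteq> vring v" using overring_eq_UNIV[OF W subW] by blast
    hence "W = vring v" using subW by (rule equalityI)
    have "\<not> P \<subset> M" using no_prime_below_center[OF SR'(1) P(1) Mp] \<open>W = vring v\<close> W_def xP x(2) by blast
    hence PM: "P = M" using M(2) by blast
    obtain c where "a - \<iota> c \<in> M" using res SR' by blast
    hence "a - \<iota> c \<in> P" unfolding PM .
    moreover have "a - \<iota> c \<in> adjoin k a"
      using in_adjoin[OF subdom_k, of a] subset_adjoin[OF subdom_k, of a] Sad by blast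
    moreover have "a - \<iota> c \<noteq> 0" using a by auto
    ultimately have False using P(3) by (auto simp: S_def)
    thus ?thesis ..
  next
    case False
    \<comment> \<open>Each nonzero element of the chart ring divides, inside R', a nonzero element
      of k[a]. It is thus invertible in the algebra generated over k(a), which therefore is all of
      K.\<close>
    define F where "F = frac_field (adjoin k a)"
    have F: "subdom F" "adjoin k a \<subseteq> F" unfolding F_def using subdom_frac_field[OF Sad] by auto
    define U where "U = adjoin_list F (b # a # xs)"
    have U: "subdom U" "F \<subseteq> U" "set (b # a # xs) \<subseteq> U"
      unfolding U_def using subdom_adjoin_list[OF F(1), of "b # a # xs"]
        subset_adjoin_list[OF F(1), of "b # a # xs"] by auto
    have "R' \<subseteq> U" unfolding R'_def using U F(2) subset_adjoin[OF subdom_k, of a]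
      by (intro adjoin_list_subset[OF subdom_k]) auto
    have "t \<in> U" for t
    proof -
      have "t \<in> frac_field R" using frac by simp
      then obtain n q where nq: "t = n / q" "n \<in> R" "q \<in> R" "q \<noteq> 0" unfolding frac_field_def by blast
      have "\<not> (*) q ` R' \<inter> S = {}" using False nq(3,4) RR' by blast
      then obtain r where r: "r \<in> R'" "q * r \<in> S" by blast
      have "inverse (q * r) \<in> F" using r(2) F(2) subdom_frac_field(3)[OF Sad, of "q * r"] by (auto simp: S_def F_def)
      hence "n * r * inverse (q * r) \<in> U" using nq r RR' \<open>R' \<subseteq> U\<close> U by (intro subdom_mult[OF U(1)]) auto
      moreover have "r \<noteq> 0" using r(2) by (auto simp: S_def)
      hence "n * r * inverse (q * r) = t" using nq by (simp add: field_simps)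
      ultimately show ?thesis by simp
    qed
    hence "U = UNIV" by blast
    hence UU: "UNIV = adjoin_list F (b # a # xs)" unfolding U_def by (rule sym)
    have "alg_mod F {0} b"
    proof (rule alg_mod_of_adjoin_list[OF F(1) UU])
      fix t :: 'a assume "t \<notin> {0}"
      thus "\<exists>r\<in>UNIV. 1 - r * t \<in> {0}" by (intro bexI[of _ "inverse t"]) auto
    qed (simp add: prime_in_zero)
    then obtain p where "coeffs_in F p" "\<exists>i. coeff p i \<noteq> 0" "poly p b = 0" by (auto simp: alg_mod_def)
    thus ?thesis unfolding F_def by (intro exI[of _ p]) auto
  qed
qed

lemma algebraic_over_adjoin:
  assumes a: "a \<notin> k"
  shows "\<exists>p. p \<noteq> 0 \<and> coeffs_in (adjoin k a) p \<and> poly p b = 0"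
proof -
  have S: "subdom (adjoin k a)" by (rule subdom_adjoin[OF subdom_k])
  obtain p where p: "p \<noteq> 0" "coeffs_in (frac_field (adjoin k a)) p" "poly p b = 0"
    using algebraic_over_adjoin_frac[OF a] by blast
  have "\<forall>i. \<exists>z. coeff p i = fst z / snd z \<and> fst z \<in> adjoin k a \<and> snd z \<in> adjoin k a \<and> snd z \<noteq> 0"
  proof
    fix i
    have "coeff p i \<in> frac_field (adjoin k a)" using p(2) by (simp add: coeffs_in_def)
    then obtain n d where "coeff p i = n / d" "n \<in> adjoin k a" "d \<in> adjoin k a" "d \<noteq> 0"
      unfolding frac_field_def by blast
    thus "\<exists>z. coeff p i = fst z / snd z \<and> fst z \<in> adjoin k a \<and> snd z \<in> adjoin k a \<and> snd z \<noteq> 0"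
      by (intro exI[of _ "(n, d)"]) simp
  qed
  from choice[OF this] obtain z where z: "\<forall>i. coeff p i = fst (z i) / snd (z i) \<and>
    fst (z i) \<in> adjoin k a \<and> snd (z i) \<in> adjoin k a \<and> snd (z i) \<noteq> 0" by (elim exE)
  define n d where "n = (\<lambda>i. fst (z i))" and "d = (\<lambda>i. snd (z i))"
  have nd: "coeff p i = n i / d i" "n i \<in> adjoin k a" "d i \<in> adjoin k a" "d i \<noteq> 0" for i
    using z by (simp_all add: n_def d_def)
  define e where "e = (\<Prod>i\<le>degree p. d i)"
  have "coeff (smult e p) i \<in> adjoin k a" for i
  proof (cases "i \<le> degree p")
    case True
    hence "e = d i * (\<Prod>i\<in>{..degree p} - {i}. d i)" unfolding e_def by (intro prod.remove[of "{..degree p}" i d]) simp_all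
    hence "coeff (smult e p) i = n i * (\<Prod>i\<in>{..degree p} - {i}. d i)"
      using nd(1)[of i] nd(4)[of i] by (simp only: coeff_smult) (simp add: field_simps)
    thus ?thesis using nd(2,3) by (simp only:) (intro subdom_mult[OF S] subdom_prod[OF S])
  next
    case False
    hence "coeff (smult e p) i = 0" by (simp add: coeff_eq_0)
    thus ?thesis using subdom_zero[OF S] by (simp only:)
  qed
  moreover have "e \<noteq> 0" unfolding e_def using nd(4) by auto
  ultimately show ?thesis using p by (intro exI[of _ "smult e p"] conjI) (simp_all add: coeffs_in_def)
qed

end


declare subdom_add [rule del] subdom_diff [rule del] subdom_minus [rule del] subdom_mult [rule del]
  subdom_power [rule del] subdom_sum [rule del] subdom_prod [rule del]

section \<open>Finiteness of the zeros and poles of a function\<close>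

context smooth_projective_curve
begin

text \<open>Dividing by the largest common power of a leaves a relation whose reduction modulo any
  prime containing a is nontrivial.\<close>

lemma strip_common_factor:
  fixes P :: "nat \<Rightarrow> 'k poly"
  assumes "a \<noteq> 0" "\<exists>i\<le>n. P i \<noteq> 0" "(\<Sum>i\<le>n. keval (P i) a * b ^ i) = 0"
  shows "\<exists>Q. (\<exists>i\<le>n. coeff (Q i) 0 \<noteq> 0) \<and> (\<Sum>i\<le>n. keval (Q i) a * b ^ i) = 0"
  using assms(2,3)
proof (induction "\<Sum>i\<le>n. degree (P i)" arbitrary: P rule: less_induct)
  case less
  show ?case
  proof (cases "\<exists>i\<le>n. coeff (P i) 0 \<noteq> 0")
    case False
    define Q where "Q = (\<lambda>i. if i \<le> n then poly_shift 1 (P i) else 0)"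
    have P: "P i = pCons 0 (Q i)" if "i \<le> n" for i
      using that False by (intro poly_eqI) (auto simp: Q_def coeff_poly_shift coeff_pCons split: nat.splits)
    obtain j where j: "j \<le> n" "P j \<noteq> 0" using less.prems(1) by blast
    have "(\<Sum>i\<le>n. degree (Q i)) < (\<Sum>i\<le>n. degree (P i))"
    proof (rule sum_strict_mono_ex1)
      show "\<forall>i\<in>{..n}. degree (Q i) \<le> degree (P i)"
        using P by (auto simp: degree_pCons_eq_if)
      show "\<exists>i\<in>{..n}. degree (Q i) < degree (P i)"
        using P[of j] j by (intro bexI[of _ j]) (auto simp: degree_pCons_eq_if)
    qed simp
    moreover have "\<exists>i\<le>n. Q i \<noteq> 0" using P[of j] j by (intro exI[of _ j]) auto
    moreover have "a * (\<Sum>i\<le>n. keval (Q i) a * b ^ i) = (\<Sum>i\<le>n. keval (P i) a * b ^ i)"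
      unfolding sum_distrib_left by (intro sum.cong) (auto simp: P mult_ac)
    hence "(\<Sum>i\<le>n. keval (Q i) a * b ^ i) = 0" using less.prems(2) assms(1) by simp
    ultimately show ?thesis using less.hyps by blast
  qed (use less.prems in blast)
qed

text \<open>Q is the relation between a and b, taken at a = 0. It depends on a and b only, so one
  finite set of residues of b serves every ring R and every prime m containing a.\<close>

lemma finitely_many_residues:
  assumes a: "a \<notin> k"
  shows "\<exists>Q::'k poly. Q \<noteq> 0 \<and> (\<forall>R m c. subdom R \<longrightarrow> k \<subseteq> R \<longrightarrow> prime_in m R \<longrightarrow> a \<in> m \<longrightarrow> b \<in> R \<longrightarrow> b - \<iota> c \<in> m \<longrightarrow> poly Q c = 0)"
proof -
  obtain p where p: "p \<noteq> 0" "coeffs_in (adjoin k a) p" "poly p b = 0" using algebraic_over_adjoin[OF a] by blast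
  have "\<forall>i. \<exists>P. coeff p i = keval P a" using p(2) by (auto simp: coeffs_in_def elim: adjoin_kE)
  from choice[OF this] obtain P where P: "\<And>i. coeff p i = keval (P i) a" by blast
  define n where "n = degree p"
  have "P n \<noteq> 0" using P[of n] p(1) by (auto simp: n_def)
  hence "\<exists>i\<le>n. P i \<noteq> 0" by blast
  moreover have "(\<Sum>i\<le>n. keval (P i) a * b ^ i) = 0" using p(3) by (simp add: poly_altdef n_def P)
  moreover have "a \<noteq> 0" using a rangeI[of \<iota> 0] by auto
  ultimately obtain Q where Q: "\<exists>i\<le>n. coeff (Q i) 0 \<noteq> 0" "(\<Sum>i\<le>n. keval (Q i) a * b ^ i) = 0"
    using strip_common_factor[of a n P b] by blast
  define q where "q = (\<Sum>i\<le>n. monom (coeff (Q i) 0) i)"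
  obtain i where i: "i \<le> n" "coeff (Q i) 0 \<noteq> 0" using Q(1) by blast
  have "coeff q i = coeff (Q i) 0" using i by (simp add: q_def coeff_sum if_distrib sum.delta cong: if_cong)
  hence "q \<noteq> 0" using i by auto
  moreover have "poly q c = 0"
    if R: "subdom R" "k \<subseteq> R" "prime_in m R" "a \<in> m" "b \<in> R" "b - \<iota> c \<in> m" for R m c
  proof -
    have mI: "ideal_in m R" using R(3) by (rule prime_inD)
    have aR: "a \<in> R" using ideal_inD(6)[OF mI R(4)] .
    have cR: "\<iota> d \<in> R" for d using R(2) by blast
    have kR: "keval F a \<in> R" for F by (rule keval_in[OF R(1,2) aR])
    have Q0: "keval F a - \<iota> (coeff F 0) \<in> m" for F
    proof (cases F)
      case (pCons d G)
      have "keval G a * a \<in> m" by (rule ideal_inD(4)[OF mI kR R(4)])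
      thus ?thesis by (simp add: pCons mult.commute)
    qed
    have "(\<Sum>i\<le>n. keval (Q i) a * (b ^ i - \<iota> c ^ i) + \<iota> c ^ i * (keval (Q i) a - \<iota> (coeff (Q i) 0))) \<in> m"
      by (intro ideal_in_sum[OF mI] ideal_inD(3)[OF mI] ideal_inD(4)[OF mI] kR Q0
        ideal_in_power_diff[OF mI R(1) R(5) cR R(6)] subdom_power[OF R(1) cR])
    also have "(\<Sum>i\<le>n. keval (Q i) a * (b ^ i - \<iota> c ^ i) + \<iota> c ^ i * (keval (Q i) a - \<iota> (coeff (Q i) 0)))
      = (\<Sum>i\<le>n. keval (Q i) a * b ^ i) - (\<Sum>i\<le>n. \<iota> (coeff (Q i) 0) * \<iota> c ^ i)"
      unfolding sum_subtractf[symmetric] by (intro sum.cong) (auto simp: algebra_simps)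
    also have "\<dots> = \<iota> (- poly q c)" unfolding Q(2)
      by (simp add: q_def poly_sum poly_monom \<iota>_minus \<iota>_sum \<iota>_mult \<iota>_power)
    finally have "\<iota> (- poly q c) \<in> m" .
    from k_notin_prime[OF R(3,2) this] show ?thesis by simp
  qed
  ultimately show ?thesis by (intro exI[of _ q] conjI allI impI)
qed

text \<open>The elements with a common residue modulo m and m' form a subring containing k, so it is
  enough to look at generators.\<close>

lemma maximal_in_eqI:
  assumes R: "R = adjoin_list k xs" and m: "maximal_in m R" and m': "maximal_in m' R"
    and eq: "\<And>x. x \<in> set xs \<Longrightarrow> \<exists>c. x - \<iota> c \<in> m \<and> x - \<iota> c \<in> m'"
  shows "m = m'"
proof -
  have SR: "subdom R" "k \<subseteq> R" unfolding R
    using subdom_adjoin_list[OF subdom_k, of xs] subset_adjoin_list[OF subdom_k, of xs] by auto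
  have mp: "prime_in m R" "prime_in m' R" using m m' by (simp_all add: maximal_in_def)
  note mI = prime_inD(1)[OF mp(1)] prime_inD(1)[OF mp(2)]
  define T where "T = {r \<in> R. \<exists>c. r - \<iota> c \<in> m \<and> r - \<iota> c \<in> m'}"
  have xsR: "set xs \<subseteq> R" unfolding R using subset_adjoin_list[OF subdom_k, of xs] by auto
  have T: "subdom T"
  proof (rule subdomI)
    show "1 \<in> T" unfolding T_def using SR(1) ideal_inD(2)[OF mI(1)] ideal_inD(2)[OF mI(2)]
      by (auto simp: \<iota>_one intro!: exI[of _ 1])
    fix r s assume "r \<in> T" "s \<in> T"
    then obtain c d where *: "r \<in> R" "s \<in> R" "r - \<iota> c \<in> m" "r - \<iota> c \<in> m'" "s - \<iota> d \<in> m" "s - \<iota> d \<in> m'"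
      by (auto simp: T_def)
    have "(r - \<iota> c) - (s - \<iota> d) \<in> m \<and> (r - \<iota> c) - (s - \<iota> d) \<in> m'"
      using ideal_in_diff[OF mI(1) SR(1)] ideal_in_diff[OF mI(2) SR(1)] * by simp
    moreover have "(r - \<iota> c) - (s - \<iota> d) = (r - s) - \<iota> (c - d)" by (simp add: \<iota>_diff)
    ultimately have "(r - s) - \<iota> (c - d) \<in> m \<and> (r - s) - \<iota> (c - d) \<in> m'" by (simp only:)
    thus "r - s \<in> T" unfolding T_def using subdom_diff[OF SR(1) *(1,2)] by blast
    have dR: "\<iota> d \<in> R" using SR(2) by blast
    have "r * (s - \<iota> d) + \<iota> d * (r - \<iota> c) \<in> m" by (intro ideal_inD(3,4)[OF mI(1)] * dR)
    moreover have "r * (s - \<iota> d) + \<iota> d * (r - \<iota> c) \<in> m'" by (intro ideal_inD(3,4)[OF mI(2)] * dR)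
    moreover have "r * (s - \<iota> d) + \<iota> d * (r - \<iota> c) = r * s - \<iota> (c * d)" by (simp add: \<iota>_mult algebra_simps)
    ultimately have "r * s - \<iota> (c * d) \<in> m \<and> r * s - \<iota> (c * d) \<in> m'" by (simp only:)
    thus "r * s \<in> T" unfolding T_def using subdom_mult[OF SR(1) *(1,2)] by blast
  qed
  have "k \<subseteq> T"
  proof
    fix x assume "x \<in> k"
    then obtain c where c: "x = \<iota> c" by blast
    have "x \<in> R" using SR(2) c by blast
    thus "x \<in> T" unfolding T_def using c ideal_inD(2)[OF mI(1)] ideal_inD(2)[OF mI(2)]
      by (intro CollectI conjI exI[of _ c]) simp_all
  qed
  moreover have "set xs \<subseteq> T" using eq xsR unfolding T_def by blast
  ultimately have RT: "R \<subseteq> T" unfolding R by (rule adjoin_list_subset[OF subdom_k T])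
  have "r \<in> m \<longleftrightarrow> r \<in> m'" for r
  proof (cases "r \<in> R")
    case True
    then obtain c where c: "r - \<iota> c \<in> m" "r - \<iota> c \<in> m'" using RT by (auto simp: T_def)
    have "r \<in> m \<longleftrightarrow> \<iota> c \<in> m" "r \<in> m' \<longleftrightarrow> \<iota> c \<in> m'"
      using ideal_in_cong_add[OF mI(1) SR(1) c(1)] ideal_in_cong_add[OF mI(2) SR(1) c(2)] by auto
    moreover have "\<iota> c \<in> m \<longleftrightarrow> c = 0" "\<iota> c \<in> m' \<longleftrightarrow> c = 0"
      using k_notin_prime[OF mp(1) SR(2)] k_notin_prime[OF mp(2) SR(2)]
        ideal_inD(2)[OF mI(1)] ideal_inD(2)[OF mI(2)] by auto
    ultimately show ?thesis by blast
  next
    case False thus ?thesis using ideal_inD(6)[OF mI(1)] ideal_inD(6)[OF mI(2)] by blast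
  qed
  thus ?thesis by blast
qed

text \<open>A maximal ideal over a is determined by the residues of the generators, and each of
  these is a root of a polynomial fixed in advance. A nonzero constant a is a unit and lies in no
  maximal ideal.\<close>

lemma finite_maximal_containing:
  assumes R: "R = adjoin_list k xs" and a: "a \<in> R" "a \<noteq> 0"
  shows "finite {m. maximal_in m R \<and> a \<in> m}"
proof (cases "a \<in> k")
  case True
  have SR: "k \<subseteq> R" unfolding R using subset_adjoin_list[OF subdom_k, of xs] by auto
  have "\<not> (maximal_in m R \<and> a \<in> m)" for m
  proof
    assume *: "maximal_in m R \<and> a \<in> m"
    obtain c where "a = \<iota> c" using True by blast
    thus False using k_notin_prime[of m R c] * SR a(2) by (auto simp: maximal_in_def)
  qed
  hence "{m. maximal_in m R \<and> a \<in> m} = {}" by blast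
  thus ?thesis by (simp only: finite.emptyI)
next
  case False
  have SR: "subdom R" "k \<subseteq> R" "set xs \<subseteq> R" unfolding R
    using subdom_adjoin_list[OF subdom_k, of xs] subset_adjoin_list[OF subdom_k, of xs] by auto
  have "\<forall>b. \<exists>Q::'k poly. Q \<noteq> 0 \<and> (\<forall>R m c. subdom R \<longrightarrow> k \<subseteq> R \<longrightarrow> prime_in m R \<longrightarrow> a \<in> m \<longrightarrow> b \<in> R \<longrightarrow> b - \<iota> c \<in> m \<longrightarrow> poly Q c = 0)"
    using finitely_many_residues[OF False] by (rule allI)
  from choice[OF this] obtain Q :: "'a \<Rightarrow> 'k poly" where Q: "\<forall>b. Q b \<noteq> 0 \<and> (\<forall>R m c. subdom R \<longrightarrow> k \<subseteq> R \<longrightarrow> prime_in m R \<longrightarrow> a \<in> m \<longrightarrow> b \<in> R \<longrightarrow> b - \<iota> c \<in> m \<longrightarrow> poly (Q b) c = 0)"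
    by (elim exE)
  have Q0: "Q b \<noteq> 0" for b using Q by blast
  have Qr: "poly (Q b) c = 0" if "maximal_in m R" "a \<in> m" "b \<in> R" "b - \<iota> c \<in> m" for m b c
  proof -
    have "prime_in m R" using that(1) by (simp add: maximal_in_def)
    with spec[OF Q, of b] SR that show ?thesis by blast
  qed
  define B where "B = (\<Union>x\<in>set xs. {c. poly (Q x) c = 0})"
  have "finite B" unfolding B_def by (intro finite_UN_I poly_roots_finite Q0) simp
  define val where "val = (\<lambda>m x. SOME c. x - \<iota> c \<in> m)"
  have val: "x - \<iota> (val m x) \<in> m" if "maximal_in m R" "x \<in> R" for m x
    unfolding val_def by (rule someI_ex) (rule residue_adjoin_list[OF R that])
  define V where "V = (\<lambda>m. map (val m) xs)"
  have inj: "inj_on V {m. maximal_in m R \<and> a \<in> m}"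
  proof (rule inj_onI)
    fix m m' assume *: "m \<in> {m. maximal_in m R \<and> a \<in> m}" "m' \<in> {m. maximal_in m R \<and> a \<in> m}" "V m = V m'"
    hence mm: "maximal_in m R" "maximal_in m' R" by auto
    show "m = m'"
    proof (rule maximal_in_eqI[OF R mm])
      fix x assume x: "x \<in> set xs"
      hence "val m x = val m' x" using *(3) unfolding V_def map_eq_conv by blast
      thus "\<exists>c. x - \<iota> c \<in> m \<and> x - \<iota> c \<in> m'" using val[OF mm(1), of x] val[OF mm(2), of x] x SR(3)
        by (intro exI[of _ "val m x"]) auto
    qed
  qed
  have sub: "V ` {m. maximal_in m R \<and> a \<in> m} \<subseteq> {cs. set cs \<subseteq> B \<and> length cs = length xs}"
  proof
    fix cs assume "cs \<in> V ` {m. maximal_in m R \<and> a \<in> m}"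
    then obtain m where m: "cs = V m" "maximal_in m R" "a \<in> m" by blast
    have "val m x \<in> B" if x: "x \<in> set xs" for x
    proof -
      have "x \<in> R" using x SR(3) by blast
      hence "poly (Q x) (val m x) = 0" by (intro Qr[OF m(2,3)] val[OF m(2)])
      thus ?thesis using x unfolding B_def by blast
    qed
    thus "cs \<in> {cs. set cs \<subseteq> B \<and> length cs = length xs}" using m(1) by (auto simp: V_def)
  qed
  show ?thesis by (rule inj_on_finite[OF inj sub finite_lists_length_eq[OF \<open>finite B\<close>]])
qed

lemma finite_ord_nonzero:
  assumes f: "f \<noteq> 0"
  shows "finite {y\<in>Y. ord_at y f \<noteq> 0}"
proof -
  obtain fs where fs: "projective_charts fs" using ex_projective_charts by blast
  have "finite (localize (chart fs g) ` {m. maximal_in m (chart fs g)} \<inter> {y\<in>Y. ord_at y f \<noteq> 0})"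
    if g: "g \<in> set fs - {0}" for g
  proof -
    define R where "R = chart fs g"
    have SR: "subdom R" using subdom_chart(1)[of fs g] by (simp add: R_def)
    have "f \<in> frac_field R" using projective_chartsD(2)[OF fs, of g] g by (simp add: R_def)
    then obtain a b where ab: "f = a / b" "a \<in> R" "b \<in> R" "b \<noteq> 0" unfolding frac_field_def by blast
    have a0: "a \<noteq> 0" using ab f by auto
    define M where "M = {m. maximal_in m R \<and> a \<in> m} \<union> {m. maximal_in m R \<and> b \<in> m}"
    have "finite M" unfolding M_def
      using finite_maximal_containing[OF _ ab(2) a0] finite_maximal_containing[OF _ ab(3,4)] R_def chart_def by simp
    moreover have "localize R ` {m. maximal_in m R} \<inter> {y\<in>Y. ord_at y f \<noteq> 0} \<subseteq> localize R ` M"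
    proof
      fix y assume "y \<in> localize R ` {m. maximal_in m R} \<inter> {y\<in>Y. ord_at y f \<noteq> 0}"
      then obtain m where m: "y = localize R m" "maximal_in m R" "y \<in> Y" "ord_at y f \<noteq> 0" by blast
      have mp: "prime_in m R" using m(2) by (simp add: maximal_in_def)
      have "a \<in> m \<or> b \<in> m"
      proof (rule ccontr)
        assume "\<not> ?thesis"
        hence "f \<in> y" "inverse f \<in> y" using ab m(1) localizeI[OF SR mp, of a b] localizeI[OF SR mp, of b a] by auto
        thus False using m(4) dval.inverse_in_vring_iff[OF dval_point[OF m(3)] f] vring_point[OF m(3)] by simp
      qed
      thus "y \<in> localize R ` M" using m by (auto simp: M_def)
    qed
    ultimately show ?thesis unfolding R_def[symmetric] by (meson finite_imageI finite_subset)
  qed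
  hence "finite (\<Union>g\<in>set fs - {0}. localize (chart fs g) ` {m. maximal_in m (chart fs g)} \<inter> {y\<in>Y. ord_at y f \<noteq> 0})"
    by (intro finite_UN_I) auto
  moreover have "{y\<in>Y. ord_at y f \<noteq> 0} \<subseteq> (\<Union>g\<in>set fs - {0}. localize (chart fs g) ` {m. maximal_in m (chart fs g)} \<inter> {y\<in>Y. ord_at y f \<noteq> 0})"
  proof
    fix y assume y: "y \<in> {y\<in>Y. ord_at y f \<noteq> 0}"
    then obtain g m where "g \<in> set fs" "g \<noteq> 0" "maximal_in m (chart fs g)" "y = localize (chart fs g) m"
      using projective_chartsD(4)[OF fs, of y] by blast
    thus "y \<in> (\<Union>g\<in>set fs - {0}. localize (chart fs g) ` {m. maximal_in m (chart fs g)} \<inter> {y\<in>Y. ord_at y f \<noteq> 0})"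
      using y by blast
  qed
  ultimately show ?thesis by (rule finite_subset[rotated])
qed

subsection \<open>Global regular functions are constant\<close>

sublocale kv: vector_space "\<lambda>c f. \<iota> c * f"
  by unfold_locales (auto simp: \<iota>_add \<iota>_mult \<iota>_one algebra_simps)

text \<open>Multiplication by x on a finite-dimensional space gives a polynomial relation for x, and
  k is algebraically closed.\<close>

lemma in_k_of_stable:
  assumes B: "finite B" and s: "s \<in> kv.span B" "s \<noteq> 0" and st: "\<And>w. w \<in> kv.span B \<Longrightarrow> x * w \<in> kv.span B"
  shows "x \<in> k"
proof -
  define f where "f = (\<lambda>i. x ^ i * s)"
  define n where "n = card B"
  have f: "f i \<in> kv.span B" for i
  proof (induction i)
    case (Suc i)
    have "x * f i \<in> kv.span B" by (rule st[OF Suc])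
    thus ?case by (simp add: f_def mult_ac)
  qed (use s in \<open>simp add: f_def\<close>)
  \<comment> \<open>Linear dependence is a property of sets, so a repetition among the x^i s is
    treated separately; it is a relation by itself.\<close>
  show ?thesis
  proof (cases "inj_on f {..n}")
    case False
    then obtain i j where ij: "f i = f j" "i \<noteq> j" unfolding inj_on_def by blast
    define P :: "'k poly" where "P = monom 1 i - monom 1 j"
    have "coeff P i = 1" using ij(2) by (simp add: P_def)
    hence "P \<noteq> 0" by auto
    moreover have "x ^ i = x ^ j" using ij(1) s(2) by (simp add: f_def)
    hence "keval P x = 0" using keval_add[of P "monom 1 j" x] by (simp add: P_def keval_monom)
    ultimately show ?thesis by (rule keval_eq_0_imp_in_k)
  next
    case True
    have "kv.dependent (f ` {..n})"
    proof (rule ccontr)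
      assume "\<not> kv.dependent (f ` {..n})"
      hence "card (f ` {..n}) \<le> card B"
        using kv.independent_span_bound[OF B] f by blast
      thus False using card_image[OF True] by (simp add: n_def)
    qed
    then obtain t u where tu: "finite t" "t \<subseteq> f ` {..n}" "(\<Sum>w\<in>t. \<iota> (u w) * w) = 0" "\<exists>w\<in>t. u w \<noteq> 0"
      unfolding kv.dependent_explicit by blast
    define J where "J = {i\<in>{..n}. f i \<in> t}"
    have t: "t = f ` J" using tu(2) by (auto simp: J_def)
    have inj: "inj_on f J" using True by (rule inj_on_subset) (auto simp: J_def)
    have fin: "finite J" by (simp add: J_def)
    define P where "P = (\<Sum>i\<in>J. monom (u (f i)) i)"
    have "keval P x * s = (\<Sum>i\<in>J. \<iota> (u (f i)) * f i)"
      by (simp add: P_def keval_sum keval_monom sum_distrib_right f_def mult.assoc)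
    also have "\<dots> = (\<Sum>w\<in>t. \<iota> (u w) * w)" unfolding t by (simp add: sum.reindex[OF inj])
    finally have "keval P x = 0" using tu(3) s(2) by simp
    moreover obtain i where i: "i \<in> J" "u (f i) \<noteq> 0" using tu(4) t by blast
    have "coeff P i = u (f i)" using i(1) fin by (simp add: P_def coeff_sum if_distrib sum.delta cong: if_cong)
    hence "P \<noteq> 0" using i(2) by auto
    ultimately show ?thesis using keval_eq_0_imp_in_k by blast
  qed
qed

lemma mult_mem_span:
  assumes "\<And>a. a \<in> A \<Longrightarrow> c * a \<in> kv.span B" "w \<in> kv.span A"
  shows "c * w \<in> kv.span B"
proof (rule kv.span_induct[OF assms(2)])
  show "kv.subspace {w. c * w \<in> kv.span B}"
  proof (rule kv.subspaceI)
    fix x y assume "x \<in> {w. c * w \<in> kv.span B}" "y \<in> {w. c * w \<in> kv.span B}"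
    thus "x + y \<in> {w. c * w \<in> kv.span B}" using kv.span_add[of "c * x" B "c * y"] by (simp add: algebra_simps)
  next
    fix d x assume "x \<in> {w. c * w \<in> kv.span B}"
    thus "\<iota> d * x \<in> {w. c * w \<in> kv.span B}" using kv.span_scale[of "c * x" B d] by (simp add: mult_ac)
  qed (simp add: kv.span_zero)
qed (use assms(1) in simp)

context
  fixes fs :: "'a list"
begin

private definition mon :: "nat \<Rightarrow> 'a set"
  where "mon N = {prod_list xs | xs. set xs \<subseteq> set fs \<and> length xs = N}"

text \<open>The piece of degree N of the homogeneous coordinate ring, placed in the function field
  by setting T = 1.\<close>

private definition S :: "nat \<Rightarrow> 'a set" where "S N = kv.span (mon N)"

private lemma finite_mon: "finite (mon N)"
proof -
  have "mon N = prod_list ` {xs. set xs \<subseteq> set fs \<and> length xs = N}" by (auto simp: mon_def)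
  thus ?thesis using finite_lists_length_eq[of "set fs" N] by simp
qed

private lemma mon_mult: "a \<in> mon M \<Longrightarrow> b \<in> mon N \<Longrightarrow> a * b \<in> mon (M + N)"
proof -
  assume "a \<in> mon M" "b \<in> mon N"
  then obtain xs ys where "a = prod_list xs" "b = prod_list ys" "set xs \<subseteq> set fs" "set ys \<subseteq> set fs"
    "length xs = M" "length ys = N" by (auto simp: mon_def)
  thus ?thesis unfolding mon_def by (intro CollectI exI[of _ "xs @ ys"]) auto
qed

private lemma S_mult: "a \<in> S M \<Longrightarrow> b \<in> S N \<Longrightarrow> a * b \<in> S (M + N)"
proof -
  assume a: "a \<in> S M" and b: "b \<in> S N"
  have "b * a \<in> kv.span (mon (M + N))"
  proof (rule mult_mem_span[of "mon M"])
    fix x assume x: "x \<in> mon M"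
    have "x * b \<in> kv.span (mon (M + N))"
      by (rule mult_mem_span[of "mon N"]) (use x mon_mult kv.span_base b in \<open>auto simp: S_def\<close>)
    thus "b * x \<in> kv.span (mon (M + N))" by (simp add: mult.commute)
  qed (use a in \<open>simp add: S_def\<close>)
  thus ?thesis by (simp add: S_def mult.commute)
qed

private lemma S_power: "g \<in> set fs \<Longrightarrow> g ^ N \<in> S N"
proof -
  assume "g \<in> set fs"
  hence "g ^ N \<in> mon N" unfolding mon_def by (intro CollectI exI[of _ "replicate N g"]) (auto simp: prod_list_replicate)
  thus ?thesis by (simp add: S_def kv.span_base)
qed

private lemma chart_in_S:
  assumes g: "g \<in> set fs" "g \<noteq> 0" and r: "r \<in> chart fs g"
  shows "\<exists>N. g ^ N * r \<in> S N"
proof -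
  define T where "T = {r. \<exists>N. g ^ N * r \<in> S N}"
  have one: "1 \<in> S 0" using S_power[OF g(1), of 0] by simp
  have "subdom T"
  proof (rule subdomI)
    show "1 \<in> T" unfolding T_def using one by (intro CollectI exI[of _ 0]) simp
    fix a b assume "a \<in> T" "b \<in> T"
    then obtain M N where *: "g ^ M * a \<in> S M" "g ^ N * b \<in> S N" unfolding T_def by blast
    have "g ^ N * (g ^ M * a) \<in> S (N + M)" "g ^ M * (g ^ N * b) \<in> S (M + N)"
      by (intro S_mult S_power g *)+
    hence "g ^ N * (g ^ M * a) - g ^ M * (g ^ N * b) \<in> S (M + N)" unfolding S_def
      by (simp add: add.commute kv.span_diff)
    moreover have "g ^ N * (g ^ M * a) - g ^ M * (g ^ N * b) = g ^ (M + N) * (a - b)"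
      by (simp add: power_add algebra_simps)
    ultimately show "a - b \<in> T" unfolding T_def by auto
    have "(g ^ M * a) * (g ^ N * b) \<in> S (M + N)" by (intro S_mult *)
    moreover have "(g ^ M * a) * (g ^ N * b) = g ^ (M + N) * (a * b)" by (simp add: power_add mult_ac)
    ultimately show "a * b \<in> T" unfolding T_def by auto
  qed
  moreover have "k \<subseteq> T"
  proof
    fix x assume "x \<in> k"
    then obtain c where "x = \<iota> c" by blast
    hence "g ^ 0 * x \<in> S 0" using kv.span_scale[of 1 "mon 0" c] one by (simp add: S_def)
    thus "x \<in> T" unfolding T_def by blast
  qed
  moreover have "set (map (\<lambda>f. f / g) fs) \<subseteq> T"
  proof
    fix x assume "x \<in> set (map (\<lambda>f. f / g) fs)"
    then obtain h where h: "h \<in> set fs" "x = h / g" by auto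
    hence "g ^ 1 * x \<in> S 1" using S_power[of h 1] g(2) by simp
    thus "x \<in> T" unfolding T_def by blast
  qed
  ultimately have "chart fs g \<subseteq> T" unfolding chart_def by (intro adjoin_list_subset[OF subdom_k])
  thus ?thesis using r by (auto simp: T_def)
qed

private lemma prod_list_extract: "prod_list xs = g ^ count_list xs g * prod_list (filter (\<lambda>h. h \<noteq> g) xs)" for g :: 'a
  by (induction xs) (auto simp: mult_ac)

private lemma length_extract: "length (filter (\<lambda>h. h \<noteq> g) xs) + count_list xs g = length xs" for g :: 'a
  by (induction xs) auto

text \<open>A high power of any generator g moves x into the graded pieces, because x lies in the
  chart of g. In a sufficiently high degree every monomial contains such a power, so multiplication
  by x preserves that piece.\<close>

lemma in_k_of_in_charts:
  assumes fs: "\<exists>g\<in>set fs. g \<noteq> 0" and x: "\<And>g. g \<in> set fs \<Longrightarrow> g \<noteq> 0 \<Longrightarrow> x \<in> chart fs g"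
  shows "x \<in> k"
proof -
  have "\<exists>N. g \<in> set fs \<longrightarrow> g \<noteq> 0 \<longrightarrow> g ^ N * x \<in> S N" for g
    using chart_in_S[of g x] x[of g] by (cases "g \<in> set fs \<and> g \<noteq> 0") auto
  hence "\<forall>g. \<exists>N. g \<in> set fs \<longrightarrow> g \<noteq> 0 \<longrightarrow> g ^ N * x \<in> S N" by (rule allI)
  from choice[OF this] obtain N where N: "\<forall>g. g \<in> set fs \<longrightarrow> g \<noteq> 0 \<longrightarrow> g ^ N g * x \<in> S (N g)" by (elim exE)
  \<comment> \<open>The \<open>Suc\<close> makes L positive, which settles the generators equal to
    0.\<close>
  define L where "L = Suc (\<Sum>g\<in>set fs. N g)"
  have L: "g ^ L * x \<in> S L" if g: "g \<in> set fs" for g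
  proof (cases "g = 0")
    case True thus ?thesis by (simp add: L_def S_def kv.span_zero)
  next
    case False
    have "N g \<le> L" unfolding L_def using member_le_sum[of g "set fs" N] g by simp
    moreover have "g ^ (L - N g) * (g ^ N g * x) \<in> S (L - N g + N g)"
      by (intro S_mult S_power g) (use N g False in blast)
    moreover have "g ^ (L - N g) * (g ^ N g * x) = g ^ (L - N g + N g) * x" by (simp add: power_add mult_ac)
    ultimately show ?thesis by simp
  qed
  \<comment> \<open>By the pigeonhole principle a monomial of this degree contains some generator at
    least L times.\<close>
  define M where "M = card (set fs) * L"
  obtain g0 where g0: "g0 \<in> set fs" "g0 \<noteq> 0" using fs by blast
  have st: "x * w \<in> kv.span (mon M)" if w: "w \<in> kv.span (mon M)" for w
  proof (rule mult_mem_span[OF _ w])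
    fix a assume "a \<in> mon M"
    then obtain xs where xs: "a = prod_list xs" "set xs \<subseteq> set fs" "length xs = M" by (auto simp: mon_def)
    have "\<exists>g\<in>set fs. count_list xs g \<ge> L"
    proof (rule ccontr)
      assume "\<not> ?thesis"
      hence "(\<Sum>g\<in>set fs. count_list xs g) < (\<Sum>g\<in>set fs. L)" using g0 by (intro sum_strict_mono) (auto simp: not_le)
      thus False using sum_count_set[OF xs(2)] xs(3) by (simp add: M_def)
    qed
    then obtain g where g: "g \<in> set fs" "count_list xs g \<ge> L" by blast
    define zs where "zs = replicate (count_list xs g - L) g @ filter (\<lambda>h. h \<noteq> g) xs"
    have "length zs + L = M" using length_extract[of g xs] g(2) xs(3) by (simp add: zs_def)
    moreover have "set zs \<subseteq> set fs" using xs(2) g(1) by (auto simp: zs_def split: if_splits)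
    ultimately have "prod_list zs \<in> S (M - L)" "M \<ge> L" unfolding S_def
      by (auto simp: mon_def intro!: kv.span_base)
    moreover have "a = g ^ L * prod_list zs" unfolding xs(1) prod_list_extract[of xs g] zs_def
      using g(2) by (simp add: prod_list_replicate power_add[symmetric] mult.assoc[symmetric])
    ultimately have "(g ^ L * x) * prod_list zs \<in> S (L + (M - L))" "L + (M - L) = M"
      and a: "a = g ^ L * prod_list zs"
      using S_mult[OF L[OF g(1)], of "prod_list zs" "M - L"] by simp_all
    moreover have "x * a = (g ^ L * x) * prod_list zs" unfolding a by (simp add: mult_ac)
    ultimately show "x * a \<in> kv.span (mon M)" unfolding S_def by metis
  qed
  show ?thesis
    by (rule in_k_of_stable[OF finite_mon _ _ st, of "g0 ^ M"])
      (use S_power[OF g0(1), of M] g0(2) in \<open>simp_all add: S_def\<close>)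
qed

end

text \<open>The denominators of x in a chart form an ideal. It lies in no maximal ideal, because x
  is regular at the corresponding point; so 1 is a denominator.\<close>

lemma in_k_of_regular:
  assumes x: "\<And>y. y \<in> Y \<Longrightarrow> x \<in> y"
  shows "x \<in> k"
proof -
  obtain fs where fs: "projective_charts fs" using ex_projective_charts by blast
  show ?thesis
  proof (rule in_k_of_in_charts[OF projective_chartsD(1)[OF fs]])
    fix g assume g: "g \<in> set fs" "g \<noteq> 0"
    define R where "R = chart fs g"
    have SR: "subdom R" using subdom_chart(1)[of fs g] by (simp add: R_def)
    define J where "J = {b\<in>R. b * x \<in> R}"
    have J: "ideal_in J R" unfolding ideal_in_def
    proof (intro conjI ballI)
      show "0 \<in> J" using SR by (simp add: J_def)
      fix a b assume "a \<in> J" "b \<in> J"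
      thus "a + b \<in> J" using subdom_add[OF SR] by (simp add: J_def distrib_right)
    next
      fix r a assume "r \<in> R" "a \<in> J"
      thus "r * a \<in> J" using subdom_mult[OF SR] by (simp add: J_def mult.assoc)
    qed (auto simp: J_def)
    have "1 \<in> J"
    proof (rule ccontr)
      assume "1 \<notin> J"
      from exists_maximal_in[OF SR J this] obtain M where M: "maximal_in M R" "J \<subseteq> M" by blast
      hence "localize R M \<in> Y" using projective_chartsD(3)[OF fs g] by (simp add: R_def)
      hence "x \<in> localize R M" by (rule x)
      then obtain a b where ab: "x = a / b" "a \<in> R" "b \<in> R" "b \<notin> M" by (auto simp: localize_def)
      have "b \<noteq> 0" using ab(4) M(1) by (auto simp: maximal_in_def prime_in_def ideal_in_def)
      hence "b \<in> J" using ab by (simp add: J_def)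
      thus False using M(2) ab(4) by blast
    qed
    thus "x \<in> chart fs g" by (simp add: J_def R_def)
  qed
qed

subsection \<open>Derivations\<close>

lemma of_nat_eq_\<iota>: "of_nat n = \<iota> (of_nat n)"
  by (induction n) (auto simp: \<iota>_add \<iota>_one)

lemma of_nat_neq_0: "n > 0 \<Longrightarrow> (of_nat n :: 'a) \<noteq> 0"
  unfolding of_nat_eq_\<iota> by simp

text \<open>The target of \<open>E\<close> is an extension field of the function field, via \<open>c\<close>.\<close>

lemma derivation_eq_0:
  fixes E c :: "'a \<Rightarrow> 'b::field"
  assumes c: "\<And>x y. c (x + y) = c x + c y" "\<And>x y. c (x * y) = c x * c y" "\<And>x. c x = 0 \<longleftrightarrow> x = 0"
    and E: "\<And>x y. E (x + y) = E x + E y" "\<And>x y. E (x * y) = c x * E y + c y * E x" "\<And>a. E (\<iota> a) = 0"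
    and a: "a \<notin> k" "E a = 0"
  shows "E b = 0"
proof -
  have E0: "E 0 = 0" using E(3)[of 0] by simp
  have Ead: "E x = 0" if "x \<in> adjoin k a" for x
  proof -
    obtain P where P: "x = keval P a" using \<open>x \<in> adjoin k a\<close> by (rule adjoin_kE)
    have "E (keval P a) = 0" by (induction P) (simp_all add: E a(2) E0)
    thus ?thesis using P by simp
  qed
  have Ep: "E (poly p b) = c (poly (pderiv p) b) * E b" if "coeffs_in (adjoin k a) p" for p
    using that
  proof (induction p)
    case 0 thus ?case using c(3)[of 0] by (simp add: E0)
  next
    case (pCons d p)
    have "d \<in> adjoin k a" "coeffs_in (adjoin k a) p" using pCons.prems subdom_adjoin[OF subdom_k, of a] by auto
    thus ?case using pCons.IH by (simp add: E Ead pderiv_pCons c algebra_simps)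
  qed
  \<comment> \<open>For a relation p of least degree, p'(b) is nonzero: characteristic 0 keeps p'
    nonzero, and its degree is smaller. Applying E to p(b) = 0 then forces E b = 0.\<close>
  define Rel where "Rel = (\<lambda>p. p \<noteq> 0 \<and> coeffs_in (adjoin k a) p \<and> poly p b = 0)"
  define p where "p = (ARG_MIN degree p. Rel p)"
  have "\<exists>p. Rel p" using algebraic_over_adjoin[OF a(1)] by (simp add: Rel_def)
  then obtain p0 where "Rel p0" by blast
  from arg_min_nat_lemma[of Rel, OF this, of degree]
  have p: "Rel p" and pmin: "\<And>q. Rel q \<Longrightarrow> degree p \<le> degree q" unfolding p_def by auto
  define n where "n = degree p"
  have pD: "p \<noteq> 0" "coeffs_in (adjoin k a) p" "poly p b = 0" using p by (simp_all add: Rel_def)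
  have "n \<noteq> 0"
  proof
    assume "n = 0"
    then obtain d where "p = [:d:]" using degree_eq_zeroE[of p] by (auto simp: n_def)
    thus False using pD by simp
  qed
  then obtain m where m: "n = Suc m" by (cases n) auto
  have "coeff (pderiv p) m = of_nat (Suc m) * coeff p n" by (simp add: coeff_pderiv m)
  moreover have "of_nat (Suc m) \<noteq> (0::'a)" by (rule of_nat_neq_0) simp
  moreover have "coeff p n \<noteq> 0" using pD(1) by (simp add: n_def)
  ultimately have "coeff (pderiv p) m \<noteq> 0" by (metis mult_eq_0_iff)
  hence "pderiv p \<noteq> 0" by auto
  moreover have "degree (pderiv p) < n"
  proof -
    have "degree (pderiv p) \<le> n - 1"
      by (rule degree_le) (auto simp: coeff_pderiv n_def coeff_eq_0)
    thus ?thesis using \<open>n \<noteq> 0\<close> by simp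
  qed
  moreover have "coeffs_in (adjoin k a) (pderiv p)"
  proof -
    have S: "subdom (adjoin k a)" by (rule subdom_adjoin[OF subdom_k])
    have "of_nat i \<in> adjoin k a" for i unfolding of_nat_eq_\<iota> using subset_adjoin[OF subdom_k, of a] by blast
    thus ?thesis using pD(2) subdom_mult[OF S] by (simp add: coeffs_in_def coeff_pderiv del: of_nat_Suc)
  qed
  ultimately have "poly (pderiv p) b \<noteq> 0" using pmin[of "pderiv p"] by (auto simp: Rel_def n_def)
  hence "c (poly (pderiv p) b) \<noteq> 0" using c(3) by blast
  moreover have "c (poly (pderiv p) b) * E b = 0" using Ep[OF pD(2)] pD(3) E0 by simp
  ultimately show ?thesis by simp
qed

end

lemma derivationsD:
  assumes "D \<in> derivations C UNIV"
  shows "D (x + y) = D x + D y" "D (x * y) = x * D y + y * D x" "c \<in> C \<Longrightarrow> D c = 0"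
    "D 0 = 0" "D 1 = 0" "D (- x) = - D x" "D (x - y) = D x - D y"
proof -
  show add: "D (x + y) = D x + D y" for x y using assms by (simp add: derivations_def)
  show mult: "D (x * y) = x * D y + y * D x" for x y using assms by (simp add: derivations_def)
  show "c \<in> C \<Longrightarrow> D c = 0" using assms by (simp add: derivations_def)
  show D0: "D 0 = 0" by (metis add add.right_neutral add_left_cancel)
  have "D 1 + D 1 = D 1 + 0" using mult[of 1 1] by (simp only: mult_1 add_0_right)
  thus "D 1 = 0" by (rule add_left_imp_eq)
  show D': "D (- x) = - D x" for x using add[of x "-x"] D0 by (simp add: eq_neg_iff_add_eq_0 add.commute)
  show "D (x - y) = D x - D y" using add[of x "-y"] D'[of y] by simp
qed

lemma derivation_divide:
  assumes "D \<in> derivations C UNIV" "b \<noteq> 0"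
  shows "D (a / b) = (b * D a - a * D b) / b ^ 2"
proof -
  have "D a = b * D (a / b) + (a / b) * D b" using derivationsD(2)[OF assms(1), of b "a / b"] assms(2) by simp
  thus ?thesis using assms(2) by (simp add: field_simps power2_eq_square)
qed

context smooth_projective_curve
begin

text \<open>The chart ring is finitely generated, so the poles of D on the generators bound those on
  the whole ring, and denominators are units at y. \<open>derivation_regular\<close> improves this
  crude bound by a Taylor expansion.\<close>

lemma derivation_pole_bounded:
  assumes D: "D \<in> derivations k UNIV" and y: "y \<in> Y"
  shows "\<exists>N. \<forall>f\<in>y. D f \<in> vge (ord_at y) (- int N)"
proof -
  define v where "v = ord_at y"
  interpret dval v unfolding v_def by (rule dval_point[OF y])
  have vr: "vring v = y" unfolding v_def by (rule vring_point[OF y])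
  obtain xs R m where R: "R = adjoin_list k xs" "frac_field R = UNIV" "maximal_in m R" "y = localize R m"
    "prime_in m R" "subdom R" "k \<subseteq> R" by (rule pointE[OF y])
  define N where "N = (\<Sum>x\<in>set xs. nat \<bar>v (D x)\<bar>)"
  have Ry: "R \<subseteq> y" unfolding R(4) by (rule subset_localize[OF R(6,5)])
  have Sy: "subdom y" using subdom_vring vr by simp
  define T where "T = {f\<in>y. D f \<in> vge v (- int N)}"
  have xsR: "set xs \<subseteq> R" unfolding R(1) using subset_adjoin_list[OF subdom_k, of xs] by auto
  have mulN: "a * b \<in> vge v (- int N)" if "a \<in> y" "b \<in> vge v (- int N)" for a b
    using vge_mult[of a 0 b "- int N"] that vr by simp
  have "subdom T"
  proof (rule subdomI)
    show "1 \<in> T" using Sy by (simp add: T_def derivationsD[OF D])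
    fix a b assume "a \<in> T" "b \<in> T"
    thus "a - b \<in> T" "a * b \<in> T"
      using subdom_diff[OF Sy] subdom_mult[OF Sy] mulN[of a "D b"] mulN[of b "D a"]
      by (auto simp: T_def derivationsD[OF D] intro: vge_diff vge_add)
  qed
  moreover have "k \<subseteq> T" using k_subset_point[OF y] by (auto simp: T_def derivationsD(3)[OF D])
  moreover have "set xs \<subseteq> T"
  proof
    fix x assume x: "x \<in> set xs"
    have "nat \<bar>v (D x)\<bar> \<le> N" unfolding N_def using member_le_sum[of x "set xs" "\<lambda>x. nat \<bar>v (D x)\<bar>"] x by simp
    hence "D x \<in> vge v (- int N)" by (intro vgeI) linarith
    thus "x \<in> T" using x xsR Ry by (auto simp: T_def)
  qed
  ultimately have RT: "R \<subseteq> T" unfolding R(1) by (rule adjoin_list_subset[OF subdom_k])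
  have "D f \<in> vge v (- int N)" if f: "f \<in> y" for f
  proof -
    obtain a b where ab: "f = a / b" "a \<in> R" "b \<in> R" "b \<notin> m" using f R(4) by (auto simp: localize_def)
    have b0: "b \<noteq> 0" using ab(4) zero_in_prime[OF R(6,5)] by auto
    have "inverse b \<in> y" unfolding R(4) by (rule inverse_in_localize[OF R(6,5) ab(3,4)])
    hence vb: "v b = 0" using inverse_in_vring_iff[OF b0] ab(3) Ry vr by blast
    have aT: "a \<in> T" "b \<in> T" using ab RT by auto
    have "b * D a - a * D b \<in> vge v (- int N)"
      by (intro vge_diff mulN) (use aT in \<open>simp_all add: T_def\<close>)
    hence "D f * b ^ 2 \<in> vge v (- int N)" using b0 by (simp add: ab(1) derivation_divide[OF D b0])
    thus ?thesis using vge_mult_nonzero_iff[of "b ^ 2" "D f" "- int N"] b0 vb by (simp add: mult.commute v_power)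
  qed
  thus ?thesis unfolding v_def by blast
qed

end



section \<open>Divisors on the curve\<close>

context smooth_projective_curve
begin

definition fsupp :: "('a set \<Rightarrow> int) \<Rightarrow> bool" where "fsupp E \<longleftrightarrow> finite {y\<in>Y. E y \<noteq> 0}"

definition deg :: "('a set \<Rightarrow> int) \<Rightarrow> int" where "deg E = (\<Sum>y\<in>{y\<in>Y. E y \<noteq> 0}. E y)"

definition L :: "('a set \<Rightarrow> int) \<Rightarrow> 'a set" where "L E = {f. \<forall>y\<in>Y. f \<in> vge (ord_at y) (- E y)}"

definition h :: "('a set \<Rightarrow> int) \<Rightarrow> nat" where "h E = kv.dim (L E)"

text \<open>Finiteness is recorded separately because \<open>kv.dim\<close> gives 0 on
  infinite-dimensional spaces, as the cardinality of an infinite basis.\<close>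

definition fin_dim :: "'a set \<Rightarrow> bool" where "fin_dim V \<longleftrightarrow> (\<exists>B. finite B \<and> V \<subseteq> kv.span B)"

lemma deg_eq_sum:
  assumes "finite S" "S \<subseteq> Y" "\<And>y. y \<in> Y \<Longrightarrow> E y \<noteq> 0 \<Longrightarrow> y \<in> S"
  shows "deg E = sum E S"
  unfolding deg_def by (rule sum.mono_neutral_left) (use assms in auto)

lemma fsupp_combine:
  assumes "fsupp E" "fsupp F" "\<And>y. y \<in> Y \<Longrightarrow> E y = 0 \<Longrightarrow> F y = 0 \<Longrightarrow> G y = 0"
  shows "fsupp G"
  using assms(1,2) unfolding fsupp_def
  by (rule finite_subset[OF _ finite_UnI, rotated]) (use assms(3) in auto)

lemma fsupp_add: "fsupp E \<Longrightarrow> fsupp F \<Longrightarrow> fsupp (\<lambda>y. E y + F y)" by (rule fsupp_combine[of E F]) auto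
lemma fsupp_diff: "fsupp E \<Longrightarrow> fsupp F \<Longrightarrow> fsupp (\<lambda>y. E y - F y)" by (rule fsupp_combine[of E F]) auto
lemma fsupp_cmult: "fsupp E \<Longrightarrow> fsupp (\<lambda>y. c * E y)" by (rule fsupp_combine[of E E]) auto
lemma fsupp_0 [simp]: "fsupp (\<lambda>y. 0)" by (simp add: fsupp_def)
lemma fsupp_ord: "f \<noteq> 0 \<Longrightarrow> fsupp (\<lambda>y. ord_at y f)" unfolding fsupp_def by (rule finite_ord_nonzero)
lemma fsupp_upd: "fsupp E \<Longrightarrow> fsupp (E(z := c))"
  unfolding fsupp_def by (rule finite_subset[of _ "insert z {y\<in>Y. E y \<noteq> 0}"]) auto

lemma deg_add:
  assumes "fsupp E" "fsupp F"
  shows "deg (\<lambda>y. E y + F y) = deg E + deg F"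
proof -
  define S where "S = {y\<in>Y. E y \<noteq> 0} \<union> {y\<in>Y. F y \<noteq> 0}"
  have S: "finite S" "S \<subseteq> Y" using assms by (auto simp: S_def fsupp_def)
  have "deg (\<lambda>y. E y + F y) = (\<Sum>y\<in>S. E y + F y)" "deg E = sum E S" "deg F = sum F S"
    by (rule deg_eq_sum[OF S]; auto simp: S_def)+
  thus ?thesis by (simp add: sum.distrib)
qed

lemma deg_cmult: "fsupp E \<Longrightarrow> deg (\<lambda>y. c * E y) = c * deg E"
  unfolding fsupp_def by (subst deg_eq_sum[of "{y\<in>Y. E y \<noteq> 0}"]) (auto simp: deg_def sum_distrib_left)

lemma deg_minus: "deg (\<lambda>y. - E y) = - deg E" by (simp add: deg_def sum_negf)

lemma deg_diff: "fsupp E \<Longrightarrow> fsupp F \<Longrightarrow> deg (\<lambda>y. E y - F y) = deg E - deg F"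
  using deg_add[of E "\<lambda>y. - F y"] deg_minus[of F] fsupp_cmult[of F "-1"] by simp

lemma deg_0 [simp]: "deg (\<lambda>y. 0) = 0" by (simp add: deg_def)

lemma deg_nonneg: "(\<And>y. y \<in> Y \<Longrightarrow> E y \<ge> 0) \<Longrightarrow> deg E \<ge> 0"
  unfolding deg_def by (rule sum_nonneg) auto

lemma deg_eq_0_imp:
  assumes "fsupp E" "\<And>y. y \<in> Y \<Longrightarrow> E y \<ge> 0" "deg E = 0" "y \<in> Y"
  shows "E y = 0"
proof (rule ccontr)
  assume "E y \<noteq> 0"
  hence "y \<in> {y\<in>Y. E y \<noteq> 0}" "finite {y\<in>Y. E y \<noteq> 0}" using assms by (auto simp: fsupp_def)
  thus False using assms(2,3) sum_nonneg_eq_0_iff[of "{y\<in>Y. E y \<noteq> 0}" E] unfolding deg_def by auto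
qed

lemma deg_upd:
  assumes "fsupp E" "z \<in> Y"
  shows "deg (E(z := E z + c)) = deg E + c"
proof -
  have fs: "fsupp (\<lambda>y. if y = z then c else 0)" unfolding fsupp_def by (rule finite_subset[of _ "{z}"]) auto
  have "E(z := E z + c) = (\<lambda>y. E y + (if y = z then c else 0))" by auto
  moreover have "deg (\<lambda>y. if y = z then c else 0) = c" using assms(2) by (subst deg_eq_sum[of "{z}"]) (simp_all split: if_splits)
  ultimately show ?thesis using deg_add[OF assms(1) fs] by simp
qed

lemma deg_cong: "(\<And>y. y \<in> Y \<Longrightarrow> E y = F y) \<Longrightarrow> deg E = deg F"
  unfolding deg_def by (intro sum.cong) auto

lemma L_mono: "(\<And>y. y \<in> Y \<Longrightarrow> E y \<le> F y) \<Longrightarrow> L E \<subseteq> L F"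
  unfolding L_def vge_def by fastforce

lemma L_cong: "(\<And>y. y \<in> Y \<Longrightarrow> E y = F y) \<Longrightarrow> L E = L F"
  using L_mono[of E F] L_mono[of F E] by auto

lemma LI: "(\<And>y. y \<in> Y \<Longrightarrow> ord_at y f \<ge> - E y) \<Longrightarrow> f \<in> L E" by (auto simp: L_def vge_def)

lemma LD: "f \<in> L E \<Longrightarrow> f \<noteq> 0 \<Longrightarrow> y \<in> Y \<Longrightarrow> ord_at y f \<ge> - E y" by (auto simp: L_def vge_def)

lemma zero_in_L [simp]: "0 \<in> L E" by (simp add: L_def vge_def)

lemma scale_vge:
  assumes "y \<in> Y" "f \<in> vge (ord_at y) n"
  shows "\<iota> c * f \<in> vge (ord_at y) n"
proof -
  interpret dval "ord_at y" using assms(1) by (rule dval_point)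
  have "\<iota> c \<in> vge (ord_at y) 0" using ord_\<iota>[OF assms(1), of c] by (cases "c = 0") (auto simp: vge_def)
  from vge_mult[OF this assms(2)] show ?thesis by simp
qed

lemma subspace_L: "kv.subspace (L E)"
proof (rule kv.subspaceI)
  fix f g assume "f \<in> L E" "g \<in> L E"
  thus "f + g \<in> L E" unfolding L_def using dval.vge_add[OF dval_point] by simp
next
  fix c f assume "f \<in> L E" thus "\<iota> c * f \<in> L E" unfolding L_def using scale_vge by simp
qed simp

lemma fin_dim_mono: "V \<subseteq> W \<Longrightarrow> fin_dim W \<Longrightarrow> fin_dim V" unfolding fin_dim_def by blast

lemma fin_dim_basis:
  assumes "kv.subspace V" "fin_dim V"
  obtains B where "finite B" "B \<subseteq> V" "kv.independent B" "kv.span B = V" "card B = kv.dim V"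
proof -
  obtain B where B: "B \<subseteq> V" "kv.independent B" "V \<subseteq> kv.span B" "card B = kv.dim V" by (rule kv.basis_exists)
  obtain T where T: "finite T" "V \<subseteq> kv.span T" using assms(2) by (auto simp: fin_dim_def)
  have "finite B" using kv.independent_span_bound[OF T(1) B(2)] B(1) T(2) by blast
  moreover have "kv.span B = V" using B(1,3) assms(1) by (metis kv.span_minimal subset_antisym)
  ultimately show ?thesis using that B by blast
qed

lemma dim_extend:
  assumes V: "kv.subspace V" "fin_dim V" and W: "kv.subspace W" "V \<subseteq> W" and b: "b \<in> W" "b \<notin> V"
    and ex: "\<And>w. w \<in> W \<Longrightarrow> \<exists>c. w - \<iota> c * b \<in> V"
  shows "fin_dim W \<and> kv.dim W = kv.dim V + 1"
proof -
  obtain B where B: "finite B" "B \<subseteq> V" "kv.independent B" "kv.span B = V" "card B = kv.dim V"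
    by (rule fin_dim_basis[OF V])
  have bB: "b \<notin> B" using b(2) B(2) by blast
  have ind: "kv.independent (insert b B)" using B(3,4) b(2) by (intro kv.independent_insertI) auto
  have sp: "W \<subseteq> kv.span (insert b B)"
  proof
    fix w assume "w \<in> W"
    then obtain c where c: "w - \<iota> c * b \<in> V" using ex by blast
    have "w - \<iota> c * b \<in> kv.span (insert b B)" using c B(4) kv.span_mono[of B "insert b B"] by blast
    moreover have "\<iota> c * b \<in> kv.span (insert b B)" by (intro kv.span_scale kv.span_base) simp
    ultimately have "(w - \<iota> c * b) + \<iota> c * b \<in> kv.span (insert b B)" by (rule kv.span_add)
    thus "w \<in> kv.span (insert b B)" by simp
  qed
  have "insert b B \<subseteq> W" using B(2) W(2) b(1) by blast
  hence "kv.dim W = card (insert b B)" using kv.basis_card_eq_dim[OF _ sp ind] by simp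
  thus ?thesis using B(1,5) bB sp unfolding fin_dim_def by (auto intro!: exI[of _ "insert b B"])
qed

text \<open>A further allowed pole at z adds at most one dimension because the residue field is k:
  divided by a function s of exactly the new order, every element becomes a constant modulo the
  maximal ideal at z.\<close>

lemma L_step:
  assumes z: "z \<in> Y" and fd: "fin_dim (L E)"
  defines "E' \<equiv> E(z := E z + 1)"
  shows "fin_dim (L E')" "h E \<le> h E'" "h E' \<le> h E + 1" "L E' \<noteq> L E \<Longrightarrow> h E' = h E + 1"
proof -
  interpret dval "ord_at z" using z by (rule dval_point)
  have sub: "L E \<subseteq> L E'" by (rule L_mono) (auto simp: E'_def)
  have main: "fin_dim (L E') \<and> kv.dim (L E') = kv.dim (L E) + 1" if ne: "L E' \<noteq> L E"
  proof -
    obtain s where s: "s \<in> L E'" "s \<notin> L E" using sub ne by blast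
    have s0: "s \<noteq> 0" using s(2) by auto
    have other: "ord_at y s \<ge> - E y" if "y \<in> Y" "y \<noteq> z" for y
      using LD[OF s(1) s0 that(1)] that(2) by (simp add: E'_def)
    have "ord_at z s \<ge> - E z - 1" using LD[OF s(1) s0 z] by (simp add: E'_def)
    moreover have "\<not> ord_at z s \<ge> - E z" using other s(2) LI[of E s] by metis
    ultimately have os: "ord_at z s = - E z - 1" by simp
    show ?thesis
    proof (rule dim_extend[OF subspace_L fd subspace_L sub s])
      fix w assume w: "w \<in> L E'"
      have "w / s \<in> vge (ord_at z) 0"
      proof (cases "w = 0")
        case False
        have "ord_at z w \<ge> - E' z" by (rule LD[OF w False z])
        thus ?thesis using v_divide[OF False s0] os by (simp add: vge_def E'_def)
      qed simp
      hence "w / s \<in> z" using vring_point[OF z] by simp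
      then obtain c where "w / s - \<iota> c \<in> vge (ord_at z) 1" using residue_point[OF z] by blast
      hence "s * (w / s - \<iota> c) \<in> vge (ord_at z) (- E z)" using s0 os by (simp add: vge_mult_nonzero_iff)
      hence cz: "w - \<iota> c * s \<in> vge (ord_at z) (- E z)" using s0 by (simp add: algebra_simps)
      have "w - \<iota> c * s \<in> L E'" using kv.subspace_diff[OF subspace_L w kv.subspace_scale[OF subspace_L s(1)]] .
      hence "w - \<iota> c * s \<in> vge (ord_at y) (- E y)" if "y \<in> Y" for y
      proof (cases "y = z")
        case False
        have "w - \<iota> c * s \<in> vge (ord_at y) (- E' y)" using \<open>w - \<iota> c * s \<in> L E'\<close> that unfolding L_def by blast
        thus ?thesis using False by (simp add: E'_def)
      qed (use cz in simp)
      thus "\<exists>c. w - \<iota> c * s \<in> L E" by (auto simp: L_def)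
    qed
  qed
  show "fin_dim (L E')" "h E \<le> h E'" "h E' \<le> h E + 1" "L E' \<noteq> L E \<Longrightarrow> h E' = h E + 1"
    using main fd by (cases "L E' = L E"; simp add: h_def)+
qed

text \<open>The points of F - E are added one at a time; their number, with multiplicity, is the
  degree of the difference.\<close>

lemma L_chain:
  assumes "fin_dim (L E)" "fsupp (\<lambda>y. F y - E y)" "\<And>y. y \<in> Y \<Longrightarrow> E y \<le> F y"
  shows "fin_dim (L F) \<and> h E \<le> h F \<and> int (h F) \<le> h E + deg (\<lambda>y. F y - E y)"
  using assms(2,3)
proof (induction "nat (deg (\<lambda>y. F y - E y))" arbitrary: F)
  case 0
  have "deg (\<lambda>y. F y - E y) \<ge> 0" by (rule deg_nonneg) (use 0 in simp)
  hence d0: "deg (\<lambda>y. F y - E y) = 0" using 0 by simp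
  have "F y = E y" if "y \<in> Y" for y using deg_eq_0_imp[OF 0(2) _ d0 that] 0(3) by simp
  hence "L F = L E" by (intro L_cong)
  thus ?case using assms(1) d0 by (simp add: h_def)
next
  case (Suc n)
  have "\<exists>z\<in>Y. F z - E z \<noteq> 0"
  proof (rule ccontr)
    assume "\<not> ?thesis"
    hence "deg (\<lambda>y. F y - E y) = deg (\<lambda>_. 0)" by (intro deg_cong) auto
    thus False using Suc.hyps(2) by simp
  qed
  then obtain z where z: "z \<in> Y" "F z > E z" using Suc.prems(2) by force
  define G where "G = F(z := F z - 1)"
  have G: "(\<lambda>y. G y - E y) = (\<lambda>y. F y - E y)(z := (F z - E z) + (- 1))" by (auto simp: G_def)
  have d: "deg (\<lambda>y. G y - E y) = deg (\<lambda>y. F y - E y) - 1"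
    unfolding G using deg_upd[OF Suc.prems(1) z(1), of "-1"] by simp
  have "fin_dim (L G) \<and> h E \<le> h G \<and> int (h G) \<le> h E + deg (\<lambda>y. G y - E y)"
  proof (rule Suc.hyps(1))
    show "n = nat (deg (\<lambda>y. G y - E y))" using d Suc.hyps(2) by simp
    show "fsupp (\<lambda>y. G y - E y)" unfolding G by (rule fsupp_upd[OF Suc.prems(1)])
    show "E y \<le> G y" if "y \<in> Y" for y using Suc.prems(2)[OF that] z by (auto simp: G_def)
  qed
  moreover have "F = G(z := G z + 1)" by (auto simp: G_def)
  ultimately show ?case using L_step[OF z(1), of G] d by simp
qed

lemma L_0: "L (\<lambda>y. 0) = k"
proof
  show "L (\<lambda>y. 0) \<subseteq> k"
  proof
    fix f assume "f \<in> L (\<lambda>y. 0)"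
    hence "f \<in> y" if "y \<in> Y" for y using that vring_point[OF that] by (auto simp: L_def)
    thus "f \<in> k" by (rule in_k_of_regular)
  qed
  show "k \<subseteq> L (\<lambda>y. 0)"
  proof
    fix x assume "x \<in> k"
    then obtain c where c: "x = \<iota> c" by blast
    have "x \<in> L (\<lambda>y. 0)" if "c \<noteq> 0" unfolding c by (rule LI) (simp add: ord_\<iota> that)
    thus "x \<in> L (\<lambda>y. 0)" using c by (cases "c = 0") simp_all
  qed
qed

lemma fin_dim_L_0: "fin_dim (L (\<lambda>y. 0))" and h_0: "h (\<lambda>y. 0) = 1"
proof -
  have sp: "k \<subseteq> kv.span {1}"
  proof
    fix x assume "x \<in> k"
    then obtain c where "x = \<iota> c * 1" by auto
    thus "x \<in> kv.span {1}" using kv.span_scale[OF kv.span_base[of 1 "{1}"], of c] by simp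
  qed
  thus "fin_dim (L (\<lambda>y. 0))" unfolding L_0 fin_dim_def by blast
  have "{1} \<subseteq> k" using subdom_one[OF subdom_k] by simp
  moreover have "kv.independent {1}" by simp
  ultimately have "card {1::'a} = kv.dim k" using sp by (intro kv.basis_card_eq_dim)
  thus "h (\<lambda>y. 0) = 1" by (simp add: h_def L_0)
qed

lemma fin_dim_L:
  assumes "fsupp E"
  shows "fin_dim (L E)"
proof -
  define F where "F = (\<lambda>y. max (E y) 0)"
  have "fsupp (\<lambda>y. F y - 0)" by (rule fsupp_combine[OF assms assms]) (simp add: F_def)
  hence "fin_dim (L F)" using L_chain[OF fin_dim_L_0, of F] by (simp add: F_def)
  moreover have "L E \<subseteq> L F" by (rule L_mono) (auto simp: F_def)
  ultimately show ?thesis by (rule fin_dim_mono[rotated])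
qed

lemma h_mono: "fsupp E \<Longrightarrow> fsupp F \<Longrightarrow> (\<And>y. y \<in> Y \<Longrightarrow> E y \<le> F y) \<Longrightarrow> h E \<le> h F"
  using L_chain[OF fin_dim_L fsupp_diff, of E F] by blast

lemma h_le: "fsupp E \<Longrightarrow> fsupp F \<Longrightarrow> (\<And>y. y \<in> Y \<Longrightarrow> E y \<le> F y) \<Longrightarrow> int (h F) \<le> h E + (deg F - deg E)"
  using L_chain[OF fin_dim_L fsupp_diff, of E F] deg_diff[of F E] by simp

lemma h_pos_imp:
  assumes "h E > 0"
  shows "\<exists>f. f \<noteq> 0 \<and> f \<in> L E"
proof (rule ccontr)
  assume "\<not> ?thesis"
  hence "L E \<subseteq> kv.span {}" by auto
  hence "kv.dim (L E) \<le> card ({} :: 'a set)" by (intro kv.dim_le_card) auto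
  thus False using assms by (simp add: h_def)
qed

lemma h_cong: assumes "\<And>y. y \<in> Y \<Longrightarrow> E y = F y" shows "h E = h F"
proof -
  have "L E = L F" by (rule L_cong) (rule assms)
  thus ?thesis by (simp add: h_def)
qed

lemma h_minus_ord_le:
  assumes E: "fsupp E" and f: "f \<noteq> 0"
  shows "h (\<lambda>y. E y - ord_at y f) \<le> h E"
proof -
  obtain B where B: "finite B" "B \<subseteq> L E" "kv.independent B" "kv.span B = L E" "card B = kv.dim (L E)"
    by (rule fin_dim_basis[OF subspace_L fin_dim_L[OF E]])
  have "L (\<lambda>y. E y - ord_at y f) \<subseteq> kv.span ((*) f ` B)"
  proof
    fix s assume s: "s \<in> L (\<lambda>y. E y - ord_at y f)"
    have "s / f \<in> vge (ord_at y) (- E y)" if y: "y \<in> Y" for y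
    proof (cases "s = 0")
      case False
      have "ord_at y s \<ge> - (E y - ord_at y f)" by (rule LD[OF s False y])
      thus ?thesis using dval.v_divide[OF dval_point[OF y] False f] by (simp add: vge_def)
    qed (simp add: vge_def)
    hence "s / f \<in> L E" unfolding L_def by blast
    hence sB: "s / f \<in> kv.span B" unfolding B(4) .
    have "f * (s / f) \<in> kv.span ((*) f ` B)"
    proof (rule mult_mem_span[OF _ sB])
      fix a assume "a \<in> B"
      thus "f * a \<in> kv.span ((*) f ` B)" by (rule kv.span_base[OF imageI])
    qed
    thus "s \<in> kv.span ((*) f ` B)" using f by simp
  qed
  hence "kv.dim (L (\<lambda>y. E y - ord_at y f)) \<le> card ((*) f ` B)" using B(1) by (intro kv.dim_le_card) auto
  also have "\<dots> \<le> card B" by (rule card_image_le[OF B(1)])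
  finally show ?thesis using B(5) by (simp add: h_def)
qed

lemma ord_inverse: "y \<in> Y \<Longrightarrow> f \<noteq> 0 \<Longrightarrow> ord_at y (inverse f) = - ord_at y f"
  by (rule dval.v_inverse[OF dval_point])

lemma h_minus_ord:
  assumes E: "fsupp E" and f: "f \<noteq> 0"
  shows "h (\<lambda>y. E y - ord_at y f) = h E"
proof (rule antisym)
  show "h (\<lambda>y. E y - ord_at y f) \<le> h E" by (rule h_minus_ord_le[OF E f])
  have "h E = h (\<lambda>y. (E y - ord_at y f) - ord_at y (inverse f))"
    by (rule h_cong) (simp add: ord_inverse f)
  also have "\<dots> \<le> h (\<lambda>y. E y - ord_at y f)"
    by (rule h_minus_ord_le[OF fsupp_diff[OF E fsupp_ord[OF f]]]) (use f in simp)
  finally show "h E \<le> h (\<lambda>y. E y - ord_at y f)" .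
qed

subsection \<open>Weak approximation\<close>

lemma point_eqI:
  assumes "y \<in> Y" "z \<in> Y" "y \<subseteq> z"
  shows "y = z"
proof -
  have "ord_at y f = ord_at z f" if "f \<noteq> 0" for f
    using vring_eq_imp_eq[OF dval_point[OF assms(1)] dval_point[OF assms(2)] _ that] vring_point assms by simp
  hence "vring (ord_at y) = vring (ord_at z)" unfolding vge_def by force
  thus ?thesis using vring_point assms by simp
qed

text \<open>Neither local ring contains the other, and the quotient of two witnesses has a zero at
  one point and a pole at the other.\<close>

lemma approx_pair:
  assumes z: "z \<in> Y" and z': "z' \<in> Y" "z \<noteq> z'"
  shows "\<exists>d. d \<noteq> 0 \<and> ord_at z d > 0 \<and> ord_at z' d < 0"
proof -
  have "\<not> z \<subseteq> z'" "\<not> z' \<subseteq> z" using point_eqI assms by blast+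
  then obtain a b where ab: "a \<in> z" "a \<notin> z'" "b \<in> z'" "b \<notin> z" by blast
  have a: "a \<noteq> 0" "ord_at z a \<ge> 0" "ord_at z' a < 0" using ab(1,2) vring_point[OF z] vring_point[OF z'(1)]
    by (auto simp: vge_def)
  have b: "b \<noteq> 0" "ord_at z' b \<ge> 0" "ord_at z b < 0" using ab(3,4) vring_point[OF z] vring_point[OF z'(1)]
    by (auto simp: vge_def)
  have "a / b \<noteq> 0" "ord_at z (a / b) > 0" "ord_at z' (a / b) < 0"
    using a b dval.v_divide[OF dval_point[OF z], of a b] dval.v_divide[OF dval_point[OF z'(1)], of a b] by auto
  thus ?thesis by blast
qed

text \<open>The function 1 / (1 + l d) is a unit where d vanishes and vanishes where d has a pole.
  The scalar l avoids the finitely many values for which 1 + l d would vanish at a point of S where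
  d is a unit.\<close>

lemma approx_pair_regular:
  assumes z: "z \<in> Y" and z': "z' \<in> Y" "z \<noteq> z'" and S: "finite S" "S \<subseteq> Y"
  shows "\<exists>e. e \<noteq> 0 \<and> ord_at z e = 0 \<and> ord_at z' e > 0 \<and> (\<forall>w\<in>S. ord_at w e \<ge> 0)"
proof -
  obtain d where d: "d \<noteq> 0" "ord_at z d > 0" "ord_at z' d < 0" using approx_pair[OF z z'] by blast
  define c where "c = (\<lambda>w. SOME c. d - \<iota> c \<in> vge (ord_at w) 1)"
  have c: "d - \<iota> (c w) \<in> vge (ord_at w) 1" if "w \<in> Y" "ord_at w d = 0" for w
  proof -
    have "d \<in> vring (ord_at w)" by (rule dval.vgeI[OF dval_point[OF that(1)]]) (simp add: that(2))
    hence "d \<in> w" unfolding vring_point[OF that(1)] .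
    from residue_point[OF that(1) this] show ?thesis unfolding c_def by (rule someI_ex)
  qed
  have fin: "finite (insert 0 ((\<lambda>w. - inverse (c w)) ` S))" using S(1) by simp
  obtain l :: 'k where l: "l \<notin> insert 0 ((\<lambda>w. - inverse (c w)) ` S)"
    by (rule exE[OF ex_new_if_finite[OF infinite_UNIV_char_0 fin]])
  have ld: "\<iota> l * d \<noteq> 0" using l d(1) by simp
  have old: "ord_at w (\<iota> l * d) = ord_at w d" if "w \<in> Y" for w
    using dval.mult[OF dval_point[OF that], of "\<iota> l" d] ord_\<iota>[OF that, of l] l d(1) by simp
  have neg: "1 + \<iota> l * d \<noteq> 0 \<and> ord_at w (1 + \<iota> l * d) = ord_at w d" if "w \<in> Y" "ord_at w d < 0" for w
  proof -
    interpret dval "ord_at w" using that(1) by (rule dval_point)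
    show ?thesis using v_add_eq[OF ld, of 1] old[OF that(1)] that(2) by (simp add: vge_def add.commute)
  qed
  have pos: "1 + \<iota> l * d \<noteq> 0 \<and> ord_at w (1 + \<iota> l * d) = 0" if "w \<in> Y" "ord_at w d > 0" for w
  proof -
    interpret dval "ord_at w" using that(1) by (rule dval_point)
    show ?thesis using v_add_eq[of 1 "\<iota> l * d"] old[OF that(1)] that(2) by (simp add: vge_def)
  qed
  have zer: "1 + \<iota> l * d \<noteq> 0 \<and> ord_at w (1 + \<iota> l * d) = 0" if w: "w \<in> Y" "ord_at w d = 0" "w \<in> S" for w
  proof -
    interpret dval "ord_at w" using w(1) by (rule dval_point)
    have "1 + l * c w \<noteq> 0"
    proof
      assume "1 + l * c w = 0"
      hence "l * c w = - 1" by (simp add: eq_neg_iff_add_eq_0 add.commute)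
      hence "c w \<noteq> 0" by (intro notI) simp
      hence "l = (l * c w) * inverse (c w)" by simp
      hence "l = - inverse (c w)" unfolding \<open>l * c w = - 1\<close> by simp
      thus False using l w(3) by blast
    qed
    hence u: "\<iota> (1 + l * c w) \<noteq> 0" "ord_at w (\<iota> (1 + l * c w)) = 0" using ord_\<iota>[OF w(1)] by auto
    have "\<iota> l * (d - \<iota> (c w)) \<in> vge (ord_at w) 1" by (rule scale_vge[OF w(1) c[OF w(1,2)]])
    hence "\<iota> (1 + l * c w) + \<iota> l * (d - \<iota> (c w)) \<noteq> 0 \<and> ord_at w (\<iota> (1 + l * c w) + \<iota> l * (d - \<iota> (c w))) = 0"
      using v_add_eq[OF u(1), of "\<iota> l * (d - \<iota> (c w))"] u(2) by simp
    moreover have "\<iota> (1 + l * c w) + \<iota> l * (d - \<iota> (c w)) = 1 + \<iota> l * d"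
      by (simp add: \<iota>_add \<iota>_mult \<iota>_one algebra_simps)
    ultimately show ?thesis by simp
  qed
  define e where "e = inverse (1 + \<iota> l * d)"
  have e0: "e \<noteq> 0" using pos[OF z d(2)] by (simp add: e_def)
  have oe: "ord_at w e = - ord_at w (1 + \<iota> l * d)" if "w \<in> Y" for w
    unfolding e_def using ord_inverse[OF that] pos[OF z d(2)] by simp
  have le: "ord_at w (1 + \<iota> l * d) \<le> 0" if "w \<in> S" for w
  proof -
    have "w \<in> Y" using that S(2) by blast
    consider "ord_at w d < 0" | "ord_at w d = 0" | "ord_at w d > 0" by linarith
    thus ?thesis using neg[OF \<open>w \<in> Y\<close>] pos[OF \<open>w \<in> Y\<close>] zer[OF \<open>w \<in> Y\<close> _ that] by cases simp_all
  qed
  show ?thesis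
  proof (intro exI[of _ e] conjI ballI e0)
    show "ord_at z e = 0" using oe[OF z] pos[OF z d(2)] by simp
    show "ord_at z' e > 0" using oe[OF z'(1)] neg[OF z'(1) d(3)] d(3) by simp
    fix w assume w: "w \<in> S"
    hence "w \<in> Y" using S(2) by blast
    thus "ord_at w e \<ge> 0" using oe[of w] le[OF w] by simp
  qed
qed

text \<open>The product of the functions from \<open>approx_pair_regular\<close> is a unit at z and
  vanishes at the other points. A power of the uniformizer t fixes the order at z, and a high power
  of the product outweighs its orders elsewhere.\<close>

lemma approx:
  assumes S: "finite S" "S \<subseteq> Y" and z: "z \<in> Y"
  shows "\<exists>f. f \<noteq> 0 \<and> ord_at z f = j \<and> (\<forall>w\<in>S - {z}. ord_at w f \<ge> N)"
proof -
  define T where "T = S - {z}"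
  have T: "finite T" "T \<subseteq> Y" using S by (auto simp: T_def)
  have "\<exists>e. z' \<in> T \<longrightarrow> e \<noteq> 0 \<and> ord_at z e = 0 \<and> ord_at z' e > 0 \<and> (\<forall>w\<in>T. ord_at w e \<ge> 0)" for z'
    using approx_pair_regular[OF z, of z' T] T by (cases "z' \<in> T") (auto simp: T_def)
  hence "\<forall>z'. \<exists>e. z' \<in> T \<longrightarrow> e \<noteq> 0 \<and> ord_at z e = 0 \<and> ord_at z' e > 0 \<and> (\<forall>w\<in>T. ord_at w e \<ge> 0)" by (rule allI)
  from choice[OF this] obtain e where e: "\<forall>z'. z' \<in> T \<longrightarrow> e z' \<noteq> 0 \<and> ord_at z (e z') = 0 \<and> ord_at z' (e z') > 0 \<and> (\<forall>w\<in>T. ord_at w (e z') \<ge> 0)"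
    by (elim exE)
  define p where "p = (\<Prod>z'\<in>T. e z')"
  have p0: "p \<noteq> 0" unfolding p_def using e T(1) by auto
  have pz: "ord_at z p = 0" unfolding p_def
    using dval.v_prod[OF dval_point[OF z], of T e] e by simp
  have pw: "ord_at w p \<ge> 1" if w: "w \<in> T" for w
  proof -
    have "ord_at w p = (\<Sum>z'\<in>T. ord_at w (e z'))" unfolding p_def
      using w T(2) e by (intro dval.v_prod[OF dval_point]) auto
    also have "\<dots> = ord_at w (e w) + (\<Sum>z'\<in>T - {w}. ord_at w (e z'))" using T(1) w by (rule sum.remove)
    also have "\<dots> \<ge> 1 + 0" using e w by (intro add_mono sum_nonneg) auto
    finally show ?thesis by simp
  qed
  obtain t where t: "t \<noteq> 0" "ord_at z t = 1" using dval.uniformizer[OF dval_point[OF z]] by blast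
  define M where "M = nat (\<bar>N\<bar> + (\<Sum>w\<in>T. \<bar>j * ord_at w t\<bar>))"
  have "ord_at z (t powi j * p ^ M) = j"
    using dval.mult[OF dval_point[OF z], of "t powi j" "p ^ M"] dval.v_power[OF dval_point[OF z] p0, of M]
      dval.v_powi[OF dval_point[OF z] t(1), of j] t p0 pz by simp
  moreover have "ord_at w (t powi j * p ^ M) \<ge> N" if w: "w \<in> S - {z}" for w
  proof -
    have w': "w \<in> T" "w \<in> Y" using w S by (auto simp: T_def)
    have "\<bar>j * ord_at w t\<bar> \<le> (\<Sum>w\<in>T. \<bar>j * ord_at w t\<bar>)" using T(1) w'(1) by (intro member_le_sum) auto
    moreover have "int M * 1 \<le> int M * ord_at w p" using pw[OF w'(1)] by (intro mult_left_mono) auto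
    moreover have "ord_at w (t powi j * p ^ M) = j * ord_at w t + int M * ord_at w p"
      using dval.mult[OF dval_point[OF w'(2)], of "t powi j" "p ^ M"] dval.v_power[OF dval_point[OF w'(2)] p0, of M]
        dval.v_powi[OF dval_point[OF w'(2)] t(1), of j] t p0 by simp
    ultimately show ?thesis unfolding M_def by linarith
  qed
  ultimately show ?thesis using t(1) p0 by (intro exI[of _ "t powi j * p ^ M"]) auto
qed

subsection \<open>Principal divisors have degree zero\<close>

text \<open>Every step of the chain raises the dimension by exactly one if some function has the
  exact new order. Its other poles are bounded by E rather than by an intermediate divisor, so the
  points may be added in any order.\<close>

lemma h_chain_eq:
  assumes E: "fsupp E" and F: "fsupp F" and le: "\<And>y. y \<in> Y \<Longrightarrow> E y \<le> F y"
    and s: "\<And>z i. z \<in> Y \<Longrightarrow> E z < i \<Longrightarrow> i \<le> F z \<Longrightarrow> \<exists>s. s \<noteq> 0 \<and> ord_at z s = - i \<and> (\<forall>w\<in>Y - {z}. ord_at w s \<ge> - E w)"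
  shows "int (h F) = h E + (deg F - deg E)"
  using F le s
proof (induction "nat (deg F - deg E)" arbitrary: F)
  case 0
  have ge: "deg (\<lambda>y. F y - E y) \<ge> 0" by (rule deg_nonneg) (use 0(3) in simp)
  have "deg (\<lambda>y. F y - E y) = deg F - deg E" by (rule deg_diff[OF 0(2) E])
  hence d0: "deg (\<lambda>y. F y - E y) = 0" "deg F = deg E" using 0(1) ge by simp_all
  have "F y = E y" if "y \<in> Y" for y
    using deg_eq_0_imp[OF fsupp_diff[OF 0(2) E] _ d0(1) that] 0(3) by simp
  hence "h F = h E" by (intro h_cong)
  thus ?case using d0 by simp
next
  case (Suc n)
  have "\<exists>z\<in>Y. F z \<noteq> E z"
  proof (rule ccontr)
    assume "\<not> ?thesis"
    hence "deg F = deg E" by (intro deg_cong) auto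
    thus False using Suc.hyps(2) by simp
  qed
  then obtain z where z: "z \<in> Y" "F z > E z" using Suc.prems(2) by force
  define G where "G = F(z := F z + (- 1))"
  have G: "fsupp G" unfolding G_def by (rule fsupp_upd[OF Suc.prems(1)])
  have dG: "deg G = deg F - 1" unfolding G_def by (subst deg_upd[OF Suc.prems(1) z(1)]) simp
  have IH: "int (h G) = h E + (deg G - deg E)"
  proof (rule Suc.hyps(1)[OF _ G])
    show "n = nat (deg G - deg E)" using dG Suc.hyps(2) by simp
    show "E y \<le> G y" if "y \<in> Y" for y using Suc.prems(2)[OF that] z by (auto simp: G_def)
    show "\<exists>s. s \<noteq> 0 \<and> ord_at w s = - i \<and> (\<forall>v\<in>Y - {w}. ord_at v s \<ge> - E v)" if "w \<in> Y" "E w < i" "i \<le> G w" for w i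
      using Suc.prems(3)[OF that(1,2)] that(3) by (auto simp: G_def split: if_splits)
  qed
  obtain s where s: "s \<noteq> 0" "ord_at z s = - F z" "\<forall>w\<in>Y - {z}. ord_at w s \<ge> - E w"
    using Suc.prems(3)[OF z] by auto
  have FG: "F = G(z := G z + 1)" by (auto simp: G_def)
  have "s \<in> L F"
  proof (rule LI)
    fix y assume "y \<in> Y" thus "ord_at y s \<ge> - F y" using s Suc.prems(2)[of y] by (cases "y = z") force+
  qed
  moreover have "s \<notin> L G" using LD[of s G z] s z by (auto simp: G_def)
  ultimately have "h F = h G + 1" using L_step(4)[OF z(1) fin_dim_L[OF G]] FG by metis
  thus ?case using IH dG by simp
qed

definition zeros :: "'a \<Rightarrow> 'a set \<Rightarrow> int" where "zeros x y = max 0 (ord_at y x)"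

definition poles :: "'a \<Rightarrow> 'a set \<Rightarrow> int" where "poles x y = max 0 (- ord_at y x)"

lemma fsupp_zeros_poles: "x \<noteq> 0 \<Longrightarrow> fsupp (zeros x)" "x \<noteq> 0 \<Longrightarrow> fsupp (poles x)"
  by (rule fsupp_combine[OF fsupp_ord fsupp_ord, of x x]; simp add: zeros_def poles_def)+

text \<open>With \<open>f\<^sub>z\<^sub>,\<^sub>j\<close> of order exactly \<open>j\<close> at \<open>z\<close> and large order at the other zeros of \<open>x\<close>, the products
  \<open>x\<^sup>l f\<^sub>z\<^sub>,\<^sub>j\<close> with \<open>l \<le> m\<close> realise \<open>(m + 1) deg (zeros x)\<close> successive orders.\<close>

lemma h_poles_ge:
  assumes x: "x \<noteq> 0"
  shows "\<exists>C. fsupp C \<and> (\<forall>y. C y \<ge> 0) \<and> (\<forall>m::nat. int (h (\<lambda>y. int m * poles x y + C y)) \<ge> (int m + 1) * deg (zeros x))"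
proof -
  define S where "S = {y\<in>Y. ord_at y x > 0}"
  have "S \<subseteq> {y\<in>Y. ord_at y x \<noteq> 0}" by (auto simp: S_def)
  hence S: "finite S" "S \<subseteq> Y" using finite_subset[OF _ finite_ord_nonzero[OF x], of S] by (simp_all add: S_def)
  have "\<exists>f. z \<in> S \<longrightarrow> f \<noteq> 0 \<and> ord_at z f = int j \<and> (\<forall>w\<in>S - {z}. ord_at w f \<ge> (\<Sum>w\<in>S. zeros x w))" for z j
    using approx[OF S, of z "int j" "\<Sum>w\<in>S. zeros x w"] S(2) by blast
  hence "\<forall>p. \<exists>f. fst p \<in> S \<longrightarrow> f \<noteq> 0 \<and> ord_at (fst p) f = int (snd p) \<and> (\<forall>w\<in>S - {fst p}. ord_at w f \<ge> (\<Sum>w\<in>S. zeros x w))"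
    by blast
  from choice[OF this] obtain f' where f': "\<forall>p. fst p \<in> S \<longrightarrow> f' p \<noteq> 0 \<and> ord_at (fst p) (f' p) = int (snd p) \<and> (\<forall>w\<in>S - {fst p}. ord_at w (f' p) \<ge> (\<Sum>w\<in>S. zeros x w))"
    by (elim exE)
  define f where "f = (\<lambda>z j. f' (z, j))"
  have f0: "f z j \<noteq> 0" and fz: "ord_at z (f z j) = int j" if "z \<in> S" for z j
    using f'[rule_format, of "(z, j)"] that by (auto simp: f_def)
  have fw: "ord_at w (f z j) \<ge> zeros x w" if "z \<in> S" "w \<in> S" "w \<noteq> z" for z w j
  proof -
    have "zeros x w \<le> (\<Sum>w\<in>S. zeros x w)" using S(1) that by (intro member_le_sum) (auto simp: zeros_def)
    also have "\<dots> \<le> ord_at w (f z j)" using f'[rule_format, of "(z, j)"] that by (auto simp: f_def)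
    finally show ?thesis .
  qed
  define I where "I = (SIGMA z:S. {..<nat (zeros x z)})"
  have I: "finite I" using S(1) by (auto simp: I_def)
  \<comment> \<open>C absorbs the poles of the finitely many chosen functions. It vanishes on S,
    where the orders have to be counted exactly.\<close>
  define C where "C = (\<lambda>y. if y \<in> S then 0 else (\<Sum>(z, j)\<in>I. \<bar>ord_at y (f z j)\<bar>))"
  have C0: "C y \<ge> 0" for y by (auto simp: C_def intro!: sum_nonneg)
  have fC: "ord_at y (f z j) \<ge> - C y" if "(z, j) \<in> I" "y \<notin> S" for y z j
  proof -
    have "\<bar>ord_at y (f z j)\<bar> \<le> (\<Sum>(z, j)\<in>I. \<bar>ord_at y (f z j)\<bar>)"
      using member_le_sum[OF that(1), of "\<lambda>(z, j). \<bar>ord_at y (f z j)\<bar>"] I by auto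
    thus ?thesis using that(2) by (simp add: C_def)
  qed
  have fsC: "fsupp C" unfolding fsupp_def
  proof (rule finite_subset)
    show "finite (\<Union>(z, j)\<in>I. {y\<in>Y. ord_at y (f z j) \<noteq> 0})"
      using I f0 finite_ord_nonzero by (intro finite_UN_I) (auto simp: I_def)
    show "{y\<in>Y. C y \<noteq> 0} \<subseteq> (\<Union>(z, j)\<in>I. {y\<in>Y. ord_at y (f z j) \<noteq> 0})"
    proof
      fix y assume y: "y \<in> {y\<in>Y. C y \<noteq> 0}"
      hence "(\<Sum>(z, j)\<in>I. \<bar>ord_at y (f z j)\<bar>) \<noteq> 0" by (auto simp: C_def split: if_splits)
      then obtain p where "p \<in> I" "(case p of (z, j) \<Rightarrow> \<bar>ord_at y (f z j)\<bar>) \<noteq> 0" by (rule sum.not_neutral_contains_not_neutral)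
      thus "y \<in> (\<Union>(z, j)\<in>I. {y\<in>Y. ord_at y (f z j) \<noteq> 0})" using y by (auto split: prod.splits)
    qed
  qed
  have "int (h (\<lambda>y. int m * poles x y + C y)) \<ge> (int m + 1) * deg (zeros x)" for m :: nat
  proof -
    \<comment> \<open>A filtration by vanishing along the zeros of x. Multiplication by x^l carries
      the functions \<open>f z j\<close> into layer l, so each of the m + 1 layers contributes deg
      (zeros x).\<close>
    define E where "E = (\<lambda>l::nat. \<lambda>y. int m * poles x y + C y - int l * zeros x y)"
    have fsE: "fsupp (E l)" for l unfolding E_def
      by (intro fsupp_diff fsupp_add fsupp_cmult fsupp_zeros_poles x fsC)
    have degE: "deg (E l) - deg (E (Suc l)) = deg (zeros x)" for l
    proof -
      have "deg (E l) - deg (E (Suc l)) = deg (\<lambda>y. E l y - E (Suc l) y)" by (rule deg_diff[OF fsE fsE, symmetric])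
      also have "\<dots> = deg (zeros x)" by (rule deg_cong) (simp add: E_def algebra_simps)
      finally show ?thesis .
    qed
    have step: "int (h (E l)) = h (E (Suc l)) + deg (zeros x)" if l: "l \<le> m" for l
    proof -
      have "int (h (E l)) = h (E (Suc l)) + (deg (E l) - deg (E (Suc l)))"
      proof (rule h_chain_eq[OF fsE fsE])
        show "E (Suc l) y \<le> E l y" for y by (simp add: E_def zeros_def algebra_simps)
        fix z i assume z: "z \<in> Y" and i: "E (Suc l) z < i" "i \<le> E l z"
        have "zeros x z > 0" using i by (simp add: E_def algebra_simps)
        hence zS: "z \<in> S" "zeros x z = ord_at z x" "poles x z = 0" "C z = 0" using z by (auto simp: S_def zeros_def poles_def C_def)
        define j where "j = nat (- int l * zeros x z - i)"
        have j: "int j = - int l * zeros x z - i" "int j < zeros x z"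
          using i zS by (auto simp: j_def E_def algebra_simps)
        have zj: "(z, j) \<in> I" using zS j(2) by (auto simp: I_def)
        define s where "s = x ^ l * f z j"
        have s0: "s \<noteq> 0" using x f0[OF zS(1)] by (simp add: s_def)
        have os: "ord_at w s = int l * ord_at w x + ord_at w (f z j)" if "w \<in> Y" for w
          unfolding s_def using dval.mult[OF dval_point[OF that], of "x ^ l" "f z j"]
            dval.v_power[OF dval_point[OF that] x, of l] x f0[OF zS(1)] by simp
        have "ord_at z s = - i" using os[OF z] fz[OF zS(1)] j(1) zS(2) by simp
        moreover have "ord_at w s \<ge> - E (Suc l) w" if w: "w \<in> Y - {z}" for w
        proof (cases "w \<in> S")
          case True
          hence "zeros x w = ord_at w x" "poles x w = 0" "C w = 0" by (auto simp: S_def zeros_def poles_def C_def)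
          thus ?thesis using os[of w] fw[OF zS(1) True, of j] w by (simp add: E_def algebra_simps)
        next
          case False
          hence "zeros x w = 0" "ord_at w x = - poles x w" using w by (auto simp: S_def zeros_def poles_def)
          moreover have "int l * poles x w \<le> int m * poles x w" using l by (intro mult_right_mono) (auto simp: poles_def)
          ultimately show ?thesis using os[of w] fC[OF zj False] w by (simp add: E_def)
        qed
        ultimately show "\<exists>s. s \<noteq> 0 \<and> ord_at z s = - i \<and> (\<forall>w\<in>Y - {z}. ord_at w s \<ge> - E (Suc l) w)" using s0 by blast
      qed
      thus ?thesis using degE by simp
    qed
    have "int (h (E 0)) = h (E l) + int l * deg (zeros x)" if "l \<le> Suc m" for l
      using that by (induction l) (auto simp: step algebra_simps)
    from this[of "Suc m"] have "int (h (E 0)) \<ge> (int m + 1) * deg (zeros x)" by (simp add: algebra_simps)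
    thus ?thesis by (simp add: E_def)
  qed
  thus ?thesis using fsC C0 by blast
qed

text \<open>Allowing m times the poles of x together with C adds at most m deg (poles x) + deg C to
  the dimension of the constants, whereas \<open>h_poles_ge\<close> produces (m + 1) deg (zeros x).
  For large m this excludes an excess of zeros.\<close>

lemma deg_zeros_le:
  assumes x: "x \<noteq> 0"
  shows "deg (zeros x) \<le> deg (poles x)"
proof (rule ccontr)
  assume "\<not> ?thesis"
  hence gt: "deg (zeros x) \<ge> deg (poles x) + 1" by simp
  obtain C where C: "fsupp C" "\<forall>y. C y \<ge> 0"
    "\<forall>m::nat. int (h (\<lambda>y. int m * poles x y + C y)) \<ge> (int m + 1) * deg (zeros x)" using h_poles_ge[OF x] by blast
  have dC: "deg C \<ge> 0" by (rule deg_nonneg) (use C(2) in simp)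
  have dP: "deg (poles x) \<ge> 0" by (rule deg_nonneg) (simp add: poles_def)
  define m where "m = nat (deg C) + 1"
  have fs: "fsupp (\<lambda>y. int m * poles x y + C y)" by (intro fsupp_add fsupp_cmult fsupp_zeros_poles x C(1))
  have "int (h (\<lambda>y. int m * poles x y + C y)) \<le> h (\<lambda>y. 0) + (deg (\<lambda>y. int m * poles x y + C y) - deg (\<lambda>y. 0))"
    by (rule h_le[OF fsupp_0 fs]) (use C(2) in \<open>simp add: poles_def\<close>)
  also have "deg (\<lambda>y. int m * poles x y + C y) = int m * deg (poles x) + deg C"
    by (simp add: deg_add fsupp_cmult fsupp_zeros_poles x C(1) deg_cmult)
  finally have "(int m + 1) * deg (zeros x) \<le> 1 + int m * deg (poles x) + deg C" using C(3) h_0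
    by (metis (no_types, lifting) deg_0 diff_zero of_nat_1 order_trans add.assoc)
  moreover have "(int m + 1) * (deg (poles x) + 1) \<le> (int m + 1) * deg (zeros x)" using gt by (intro mult_left_mono) auto
  ultimately have "int m + deg (poles x) \<le> deg C" by (simp add: algebra_simps)
  thus False using dP dC by (simp add: m_def)
qed

lemma deg_zeros_eq_poles:
  assumes x: "x \<noteq> 0"
  shows "deg (zeros x) = deg (poles x)"
proof (rule antisym[OF deg_zeros_le[OF x]])
  have "deg (zeros (inverse x)) = deg (poles x)" "deg (poles (inverse x)) = deg (zeros x)"
    by (rule deg_cong; simp add: zeros_def poles_def ord_inverse x)+
  thus "deg (poles x) \<le> deg (zeros x)" using deg_zeros_le[of "inverse x"] x by simp
qed

theorem deg_principal:
  assumes x: "x \<noteq> 0"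
  shows "deg (\<lambda>y. ord_at y x) = 0"
proof -
  have "deg (\<lambda>y. ord_at y x) = deg (\<lambda>y. zeros x y - poles x y)" by (rule deg_cong) (auto simp: zeros_def poles_def)
  also have "\<dots> = deg (zeros x) - deg (poles x)" by (intro deg_diff fsupp_zeros_poles x)
  finally show ?thesis using deg_zeros_eq_poles[OF x] by simp
qed

subsection \<open>Riemann's theorem\<close>

lemma ex_point: "\<exists>y. y \<in> Y"
proof -
  obtain fs where fs: "projective_charts fs" using ex_projective_charts by blast
  obtain g where g: "g \<in> set fs" "g \<noteq> 0" using projective_chartsD(1)[OF fs] by blast
  have S: "subdom (chart fs g)" by (rule subdom_chart(1))
  have "\<exists>M. maximal_in M (chart fs g) \<and> {0} \<subseteq> M"
    by (rule exists_maximal_in[OF S]) (use prime_in_zero[OF S] in \<open>auto simp: prime_in_def\<close>)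
  thus ?thesis using projective_chartsD(3)[OF fs g] by blast
qed

lemma ex_nonconstant: "\<exists>x. x \<notin> k \<and> deg (poles x) > 0"
proof -
  obtain y where y: "y \<in> Y" using ex_point by blast
  obtain t where t: "t \<noteq> 0" "ord_at y t = 1" using dval.uniformizer[OF dval_point[OF y]] by blast
  define x where "x = inverse t"
  have ox: "ord_at y x = -1" "x \<noteq> 0" using ord_inverse[OF y t(1)] t by (simp_all add: x_def)
  have "x \<notin> k"
  proof
    assume "x \<in> k"
    then obtain c where "x = \<iota> c" by blast
    thus False using ord_\<iota>[OF y, of c] ox by (cases "c = 0") auto
  qed
  moreover have "deg (poles x) \<noteq> 0"
  proof
    assume d: "deg (poles x) = 0"
    have "poles x y = 0"
      by (rule deg_eq_0_imp[OF fsupp_zeros_poles(2)[OF ox(2)] _ d y]) (simp add: poles_def)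
    thus False using ox by (simp add: poles_def)
  qed
  moreover have "deg (poles x) \<ge> 0" by (rule deg_nonneg) (simp add: poles_def)
  ultimately show ?thesis by (intro exI[of _ x]) auto
qed

text \<open>For multiples of the poles of x the bound follows from \<open>h_poles_ge\<close>. A
  general E lies below a divisor linearly equivalent to such a multiple, and passing down to E costs
  at most the difference of the degrees.\<close>

lemma riemann_inequality: "\<exists>g. \<forall>E. fsupp E \<longrightarrow> int (h E) \<ge> deg E - g"
proof -
  obtain x where x: "x \<notin> k" "deg (poles x) > 0" using ex_nonconstant by blast
  have x0: "x \<noteq> 0" using x(1) rangeI[of \<iota> 0] by auto
  obtain C where C: "fsupp C" "\<forall>y. C y \<ge> 0"
    "\<forall>m::nat. int (h (\<lambda>y. int m * poles x y + C y)) \<ge> (int m + 1) * deg (zeros x)" using h_poles_ge[OF x0] by blast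
  define n where "n = deg (poles x)"
  have fsP: "fsupp (\<lambda>y. int m * poles x y)" for m by (intro fsupp_cmult fsupp_zeros_poles x0)
  have dP: "deg (\<lambda>y. int m * poles x y) = int m * n" for m unfolding n_def by (intro deg_cmult fsupp_zeros_poles x0)
  have hm: "int (h (\<lambda>y. int m * poles x y)) \<ge> int m * n - deg C" for m
  proof -
    have "int (h (\<lambda>y. int m * poles x y + C y)) \<le> h (\<lambda>y. int m * poles x y) +
       (deg (\<lambda>y. int m * poles x y + C y) - deg (\<lambda>y. int m * poles x y))"
      by (rule h_le[OF fsP fsupp_add[OF fsP C(1)]]) (use C(2) in simp)
    also have "deg (\<lambda>y. int m * poles x y + C y) = int m * n + deg C" by (simp add: deg_add[OF fsP C(1)] dP)
    finally have "int (h (\<lambda>y. int m * poles x y + C y)) \<le> h (\<lambda>y. int m * poles x y) + deg C" by (simp add: dP)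
    moreover have "int (h (\<lambda>y. int m * poles x y + C y)) \<ge> (int m + 1) * n"
      using C(3) deg_zeros_eq_poles[OF x0] by (simp add: n_def)
    ultimately show ?thesis using x(2) by (simp add: n_def algebra_simps)
  qed
  have "int (h E) \<ge> deg E - deg C" if E: "fsupp E" for E
  proof -
    define P where "P = (\<lambda>y. max (E y) 0)"
    have P: "fsupp P" unfolding P_def by (rule fsupp_combine[OF E E]) auto
    have dP0: "deg P \<ge> 0" by (rule deg_nonneg) (simp add: P_def)
    \<comment> \<open>Since n is at least 1, this m leaves a nonzero section after P, and hence E,
      is subtracted from m times the poles of x.\<close>
    define m where "m = nat (deg P + deg C + 1)"
    have "deg C \<ge> 0" by (rule deg_nonneg) (use C(2) in simp)
    hence m: "int m = deg P + deg C + 1" using dP0 by (simp add: m_def)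
    have "int (h (\<lambda>y. int m * poles x y)) \<le> h (\<lambda>y. int m * poles x y - P y) +
       (deg (\<lambda>y. int m * poles x y) - deg (\<lambda>y. int m * poles x y - P y))"
      by (rule h_le[OF fsupp_diff[OF fsP P] fsP]) (simp add: P_def)
    hence "int (h (\<lambda>y. int m * poles x y - P y)) \<ge> int m * n - deg C - deg P"
      using hm[of m] by (simp add: deg_diff[OF fsP P])
    moreover have "int m * 1 \<le> int m * n" using x(2) by (intro mult_left_mono) (auto simp: n_def)
    moreover have "h (\<lambda>y. int m * poles x y - P y) \<le> h (\<lambda>y. int m * poles x y - E y)"
      by (rule h_mono[OF fsupp_diff[OF fsP P] fsupp_diff[OF fsP E]]) (simp add: P_def)
    ultimately have "h (\<lambda>y. int m * poles x y - E y) > 0" using m by linarith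
    then obtain f where f: "f \<noteq> 0" "f \<in> L (\<lambda>y. int m * poles x y - E y)" using h_pos_imp by blast
    define G where "G = (\<lambda>y. int m * poles x y - ord_at y (inverse f))"
    have if0: "inverse f \<noteq> 0" using f(1) by simp
    have G: "fsupp G" unfolding G_def by (rule fsupp_diff[OF fsP fsupp_ord[OF if0]])
    have "int (h G) \<le> h E + (deg G - deg E)"
    proof (rule h_le[OF E G])
      fix y assume y: "y \<in> Y"
      show "E y \<le> G y" using LD[OF f(2,1) y] ord_inverse[OF y f(1)] by (simp add: G_def)
    qed
    moreover have "h G = h (\<lambda>y. int m * poles x y)" unfolding G_def by (rule h_minus_ord[OF fsP if0])
    moreover have "deg G = int m * n" unfolding G_def using deg_diff[OF fsP fsupp_ord[OF if0]] deg_principal[OF if0] dP by simp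
    ultimately show ?thesis using hm[of m] by simp
  qed
  thus ?thesis by blast
qed

text \<open>Let F maximize deg - h, which is bounded above by the inequality. If deg E is large, a
  section of E - F makes F linearly equivalent to a divisor below E, and then deg - h of E is at
  least that of F, hence equal to it. The function s shifts the quantity into \<nat> so that a
  maximum exists.\<close>

theorem riemann: "\<exists>g c. \<forall>E. fsupp E \<longrightarrow> deg E \<ge> c \<longrightarrow> int (h E) = deg E - g"
proof -
  obtain g where g: "\<And>E. fsupp E \<Longrightarrow> int (h E) \<ge> deg E - g" using riemann_inequality by blast
  define s where "s = (\<lambda>E. nat (g - (deg E - int (h E))))"
  define F where "F = (ARG_MIN s E. fsupp E)"
  from arg_min_nat_lemma[of fsupp, OF fsupp_0, of s]
  have F: "fsupp F" and Fmin: "\<And>E. fsupp E \<Longrightarrow> s F \<le> s E" unfolding F_def by blast+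
  have le: "deg E - int (h E) \<le> deg F - int (h F)" if "fsupp E" for E
    using Fmin[OF that] g[OF that] g[OF F] by (simp add: s_def)
  have "int (h E) = deg E - (deg F - int (h F))" if E: "fsupp E" "deg E \<ge> deg F + g + 1" for E
  proof -
    have "int (h (\<lambda>y. E y - F y)) > 0" using g[OF fsupp_diff[OF E(1) F]] deg_diff[OF E(1) F] E(2) by simp
    hence "h (\<lambda>y. E y - F y) > 0" by simp
    from h_pos_imp[OF this] obtain f where f: "f \<noteq> 0" "f \<in> L (\<lambda>y. E y - F y)" by blast
    define G where "G = (\<lambda>y. F y - ord_at y f)"
    have G: "fsupp G" unfolding G_def by (rule fsupp_diff[OF F fsupp_ord[OF f(1)]])
    have dG: "deg G = deg F" unfolding G_def using deg_diff[OF F fsupp_ord[OF f(1)]] deg_principal[OF f(1)] by simp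
    have hG: "h G = h F" unfolding G_def by (rule h_minus_ord[OF F f(1)])
    have "int (h E) \<le> h G + (deg E - deg G)"
    proof (rule h_le[OF G E(1)])
      fix y assume y: "y \<in> Y"
      show "G y \<le> E y" using LD[OF f(2,1) y] by (simp add: G_def)
    qed
    thus ?thesis using le[OF E(1)] dG hG by simp
  qed
  thus ?thesis by (intro exI allI impI)
qed

text \<open>In large degree h is determined by the degree, so L shrinks strictly when the
  coefficient at z is lowered by one; a function that gets lost has the exact order there.\<close>

lemma ex_section_exact: "\<exists>c. \<forall>E z. fsupp E \<longrightarrow> deg E \<ge> c \<longrightarrow> z \<in> Y \<longrightarrow> (\<exists>f. f \<noteq> 0 \<and> f \<in> L E \<and> ord_at z f = - E z)"
proof -
  obtain g c where gc': "\<forall>E. fsupp E \<longrightarrow> deg E \<ge> c \<longrightarrow> int (h E) = deg E - g" using riemann by (elim exE)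
  have gc: "int (h E) = deg E - g" if "fsupp E" "deg E \<ge> c" for E using gc' that by blast
  have "\<exists>f. f \<noteq> 0 \<and> f \<in> L E \<and> ord_at z f = - E z" if E: "fsupp E" "deg E \<ge> c + 1" and z: "z \<in> Y" for E z
  proof -
    define G where "G = E(z := E z + (- 1))"
    have G: "fsupp G" "deg G = deg E - 1" unfolding G_def
      using fsupp_upd[OF E(1)] deg_upd[OF E(1) z, of "-1"] by simp_all
    have "h E \<noteq> h G" using gc[OF E(1)] gc[OF G(1)] G(2) E(2) by simp
    hence "L E \<noteq> L G" by (auto simp: h_def)
    moreover have "L G \<subseteq> L E" by (rule L_mono) (simp add: G_def)
    ultimately obtain f where f: "f \<in> L E" "f \<notin> L G" by blast
    have f0: "f \<noteq> 0" using f(2) by auto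
    have "ord_at z f < - G z"
    proof (rule ccontr)
      assume a: "\<not> ord_at z f < - G z"
      have "f \<in> L G"
      proof (rule LI)
        fix y assume "y \<in> Y" thus "ord_at y f \<ge> - G y" using a LD[OF f(1) f0] by (cases "y = z") (auto simp: G_def)
      qed
      thus False using f(2) by simp
    qed
    hence "ord_at z f = - E z" using LD[OF f(1) f0 z] by (simp add: G_def)
    thus ?thesis using f f0 by blast
  qed
  thus ?thesis by (intro exI[of _ "c + 1"] allI impI)
qed

text \<open>A nonzero section makes E linearly equivalent to an effective divisor of degree at most
  0, which must be 0.\<close>

lemma h_le_1_of_deg_nonpos:
  assumes E: "fsupp E" "deg E \<le> 0"
  shows "h E \<le> 1"
proof (cases "h E > 0")
  case True
  then obtain f where f: "f \<noteq> 0" "f \<in> L E" using h_pos_imp by blast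
  define G where "G = (\<lambda>y. E y - ord_at y (inverse f))"
  have if0: "inverse f \<noteq> 0" using f(1) by simp
  have fsG: "fsupp G" unfolding G_def by (rule fsupp_diff[OF E(1) fsupp_ord[OF if0]])
  have G0: "G y \<ge> 0" if "y \<in> Y" for y using LD[OF f(2,1) that] ord_inverse[OF that f(1)] by (simp add: G_def)
  have "deg G = deg E" unfolding G_def using deg_diff[OF E(1) fsupp_ord[OF if0]] deg_principal[OF if0] by simp
  moreover have "deg G \<ge> 0" by (rule deg_nonneg[OF G0])
  ultimately have "deg G = 0" using E(2) by simp
  hence "G y = 0" if "y \<in> Y" for y using deg_eq_0_imp[OF fsG G0 _ that] by simp
  hence "h G = h (\<lambda>y. 0)" by (rule h_cong)
  moreover have "h G = h E" unfolding G_def by (rule h_minus_ord[OF E(1) if0])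
  ultimately show ?thesis using h_0 by simp
qed simp

end


section \<open>Valuations on rational functions in one variable\<close>

text \<open>Values may be negative and the value group is not normalized, since weighted Gauss
  valuations are of this kind on polynomials. \<open>dval_vfract\<close> then asks for an element of
  value 1.\<close>

locale prevaluation =
  fixes V :: "'b::idom \<Rightarrow> int"
  assumes V_mult: "a \<noteq> 0 \<Longrightarrow> b \<noteq> 0 \<Longrightarrow> V (a * b) = V a + V b"
    and V_add: "a \<noteq> 0 \<Longrightarrow> b \<noteq> 0 \<Longrightarrow> a + b \<noteq> 0 \<Longrightarrow> min (V a) (V b) \<le> V (a + b)"

definition vfract :: "('b::idom \<Rightarrow> int) \<Rightarrow> 'b fract \<Rightarrow> int"
  where "vfract V x = (THE n. \<exists>a b. a \<noteq> 0 \<and> b \<noteq> 0 \<and> x = to_fract a / to_fract b \<and> n = V a - V b)"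

lemma fract_quotient:
  obtains a b where "b \<noteq> 0" "x = to_fract a / to_fract b"
  by (cases x rule: Fract_cases) (auto simp: Fract_conv_to_fract)

context prevaluation
begin

lemma vfract_quotient:
  assumes "a \<noteq> 0" "b \<noteq> 0"
  shows "vfract V (to_fract a / to_fract b) = V a - V b"
  unfolding vfract_def
proof (rule the_equality)
  show "\<exists>c d. c \<noteq> 0 \<and> d \<noteq> 0 \<and> to_fract a / to_fract b = to_fract c / to_fract d \<and> V a - V b = V c - V d"
    using assms by blast
  fix n assume "\<exists>c d. c \<noteq> 0 \<and> d \<noteq> 0 \<and> to_fract a / to_fract b = to_fract c / to_fract d \<and> n = V c - V d"
  then obtain c d where *: "c \<noteq> 0" "d \<noteq> 0" "to_fract a / to_fract b = to_fract c / to_fract d" "n = V c - V d"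
    by blast
  have "to_fract (a * d) = to_fract (c * b)" using *(1-3) assms by (simp add: field_simps)
  hence "a * d = c * b" by (simp only: to_fract_eq_iff)
  hence "V a + V d = V c + V b" using V_mult[of a d] V_mult[of c b] * assms by simp
  thus "n = V a - V b" using *(4) by simp
qed

lemma V_one: "V 1 = 0" using V_mult[of 1 1] by simp

lemma vfract_to_fract: "a \<noteq> 0 \<Longrightarrow> vfract V (to_fract a) = V a"
  using vfract_quotient[of a 1] by (simp add: V_one)

lemma dval_vfract:
  assumes "x \<noteq> 0" "vfract V x = 1"
  shows "dval (vfract V)"
proof
  fix x y :: "'b fract" assume xy: "x \<noteq> 0" "y \<noteq> 0"
  obtain a b where ab: "b \<noteq> 0" "x = to_fract a / to_fract b" by (rule fract_quotient)
  obtain c d where cd: "d \<noteq> 0" "y = to_fract c / to_fract d" by (rule fract_quotient)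
  have ne: "a \<noteq> 0" "c \<noteq> 0" using xy ab cd by auto
  have vx: "vfract V x = V a - V b" "vfract V y = V c - V d" using ab cd ne by (simp_all add: vfract_quotient)
  have "x * y = to_fract (a * c) / to_fract (b * d)" by (simp add: ab cd)
  moreover have "vfract V (to_fract (a * c) / to_fract (b * d)) = V (a * c) - V (b * d)"
    using ab cd ne by (intro vfract_quotient) simp_all
  ultimately show "vfract V (x * y) = vfract V x + vfract V y"
    using ab cd ne vx by (simp add: V_mult)
  assume s: "x + y \<noteq> 0"
  have sum: "x + y = to_fract (a * d + c * b) / to_fract (b * d)" using ab cd by (simp add: field_simps)
  have nz: "a * d + c * b \<noteq> 0"
  proof
    assume "a * d + c * b = 0"
    hence "x + y = 0" unfolding sum by (simp only: to_fract_0 div_0)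
    thus False using s by simp
  qed
  have "vfract V (x + y) = V (a * d + c * b) - V (b * d)"
    unfolding sum using ab cd nz by (intro vfract_quotient) simp_all
  moreover have "min (V (a * d)) (V (c * b)) \<le> V (a * d + c * b)"
    using V_add[of "a * d" "c * b"] ab(1) cd(1) ne nz by simp
  ultimately show "min (vfract V x) (vfract V y) \<le> vfract V (x + y)"
    using ab cd ne by (simp add: vfract_quotient V_mult)
next
  show "\<exists>t. t \<noteq> 0 \<and> vfract V t = 1" using assms by blast
qed

end

subsection \<open>Weighted Gauss valuations\<close>

definition wpoly :: "('a::field \<Rightarrow> int) \<Rightarrow> int \<Rightarrow> int \<Rightarrow> 'a poly \<Rightarrow> int"
  where "wpoly v p q f = Min ((\<lambda>m. q * v (coeff f m) + p * int m) ` {m. coeff f m \<noteq> 0})"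

context dval
begin

lemma wpoly_ge_iff:
  assumes "f \<noteq> 0"
  shows "n \<le> wpoly v p q f \<longleftrightarrow> (\<forall>m. coeff f m \<noteq> 0 \<longrightarrow> n \<le> q * v (coeff f m) + p * int m)"
proof -
  have "{m. coeff f m \<noteq> 0} \<subseteq> {..degree f}" using le_degree by blast
  hence "finite {m. coeff f m \<noteq> 0}" by (rule finite_subset) simp
  moreover have "coeff f (degree f) \<noteq> 0" using assms by simp
  hence "{m. coeff f m \<noteq> 0} \<noteq> {}" by blast
  ultimately show ?thesis unfolding wpoly_def by (subst Min_ge_iff) auto
qed

lemma wpoly_attained:
  assumes "f \<noteq> 0"
  shows "\<exists>m. coeff f m \<noteq> 0 \<and> wpoly v p q f = q * v (coeff f m) + p * int m \<and>
    (\<forall>j<m. coeff f j \<noteq> 0 \<longrightarrow> wpoly v p q f + 1 \<le> q * v (coeff f j) + p * int j)"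
proof -
  define P where "P = (\<lambda>m. coeff f m \<noteq> 0 \<and> wpoly v p q f = q * v (coeff f m) + p * int m)"
  have ge: "wpoly v p q f \<le> q * v (coeff f m) + p * int m" if "coeff f m \<noteq> 0" for m
    using wpoly_ge_iff[OF assms, of "wpoly v p q f" p q] that by blast
  have ex: "\<exists>m. P m"
  proof (rule ccontr)
    assume "\<not> ?thesis"
    hence "\<forall>m. coeff f m \<noteq> 0 \<longrightarrow> wpoly v p q f + 1 \<le> q * v (coeff f m) + p * int m"
      using ge unfolding P_def by force
    hence "wpoly v p q f + 1 \<le> wpoly v p q f" using wpoly_ge_iff[OF assms] by blast
    thus False by simp
  qed
  define m where "m = (LEAST m. P m)"
  have "P m" unfolding m_def by (rule LeastI_ex[OF ex])
  moreover have "wpoly v p q f + 1 \<le> q * v (coeff f j) + p * int j" if "j < m" "coeff f j \<noteq> 0" for j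
    using not_less_Least[of j P] ge[of j] that unfolding m_def P_def by force
  ultimately show ?thesis unfolding P_def by blast
qed

text \<open>The bound s is compared with q v and not with v, because the weights that occur need not
  be divisible by q.\<close>

lemma scaled_v_sum:
  assumes "q > 0" "\<And>i. i \<in> I \<Longrightarrow> g i = 0 \<or> s \<le> q * v (g i)"
  shows "sum g I = 0 \<or> s \<le> q * v (sum g I)"
  using assms(2)
proof (induction I rule: infinite_finite_induct)
  case (insert i I)
  have 1: "g i = 0 \<or> s \<le> q * v (g i)" "sum g I = 0 \<or> s \<le> q * v (sum g I)" using insert by auto
  show ?case
  proof (cases "g i = 0 \<or> sum g I = 0 \<or> g i + sum g I = 0")
    case True thus ?thesis using 1 insert.hyps by auto
  next
    case False
    hence "min (v (g i)) (v (sum g I)) \<le> v (g i + sum g I)" using add by blast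
    hence "q * min (v (g i)) (v (sum g I)) \<le> q * v (g i + sum g I)" using assms(1) by (intro mult_left_mono) auto
    moreover have "s \<le> q * min (v (g i)) (v (sum g I))" using 1 False by (simp add: min_def)
    ultimately show ?thesis using insert.hyps by simp
  qed
qed auto

text \<open>Gauss's lemma: for the least indices i and j at which the two minima are attained, the
  coefficient of the product at i + j has exactly one term of minimal weight, so this term cannot
  cancel.\<close>

lemma wpoly_mult:
  assumes q: "q > 0" and f: "f \<noteq> 0" and g: "g \<noteq> 0"
  shows "wpoly v p q (f * g) = wpoly v p q f + wpoly v p q g"
proof -
  let ?w = "wpoly v p q"
  define W where "W = (\<lambda>(x::'a) (m::nat). q * v x + p * int m)"
  have ge: "?w h \<le> W (coeff h m) m" if "h \<noteq> 0" "coeff h m \<noteq> 0" for h m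
    using wpoly_ge_iff[OF that(1), of "?w h" p q] that(2) by (simp add: W_def)
  have Wm: "W (x * y) (a + b) = W x a + W y b" if "x \<noteq> 0" "y \<noteq> 0" for x y a b
    using that by (simp add: W_def mult algebra_simps)
  have fg: "f * g \<noteq> 0" using f g by simp
  have "?w f + ?w g \<le> ?w (f * g)" unfolding wpoly_ge_iff[OF fg]
  proof (intro allI impI)
    fix m assume m: "coeff (f * g) m \<noteq> 0"
    have "coeff (f * g) m = 0 \<or> ?w f + ?w g - p * int m \<le> q * v (coeff (f * g) m)"
      unfolding coeff_mult
    proof (rule scaled_v_sum[OF q])
      fix i assume i: "i \<in> {..m}"
      show "coeff f i * coeff g (m - i) = 0 \<or>
        ?w f + ?w g - p * int m \<le> q * v (coeff f i * coeff g (m - i))"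
      proof (cases "coeff f i = 0 \<or> coeff g (m - i) = 0")
        case False
        hence "W (coeff f i * coeff g (m - i)) (i + (m - i)) \<ge> ?w f + ?w g"
          using Wm ge[OF f, of i] ge[OF g, of "m - i"] by simp
        thus ?thesis using i by (simp add: W_def)
      qed auto
    qed
    thus "?w f + ?w g \<le> q * v (coeff (f * g) m) + p * int m" using m by simp
  qed
  moreover have "?w (f * g) \<le> ?w f + ?w g"
  proof -
    obtain i where i: "coeff f i \<noteq> 0" "?w f = W (coeff f i) i"
      "\<forall>k<i. coeff f k \<noteq> 0 \<longrightarrow> ?w f + 1 \<le> W (coeff f k) k"
      using wpoly_attained[OF f, of p q] unfolding W_def by blast
    obtain j where j: "coeff g j \<noteq> 0" "?w g = W (coeff g j) j"
      "\<forall>k<j. coeff g k \<noteq> 0 \<longrightarrow> ?w g + 1 \<le> W (coeff g k) k"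
      using wpoly_attained[OF g, of p q] unfolding W_def by blast
    define x r where "x = coeff f i * coeff g j"
      and "r = (\<Sum>k\<in>{..i+j} - {i}. coeff f k * coeff g (i + j - k))"
    have x0: "x \<noteq> 0" using i j by (simp add: x_def)
    have Wx: "W x (i + j) = ?w f + ?w g" using Wm i j by (simp add: x_def)
    have "r = 0 \<or> ?w f + ?w g + 1 - p * int (i + j) \<le> q * v r" unfolding r_def
    proof (rule scaled_v_sum[OF q])
      fix k assume k: "k \<in> {..i+j} - {i}"
      show "coeff f k * coeff g (i + j - k) = 0 \<or>
        ?w f + ?w g + 1 - p * int (i + j) \<le> q * v (coeff f k * coeff g (i + j - k))"
      proof (cases "coeff f k = 0 \<or> coeff g (i + j - k) = 0")
        case False
        have "k < i \<or> i + j - k < j" using k by auto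
        hence "?w f + ?w g + 1 \<le> W (coeff f k) k + W (coeff g (i + j - k)) (i + j - k)"
        proof
          assume "k < i"
          hence "?w f + 1 \<le> W (coeff f k) k" using i(3) False by blast
          thus ?thesis using ge[OF g, of "i + j - k"] False by simp
        next
          assume "i + j - k < j"
          hence "?w g + 1 \<le> W (coeff g (i + j - k)) (i + j - k)" using j(3) False by blast
          thus ?thesis using ge[OF f, of k] False by simp
        qed
        also have "\<dots> = W (coeff f k * coeff g (i + j - k)) (k + (i + j - k))" using Wm False by simp
        also have "k + (i + j - k) = i + j" using k by simp
        finally show ?thesis by (simp add: W_def)
      qed auto
    qed
    hence "r \<in> vge v (v x + 1)"
    proof
      assume "?w f + ?w g + 1 - p * int (i + j) \<le> q * v r"
      hence "q * v x < q * v r" using Wx by (simp add: W_def)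
      hence "v x < v r" using q by simp
      thus ?thesis by (simp add: vge_def)
    qed simp
    from v_add_eq[OF x0 this] have xr: "x + r \<noteq> 0" "v (x + r) = v x" by auto
    have "coeff (f * g) (i + j) = x + r"
      unfolding coeff_mult x_def r_def by (subst sum.remove[of "{..i+j}" i]) auto
    hence "coeff (f * g) (i + j) \<noteq> 0" "W (coeff (f * g) (i + j)) (i + j) = ?w f + ?w g"
      using xr Wx by (simp_all add: W_def)
    thus ?thesis using ge[OF fg] by metis
  qed
  ultimately show ?thesis by simp
qed

lemma prevaluation_wpoly:
  assumes q: "q > 0"
  shows "prevaluation (wpoly v p q)"
proof
  fix f g :: "'a poly" assume fg: "f \<noteq> 0" "g \<noteq> 0"
  show "wpoly v p q (f * g) = wpoly v p q f + wpoly v p q g" by (rule wpoly_mult[OF q fg])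
  assume s: "f + g \<noteq> 0"
  let ?w = "wpoly v p q"
  show "min (?w f) (?w g) \<le> ?w (f + g)" unfolding wpoly_ge_iff[OF s]
  proof (intro allI impI)
    fix m assume m: "coeff (f + g) m \<noteq> 0"
    have "(\<Sum>i\<in>{0::nat,1}. if i = 0 then coeff f m else coeff g m) = 0 \<or>
       min (?w f) (?w g) - p * int m \<le> q * v (\<Sum>i\<in>{0::nat,1}. if i = 0 then coeff f m else coeff g m)"
    proof (rule scaled_v_sum[OF q])
      fix i :: nat assume "i \<in> {0, 1}"
      have "coeff f m = 0 \<or> ?w f \<le> q * v (coeff f m) + p * int m"
        using wpoly_ge_iff[OF fg(1), of "?w f" p q] by blast
      moreover have "coeff g m = 0 \<or> ?w g \<le> q * v (coeff g m) + p * int m"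
        using wpoly_ge_iff[OF fg(2), of "?w g" p q] by blast
      ultimately show "(if i = 0 then coeff f m else coeff g m) = 0 \<or>
        min (?w f) (?w g) - p * int m \<le> q * v (if i = 0 then coeff f m else coeff g m)"
        by (cases "i = 0") (auto simp: min_def)
    qed
    thus "min (?w f) (?w g) \<le> q * v (coeff (f + g) m) + p * int m" using m by simp
  qed
qed

end

subsection \<open>Valuations at primes of the polynomial ring\<close>

definition vprime :: "'a::field poly \<Rightarrow> 'a poly \<Rightarrow> int"
  where "vprime \<pi> f = (THE n. \<exists>m g. n = int m \<and> f = \<pi> ^ m * g \<and> \<not> \<pi> dvd g)"

lemma prime_elem_degree_pos:
  fixes \<pi> :: "'a::field poly"
  assumes "prime_elem \<pi>"
  shows "degree \<pi> > 0"
proof (rule ccontr)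
  assume "\<not> ?thesis"
  then obtain c where c: "\<pi> = [:c:]" using degree_eq_zeroE[of \<pi>] by auto
  have "c \<noteq> 0" using assms c by (auto simp: prime_elem_def)
  hence "\<pi> * [:inverse c:] = 1" by (simp add: c one_pCons)
  hence "\<pi> dvd 1" by (metis dvd_triv_left)
  thus False using assms by (simp add: prime_elem_def)
qed

lemma prime_elem_power_decomp:
  fixes \<pi> f :: "'a::field poly"
  assumes \<pi>: "prime_elem \<pi>" and "f \<noteq> 0"
  shows "\<exists>m g. f = \<pi> ^ m * g \<and> \<not> \<pi> dvd g"
  using assms(2)
proof (induction "degree f" arbitrary: f rule: less_induct)
  case less
  show ?case
  proof (cases "\<pi> dvd f")
    case True
    then obtain g where g: "f = \<pi> * g" by (elim dvdE)
    have "g \<noteq> 0" "\<pi> \<noteq> 0" using less.prems g by auto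
    hence "degree f = degree \<pi> + degree g" unfolding g by (rule degree_mult_eq[rotated])
    then obtain m h where h: "g = \<pi> ^ m * h" "\<not> \<pi> dvd h" using less.hyps[of g] prime_elem_degree_pos[OF \<pi>] \<open>g \<noteq> 0\<close> by auto
    have "f = \<pi> ^ Suc m * h" using g h by simp
    thus ?thesis using h(2) by blast
  next
    case False
    have "f = \<pi> ^ 0 * f" by simp
    thus ?thesis using False by blast
  qed
qed

lemma vprime_eq:
  fixes \<pi> g :: "'a::field poly"
  assumes \<pi>: "prime_elem \<pi>" and g: "\<not> \<pi> dvd g"
  shows "vprime \<pi> (\<pi> ^ m * g) = int m"
  unfolding vprime_def
proof (rule the_equality)
  show "\<exists>ma ga. int m = int ma \<and> \<pi> ^ m * g = \<pi> ^ ma * ga \<and> \<not> \<pi> dvd ga" using g by blast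
  fix n assume "\<exists>ma ga. n = int ma \<and> \<pi> ^ m * g = \<pi> ^ ma * ga \<and> \<not> \<pi> dvd ga"
  then obtain l h where l: "n = int l" "\<pi> ^ m * g = \<pi> ^ l * h" "\<not> \<pi> dvd h" by blast
  have \<pi>0: "\<pi> \<noteq> 0" using \<pi> by auto
  have *: "a = b" if "\<pi> ^ a * x = \<pi> ^ b * y" "\<not> \<pi> dvd x" "\<not> \<pi> dvd y" "a \<le> b" for a b and x y :: "'a poly"
  proof (rule ccontr)
    assume "a \<noteq> b"
    hence "\<pi> ^ b = \<pi> ^ a * (\<pi> * \<pi> ^ (b - a - 1))" using that(4) by (simp add: power_add[symmetric] flip: power_Suc)
    hence "x = \<pi> * (\<pi> ^ (b - a - 1) * y)" using that(1) \<pi>0 by (simp add: mult.assoc)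
    thus False using that(2) by simp
  qed
  have "m = l" using *[OF l(2) g l(3)] *[OF l(2)[symmetric] l(3) g] by (cases "m \<le> l") auto
  thus "n = int m" using l(1) by simp
qed

lemma prevaluation_vprime:
  fixes \<pi> :: "'a::field poly"
  assumes \<pi>: "prime_elem \<pi>"
  shows "prevaluation (vprime \<pi>)"
proof
  fix f g :: "'a poly" assume fg: "f \<noteq> 0" "g \<noteq> 0"
  obtain a f' where f: "f = \<pi> ^ a * f'" "\<not> \<pi> dvd f'" using prime_elem_power_decomp[OF \<pi> fg(1)] by blast
  obtain b g' where g: "g = \<pi> ^ b * g'" "\<not> \<pi> dvd g'" using prime_elem_power_decomp[OF \<pi> fg(2)] by blast
  have "f * g = \<pi> ^ (a + b) * (f' * g')" by (simp add: f g power_add mult_ac)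
  moreover have "\<not> \<pi> dvd f' * g'" using f(2) g(2) prime_elem_dvd_mult_iff[OF \<pi>] by blast
  ultimately have "vprime \<pi> (f * g) = int (a + b)" using vprime_eq[OF \<pi>, of "f' * g'" "a + b"] by simp
  thus "vprime \<pi> (f * g) = vprime \<pi> f + vprime \<pi> g"
    using vprime_eq[OF \<pi> f(2), of a] vprime_eq[OF \<pi> g(2), of b] f(1) g(1) by simp
  assume s: "f + g \<noteq> 0"
  define n where "n = min a b"
  have "f + g = \<pi> ^ n * (\<pi> ^ (a - n) * f' + \<pi> ^ (b - n) * g')"
    by (simp add: f g n_def distrib_left mult.assoc[symmetric] power_add[symmetric])
  moreover define r where "r = \<pi> ^ (a - n) * f' + \<pi> ^ (b - n) * g'"
  ultimately have r: "f + g = \<pi> ^ n * r" "r \<noteq> 0" using s by auto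
  obtain c r' where c: "r = \<pi> ^ c * r'" "\<not> \<pi> dvd r'" using prime_elem_power_decomp[OF \<pi> r(2)] by blast
  have "f + g = \<pi> ^ (n + c) * r'" by (simp add: r(1) c(1) power_add mult_ac)
  hence "vprime \<pi> (f + g) = int (n + c)" using vprime_eq[OF \<pi> c(2)] by simp
  thus "min (vprime \<pi> f) (vprime \<pi> g) \<le> vprime \<pi> (f + g)"
    using vprime_eq[OF \<pi> f(2), of a] vprime_eq[OF \<pi> g(2), of b] f(1) g(1) by (simp add: n_def)
qed

lemma vprime_pos_iff:
  fixes \<pi> f :: "'a::field poly"
  assumes \<pi>: "prime_elem \<pi>" and f: "f \<noteq> 0"
  shows "vprime \<pi> f \<ge> 0" "vprime \<pi> f > 0 \<longleftrightarrow> \<pi> dvd f"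
proof -
  obtain a g where f': "f = \<pi> ^ a * g" "\<not> \<pi> dvd g" using prime_elem_power_decomp[OF \<pi> f] by blast
  have v: "vprime \<pi> f = int a" using vprime_eq[OF \<pi> f'(2)] f'(1) by simp
  show "vprime \<pi> f \<ge> 0" using v by simp
  show "vprime \<pi> f > 0 \<longleftrightarrow> \<pi> dvd f"
  proof (cases a)
    case 0 thus ?thesis using v f' by simp
  next
    case (Suc b)
    have "\<pi> dvd f" unfolding f'(1) Suc by simp
    thus ?thesis using v Suc by simp
  qed
qed

lemma dval_vprime:
  fixes \<pi> :: "'a::field poly"
  assumes \<pi>: "prime_elem \<pi>"
  shows "dval (vfract (vprime \<pi>))"
proof -
  interpret prevaluation "vprime \<pi>" by (rule prevaluation_vprime[OF \<pi>])
  have \<pi>0: "\<pi> \<noteq> 0" and "\<not> \<pi> dvd 1" using \<pi> by (auto simp: prime_elem_def)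
  hence "vprime \<pi> (\<pi> ^ 1 * 1) = 1" using vprime_eq[OF \<pi>, of 1 1] by simp
  hence "vfract (vprime \<pi>) (to_fract \<pi>) = 1" using vfract_to_fract[OF \<pi>0] by simp
  thus ?thesis using \<pi>0 by (intro dval_vfract[of "to_fract \<pi>"]) simp_all
qed

lemma vfract_vprime_unit:
  fixes \<pi> f :: "'a::field poly"
  assumes "prime_elem \<pi>" "\<not> \<pi> dvd f"
  shows "vfract (vprime \<pi>) (to_fract f) = 0"
proof -
  have "f \<noteq> 0" using assms(2) by (intro notI) simp
  thus ?thesis using prevaluation.vfract_to_fract[OF prevaluation_vprime[OF assms(1)]] vprime_eq[OF assms, of 0] by simp
qed

lemma to_fract_in_vring_vprime:
  fixes \<pi> f :: "'a::field poly"
  assumes "prime_elem \<pi>"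
  shows "to_fract f \<in> vring (vfract (vprime \<pi>))"
  using prevaluation.vfract_to_fract[OF prevaluation_vprime[OF assms], of f] vprime_pos_iff(1)[OF assms, of f]
  by (cases "f = 0") (simp_all add: vge_def)


section \<open>The graded ring of a divisor with rational coefficients\<close>

definition \<chi> :: "'a::field poly fract" where "\<chi> = to_fract [:0, 1:]"

definition hmon :: "'a::field \<Rightarrow> int \<Rightarrow> 'a poly fract" where "hmon x n = to_fract [:x:] * \<chi> powi n"

lemma \<chi>_nonzero [simp]: "\<chi> \<noteq> 0" by (simp add: \<chi>_def)

lemma hmon_eq_0_iff [simp]: "hmon x n = 0 \<longleftrightarrow> x = 0" by (simp add: hmon_def)

lemma hmon_zero [simp]: "hmon 0 n = 0" by simp

lemma hmon_mult: "hmon x m * hmon y n = hmon (x * y) (m + n)"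
proof -
  have "to_fract [:x:] * to_fract [:y:] = to_fract [:x * y:]" by (simp flip: to_fract_mult)
  thus ?thesis by (simp add: hmon_def power_int_add mult_ac)
qed

lemma hmon_add: "hmon x n + hmon y n = hmon (x + y) n"
proof -
  have "to_fract [:x:] + to_fract [:y:] = to_fract [:x + y:]" by (simp flip: to_fract_add)
  thus ?thesis by (simp add: hmon_def distrib_right[symmetric])
qed

lemma hmon_one [simp]: "hmon 1 0 = 1" by (simp add: hmon_def flip: one_pCons)

lemma hmon_diff: "hmon x n - hmon y n = hmon (x - y) n"
  using hmon_add[of "x - y" n y] by (simp add: algebra_simps)

lemma hmon_inverse: "inverse (hmon x n) = hmon (inverse x) (- n)"
proof (cases "x = 0")
  case False
  hence "hmon x n * hmon (inverse x) (- n) = 1" by (simp add: hmon_mult)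
  thus ?thesis by (rule inverse_unique)
qed simp

lemma hmon_power: "hmon x n ^ i = hmon (x ^ i) (int i * n)"
  by (induction i) (auto simp: hmon_mult algebra_simps)

lemma hmon_powi: "x \<noteq> 0 \<Longrightarrow> hmon x n powi i = hmon (x powi i) (i * n)"
  by (cases i rule: int_cases4) (auto simp: power_int_minus hmon_inverse hmon_power)

lemma hmon_prod: "(\<Prod>i\<in>I. hmon (x i) (n i)) = hmon (\<Prod>i\<in>I. x i) (\<Sum>i\<in>I. n i)"
  by (induction I rule: infinite_finite_induct) (auto simp: hmon_mult)

lemma hmon_of_nat:
  fixes x :: "'a::field"
  shows "hmon x (int n) = to_fract (monom x n)"
proof -
  have "(\<chi> :: 'a poly fract) ^ n = to_fract (monom 1 n)" by (induction n) (auto simp: \<chi>_def monom_Suc simp flip: to_fract_mult)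
  hence "hmon x (int n) = to_fract ([:x:] * monom 1 n)" by (simp only: hmon_def power_int_of_nat to_fract_mult)
  thus ?thesis by (simp add: smult_monom)
qed

lemma to_fract_eq_sum_hmon: "to_fract f = (\<Sum>m\<le>degree f. hmon (coeff f m) (int m))"
  unfolding hmon_of_nat to_fract_sum[symmetric] poly_as_sum_of_monoms ..

text \<open>Numerators and denominators are functions on all points. Coprimality forces q = 1
  wherever p = 0, so q exceeds 1 at finitely many points only.\<close>

locale dpd = smooth_projective_curve \<iota> Y
  for \<iota> :: "'k::{alg_closed_field, field_char_0} \<Rightarrow> 'a::field" and Y :: "'a set set" +
  fixes p q :: "'a set \<Rightarrow> int"
  assumes q_pos: "y \<in> Y \<Longrightarrow> q y > 0" and pq_coprime: "y \<in> Y \<Longrightarrow> coprime (p y) (q y)"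
    and p_finite: "finite {y\<in>Y. p y \<noteq> 0}"
    and deg_pos: "(\<Sum>y\<in>{y\<in>Y. p y \<noteq> 0}. rat_of_int (p y) / rat_of_int (q y)) > 0"
begin

text \<open>\<open>w y\<close> is the valuation of the orbit closure over \<open>y\<close>, with value group \<open>\<int>\<close>.\<close>

definition w :: "'a set \<Rightarrow> 'a poly fract \<Rightarrow> int" where "w y = vfract (wpoly (ord_at y) (p y) (q y))"

definition \<delta> :: rat where "\<delta> = (\<Sum>y\<in>{y\<in>Y. p y \<noteq> 0}. rat_of_int (p y) / rat_of_int (q y))"

definition A :: "'a poly fract set" where "A = {to_fract f | f. \<forall>y\<in>Y. to_fract f \<in> vring (w y)}"

lemma pre_w: "y \<in> Y \<Longrightarrow> prevaluation (wpoly (ord_at y) (p y) (q y))"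
  by (rule dval.prevaluation_wpoly[OF dval_point q_pos])

lemma w_to_fract: "y \<in> Y \<Longrightarrow> f \<noteq> 0 \<Longrightarrow> w y (to_fract f) = wpoly (ord_at y) (p y) (q y) f"
  unfolding w_def by (rule prevaluation.vfract_to_fract[OF pre_w])

lemma wpoly_monom: "x \<noteq> 0 \<Longrightarrow> wpoly v a b (monom x n) = b * v x + a * int n"
proof -
  assume "x \<noteq> 0"
  hence "{m. coeff (monom x n) m \<noteq> 0} = {n}" by auto
  thus ?thesis by (simp add: wpoly_def)
qed

lemma w_hmon:
  assumes y: "y \<in> Y" and x: "x \<noteq> 0"
  shows "w y (hmon x n) = q y * ord_at y x + p y * n"
proof -
  interpret prevaluation "wpoly (ord_at y) (p y) (q y)" by (rule pre_w[OF y])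
  have one: "ord_at y 1 = 0" using ord_\<iota>[OF y, of 1] by (simp add: \<iota>_one)
  show ?thesis
  proof (cases n rule: int_cases4)
    case (nonneg m)
    thus ?thesis using x y by (simp add: hmon_of_nat w_to_fract wpoly_monom)
  next
    case (neg m)
    have "hmon x n * hmon 1 (int m) = hmon x (int 0)" by (simp add: hmon_mult neg)
    hence "hmon x n = to_fract (monom x 0) / to_fract (monom 1 m)"
      unfolding hmon_of_nat by (simp add: field_simps)
    hence "w y (hmon x n) = wpoly (ord_at y) (p y) (q y) (monom x 0) - wpoly (ord_at y) (p y) (q y) (monom 1 m)"
      unfolding w_def using x by (simp only:) (rule vfract_quotient; simp)
    thus ?thesis using x by (simp add: wpoly_monom one neg)
  qed
qed

lemma bezout_pq: "y \<in> Y \<Longrightarrow> \<exists>\<alpha> \<beta>. q y * \<alpha> + p y * \<beta> = 1"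
  using bezout_int[of "q y" "p y"] pq_coprime[of y] by (simp add: gcd.commute coprime_iff_gcd_eq_1 mult.commute)

lemma dval_w:
  assumes y: "y \<in> Y"
  shows "dval (w y)"
proof -
  \<comment> \<open>Coprimality provides an element of value 1, namely t^\<alpha> \<chi>^\<beta>;
    without it the value group could be smaller than \<int>.\<close>
  obtain \<alpha> \<beta> where ab: "q y * \<alpha> + p y * \<beta> = 1" using bezout_pq[OF y] by blast
  obtain t where t: "t \<noteq> 0" "ord_at y t = 1" using dval.uniformizer[OF dval_point[OF y]] by blast
  have "ord_at y (t powi \<alpha>) = \<alpha>" using dval.v_powi[OF dval_point[OF y] t(1)] t(2) by simp
  hence "w y (hmon (t powi \<alpha>) \<beta>) = 1" using w_hmon[OF y, of "t powi \<alpha>" \<beta>] t(1) ab by simp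
  moreover have "hmon (t powi \<alpha>) \<beta> \<noteq> 0" using t(1) by simp
  ultimately show ?thesis unfolding w_def by (intro prevaluation.dval_vfract[OF pre_w[OF y]])
qed

text \<open>The valuations are compatible with the grading by powers of \<chi>, so questions about
  the ring and its ideals can be settled on monomials.\<close>

lemma vge_w_to_fract_iff:
  assumes y: "y \<in> Y"
  shows "to_fract f \<in> vge (w y) n \<longleftrightarrow> (\<forall>m. hmon (coeff f m) (int m) \<in> vge (w y) n)"
proof (cases "f = 0")
  case False
  have "hmon (coeff f m) (int m) \<in> vge (w y) n \<longleftrightarrow>
    (coeff f m \<noteq> 0 \<longrightarrow> n \<le> q y * ord_at y (coeff f m) + p y * int m)" for m
    by (cases "coeff f m = 0") (auto simp: vge_def w_hmon[OF y])
  thus ?thesis using False dval.wpoly_ge_iff[OF dval_point[OF y] False, of n "p y" "q y"]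
    by (simp add: vge_def w_to_fract[OF y False])
qed (simp add: vge_def)

lemma fsupp_w:
  assumes "g \<noteq> 0"
  shows "fsupp (\<lambda>y. w y g)"
proof -
  have poly: "fsupp (\<lambda>y. w y (to_fract f))" if f: "f \<noteq> 0" for f
  proof -
    have "{y\<in>Y. w y (to_fract f) \<noteq> 0} \<subseteq>
      {y\<in>Y. p y \<noteq> 0} \<union> (\<Union>m\<in>{m\<in>{..degree f}. coeff f m \<noteq> 0}. {y\<in>Y. ord_at y (coeff f m) \<noteq> 0})"
    proof
      fix y assume y: "y \<in> {y\<in>Y. w y (to_fract f) \<noteq> 0}"
      obtain m where m: "coeff f m \<noteq> 0"
        "wpoly (ord_at y) (p y) (q y) f = q y * ord_at y (coeff f m) + p y * int m"
        using dval.wpoly_attained[OF dval_point f, of y "p y" "q y"] y by blast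
      have "m \<le> degree f" using m(1) by (rule le_degree)
      moreover have "p y \<noteq> 0 \<or> ord_at y (coeff f m) \<noteq> 0"
      proof (rule ccontr)
        assume "\<not> ?thesis"
        hence "w y (to_fract f) = 0" using m(2) w_to_fract[of y f] y f by simp
        thus False using y by simp
      qed
      ultimately show "y \<in> {y\<in>Y. p y \<noteq> 0} \<union> (\<Union>m\<in>{m\<in>{..degree f}. coeff f m \<noteq> 0}. {y\<in>Y. ord_at y (coeff f m) \<noteq> 0})"
        using y m(1) by blast
    qed
    thus ?thesis unfolding fsupp_def by (rule finite_subset) (auto simp: p_finite intro!: finite_ord_nonzero)
  qed
  obtain a b where ab: "b \<noteq> 0" "g = to_fract a / to_fract b" by (rule fract_quotient)
  have a0: "a \<noteq> 0" using assms ab by auto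
  have "w y g = w y (to_fract a) - w y (to_fract b)" if "y \<in> Y" for y
    unfolding ab(2) using dval.v_divide[OF dval_w[OF that]] a0 ab(1) by simp
  thus ?thesis using fsupp_combine[OF poly[OF a0] poly[OF ab(1)], of "\<lambda>y. w y g"] by simp
qed

lemma delta_eq:
  assumes "finite S" "S \<subseteq> Y" "{y\<in>Y. p y \<noteq> 0} \<subseteq> S"
  shows "\<delta> = (\<Sum>y\<in>S. rat_of_int (p y) / rat_of_int (q y))"
  unfolding \<delta>_def
proof (rule sum.mono_neutral_left[OF assms(1,3)], rule ballI)
  fix i assume "i \<in> S - {y\<in>Y. p y \<noteq> 0}"
  hence "p i = 0" using assms(2) by blast
  thus "rat_of_int (p i) / rat_of_int (q i) = 0" by simp
qed

text \<open>The divisor div x + n D_1 is effective, and its degree is n \<delta> because principal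
  divisors have degree 0. For n = 0 the function x is regular everywhere and hence constant.\<close>

lemma homogeneous_regular:
  assumes x: "x \<noteq> 0" and n: "\<And>y. y \<in> Y \<Longrightarrow> 0 \<le> w y (hmon x n)"
  shows "n \<ge> 0" "n = 0 \<Longrightarrow> x \<in> k"
proof -
  define S where "S = {y\<in>Y. p y \<noteq> 0} \<union> {y\<in>Y. ord_at y x \<noteq> 0}"
  have S: "finite S" "S \<subseteq> Y" unfolding S_def by (intro finite_UnI p_finite finite_ord_nonzero[OF x]) blast
  have nn: "rat_of_int (ord_at y x) + of_int n * (of_int (p y) / of_int (q y)) \<ge> 0" if y: "y \<in> Y" for y
  proof -
    have "q y * ord_at y x + p y * n \<ge> 0" using n[OF y] w_hmon[OF y x] by simp
    hence "rat_of_int (q y * ord_at y x + p y * n) \<ge> 0" by (simp only: of_int_0_le_iff)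
    hence "rat_of_int (q y * ord_at y x + p y * n) / of_int (q y) \<ge> 0" using q_pos[OF y] by (intro divide_nonneg_pos) auto
    moreover have "rat_of_int (q y * ord_at y x + p y * n) / of_int (q y) = of_int (ord_at y x) + of_int n * (of_int (p y) / of_int (q y))"
      using q_pos[OF y] by (simp add: add_divide_distrib mult.commute)
    ultimately show ?thesis by simp
  qed
  have "(\<Sum>y\<in>S. rat_of_int (ord_at y x) + of_int n * (of_int (p y) / of_int (q y))) \<ge> 0"
    using nn S(2) by (intro sum_nonneg) auto
  also have "(\<Sum>y\<in>S. rat_of_int (ord_at y x) + of_int n * (of_int (p y) / of_int (q y)))
     = of_int (\<Sum>y\<in>S. ord_at y x) + of_int n * (\<Sum>y\<in>S. of_int (p y) / of_int (q y))"
    by (simp add: sum.distrib sum_distrib_left)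
  also have "(\<Sum>y\<in>S. ord_at y x) = deg (\<lambda>y. ord_at y x)"
    by (rule deg_eq_sum[OF S, symmetric]) (simp add: S_def)
  also have "\<dots> = 0" by (rule deg_principal[OF x])
  also have "(\<Sum>y\<in>S. rat_of_int (p y) / of_int (q y)) = \<delta>"
    by (rule delta_eq[OF S, symmetric]) (simp add: S_def)
  finally have "of_int n * \<delta> \<ge> 0" by simp
  thus "n \<ge> 0" using deg_pos by (simp add: \<delta>_def zero_le_mult_iff)
  assume n0: "n = 0"
  have "x \<in> y" if y: "y \<in> Y" for y
  proof -
    have "q y * ord_at y x \<ge> 0" using n[OF y] w_hmon[OF y x, of n] n0 by simp
    hence "ord_at y x \<ge> 0" using q_pos[OF y] by (simp add: zero_le_mult_iff)
    hence "x \<in> vring (ord_at y)" by (simp add: vge_def)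
    thus ?thesis using vring_point[OF y] by simp
  qed
  thus "x \<in> k" by (rule in_k_of_regular)
qed

text \<open>Sections of the round-downs \<open>\<lfloor>(n p - B) / q\<rfloor>\<close> for \<open>n\<close> in the residue class modulo \<open>q\<close>
  which makes the coefficient at \<open>y\<close> integral.\<close>

lemma ex_homogeneous:
  assumes y: "y \<in> Y" and B: "fsupp B"
  shows "\<exists>(n::nat) x. n > (N::nat) \<and> x \<noteq> 0 \<and> w y (hmon x n) = e \<and> (\<forall>z\<in>Y - {y}. w z (hmon x n) \<ge> B z)"
proof -
  obtain \<alpha> \<beta> where ab: "q y * \<alpha> + p y * \<beta> = 1" using bezout_pq[OF y] by blast
  obtain c where c: "\<forall>E z. fsupp E \<longrightarrow> deg E \<ge> c \<longrightarrow> z \<in> Y \<longrightarrow> (\<exists>f. f \<noteq> 0 \<and> f \<in> L E \<and> ord_at z f = - E z)"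
    using ex_section_exact by (elim exE)
  define B' where "B' = B(y := e)"
  define S where "S = {y\<in>Y. p y \<noteq> 0} \<union> {y\<in>Y. B' y \<noteq> 0}"
  have fB: "fsupp B'" unfolding B'_def by (rule fsupp_upd[OF B])
  have S: "finite S" "S \<subseteq> Y" using p_finite fB by (auto simp: S_def fsupp_def)
  \<comment> \<open>The loss against n \<delta>: at each point of S, the prescribed value divided by
    q, and at most 1 from rounding down.\<close>
  define \<kappa> where "\<kappa> = (\<Sum>z\<in>S. rat_of_int (B' z) / of_int (q z) + 1)"
  define E where "E = (\<lambda>n z. (p z * n - B' z) div q z)"
  have E0: "E n z = 0" if "z \<in> Y" "z \<notin> S" for n z using that by (auto simp: E_def S_def)
  have fE: "fsupp (E n)" for n unfolding fsupp_def by (rule finite_subset[OF _ S(1)]) (use E0 in blast)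
  have degE: "rat_of_int (deg (E n)) \<ge> of_int n * \<delta> - \<kappa>" for n
  proof -
    have "of_int n * \<delta> = of_int n * (\<Sum>z\<in>S. rat_of_int (p z) / of_int (q z))"
      using delta_eq[OF S] by (simp add: S_def)
    hence "of_int n * \<delta> - \<kappa> = (\<Sum>z\<in>S. of_int n * (rat_of_int (p z) / of_int (q z)) - (rat_of_int (B' z) / of_int (q z) + 1))"
      unfolding \<kappa>_def sum_distrib_left sum_subtractf by simp
    also have "\<dots> = (\<Sum>z\<in>S. rat_of_int (p z * n - B' z) / of_int (q z) - 1)"
      by (intro sum.cong) (simp_all add: diff_divide_distrib algebra_simps)
    also have "\<dots> \<le> (\<Sum>z\<in>S. rat_of_int (E n z))"
    proof (rule sum_mono)
      fix z assume "z \<in> S"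
      have "E n z = \<lfloor>rat_of_int (p z * n - B' z) / of_int (q z)\<rfloor>" unfolding E_def by (rule floor_divide_of_int_eq[symmetric])
      thus "rat_of_int (p z * n - B' z) / of_int (q z) - 1 \<le> of_int (E n z)" by linarith
    qed
    also have "\<dots> = of_int (\<Sum>z\<in>S. E n z)" by simp
    also have "(\<Sum>z\<in>S. E n z) = deg (E n)" by (rule deg_eq_sum[OF S, symmetric]) (use E0 in blast)
    finally show ?thesis .
  qed
  define M where "M = \<bar>\<beta> * e\<bar> + int N + 1 + \<bar>\<lceil>(of_int c + \<kappa>) / \<delta>\<rceil>\<bar>"
  \<comment> \<open>As p \<beta> is 1 modulo q, the choice of n congruent to \<beta> e modulo q
    makes p n - e divisible by q. The added multiple of q pushes n above M.\<close>
  define n where "n = \<beta> * e + q y * (M + \<bar>\<beta> * e\<bar>)"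
  have "1 * (M + \<bar>\<beta> * e\<bar>) \<le> q y * (M + \<bar>\<beta> * e\<bar>)" using q_pos[OF y] by (intro mult_right_mono) (auto simp: M_def)
  moreover have "M \<le> b + r" if a: "1 * (M + \<bar>b\<bar>) \<le> r" for b r
    using a abs_ge_minus_self[of b] by simp
  ultimately have nM: "n \<ge> M" unfolding n_def by blast
  hence nN: "n > int N" unfolding M_def by linarith
  have "of_int n \<ge> (of_int c + \<kappa>) / \<delta>" using nM unfolding M_def by linarith
  hence "of_int n * \<delta> \<ge> of_int c + \<kappa>" using deg_pos by (simp add: \<delta>_def[symmetric] pos_divide_le_eq)
  hence "rat_of_int (deg (E n)) \<ge> of_int c" using degE[of n] by linarith
  hence "deg (E n) \<ge> c" by simp
  then obtain f where f: "f \<noteq> 0" "f \<in> L (E n)" "ord_at y f = - E n y" using c fE y by blast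
  have "p y * n - e = (p y * \<beta> - 1) * e + p y * q y * (M + \<bar>\<beta> * e\<bar>)" by (simp add: n_def algebra_simps)
  also have "p y * \<beta> - 1 = - (q y * \<alpha>)" using ab by simp
  finally have "p y * n - e = q y * (- \<alpha> * e + p y * (M + \<bar>\<beta> * e\<bar>))" by (simp add: algebra_simps)
  hence "q y * E n y = p y * n - e" using q_pos[OF y] by (simp add: E_def B'_def)
  hence "w y (hmon f n) = e" using w_hmon[OF y f(1)] f(3) by simp
  moreover have "w z (hmon f n) \<ge> B z" if z: "z \<in> Y - {y}" for z
  proof -
    have "z \<in> Y" using z by simp
    have "ord_at z f \<ge> - E n z" using LD[OF f(2,1)] z by simp
    hence "q z * ord_at z f \<ge> q z * (- E n z)" using q_pos[OF \<open>z \<in> Y\<close>] by (intro mult_left_mono) auto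
    moreover have "q z * E n z \<le> p z * n - B' z" unfolding E_def
      using q_pos[OF \<open>z \<in> Y\<close>] pos_mod_sign[of "q z" "p z * n - B' z"] mult_div_mod_eq[of "q z" "p z * n - B' z"] by linarith
    ultimately show ?thesis using w_hmon[OF \<open>z \<in> Y\<close> f(1)] z by (simp add: B'_def)
  qed
  ultimately show ?thesis using f(1) nN by (intro exI[of _ "nat n"] exI[of _ f]) auto
qed

subsection \<open>Primes of the graded ring\<close>

lemma subdom_A: "subdom A"
proof (rule subdomI)
  show "1 \<in> A" unfolding A_def using subdom_one[OF dval.subdom_vring[OF dval_w]]
    by (intro CollectI exI[of _ 1]) simp
  fix a b assume "a \<in> A" "b \<in> A"
  then obtain f g where fg: "a = to_fract f" "b = to_fract g"
    "\<And>y. y \<in> Y \<Longrightarrow> to_fract f \<in> vring (w y)" "\<And>y. y \<in> Y \<Longrightarrow> to_fract g \<in> vring (w y)" unfolding A_def by blast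
  have "\<forall>y\<in>Y. to_fract (f - g) \<in> vring (w y)" "\<forall>y\<in>Y. to_fract (f * g) \<in> vring (w y)"
    using fg(3,4) subdom_diff[OF dval.subdom_vring[OF dval_w]] subdom_mult[OF dval.subdom_vring[OF dval_w]] by simp_all
  moreover have "a - b = to_fract (f - g)" "a * b = to_fract (f * g)" by (simp_all add: fg)
  ultimately show "a - b \<in> A" "a * b \<in> A" unfolding A_def by blast+
qed

lemma A_subset_vring: "y \<in> Y \<Longrightarrow> A \<subseteq> vring (w y)" unfolding A_def by blast

lemma hmon_in_A:
  assumes "n \<ge> 0" "\<And>y. y \<in> Y \<Longrightarrow> hmon x n \<in> vring (w y)"
  shows "hmon x n \<in> A"
proof -
  have "hmon x n = to_fract (monom x (nat n))" using assms(1) by (simp flip: hmon_of_nat)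
  thus ?thesis unfolding A_def using assms(2) by auto
qed

lemma A_components:
  assumes "to_fract f \<in> A"
  shows "hmon (coeff f m) (int m) \<in> A"
proof (rule hmon_in_A)
  fix y assume y: "y \<in> Y"
  have "to_fract f \<in> vring (w y)" using assms A_subset_vring[OF y] by blast
  thus "hmon (coeff f m) (int m) \<in> vring (w y)" using vge_w_to_fract_iff[OF y] by blast
qed simp

lemma in_AE: assumes "a \<in> A" obtains f where "a = to_fract f" "to_fract f \<in> A"
  using assms unfolding A_def by blast

lemma const_in_A: "hmon (\<iota> c) 0 \<in> A"
proof (rule hmon_in_A)
  fix y assume y: "y \<in> Y"
  show "hmon (\<iota> c) 0 \<in> vring (w y)" using w_hmon[OF y, of "\<iota> c" 0] ord_\<iota>[OF y, of c] by (cases "c = 0") (auto simp: vge_def)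
qed simp

lemma coeff_0_in_k:
  assumes "to_fract f \<in> A"
  shows "coeff f 0 \<in> k"
proof (cases "coeff f 0 = 0")
  case False
  have "0 \<le> w y (hmon (coeff f 0) 0)" if "y \<in> Y" for y
    using A_components[OF assms, of 0] A_subset_vring[OF that] False by (auto simp: vge_def)
  thus ?thesis using homogeneous_regular(2)[OF False] by blast
qed (use rangeI[of \<iota> 0] in simp)

definition Pt :: "'a set \<Rightarrow> 'a poly fract set" where "Pt y = vge (w y) 1 \<inter> A"

definition vertex :: "'a poly fract set" where "vertex = {to_fract f | f. to_fract f \<in> A \<and> coeff f 0 = 0}"

lemma prime_Pt: "y \<in> Y \<Longrightarrow> prime_in (Pt y) A"
  unfolding Pt_def by (rule prime_in_Int[OF dval.prime_in_vge_1[OF dval_w] subdom_A A_subset_vring])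

lemma Pt_components:
  assumes "y \<in> Y" "to_fract f \<in> Pt y"
  shows "hmon (coeff f m) (int m) \<in> Pt y"
  using assms A_components[of f m] vge_w_to_fract_iff[OF assms(1), of f 1] unfolding Pt_def by blast

lemma to_fract_in_vertex_iff: "to_fract f \<in> vertex \<longleftrightarrow> to_fract f \<in> A \<and> coeff f 0 = 0"
  unfolding vertex_def by auto

text \<open>The ideal of positive degree is the center on A of the \<chi>-adic valuation, hence
  prime.\<close>

lemma prime_vertex: "prime_in vertex A"
proof -
  define \<pi> :: "'a poly" where "\<pi> = [:0, 1:]"
  have \<pi>: "prime_elem \<pi>" unfolding \<pi>_def by (intro field_poly_irreducible_imp_prime irreducible_linear_field_poly) simp
  have "to_fract f \<in> vge (vfract (vprime \<pi>)) 1 \<longleftrightarrow> coeff f 0 = 0" for f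
  proof (cases "f = 0")
    case False
    have "to_fract f \<in> vge (vfract (vprime \<pi>)) 1 \<longleftrightarrow> \<pi> dvd f"
      using False vprime_pos_iff(2)[OF \<pi> False] prevaluation.vfract_to_fract[OF prevaluation_vprime[OF \<pi>] False]
      by (simp add: vge_def int_one_le_iff_zero_less)
    also have "\<dots> \<longleftrightarrow> coeff f 0 = 0" using poly_eq_0_iff_dvd[of f 0] by (simp add: \<pi>_def poly_0_coeff_0)
    finally show ?thesis .
  qed (simp add: vge_def)
  hence "vertex = vge (vfract (vprime \<pi>)) 1 \<inter> A" unfolding vertex_def A_def by blast
  moreover have "A \<subseteq> vring (vfract (vprime \<pi>))" unfolding A_def using to_fract_in_vring_vprime[OF \<pi>] by blast
  ultimately show ?thesis using prime_in_Int[OF dval.prime_in_vge_1[OF dval_vprime[OF \<pi>]] subdom_A] by simp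
qed

sublocale E: alg_closed_embedding "\<lambda>c. hmon (\<iota> c) 0"
  by unfold_locales (simp_all add: \<iota>_one \<iota>_add \<iota>_mult hmon_add hmon_mult)

lemma k_subset_A: "E.k \<subseteq> A" using const_in_A by blast

lemma maximal_vertex: "maximal_in vertex A"
proof (rule E.maximal_in_of_residues[OF subdom_A k_subset_A prime_vertex])
  fix a assume "a \<in> A"
  then obtain f where f: "a = to_fract f" "to_fract f \<in> A" by (rule in_AE)
  obtain c where c: "coeff f 0 = \<iota> c" using coeff_0_in_k[OF f(2)] by blast
  have eq: "hmon (\<iota> c) 0 = to_fract [:\<iota> c:]" by (simp add: hmon_def)
  have "to_fract f - to_fract [:\<iota> c:] \<in> A"
    using subdom_diff[OF subdom_A f(2) const_in_A, of c] by (simp only: eq)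
  hence "to_fract (f - [:\<iota> c:]) \<in> vertex" unfolding to_fract_in_vertex_iff using c by simp
  hence "a - hmon (\<iota> c) 0 \<in> vertex" by (simp only: f(1) eq to_fract_diff)
  thus "\<exists>c. a - hmon (\<iota> c) 0 \<in> vertex" by (rule exI)
qed

lemma maximal_in_subset_eq:
  assumes "maximal_in M R" "prime_in P R" "M \<subseteq> P"
  shows "P = M"
proof (rule ccontr)
  note PI = prime_inD(1)[OF assms(2)]
  assume "P \<noteq> M"
  then obtain a where a: "a \<in> P" "a \<notin> M" using assms(3) by blast
  then obtain r where r: "r \<in> R" "1 - r * a \<in> M" using assms(1) ideal_inD(6)[OF PI a(1)] unfolding maximal_in_def by blast
  have "(1 - r * a) + r * a \<in> P" by (intro ideal_inD(3,4)[OF PI] r a) (use r assms(3) in blast)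
  thus False using prime_inD(2)[OF assms(2)] by simp
qed

lemma component_notin:
  assumes Q: "prime_in Q A" and f: "to_fract f \<notin> Q"
  shows "\<exists>m. hmon (coeff f m) (int m) \<notin> Q"
proof (rule ccontr)
  assume "\<not> ?thesis"
  hence "(\<Sum>m\<le>degree f. hmon (coeff f m) (int m)) \<in> Q"
    by (intro ideal_in_sum[OF prime_inD(1)[OF Q]]) blast
  thus False using f by (simp flip: to_fract_eq_sum_hmon)
qed

text \<open>Some component of an element outside Q is outside Q. Its degree is positive because
  components of degree 0 are constants, which have value 0 along \<open>w y\<close>.\<close>

lemma homogeneous_in_Pt:
  assumes y: "y \<in> Y" and Q: "prime_in Q A" and nP: "\<not> Pt y \<subseteq> Q"
  shows "\<exists>x m. m > 0 \<and> x \<noteq> 0 \<and> hmon x m \<in> Pt y \<and> hmon x m \<notin> Q"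
proof -
  obtain a where a: "a \<in> Pt y" "a \<notin> Q" using nP by blast
  then obtain f where f: "a = to_fract f" unfolding Pt_def by (auto elim: in_AE)
  obtain m where m: "hmon (coeff f m) (int m) \<notin> Q" using component_notin[OF Q] a f by blast
  define x where "x = coeff f m"
  have xP: "hmon x (int m) \<in> Pt y" unfolding x_def by (rule Pt_components[OF y]) (use a f in simp)
  have x0: "x \<noteq> 0" using m ideal_inD(2)[OF prime_inD(1)[OF Q]] unfolding x_def by (intro notI) simp
  have "m \<noteq> 0"
  proof
    assume m0: "m = 0"
    have "0 \<le> w z (hmon x 0)" if "z \<in> Y" for z
    proof -
      have "hmon x 0 \<in> vring (w z)" using xP m0 A_subset_vring[OF that] unfolding Pt_def by (simp add: subset_iff)
      thus ?thesis using x0 by (simp add: vge_def)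
    qed
    hence "x \<in> k" using homogeneous_regular(2)[OF x0] by blast
    then obtain c where "x = \<iota> c" by blast
    hence "w y (hmon x 0) = 0" using w_hmon[OF y x0, of 0] ord_\<iota>[OF y, of c] x0 by (cases "c = 0") (simp_all add: E.\<iota>_zero)
    thus False using xP x0 m0 unfolding Pt_def by (simp add: vge_def)
  qed
  thus ?thesis using x0 xP m unfolding x_def by (intro exI[of _ "coeff f m"] exI[of _ "int m"]) auto
qed

text \<open>Every center contains a homogeneous element of positive degree outside Q. A product of
  high powers of these, over the finitely many points where the monomial has a nonzero value, is a
  denominator that clears its poles and a negative degree.\<close>

lemma hmon_in_localize_generic:
  assumes Q: "prime_in Q A" and nP: "\<And>y. y \<in> Y \<Longrightarrow> \<not> Pt y \<subseteq> Q"
  shows "hmon x n \<in> localize A Q"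
proof (cases "x = 0")
  case False
  have "\<forall>y. \<exists>b. y \<in> Y \<longrightarrow> snd b > 0 \<and> fst b \<noteq> 0 \<and> hmon (fst b) (snd b) \<in> Pt y \<and> hmon (fst b) (snd b) \<notin> Q"
    using homogeneous_in_Pt[OF _ Q nP] by force
  from choice[OF this] obtain b where b': "\<forall>y. y \<in> Y \<longrightarrow> snd (b y) > 0 \<and> fst (b y) \<noteq> 0 \<and>
    hmon (fst (b y)) (snd (b y)) \<in> Pt y \<and> hmon (fst (b y)) (snd (b y)) \<notin> Q" by (elim exE)
  define bx M where "bx = (\<lambda>y. fst (b y))" and "M = (\<lambda>y. snd (b y))"
  have b: "M y > 0" "bx y \<noteq> 0" "hmon (bx y) (M y) \<in> Pt y" "hmon (bx y) (M y) \<notin> Q" if "y \<in> Y" for y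
    using b' that unfolding bx_def M_def by blast+
  have bA: "hmon (bx y) (M y) \<in> A" if "y \<in> Y" for y using b(3)[OF that] unfolding Pt_def by blast
  obtain y0 where y0: "y0 \<in> Y" using ex_point by blast
  \<comment> \<open>The extra point keeps S nonempty, so that the degree of the denominator is at
    least N and hence at least the absolute value of n.\<close>
  define S where "S = insert y0 {y\<in>Y. w y (hmon x n) \<noteq> 0}"
  have "finite {y\<in>Y. w y (hmon x n) \<noteq> 0}" using fsupp_w[of "hmon x n"] False by (simp add: fsupp_def)
  hence S: "finite S" "S \<subseteq> Y" using y0 by (auto simp: S_def)
  define N where "N = nat (\<bar>n\<bar> + (\<Sum>y\<in>S. \<bar>w y (hmon x n)\<bar>))"
  define c where "c = (\<Prod>y\<in>S. hmon (bx y) (M y) ^ N)"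
  have cA: "c \<in> A" unfolding c_def using bA S(2) by (intro subdom_prod[OF subdom_A] subdom_power[OF subdom_A]) blast
  have cQ: "c \<notin> Q" unfolding c_def
  proof (rule prime_in_prod[OF Q subdom_A])
    fix y assume "y \<in> S"
    hence y: "y \<in> Y" using S(2) by blast
    show "hmon (bx y) (M y) ^ N \<in> A" by (intro subdom_power[OF subdom_A] bA y)
    show "hmon (bx y) (M y) ^ N \<notin> Q" using prime_in_power[OF Q subdom_A bA[OF y]] b(4)[OF y] by blast
  qed
  define x' m' where "x' = (\<Prod>y\<in>S. bx y ^ N)" and "m' = (\<Sum>y\<in>S. int N * M y)"
  have c: "c = hmon x' m'" unfolding c_def x'_def m'_def hmon_power hmon_prod ..
  have bx0: "bx z ^ N \<noteq> 0" if z: "z \<in> S" for z using b(2) S(2) z by (simp add: subset_iff)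
  have x'0: "x' \<noteq> 0" unfolding x'_def using S(1) bx0 by (simp only: prod_zero_iff) blast
  have "int N * 1 \<le> int N * M y0" using b(1)[OF y0] by (intro mult_left_mono) auto
  also have "\<dots> \<le> m'" unfolding m'_def
  proof (rule member_le_sum[OF _ _ S(1)])
    show "y0 \<in> S" by (simp add: S_def)
    fix z assume "z \<in> S - {y0}"
    hence "M z > 0" using S(2) b(1) by blast
    thus "0 \<le> int N * M z" by simp
  qed
  finally have m'N: "m' \<ge> int N" by simp
  have N: "int N = \<bar>n\<bar> + (\<Sum>y\<in>S. \<bar>w y (hmon x n)\<bar>)" unfolding N_def by (simp add: sum_nonneg)
  have "hmon (x * x') (n + m') \<in> A"
  proof (rule hmon_in_A)
    have "(\<Sum>y\<in>S. \<bar>w y (hmon x n)\<bar>) \<ge> 0" by (rule sum_nonneg) simp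
    thus "n + m' \<ge> 0" using m'N N by linarith
    fix y assume y: "y \<in> Y"
    interpret dval "w y" by (rule dval_w[OF y])
    have "c \<in> vring (w y)" using cA A_subset_vring[OF y] by blast
    hence cge: "w y c \<ge> 0" using c x'0 by (simp add: vge_def)
    have "w y (hmon x n) + w y c \<ge> 0"
    proof (cases "y \<in> S")
      case True
      have f0: "hmon (bx z) (M z) ^ N \<noteq> 0" if z: "z \<in> S" for z using b(2) S(2) z by (simp add: subset_iff)
      have "w y c = (\<Sum>z\<in>S. w y (hmon (bx z) (M z) ^ N))" unfolding c_def by (rule v_prod[OF f0])
      moreover have "w y (hmon (bx y) (M y) ^ N) \<le> (\<Sum>z\<in>S. w y (hmon (bx z) (M z) ^ N))"
      proof (rule member_le_sum[OF True _ S(1)])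
        fix z assume "z \<in> S - {y}"
        hence z: "z \<in> Y" using S(2) by blast
        have "hmon (bx z) (M z) ^ N \<in> vring (w y)" using subdom_power[OF subdom_A bA[OF z]] A_subset_vring[OF y] by blast
        thus "0 \<le> w y (hmon (bx z) (M z) ^ N)" using b(2)[OF z] by (simp add: vge_def)
      qed
      moreover have "w y (hmon (bx y) (M y)) \<ge> 1" using b(2,3)[OF y] unfolding Pt_def by (simp add: vge_def)
      hence "int N * 1 \<le> int N * w y (hmon (bx y) (M y))" by (intro mult_left_mono) auto
      moreover have "w y (hmon (bx y) (M y) ^ N) = int N * w y (hmon (bx y) (M y))" using b(2)[OF y] by (intro v_power) simp
      moreover have "\<bar>w y (hmon x n)\<bar> \<le> (\<Sum>y\<in>S. \<bar>w y (hmon x n)\<bar>)" using True S(1) by (intro member_le_sum) auto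
      ultimately show ?thesis using N by linarith
    next
      case False thus ?thesis using y cge by (simp add: S_def)
    qed
    moreover have "w y (hmon (x * x') (n + m')) = w y (hmon x n) + w y c"
      unfolding c hmon_mult[symmetric] using \<open>x \<noteq> 0\<close> x'0 by (intro mult) simp_all
    ultimately show "hmon (x * x') (n + m') \<in> vring (w y)" by (intro vgeI) simp
  qed
  hence "hmon x n * c \<in> A" by (simp add: c hmon_mult)
  hence "hmon x n * c / c \<in> localize A Q" using cA cQ by (rule localizeI[OF subdom_A Q])
  thus ?thesis using c x'0 by simp
qed (use subdom_zero[OF subdom_localize[OF subdom_A Q]] in simp)

text \<open>Along \<open>w y\<close>, homogeneous elements of value 0 are powers of each other up to
  constants: suitable powers of two of them differ, after scaling one by a constant, by an element
  of the center. If one of positive degree lies in Q, all elements of positive degree do.\<close>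

lemma homogeneous_notin:
  assumes y: "y \<in> Y" and Q: "prime_in Q A" "Pt y \<subseteq> Q" "Q \<noteq> vertex"
    and c: "n > 0" "x \<noteq> 0" "hmon x n \<in> A" "w y (hmon x n) = 0"
  shows "hmon x n \<notin> Q"
proof
  assume cQ: "hmon x n \<in> Q"
  note QI = prime_inD(1)[OF Q(1)]
  interpret v: dval "ord_at y" by (rule dval_point[OF y])
  interpret dval "w y" by (rule dval_w[OF y])
  have main: "hmon z m \<in> Q" if m: "m > 0" and z: "hmon z m \<in> A" for z m
  proof (cases "hmon z m \<in> vge (w y) 1")
    case True thus ?thesis using z Q(2) unfolding Pt_def by blast
  next
    case False
    hence z0: "z \<noteq> 0" by auto
    have "w y (hmon z m) \<ge> 0" using z z0 A_subset_vring[OF y] by (auto simp: vge_def)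
    hence wz: "w y (hmon z m) = 0" using False by (simp add: vge_def)
    \<comment> \<open>The exponents equalize the degrees, so the quotient is a function on the
      curve, of order 0 at y; its residue is the constant sought.\<close>
    define u where "u = z ^ nat n / x ^ nat m"
    have "q y * ord_at y u = n * (q y * ord_at y z) - m * (q y * ord_at y x)"
      using z0 c m by (simp add: u_def v.v_divide v.v_power algebra_simps)
    also have "q y * ord_at y z = - p y * m" using wz w_hmon[OF y z0, of m] by linarith
    also have "q y * ord_at y x = - p y * n" using c(4) w_hmon[OF y c(2), of n] by linarith
    finally have "q y * ord_at y u = 0" by (simp add: algebra_simps)
    hence "ord_at y u = 0" using q_pos[OF y] by simp
    hence "u \<in> vring (ord_at y)" by (simp add: vge_def)
    then obtain l where l: "u - \<iota> l \<in> vge (ord_at y) 1" using residue_point[OF y] vring_point[OF y] by auto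
    define r where "r = x ^ nat m * (u - \<iota> l)"
    have r: "r = z ^ nat n - \<iota> l * x ^ nat m" using c(2) by (simp add: r_def u_def algebra_simps)
    have xm: "hmon x n ^ nat m \<in> Q"
    proof -
      obtain j where j: "nat m = Suc j" using m by (cases "nat m") auto
      have "hmon x n ^ j * hmon x n \<in> Q" by (intro ideal_inD(4)[OF QI] cQ subdom_power[OF subdom_A] c(3))
      thus ?thesis by (simp add: j mult.commute)
    qed
    have eq: "hmon z m ^ nat n - hmon (\<iota> l) 0 * hmon x n ^ nat m = hmon r (n * m)"
      using c(1) m by (simp add: hmon_power hmon_mult hmon_diff r mult.commute)
    have "hmon z m ^ nat n - hmon (\<iota> l) 0 * hmon x n ^ nat m \<in> A"
      by (intro subdom_diff[OF subdom_A] subdom_mult[OF subdom_A] subdom_power[OF subdom_A] z c const_in_A)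
    moreover have "hmon r (n * m) \<in> vge (w y) 1"
    proof (cases "r = 0")
      case False
      hence ul: "u - \<iota> l \<noteq> 0" by (auto simp: r_def)
      hence "ord_at y (u - \<iota> l) \<ge> 1" using l by (simp add: vge_def)
      hence "q y * ord_at y (u - \<iota> l) \<ge> q y * 1" using q_pos[OF y] by (intro mult_left_mono) auto
      moreover have "ord_at y r = m * ord_at y x + ord_at y (u - \<iota> l)"
        using c(2) ul m by (simp add: r_def v.mult v.v_power)
      hence "w y (hmon r (n * m)) = m * (q y * ord_at y x + p y * n) + q y * ord_at y (u - \<iota> l)"
        using w_hmon[OF y False, of "n * m"] by (simp add: algebra_simps)
      moreover have "q y * ord_at y x + p y * n = 0" using c w_hmon[OF y c(2), of n] by simp
      ultimately have "w y (hmon r (n * m)) = q y * ord_at y (u - \<iota> l)" by simp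
      hence "w y (hmon r (n * m)) \<ge> 1"
        using q_pos[OF y] \<open>q y * ord_at y (u - \<iota> l) \<ge> q y * 1\<close> by linarith
      thus ?thesis by (rule vgeI)
    qed simp
    ultimately have "hmon z m ^ nat n - hmon (\<iota> l) 0 * hmon x n ^ nat m \<in> Q" using Q(2) eq unfolding Pt_def by auto
    moreover have "hmon (\<iota> l) 0 * hmon x n ^ nat m \<in> Q" by (rule ideal_inD(4)[OF QI const_in_A xm])
    ultimately have "(hmon z m ^ nat n - hmon (\<iota> l) 0 * hmon x n ^ nat m) + hmon (\<iota> l) 0 * hmon x n ^ nat m \<in> Q"
      by (rule ideal_inD(3)[OF QI])
    hence "hmon z m ^ nat n \<in> Q" by simp
    thus ?thesis by (rule prime_in_power[OF Q(1) subdom_A z])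
  qed
  have "vertex \<subseteq> Q"
  proof
    fix a assume "a \<in> vertex"
    then obtain f where f: "a = to_fract f" "to_fract f \<in> A" "coeff f 0 = 0" unfolding vertex_def by blast
    have "hmon (coeff f m) (int m) \<in> Q" for m
      using main[of "int m" "coeff f m"] A_components[OF f(2), of m] f(3) ideal_inD(2)[OF QI]
      by (cases "m = 0") simp_all
    thus "a \<in> Q" unfolding f(1) to_fract_eq_sum_hmon[of f] by (intro ideal_in_sum[OF QI])
  qed
  hence "Q = vertex" by (rule maximal_in_subset_eq[OF maximal_vertex Q(1)])
  thus False using Q(3) by simp
qed

lemma ex_homogeneous_in_A:
  assumes y: "y \<in> Y" and B: "fsupp B" "\<And>z. z \<in> Y \<Longrightarrow> B z \<ge> 0" and e: "e \<ge> 0"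
  obtains n x where "n > (N::nat)" "x \<noteq> 0" "hmon x (int n) \<in> A" "hmon x (int n) \<in> vertex" "w y (hmon x (int n)) = e"
    "\<And>z. z \<in> Y \<Longrightarrow> z \<noteq> y \<Longrightarrow> B z \<le> w z (hmon x (int n))"
proof -
  obtain n x where h: "n > N" "x \<noteq> 0" "w y (hmon x (int n)) = e" "\<forall>z\<in>Y - {y}. B z \<le> w z (hmon x (int n))"
    using ex_homogeneous[OF y B(1), of N e] by (elim exE conjE)
  have hB: "B z \<le> w z (hmon x (int n))" if z: "z \<in> Y" "z \<noteq> y" for z using h(4) z by simp
  have hA: "hmon x (int n) \<in> A"
  proof (rule hmon_in_A)
    fix z assume z: "z \<in> Y"
    have "0 \<le> w z (hmon x (int n))"
    proof (cases "z = y")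
      case False thus ?thesis using hB[OF z] B(2)[OF z] by simp
    qed (use h(3) e in simp)
    thus "hmon x (int n) \<in> vring (w z)" by (simp add: vge_def)
  qed simp
  have "to_fract (monom x n) \<in> vertex" unfolding to_fract_in_vertex_iff
    using hA h(1) by (simp add: hmon_of_nat)
  hence "hmon x (int n) \<in> vertex" by (simp add: hmon_of_nat)
  thus ?thesis using that h(1,2,3) hA hB by blast
qed

text \<open>A homogeneous c with value 0 along \<open>w y\<close> and large values at the other
  poles of the monomial clears these poles; it lies outside Q by \<open>homogeneous_notin\<close>,
  so it may serve as a denominator.\<close>

lemma hmon_in_localize_special:
  assumes y: "y \<in> Y" and Q: "prime_in Q A" "Pt y \<subseteq> Q" "Q \<noteq> vertex" and x: "hmon x n \<in> vring (w y)"
  shows "hmon x n \<in> localize A Q" "hmon x n \<in> vge (w y) 1 \<Longrightarrow> hmon x n \<in> max_ideal (localize A Q)"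
proof -
  have *: "\<exists>c\<in>A. c \<notin> Q \<and> c * hmon x n \<in> A \<and> w y c = 0 \<and> c \<noteq> 0" if x0: "x \<noteq> 0"
  proof -
    define B where "B = (\<lambda>z. max 0 (- w z (hmon x n)))"
    have fw: "fsupp (\<lambda>z. w z (hmon x n))" using fsupp_w[of "hmon x n"] x0 by simp
    have B: "fsupp B" by (rule fsupp_combine[OF fw fw]) (simp add: B_def)
    obtain m u where c: "m > nat \<bar>n\<bar>" "u \<noteq> 0" "hmon u (int m) \<in> A" "w y (hmon u (int m)) = 0"
      "\<And>z. z \<in> Y \<Longrightarrow> z \<noteq> y \<Longrightarrow> B z \<le> w z (hmon u (int m))"
      by (rule ex_homogeneous_in_A[OF y B, of 0 "nat \<bar>n\<bar>"]) (simp_all add: B_def)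
    note cA = c(3)
    have "hmon u (int m) \<notin> Q" using c(1) by (intro homogeneous_notin[OF y Q _ c(2) cA c(4)]) simp
    moreover have "hmon (u * x) (int m + n) \<in> A"
    proof (rule hmon_in_A)
      show "int m + n \<ge> 0" using c(1) by linarith
      fix z assume z: "z \<in> Y"
      have "w z (hmon u (int m)) + w z (hmon x n) \<ge> 0"
      proof (cases "z = y")
        case True thus ?thesis using c(4) x x0 by (simp add: vge_def)
      next
        case False
        hence "w z (hmon u (int m)) \<ge> B z" by (intro c(5) z)
        thus ?thesis by (simp add: B_def)
      qed
      moreover have "w z (hmon (u * x) (int m + n)) = w z (hmon u (int m)) + w z (hmon x n)"
        unfolding hmon_mult[symmetric] using c(2) x0 by (intro dval.mult[OF dval_w[OF z]]) simp_all
      ultimately show "hmon (u * x) (int m + n) \<in> vring (w z)" by (simp add: vge_def)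
    qed
    ultimately show ?thesis using cA c(2,4) by (intro bexI[of _ "hmon u (int m)"]) (simp_all add: hmon_mult)
  qed
  have S: "subdom (localize A Q)" by (rule subdom_localize[OF subdom_A Q(1)])
  show "hmon x n \<in> localize A Q"
  proof (cases "x = 0")
    case False
    then obtain c where c: "c \<in> A" "c \<notin> Q" "c * hmon x n \<in> A" "c \<noteq> 0" using * by blast
    have "c * hmon x n / c \<in> localize A Q" by (rule localizeI[OF subdom_A Q(1) c(3,1,2)])
    thus ?thesis using c(4) by simp
  qed (use subdom_zero[OF S] in simp)
  assume x1: "hmon x n \<in> vge (w y) 1"
  show "hmon x n \<in> max_ideal (localize A Q)"
  proof (cases "x = 0")
    case False
    then obtain c where c: "c \<in> A" "c \<notin> Q" "c * hmon x n \<in> A" "c \<noteq> 0" "w y c = 0" using * by blast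
    have "w y (c * hmon x n) = w y (hmon x n)" using dval.mult[OF dval_w[OF y] c(4), of "hmon x n"] False c(5) by simp
    hence "c * hmon x n \<in> Q" using c(3) x1 Q(2) False c(4) unfolding Pt_def by (auto simp: vge_def)
    hence "c * hmon x n / c \<in> max_ideal (localize A Q)" unfolding max_ideal_localize[OF subdom_A Q(1)] using c(1,2) by blast
    thus ?thesis using c(4) by simp
  qed (use S subdom_zero[OF S] in \<open>simp add: max_ideal_def\<close>)
qed

end


section \<open>Localizations of the graded ring\<close>

context alg_closed_embedding
begin

lemma keval_cong_ideal:
  assumes m: "ideal_in m R" and R: "subdom R" "k \<subseteq> R" "x \<in> R" and x: "x - \<iota> c \<in> m"
  shows "keval F x - \<iota> (poly F c) \<in> m"
proof (induction F)
  case 0 show ?case using ideal_inD(2)[OF m] by (simp add: \<iota>_zero)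
next
  case (pCons a F)
  have "x * (keval F x - \<iota> (poly F c)) \<in> m" by (rule ideal_inD(4)[OF m R(3) pCons.IH])
  moreover have "\<iota> (poly F c) \<in> R" using R(2) by blast
  hence "\<iota> (poly F c) * (x - \<iota> c) \<in> m" by (rule ideal_inD(4)[OF m _ x])
  ultimately have "x * (keval F x - \<iota> (poly F c)) + \<iota> (poly F c) * (x - \<iota> c) \<in> m" by (rule ideal_inD(3)[OF m])
  moreover have "x * (keval F x - \<iota> (poly F c)) + \<iota> (poly F c) * (x - \<iota> c) = keval (pCons a F) x - \<iota> (poly (pCons a F) c)"
    by (simp add: \<iota>_add \<iota>_mult algebra_simps)
  ultimately show ?case by simp
qed

end

lemma common_denominator:
  assumes A: "subdom A" and P: "prime_in P A" and "a \<in> localize A P" "b \<in> localize A P"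
  obtains d where "d \<in> A" "d \<notin> P" "d \<noteq> 0" "d * a \<in> A" "d * b \<in> A"
proof -
  obtain a1 a2 where a: "a = a1 / a2" "a1 \<in> A" "a2 \<in> A" "a2 \<notin> P" using assms(3) unfolding localize_def by blast
  obtain b1 b2 where b: "b = b1 / b2" "b1 \<in> A" "b2 \<in> A" "b2 \<notin> P" using assms(4) unfolding localize_def by blast
  have nz: "a2 \<noteq> 0" "b2 \<noteq> 0" using a(4) b(4) zero_in_prime[OF A P] by auto
  have 1: "a2 * b2 \<in> A" by (intro subdom_mult[OF A] a b)
  have 2: "a2 * b2 \<notin> P" using prime_inD(3)[OF P a(3) b(3)] a(4) b(4) by blast
  have 3: "(a2 * b2) * a = b2 * a1" "(a2 * b2) * b = a2 * b1" using nz by (simp_all add: a(1) b(1))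
  have 4: "b2 * a1 \<in> A" "a2 * b1 \<in> A" by (intro subdom_mult[OF A] a b)+
  have 5: "a2 * b2 * a \<in> A" "a2 * b2 * b \<in> A" unfolding 3 by (rule 4)+
  show ?thesis by (rule that[OF 1 2 _ 5]) (use nz in simp)
qed

lemma (in dval) localize_center:
  assumes D: "subdom D" "D \<subseteq> vring v"
  shows "prime_in (vge v 1 \<inter> D) D" "localize D (vge v 1 \<inter> D) \<subseteq> vring v"
    "max_ideal (localize D (vge v 1 \<inter> D)) \<subseteq> vge v 1"
proof -
  show P: "prime_in (vge v 1 \<inter> D) D" by (rule prime_in_Int[OF prime_in_vge_1 D])
  have den: "b \<noteq> 0 \<and> v b = 0" if b: "b \<in> D" "b \<notin> vge v 1 \<inter> D" for b
  proof -
    have "b \<in> vring v" using b(1) D(2) by blast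
    thus ?thesis using b by (auto simp: vge_def)
  qed
  have quot: "a / b \<in> vge v n" if a: "a \<in> vge v n" and b: "b \<in> D" "b \<notin> vge v 1 \<inter> D" for a b n
    using den[OF b] a by (cases "a = 0") (simp_all add: vge_def v_divide)
  show "localize D (vge v 1 \<inter> D) \<subseteq> vring v"
  proof
    fix x assume "x \<in> localize D (vge v 1 \<inter> D)"
    then obtain a b where ab: "x = a / b" "a \<in> D" "b \<in> D" "b \<notin> vge v 1 \<inter> D" unfolding localize_def by blast
    show "x \<in> vring v" unfolding ab(1) by (rule quot[OF _ ab(3,4)]) (use ab(2) D(2) in blast)
  qed
  show "max_ideal (localize D (vge v 1 \<inter> D)) \<subseteq> vge v 1"
  proof
    fix x assume "x \<in> max_ideal (localize D (vge v 1 \<inter> D))"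
    then obtain a b where ab: "x = a / b" "a \<in> vge v 1 \<inter> D" "b \<in> D" "b \<notin> vge v 1 \<inter> D"
      unfolding max_ideal_localize[OF D(1) P] by blast
    show "x \<in> vge v 1" unfolding ab(1) by (rule quot[OF _ ab(3,4)]) (use ab(2) in blast)
  qed
qed

lemma inverse_in_of_notin_max_ideal: "x \<in> R \<Longrightarrow> x \<notin> max_ideal R \<Longrightarrow> inverse x \<in> R"
  unfolding max_ideal_def by blast

lemma vring_vprime_quotient:
  fixes \<pi> :: "'a::field poly"
  assumes \<pi>: "prime_elem \<pi>" and f: "f \<in> vring (vfract (vprime \<pi>))"
  obtains a b where "\<not> \<pi> dvd b" "f = to_fract a / to_fract b"
proof (cases "f = 0")
  case True
  have "\<not> \<pi> dvd 1" using \<pi> by (simp add: prime_elem_def)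
  thus ?thesis by (rule that[of 1 0]) (simp add: True)
next
  case False
  interpret V: prevaluation "vprime \<pi>" by (rule prevaluation_vprime[OF \<pi>])
  obtain a b where ab: "b \<noteq> 0" "f = to_fract a / to_fract b" by (rule fract_quotient)
  have a0: "a \<noteq> 0" using False ab(2) by (intro notI) simp
  obtain i c where a: "a = \<pi> ^ i * c" "\<not> \<pi> dvd c" using prime_elem_power_decomp[OF \<pi> a0] by blast
  obtain j d where b: "b = \<pi> ^ j * d" "\<not> \<pi> dvd d" using prime_elem_power_decomp[OF \<pi> ab(1)] by blast
  have "vfract (vprime \<pi>) f = int i - int j"
    unfolding ab(2) V.vfract_quotient[OF a0 ab(1)] unfolding a(1) b(1) vprime_eq[OF \<pi> a(2)] vprime_eq[OF \<pi> b(2)] ..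
  hence "j \<le> i" using f False by (simp add: vge_def)
  hence "a = \<pi> ^ (i - j) * c * \<pi> ^ j" unfolding a(1) by (simp add: mult_ac flip: power_add)
  moreover have "\<pi> \<noteq> 0" using \<pi> by (simp add: prime_elem_def)
  ultimately have "f = to_fract (\<pi> ^ (i - j) * c) / to_fract d" using ab b by (simp add: field_simps)
  thus ?thesis by (rule that[OF b(2)])
qed

lemma vring_vprime_subset:
  fixes \<pi> :: "'a::field poly"
  assumes \<pi>: "prime_elem \<pi>" and R: "subdom R" "\<And>f. to_fract f \<in> R" and nd: "\<And>b. \<not> \<pi> dvd b \<Longrightarrow> to_fract b \<notin> max_ideal R"
  shows "vring (vfract (vprime \<pi>)) \<subseteq> R"
proof
  fix f assume f: "f \<in> vring (vfract (vprime \<pi>))"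
  obtain a b where ab: "\<not> \<pi> dvd b" "f = to_fract a / to_fract b" by (rule vring_vprime_quotient[OF \<pi> f])
  have "inverse (to_fract b) \<in> R" by (rule inverse_in_of_notin_max_ideal[OF R(2) nd[OF ab(1)]])
  hence "to_fract a * inverse (to_fract b) \<in> R" by (rule subdom_mult[OF R])
  thus "f \<in> R" unfolding ab(2) divide_inverse .
qed

context dpd
begin

lemma ex_hmon_value:
  assumes y: "y \<in> Y"
  shows "\<exists>x n. x \<noteq> 0 \<and> w y (hmon x n) = e"
proof -
  obtain \<alpha> \<beta> where ab: "q y * \<alpha> + p y * \<beta> = 1" using bezout_pq[OF y] by blast
  obtain t where t: "t \<noteq> 0" "ord_at y t = 1" using dval.uniformizer[OF dval_point[OF y]] by blast
  have "ord_at y (t powi (\<alpha> * e)) = \<alpha> * e" using dval.v_powi[OF dval_point[OF y] t(1)] t(2) by simp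
  hence "w y (hmon (t powi (\<alpha> * e)) (\<beta> * e)) = (q y * \<alpha> + p y * \<beta>) * e"
    using w_hmon[OF y, of "t powi (\<alpha> * e)" "\<beta> * e"] t(1) by (simp add: algebra_simps)
  thus ?thesis using ab t(1) by (intro exI[of _ "t powi (\<alpha> * e)"] exI[of _ "\<beta> * e"]) simp
qed

lemma Pt_subset_vertex:
  assumes y: "y \<in> Y"
  shows "Pt y \<subseteq> vertex"
proof
  fix a assume a: "a \<in> Pt y"
  hence aA: "a \<in> A" unfolding Pt_def by blast
  obtain f where f: "a = to_fract f" "to_fract f \<in> A" by (rule in_AE[OF aA])
  have "hmon (coeff f 0) (int 0) \<in> Pt y" by (rule Pt_components[OF y]) (use a f(1) in simp)
  hence 1: "hmon (coeff f 0) 0 \<in> vge (w y) 1" unfolding Pt_def by simp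
  have "coeff f 0 = 0"
  proof (rule ccontr)
    assume c0: "coeff f 0 \<noteq> 0"
    obtain c where c: "coeff f 0 = \<iota> c" using coeff_0_in_k[OF f(2)] by blast
    have "c \<noteq> 0" using c0 c \<iota>_zero by (intro notI) simp
    hence "w y (hmon (coeff f 0) 0) = 0" using w_hmon[OF y c0, of 0] ord_\<iota>[OF y, of c] c by simp
    thus False using 1 c0 by (simp add: vge_def)
  qed
  thus "a \<in> vertex" unfolding f(1) to_fract_in_vertex_iff using f(2) by simp
qed

lemma Pt_neq_vertex:
  assumes y: "y \<in> Y"
  shows "Pt y \<noteq> vertex"
proof -
  obtain n x where h: "n > (0::nat)" "x \<noteq> 0" "hmon x (int n) \<in> vertex" "w y (hmon x (int n)) = 0"
    by (rule ex_homogeneous_in_A[OF y fsupp_0, of 0 0]) simp_all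
  have "hmon x (int n) \<notin> Pt y" using h(2,4) unfolding Pt_def by (simp add: vge_def)
  thus ?thesis using h(3) by blast
qed

lemma Pt_neq_0:
  assumes y: "y \<in> Y"
  shows "Pt y \<noteq> {0}"
proof -
  obtain n x where h: "n > (0::nat)" "x \<noteq> 0" "hmon x (int n) \<in> A" "w y (hmon x (int n)) = 1"
    by (rule ex_homogeneous_in_A[OF y fsupp_0, of 1 0]) simp_all
  have "hmon x (int n) \<in> Pt y" using h(3,4) unfolding Pt_def by (simp add: vge_def)
  thus ?thesis using h(2) by force
qed

lemma laurent_in_vge_iff:
  assumes y: "y \<in> Y" and x: "x \<noteq> 0"
  shows "to_fract f * hmon x n \<in> vge (w y) e \<longleftrightarrow> (\<forall>m. hmon (coeff f m * x) (int m + n) \<in> vge (w y) e)"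
proof -
  interpret dval "w y" by (rule dval_w[OF y])
  have h: "hmon x n \<noteq> 0" using x by simp
  have "to_fract f * hmon x n \<in> vge (w y) e \<longleftrightarrow> to_fract f \<in> vge (w y) (e - w y (hmon x n))"
    using vge_mult_nonzero_iff[OF h, of "to_fract f" e] by (simp only: mult.commute)
  also have "\<dots> \<longleftrightarrow> (\<forall>m. hmon (coeff f m) (int m) \<in> vge (w y) (e - w y (hmon x n)))"
    by (rule vge_w_to_fract_iff[OF y])
  also have "\<dots> \<longleftrightarrow> (\<forall>m. hmon x n * hmon (coeff f m) (int m) \<in> vge (w y) e)"
    by (simp only: vge_mult_nonzero_iff[OF h])
  finally show ?thesis by (simp only: hmon_mult mult.commute add.commute)
qed

lemma to_fract_mult_hmon:
  "to_fract f * hmon x n = (\<Sum>m\<le>degree f. hmon (coeff f m * x) (int m + n))"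
  unfolding to_fract_eq_sum_hmon[of f] by (simp only: sum_distrib_right hmon_mult)

text \<open>Numerator and denominator are multiplied by a monomial that gives the denominator the
  value 0. Both then are sums of monomials in the valuation ring, which lie in the localization, and
  the denominator is a unit there.\<close>

lemma localize_Pt:
  assumes y: "y \<in> Y"
  shows "localize A (Pt y) = vring (w y)"
proof
  interpret dval "w y" by (rule dval_w[OF y])
  note Q = prime_Pt[OF y] and S = subdom_localize[OF subdom_A prime_Pt[OF y]]
  note center = localize_center[OF subdom_A A_subset_vring[OF y], folded Pt_def]
  note special = hmon_in_localize_special(1)[OF y Q subset_refl Pt_neq_vertex[OF y]]
  show "localize A (Pt y) \<subseteq> vring (w y)" by (rule center(2))
  show "vring (w y) \<subseteq> localize A (Pt y)"
  proof
    fix f assume f: "f \<in> vring (w y)"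
    obtain a b where ab: "b \<noteq> 0" "f = to_fract a / to_fract b" by (rule fract_quotient)
    obtain x n where x: "x \<noteq> 0" "w y (hmon x n) = - w y (to_fract b)" using ex_hmon_value[OF y] by blast
    define a' b' where "a' = to_fract a * hmon x n" and "b' = to_fract b * hmon x n"
    have b': "b' \<noteq> 0" "w y b' = 0" using ab(1) x by (simp_all add: b'_def mult)
    have f': "f = a' * inverse b'" using ab x(1) by (simp add: a'_def b'_def field_simps)
    have bf: "b' * f = a'" using f' b'(1) by simp
    have a': "a' \<in> vring (w y)" unfolding bf[symmetric] using f b' by (simp add: vge_mult_nonzero_iff)
    have b'v: "b' \<in> vring (w y)" using b'(2) by (simp add: vge_def)
    have aR: "a' \<in> localize A (Pt y)" unfolding a'_def to_fract_mult_hmon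
      by (intro subdom_sum[OF S] special) (use a' laurent_in_vge_iff[OF y x(1), of a n 0] a'_def in blast)
    have bR: "b' \<in> localize A (Pt y)" unfolding b'_def to_fract_mult_hmon
      by (intro subdom_sum[OF S] special) (use b'v laurent_in_vge_iff[OF y x(1), of b n 0] b'_def in blast)
    have "b' \<notin> vge (w y) 1" using b' by (simp add: vge_def)
    hence "b' \<notin> max_ideal (localize A (Pt y))" using center(3) by blast
    from inverse_in_of_notin_max_ideal[OF bR this] show "f \<in> localize A (Pt y)"
      unfolding f' by (rule subdom_mult[OF S aR])
  qed
qed

subsection \<open>Primes containing the center of a point\<close>

text \<open>Up to higher order along \<open>w y\<close>, a monomial of value 0 is a constant times a
  power of s = t^(-p) \<chi>^q: value 0 means q ord x = - p n, and coprimality gives q | n. The last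
  two conjuncts record that terms of value 0 survive and that different degrees lead to different
  exponents n / q.\<close>

lemma homogeneous_residue:
  assumes y: "y \<in> Y" and P: "prime_in P A" "Pt y \<subseteq> P" "P \<noteq> vertex" and t: "t \<noteq> 0" "ord_at y t = 1"
    and x: "hmon x (int n) \<in> vring (w y)"
  shows "\<exists>c. hmon x (int n) - hmon (\<iota> c) 0 * hmon (t powi (- p y)) (q y) ^ (n div nat (q y)) \<in> max_ideal (localize A P) \<and>
    (hmon x (int n) \<notin> vge (w y) 1 \<longrightarrow> c \<noteq> 0) \<and> (c \<noteq> 0 \<longrightarrow> nat (q y) dvd n)"
proof (cases "hmon x (int n) \<in> vge (w y) 1")
  case True
  have "hmon x (int n) \<in> max_ideal (localize A P)" by (rule hmon_in_localize_special(2)[OF y P x True])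
  thus ?thesis using True by (intro exI[of _ 0]) (simp add: \<iota>_zero)
next
  case False
  interpret v: dval "ord_at y" by (rule dval_point[OF y])
  have x0: "x \<noteq> 0" using False by (intro notI) (simp add: vge_def)
  have "w y (hmon x (int n)) = 0" using False x by (simp add: vge_def)
  hence eq: "q y * ord_at y x = - (p y * int n)" using w_hmon[OF y x0, of "int n"] by linarith
  hence "q y dvd p y * int n" by (metis dvd_minus_iff dvd_triv_left)
  moreover have "coprime (q y) (p y)" using pq_coprime[OF y] by (simp only: coprime_commute)
  ultimately have "q y dvd int n" using coprime_dvd_mult_right_iff by blast
  then obtain i where i: "int n = q y * i" by (elim dvdE)
  have "i \<ge> 0"
  proof (rule ccontr)
    assume "\<not> ?thesis"
    hence "q y * i < 0" using q_pos[OF y] by (simp add: mult_pos_neg)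
    thus False using i by simp
  qed
  then obtain j where ij: "i = int j" using nonneg_int_cases by blast
  have n: "n = nat (q y) * j" using i ij q_pos[OF y] by (metis nat_int nat_mult_distrib less_imp_le)
  have nj: "n div nat (q y) = j" using n q_pos[OF y] by simp
  have "q y * ord_at y x = q y * (- p y * int j)" using eq i ij by (simp add: algebra_simps)
  hence ox: "ord_at y x = - p y * int j" using q_pos[OF y] by (simp only: mult_cancel_left) simp
  define s where "s = t powi (- p y)"
  have s: "s \<noteq> 0" "ord_at y s = - p y" using t by (simp_all add: s_def v.v_powi)
  define u where "u = x / s ^ j"
  have u: "u \<noteq> 0" "ord_at y u = 0" using x0 s ox by (simp_all add: u_def v.v_divide v.v_power)
  have "u \<in> vring (ord_at y)" using u(2) by (simp add: vge_def)
  hence "u \<in> y" unfolding vring_point[OF y] .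
  then obtain c where c: "u - \<iota> c \<in> vge (ord_at y) 1" using residue_point[OF y] by blast
  have c0: "c \<noteq> 0"
  proof
    assume "c = 0"
    thus False using c u by (simp add: \<iota>_zero vge_def)
  qed
  have x_eq: "x = u * s ^ j" using s(1) by (simp add: u_def)
  have "hmon x (int n) - hmon (\<iota> c) 0 * hmon s (q y) ^ j = hmon x (int n) - hmon (\<iota> c * s ^ j) (int n)"
    using i ij by (simp add: hmon_power hmon_mult mult.commute)
  also have "\<dots> = hmon ((u - \<iota> c) * s ^ j) (int n)" unfolding hmon_diff x_eq by (simp only: left_diff_distrib)
  finally have d: "hmon x (int n) - hmon (\<iota> c) 0 * hmon s (q y) ^ j = hmon ((u - \<iota> c) * s ^ j) (int n)" .
  have "hmon ((u - \<iota> c) * s ^ j) (int n) \<in> vge (w y) 1"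
  proof (cases "u - \<iota> c = 0")
    case False
    hence "ord_at y (u - \<iota> c) \<ge> 1" using c by (simp add: vge_def)
    hence le: "q y * 1 \<le> q y * ord_at y (u - \<iota> c)" using q_pos[OF y] by (intro mult_left_mono) auto
    have nz: "(u - \<iota> c) * s ^ j \<noteq> 0" using False s(1) by simp
    have o: "ord_at y ((u - \<iota> c) * s ^ j) = ord_at y (u - \<iota> c) - int j * p y" using False s by (simp add: v.mult v.v_power)
    have "w y (hmon ((u - \<iota> c) * s ^ j) (int n)) = q y * (ord_at y (u - \<iota> c) - int j * p y) + p y * (q y * int j)"
      unfolding w_hmon[OF y nz] o unfolding i ij ..
    hence "w y (hmon ((u - \<iota> c) * s ^ j) (int n)) = q y * ord_at y (u - \<iota> c)" by (simp add: algebra_simps)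
    hence "w y (hmon ((u - \<iota> c) * s ^ j) (int n)) \<ge> 1" using le q_pos[OF y] by linarith
    thus ?thesis by (simp add: vge_def)
  qed (simp add: vge_def)
  moreover from this have "hmon ((u - \<iota> c) * s ^ j) (int n) \<in> vring (w y)" by (auto simp: vge_def)
  ultimately have "hmon ((u - \<iota> c) * s ^ j) (int n) \<in> max_ideal (localize A P)"
    by (intro hmon_in_localize_special(2)[OF y P])
  thus ?thesis using c0 n unfolding nj s_def[symmetric] d[symmetric] by (intro exI[of _ c]) simp
qed

text \<open>Modulo the maximal ideal at P, elements of A become polynomials in s over k. An element
  of P outside the center gives a nonzero polynomial relation for s, so s, and with it all of A, has
  residues in k.\<close>

lemma maximal_special:
  assumes y: "y \<in> Y" and P: "prime_in P A" "Pt y \<subseteq> P" "P \<noteq> vertex" "P \<noteq> Pt y"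
  shows "maximal_in P A"
proof -
  define R m where "R = localize A P" and "m = max_ideal R"
  have S: "subdom R" unfolding R_def by (rule subdom_localize[OF subdom_A P(1)])
  have mP: "prime_in m R" unfolding m_def R_def by (rule prime_max_ideal_localize[OF subdom_A P(1)])
  note mI = prime_inD(1)[OF mP]
  have mA: "m \<inter> A = P" unfolding m_def R_def by (rule max_ideal_localize_Int[OF subdom_A P(1)])
  have AR: "A \<subseteq> R" unfolding R_def by (rule subset_localize[OF subdom_A P(1)])
  have kR: "E.k \<subseteq> R" using k_subset_A AR by blast
  obtain t where t: "t \<noteq> 0" "ord_at y t = 1" using dval.uniformizer[OF dval_point[OF y]] by blast
  define s where "s = hmon (t powi (- p y)) (q y)"
  have "ord_at y (t powi (- p y)) = - p y" using dval.v_powi[OF dval_point[OF y] t(1)] t(2) by simp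
  hence "w y s = 0" using w_hmon[OF y, of "t powi (- p y)" "q y"] t(1) by (simp add: s_def)
  hence "s \<in> vring (w y)" by (simp add: vge_def)
  hence sR: "s \<in> R" unfolding s_def R_def by (rule hmon_in_localize_special(1)[OF y P(1-3)])
  have red: "\<exists>F. to_fract f - E.keval F s \<in> m \<and> (to_fract f \<notin> vge (w y) 1 \<longrightarrow> F \<noteq> 0)" if f: "to_fract f \<in> A" for f
  proof -
    have fv: "hmon (coeff f i) (int i) \<in> vring (w y)" for i
      using A_components[OF f, of i] A_subset_vring[OF y] by blast
    have "\<forall>i. \<exists>c. hmon (coeff f i) (int i) - hmon (\<iota> c) 0 * s ^ (i div nat (q y)) \<in> m \<and>
      (hmon (coeff f i) (int i) \<notin> vge (w y) 1 \<longrightarrow> c \<noteq> 0) \<and> (c \<noteq> 0 \<longrightarrow> nat (q y) dvd i)"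
      unfolding s_def m_def R_def by (intro allI homogeneous_residue[OF y P(1-3) t fv])
    from choice[OF this] obtain c where c: "\<forall>i. hmon (coeff f i) (int i) - hmon (\<iota> (c i)) 0 * s ^ (i div nat (q y)) \<in> m \<and>
      (hmon (coeff f i) (int i) \<notin> vge (w y) 1 \<longrightarrow> c i \<noteq> 0) \<and> (c i \<noteq> 0 \<longrightarrow> nat (q y) dvd i)" by (elim exE)
    define F where "F = (\<Sum>i\<le>degree f. monom (c i) (i div nat (q y)))"
    have "to_fract f - E.keval F s = (\<Sum>i\<le>degree f. hmon (coeff f i) (int i) - hmon (\<iota> (c i)) 0 * s ^ (i div nat (q y)))"
      unfolding F_def E.keval_sum E.keval_monom to_fract_eq_sum_hmon[of f] by (rule sum_subtractf[symmetric])
    moreover have "(\<Sum>i\<le>degree f. hmon (coeff f i) (int i) - hmon (\<iota> (c i)) 0 * s ^ (i div nat (q y))) \<in> m"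
      by (rule ideal_in_sum[OF mI]) (use c in blast)
    moreover have "F \<noteq> 0" if nf: "to_fract f \<notin> vge (w y) 1"
    proof -
      obtain i where i: "hmon (coeff f i) (int i) \<notin> vge (w y) 1" using nf vge_w_to_fract_iff[OF y, of f 1] by blast
      have ci: "c i \<noteq> 0" using c i by blast
      have "coeff f i \<noteq> 0" using i by (intro notI) (simp add: vge_def)
      hence id: "i \<le> degree f" by (rule le_degree)
      \<comment> \<open>Indices with a nonzero constant are multiples of q, so they contribute to
        different exponents and nothing cancels.\<close>
      have "coeff F (i div nat (q y)) = (\<Sum>l\<le>degree f. if l div nat (q y) = i div nat (q y) then c l else 0)"
        unfolding F_def by (simp add: coeff_sum)
      also have "\<dots> = (\<Sum>l\<le>degree f. if l = i then c i else 0)"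
      proof (rule sum.cong)
        fix l
        show "(if l div nat (q y) = i div nat (q y) then c l else 0) = (if l = i then c i else 0)"
        proof (cases "c l = 0")
          case False
          have "nat (q y) dvd l" "nat (q y) dvd i" using c False ci by blast+
          hence "l div nat (q y) = i div nat (q y) \<longleftrightarrow> l = i" using dvd_div_eq_iff by blast
          thus ?thesis by simp
        qed (use ci in auto)
      qed simp
      also have "\<dots> = c i" using id by simp
      finally show ?thesis using ci by auto
    qed
    ultimately show ?thesis by (intro exI[of _ F]) simp
  qed
  obtain a where a: "a \<in> P" "a \<notin> Pt y" using P(2,4) by blast
  have aA: "a \<in> A" using a(1) ideal_inD(1)[OF prime_inD(1)[OF P(1)]] by blast
  obtain f where f: "a = to_fract f" "to_fract f \<in> A" by (rule in_AE[OF aA])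
  have nf: "to_fract f \<notin> vge (w y) 1" using a(2) f unfolding Pt_def by simp
  obtain F where F: "to_fract f - E.keval F s \<in> m" "F \<noteq> 0" using red[OF f(2)] nf by blast
  have "to_fract f \<in> m" using a(1) mA f(1) by blast
  hence "to_fract f - (to_fract f - E.keval F s) \<in> m" using F(1) by (rule ideal_in_diff[OF mI S])
  hence "E.keval F s \<in> m" by simp
  then obtain c where c: "s - hmon (\<iota> c) 0 \<in> m" using E.keval_prime_root[OF mP S kR sR F(2)] by blast
  show ?thesis
  proof (rule E.maximal_in_of_residues[OF subdom_A k_subset_A P(1)])
    fix b assume bA: "b \<in> A"
    obtain g where g: "b = to_fract g" "to_fract g \<in> A" by (rule in_AE[OF bA])
    obtain G where G: "to_fract g - E.keval G s \<in> m" using red[OF g(2)] by blast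
    have "E.keval G s - hmon (\<iota> (poly G c)) 0 \<in> m" by (rule E.keval_cong_ideal[OF mI S kR sR c])
    hence "(to_fract g - E.keval G s) + (E.keval G s - hmon (\<iota> (poly G c)) 0) \<in> m" by (rule ideal_inD(3)[OF mI G])
    hence "b - hmon (\<iota> (poly G c)) 0 \<in> m" by (simp add: g(1))
    moreover have "b - hmon (\<iota> (poly G c)) 0 \<in> A" by (rule subdom_diff[OF subdom_A bA const_in_A])
    ultimately have "b - hmon (\<iota> (poly G c)) 0 \<in> P" using mA by blast
    thus "\<exists>c. b - hmon (\<iota> c) 0 \<in> P" by (rule exI)
  qed
qed

text \<open>Locally at P the center of \<open>w y\<close> is generated by a monomial of value 1, and
  an element s of P outside the center has value 0. If the monomial divides s a, then
  \<open>w y\<close> shows that it divides a.\<close>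

lemma depth_special:
  assumes y: "y \<in> Y" and P: "prime_in P A" "Pt y \<subseteq> P" "P \<noteq> vertex" "P \<noteq> Pt y"
  shows "2 \<le> depth (localize A P)"
proof -
  interpret dval "w y" by (rule dval_w[OF y])
  define R where "R = localize A P"
  have S: "subdom R" unfolding R_def by (rule subdom_localize[OF subdom_A P(1)])
  have mP: "prime_in (max_ideal R) R" unfolding R_def by (rule prime_max_ideal_localize[OF subdom_A P(1)])
  have RP: "P \<subseteq> max_ideal R" using max_ideal_localize_Int[OF subdom_A P(1)] unfolding R_def by blast
  obtain x n where x: "x \<noteq> 0" "w y (hmon x n) = 1" using ex_hmon_value[OF y] by blast
  have "hmon x n \<in> vge (w y) 1" "hmon x n \<in> vring (w y)" using x by (simp_all add: vge_def)
  hence xm: "hmon x n \<in> max_ideal R" unfolding R_def by (intro hmon_in_localize_special(2)[OF y P(1-3)])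
  obtain s where s: "s \<in> P" "s \<notin> Pt y" using P(2,4) by blast
  have sA: "s \<in> A" using s(1) ideal_inD(1)[OF prime_inD(1)[OF P(1)]] by blast
  have unit: "d \<noteq> 0 \<and> w y d = 0" if d: "d \<in> A" "d \<notin> Pt y" for d
  proof -
    have "d \<in> vring (w y)" using d(1) A_subset_vring[OF y] by blast
    thus ?thesis using d unfolding Pt_def by (auto simp: vge_def)
  qed
  show ?thesis unfolding R_def[symmetric]
  proof (rule depth_ge2[OF S xm _ _ prime_inD(1)[OF mP]])
    show "hmon x n \<noteq> 0" using x by simp
    show "s \<in> max_ideal R" using s(1) RP by blast
    fix a b assume a: "a \<in> R" and b: "b \<in> R" and ab: "s * a = hmon x n * b"
    obtain d where d: "d \<in> A" "d \<notin> P" "d \<noteq> 0" "d * a \<in> A" "d * b \<in> A"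
      by (rule common_denominator[OF subdom_A P(1) a[unfolded R_def] b[unfolded R_def]])
    have dA: "d * a \<in> A" by (rule d(4))
    obtain f where f: "d * a = to_fract f" "to_fract f \<in> A" by (rule in_AE[OF dA])
    have "d * b \<in> vring (w y)" using d(5) A_subset_vring[OF y] by blast
    hence "hmon x n * (d * b) \<in> vge (w y) 1" using x by (simp add: vge_mult_nonzero_iff)
    moreover have "hmon x n * (d * b) = s * (d * a)" using ab by (simp add: mult_ac)
    ultimately have "s * (d * a) \<in> vge (w y) 1" by simp
    hence f1: "to_fract f \<in> vge (w y) 1" using unit[OF sA s(2)] f(1) by (simp add: vge_mult_nonzero_iff)
    define x' where "x' = inverse x"
    have x': "x' \<noteq> 0" "hmon x' (- n) * hmon x n = 1" using x(1) by (simp_all add: x'_def hmon_mult)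
    have "w y (hmon x' (- n)) + w y (hmon x n) = 0" using mult[of "hmon x' (- n)" "hmon x n"] x(1) x' by simp
    hence "w y (hmon x' (- n)) = - 1" using x(2) by simp
    hence "hmon x' (- n) * to_fract f \<in> vring (w y)" using f1 x'(1) by (simp add: vge_mult_nonzero_iff)
    hence fx: "to_fract f * hmon x' (- n) \<in> vring (w y)" by (simp only: mult.commute)
    have fR: "to_fract f * hmon x' (- n) \<in> R" unfolding to_fract_mult_hmon R_def
      by (intro subdom_sum[OF S[unfolded R_def]] hmon_in_localize_special(1)[OF y P(1-3)])
        (use fx laurent_in_vge_iff[OF y x'(1), of f "- n" 0] in blast)
    have "inverse d \<in> R" unfolding R_def by (rule inverse_in_localize[OF subdom_A P(1) d(1,2)])
    hence c: "inverse d * (to_fract f * hmon x' (- n)) \<in> R" using fR by (rule subdom_mult[OF S])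
    have "hmon x n * (inverse d * (to_fract f * hmon x' (- n))) = inverse d * to_fract f * (hmon x' (- n) * hmon x n)"
      by (simp only: mult_ac)
    also have "\<dots> = a" using x'(2) d(3) unfolding f(1)[symmetric] by simp
    finally show "\<exists>c\<in>R. a = hmon x n * c" using c by (intro bexI[OF _ c]) simp
  qed
qed

text \<open>By \<open>homogeneous_regular\<close> a monomial regular along all \<open>w y\<close>
  has degree at least 0, so no terms of negative degree survive. This extends functions across the
  vertex.\<close>

lemma regular_laurent_in_A:
  assumes x: "x \<noteq> 0" and g: "\<And>y. y \<in> Y \<Longrightarrow> to_fract f * hmon x n \<in> vring (w y)"
  shows "to_fract f * hmon x n \<in> A"
  unfolding to_fract_mult_hmon
proof (rule subdom_sum[OF subdom_A])
  fix m
  have v: "hmon (coeff f m * x) (int m + n) \<in> vring (w y)" if y: "y \<in> Y" for y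
    using g[OF y] laurent_in_vge_iff[OF y x, of f n 0] by blast
  show "hmon (coeff f m * x) (int m + n) \<in> A"
  proof (cases "coeff f m = 0")
    case False
    hence nz: "coeff f m * x \<noteq> 0" using x by simp
    have "0 \<le> w y (hmon (coeff f m * x) (int m + n))" if y: "y \<in> Y" for y
      using v[OF y] nz by (simp add: vge_def)
    hence "int m + n \<ge> 0" using homogeneous_regular(1)[OF nz] by blast
    thus ?thesis using v by (rule hmon_in_A)
  qed (use subdom_zero[OF subdom_A] in simp)
qed

text \<open>The regular sequence consists of a monomial of positive degree and an element s of value
  0 along each \<open>w y\<close> where the monomial vanishes. A fraction that can be written with
  either denominator is then regular along every \<open>w y\<close>.\<close>

lemma depth_vertex: "2 \<le> depth (localize A vertex)"
proof -
  define R where "R = localize A vertex"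
  have S: "subdom R" unfolding R_def by (rule subdom_localize[OF subdom_A prime_vertex])
  have mP: "prime_in (max_ideal R) R" unfolding R_def by (rule prime_max_ideal_localize[OF subdom_A prime_vertex])
  have RP: "vertex \<subseteq> max_ideal R" using max_ideal_localize_Int[OF subdom_A prime_vertex] unfolding R_def by blast
  obtain y0 where y0: "y0 \<in> Y" using ex_point by blast
  obtain n x where x: "n > (0::nat)" "x \<noteq> 0" "hmon x (int n) \<in> A" "hmon x (int n) \<in> vertex" "w y0 (hmon x (int n)) = 1"
    by (rule ex_homogeneous_in_A[OF y0 fsupp_0, of 1 0]) simp_all
  define Z where "Z = {y\<in>Y. w y (hmon x (int n)) \<noteq> 0}"
  have finZ: "finite Z" using fsupp_w[of "hmon x (int n)"] x(2) unfolding Z_def fsupp_def by simp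
  define B where "B = (\<lambda>y. if y \<in> Z then 1 else (0::int))"
  have "{y \<in> Y. B y \<noteq> 0} \<subseteq> Z" unfolding B_def by (rule subsetI) (simp split: if_splits)
  hence fB: "fsupp B" unfolding fsupp_def by (rule finite_subset[OF _ finZ])
  have ex: "\<exists>c. y \<in> Z \<longrightarrow> c \<in> vertex \<and> c \<noteq> 0 \<and> w y c = 0 \<and> (\<forall>z\<in>Z. z \<noteq> y \<longrightarrow> 1 \<le> w z c)" for y
  proof (cases "y \<in> Z")
    case True
    hence y: "y \<in> Y" by (simp add: Z_def)
    obtain n' x' where h: "x' \<noteq> 0" "hmon x' (int n') \<in> vertex" "w y (hmon x' (int n')) = 0"
      "\<And>z. z \<in> Y \<Longrightarrow> z \<noteq> y \<Longrightarrow> B z \<le> w z (hmon x' (int n'))"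
      by (rule ex_homogeneous_in_A[OF y fB, of 0 0]) (simp_all add: B_def)
    have "1 \<le> w z (hmon x' (int n'))" if z: "z \<in> Z" "z \<noteq> y" for z
    proof -
      have "z \<in> Y" using z(1) by (simp add: Z_def)
      thus ?thesis using h(4)[OF _ z(2)] z(1) by (simp add: B_def)
    qed
    thus ?thesis using h(1-3) by (intro exI[of _ "hmon x' (int n')"]) simp
  qed simp
  have "\<forall>y. \<exists>c. y \<in> Z \<longrightarrow> c \<in> vertex \<and> c \<noteq> 0 \<and> w y c = 0 \<and> (\<forall>z\<in>Z. z \<noteq> y \<longrightarrow> 1 \<le> w z c)" by (intro allI ex)
  from choice[OF this] obtain c where c': "\<forall>y. y \<in> Z \<longrightarrow> c y \<in> vertex \<and> c y \<noteq> 0 \<and> w y (c y) = 0 \<and>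
    (\<forall>z\<in>Z. z \<noteq> y \<longrightarrow> 1 \<le> w z (c y))" by (elim exE)
  have c: "c y \<in> vertex" "c y \<noteq> 0" "w y (c y) = 0" "\<And>z. z \<in> Z \<Longrightarrow> z \<noteq> y \<Longrightarrow> 1 \<le> w z (c y)" if y: "y \<in> Z" for y
    using c' y by simp_all
  \<comment> \<open>At a point y of Z the summand belonging to y has value 0 and the others have
    value at least 1, so s has value 0 there.\<close>
  define s where "s = sum c Z"
  have sv: "s \<in> vertex" unfolding s_def by (rule ideal_in_sum[OF prime_inD(1)[OF prime_vertex] c(1)])
  have ws: "s \<noteq> 0 \<and> w y s = 0" if y: "y \<in> Z" for y
  proof -
    interpret dval "w y" by (rule dval_w) (use y in \<open>simp add: Z_def\<close>)
    have "sum c (Z - {y}) \<in> vge (w y) 1"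
    proof (rule vge_sum)
      fix z assume "z \<in> Z - {y}"
      hence z: "z \<in> Z" "z \<noteq> y" by simp_all
      have "1 \<le> w y (c z)" by (rule c(4)[OF z(1) y not_sym[OF z(2)]])
      thus "c z \<in> vge (w y) 1" by (rule vgeI)
    qed
    hence "c y + sum c (Z - {y}) \<noteq> 0" "w y (c y + sum c (Z - {y})) = w y (c y)"
      using v_add_eq[OF c(2)[OF y]] c(3)[OF y] by simp_all
    thus ?thesis using c(3)[OF y] sum.remove[OF finZ y, of c] by (simp add: s_def)
  qed
  show ?thesis unfolding R_def[symmetric]
  proof (rule depth_ge2[OF S _ _ _ prime_inD(1)[OF mP]])
    show "hmon x (int n) \<in> max_ideal R" "s \<in> max_ideal R" using x(4) sv RP by blast+
    show "hmon x (int n) \<noteq> 0" using x(2) by simp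
    fix a b assume a: "a \<in> R" and b: "b \<in> R" and ab: "s * a = hmon x (int n) * b"
    obtain d where d: "d \<in> A" "d \<notin> vertex" "d \<noteq> 0" "d * a \<in> A" "d * b \<in> A"
      by (rule common_denominator[OF subdom_A prime_vertex a[unfolded R_def] b[unfolded R_def]])
    have dA: "d * a \<in> A" by (rule d(4))
    obtain f where f: "d * a = to_fract f" "to_fract f \<in> A" by (rule in_AE[OF dA])
    define x' where "x' = inverse x"
    have x': "x' \<noteq> 0" "hmon x (int n) * hmon x' (- int n) = 1" using x(2) by (simp_all add: x'_def hmon_mult)
    define g where "g = to_fract f * hmon x' (- int n)"
    have g1: "hmon x (int n) * g = d * a" using x'(2) f(1) by (simp add: g_def mult_ac)
    have "hmon x (int n) * (s * g) = s * (d * a)" using g1 by (simp add: mult_ac)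
    also have "\<dots> = hmon x (int n) * (d * b)" using ab by (simp add: mult_ac)
    finally have g2: "s * g = d * b" using x(2) by simp
    have "g \<in> vring (w y)" if y: "y \<in> Y" for y
    proof -
      interpret dval "w y" by (rule dval_w[OF y])
      have v: "d * a \<in> vring (w y)" "d * b \<in> vring (w y)" using d(4,5) A_subset_vring[OF y] by blast+
      show ?thesis
      proof (cases "y \<in> Z")
        case True
        thus ?thesis using v(2) ws[OF True] unfolding g2[symmetric] by (simp add: vge_mult_nonzero_iff)
      next
        case False
        hence "w y (hmon x (int n)) = 0" using y by (simp add: Z_def)
        thus ?thesis using v(1) x(2) unfolding g1[symmetric] by (simp add: vge_mult_nonzero_iff)
      qed
    qed
    hence "g \<in> A" unfolding g_def by (rule regular_laurent_in_A[OF x'(1)])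
    hence gR: "g \<in> R" using subset_localize[OF subdom_A prime_vertex] unfolding R_def by blast
    have "inverse d \<in> R" unfolding R_def by (rule inverse_in_localize[OF subdom_A prime_vertex d(1,2)])
    hence cR: "inverse d * g \<in> R" using gR by (rule subdom_mult[OF S])
    have "hmon x (int n) * (inverse d * g) = inverse d * (hmon x (int n) * g)" by (simp only: mult_ac)
    also have "\<dots> = a" unfolding g1 using d(3) by simp
    finally show "\<exists>c\<in>R. a = hmon x (int n) * c" by (intro bexI[OF _ cR]) simp
  qed
qed

subsection \<open>Classification of primes\<close>

lemma krull_dim_UNIV_eq_0: "krull_dim (UNIV :: 'b::field set) = 0"
proof -
  have z: "P = {0}" if P: "prime_in P (UNIV :: 'b set)" for P
  proof -
    have "a = 0" if a: "a \<in> P" for a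
    proof (rule ccontr)
      assume "a \<noteq> 0"
      have "inverse a * a \<in> P" by (rule ideal_inD(4)[OF prime_inD(1)[OF P] UNIV_I a])
      thus False using \<open>a \<noteq> 0\<close> prime_inD(2)[OF P] by simp
    qed
    thus ?thesis using ideal_inD(2)[OF prime_inD(1)[OF P]] by blast
  qed
  have "krull_dim (UNIV :: 'b set) \<le> enat 0"
  proof (rule krull_dim_leI)
    fix P :: "nat \<Rightarrow> 'b set" show "\<not> prime_chain UNIV (Suc 0) P"
    proof
      assume "prime_chain UNIV (Suc 0) P"
      hence "prime_in (P 0) UNIV" "prime_in (P 1) UNIV" "P 0 \<subset> P 1"
        unfolding prime_chain_def by (simp_all add: spec_iff[OF subdom_UNIV, symmetric])
      thus False using z[of "P 0"] z[of "P 1"] by simp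
    qed
  qed
  thus ?thesis unfolding zero_enat_def[symmetric] by simp
qed

lemma vfract_hmon:
  fixes \<pi> :: "'a poly"
  assumes \<pi>: "prime_elem \<pi>" "\<not> \<pi> dvd [:0, 1:]" and x: "x \<noteq> 0"
  shows "vfract (vprime \<pi>) (hmon x n) = 0"
proof -
  interpret dval "vfract (vprime \<pi>)" by (rule dval_vprime[OF \<pi>(1)])
  have "\<not> \<pi> dvd [:x:]"
  proof
    assume "\<pi> dvd [:x:]"
    hence "degree \<pi> \<le> degree [:x:]" using x by (intro dvd_imp_degree_le) simp_all
    thus False using prime_elem_degree_pos[OF \<pi>(1)] by simp
  qed
  thus ?thesis using x \<pi>(2) by (simp add: hmon_def mult v_powi \<chi>_def vfract_vprime_unit[OF \<pi>(1)])
qed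

text \<open>Monomials are units along \<pi> because \<pi> does not divide \<chi>. Hence the center
  of \<pi> contains no \<open>Pt y\<close>, and the localization contains all polynomials.\<close>

lemma localize_center_vprime:
  fixes \<pi> :: "'a poly"
  assumes \<pi>: "prime_elem \<pi>" "\<not> \<pi> dvd [:0, 1:]"
  defines "Q \<equiv> vge (vfract (vprime \<pi>)) 1 \<inter> A"
  shows "prime_in Q A" "localize A Q = vring (vfract (vprime \<pi>))"
proof -
  interpret dval "vfract (vprime \<pi>)" by (rule dval_vprime[OF \<pi>(1)])
  have A: "A \<subseteq> vring (vfract (vprime \<pi>))" unfolding A_def using to_fract_in_vring_vprime[OF \<pi>(1)] by blast
  note center = localize_center[OF subdom_A A, folded Q_def]
  show P: "prime_in Q A" by (rule center(1))
  note S = subdom_localize[OF subdom_A P]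

  have "\<not> Pt y \<subseteq> Q" if y: "y \<in> Y" for y
  proof -
    obtain n x where h: "n > (0::nat)" "x \<noteq> 0" "hmon x (int n) \<in> A" "w y (hmon x (int n)) = 1"
      by (rule ex_homogeneous_in_A[OF y fsupp_0, of 1 0]) simp_all
    have "hmon x (int n) \<in> Pt y" using h(3,4) unfolding Pt_def by (simp add: vge_def)
    moreover have "hmon x (int n) \<notin> Q" using vfract_hmon[OF \<pi> h(2), of "int n"] h(2) unfolding Q_def by (simp add: vge_def)
    ultimately show ?thesis by blast
  qed
  note generic = hmon_in_localize_generic[OF P this]
  have poly_in: "to_fract f \<in> localize A Q" for f
    unfolding to_fract_eq_sum_hmon[of f] by (intro subdom_sum[OF S] generic)
  show "localize A Q = vring (vfract (vprime \<pi>))"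
  proof
    show "localize A Q \<subseteq> vring (vfract (vprime \<pi>))" by (rule center(2))
    show "vring (vfract (vprime \<pi>)) \<subseteq> localize A Q"
    proof (rule vring_vprime_subset[OF \<pi>(1) S poly_in])
      fix b assume b: "\<not> \<pi> dvd b"
      hence "b \<noteq> 0" by (intro notI) simp
      hence "to_fract b \<notin> vge (vfract (vprime \<pi>)) 1" using vfract_vprime_unit[OF \<pi>(1) b] by (simp add: vge_def)
      thus "to_fract b \<notin> max_ideal (localize A Q)" using center(3) by blast
    qed
  qed
qed

text \<open>The localization contains K[\<chi>, 1/\<chi>]. Unless P = 0, its maximal ideal meets
  K[\<chi>] in a prime generated by an element \<pi> of least degree; the localization then contains
  the valuation ring of \<pi>, which is a maximal proper subring.\<close>

lemma localize_generic:
  assumes P: "prime_in P A" "\<And>y. y \<in> Y \<Longrightarrow> \<not> Pt y \<subseteq> P"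
  shows "P = {0} \<or> (\<exists>\<pi>. prime_elem \<pi> \<and> \<not> \<pi> dvd [:0, 1:] \<and> localize A P = vring (vfract (vprime \<pi>)))"
proof -
  define R m where "R = localize A P" and "m = max_ideal R"
  have S: "subdom R" unfolding R_def by (rule subdom_localize[OF subdom_A P(1)])
  have mP: "prime_in m R" unfolding m_def R_def by (rule prime_max_ideal_localize[OF subdom_A P(1)])
  note mI = prime_inD(1)[OF mP]
  have mA: "m \<inter> A = P" unfolding m_def R_def by (rule max_ideal_localize_Int[OF subdom_A P(1)])
  have h: "hmon x n \<in> R" for x n unfolding R_def by (rule hmon_in_localize_generic[OF P])
  have poly_in: "to_fract f \<in> R" for f
    unfolding to_fract_eq_sum_hmon[of f] by (intro subdom_sum[OF S] h)
  show ?thesis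
  proof (cases "\<exists>f. f \<noteq> 0 \<and> to_fract f \<in> m")
    case False
    have "P = {0}"
    proof -
      have "a = 0" if a: "a \<in> P" for a
      proof -
        have "a \<in> A" using a ideal_inD(1)[OF prime_inD(1)[OF P(1)]] by blast
        then obtain f where f: "a = to_fract f" "to_fract f \<in> A" by (rule in_AE)
        have "to_fract f \<in> m" using a f(1) mA by blast
        thus ?thesis using False f(1) by auto
      qed
      thus ?thesis using zero_in_prime[OF subdom_A P(1)] by blast
    qed
    thus ?thesis ..
  next
    case True
    define N where "N = (LEAST n. \<exists>f. f \<noteq> 0 \<and> to_fract f \<in> m \<and> degree f = n)"
    have "\<exists>n f. f \<noteq> 0 \<and> to_fract f \<in> m \<and> degree f = n" using True by blast
    hence "\<exists>f. f \<noteq> 0 \<and> to_fract f \<in> m \<and> degree f = N" unfolding N_def by (rule LeastI_ex)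
    then obtain \<pi> where \<pi>: "\<pi> \<noteq> 0" "to_fract \<pi> \<in> m" "degree \<pi> = N" by blast
    have min: "N \<le> degree f" if f: "f \<noteq> 0" "to_fract f \<in> m" for f
      unfolding N_def by (rule Least_le) (use f in blast)
    have dvd: "\<pi> dvd f" if f: "to_fract f \<in> m" for f
    proof -
      have "f mod \<pi> = 0"
      proof (rule ccontr)
        assume nz: "f mod \<pi> \<noteq> 0"
        have "to_fract (f div \<pi>) * to_fract \<pi> \<in> m" by (rule ideal_inD(4)[OF mI poly_in \<pi>(2)])
        hence "to_fract f - to_fract (f div \<pi>) * to_fract \<pi> \<in> m" by (rule ideal_in_diff[OF mI S f])
        moreover have "f mod \<pi> = f - f div \<pi> * \<pi>" by (rule minus_div_mult_eq_mod[symmetric])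
        hence "to_fract (f mod \<pi>) = to_fract f - to_fract (f div \<pi>) * to_fract \<pi>" by simp
        ultimately have "to_fract (f mod \<pi>) \<in> m" by simp
        hence "N \<le> degree (f mod \<pi>)" by (rule min[OF nz])
        moreover have "degree (f mod \<pi>) < degree \<pi>" using degree_mod_less[OF \<pi>(1), of f] nz by simp
        ultimately show False using \<pi>(3) by simp
      qed
      thus ?thesis by (rule mod_0_imp_dvd)
    qed
    have dvd_iff: "to_fract f \<in> m \<longleftrightarrow> \<pi> dvd f" for f
    proof
      assume "\<pi> dvd f"
      then obtain g where g: "f = \<pi> * g" by (elim dvdE)
      have "to_fract g * to_fract \<pi> \<in> m" by (rule ideal_inD(4)[OF mI poly_in \<pi>(2)])
      thus "to_fract f \<in> m" by (simp add: g mult.commute)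
    qed (rule dvd)
    have pr: "prime_elem \<pi>"
      unfolding prime_elem_def
    proof (intro conjI allI impI)
      show "\<pi> \<noteq> 0" by (rule \<pi>(1))
      show "\<not> \<pi> dvd 1" using dvd_iff[of 1] prime_inD(2)[OF mP] by simp
      fix a b assume "\<pi> dvd a * b"
      hence "to_fract a * to_fract b \<in> m" using dvd_iff[of "a * b"] by simp
      thus "\<pi> dvd a \<or> \<pi> dvd b" using prime_inD(3)[OF mP poly_in poly_in] dvd_iff by blast
    qed
    have n\<chi>: "\<not> \<pi> dvd [:0, 1:]"
    proof
      assume "\<pi> dvd [:0, 1:]"
      hence "\<chi> \<in> m" using dvd_iff unfolding \<chi>_def by blast
      hence "hmon 1 (- 1) * \<chi> \<in> m" by (rule ideal_inD(4)[OF mI h])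
      moreover have "hmon 1 (- 1) * \<chi> = (1 :: 'a poly fract)" by (simp add: hmon_def flip: one_pCons)
      ultimately show False using prime_inD(2)[OF mP] by simp
    qed
    interpret dval "vfract (vprime \<pi>)" by (rule dval_vprime[OF pr])
    have sub: "vring (vfract (vprime \<pi>)) \<subseteq> R"
      by (rule vring_vprime_subset[OF pr S poly_in]) (use dvd_iff in \<open>simp add: m_def\<close>)
    have "R \<subseteq> vring (vfract (vprime \<pi>))"
    proof (rule ccontr)
      assume "\<not> ?thesis"
      then obtain u where "u \<in> R" "u \<notin> vring (vfract (vprime \<pi>))" by blast
      hence "R = UNIV" by (rule overring_eq_UNIV[OF S sub])
      hence "to_fract \<pi> \<notin> m" unfolding m_def max_ideal_def using \<pi>(1) by simp
      thus False using \<pi>(2) by blast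
    qed
    hence "R = vring (vfract (vprime \<pi>))" using sub by (rule subset_antisym)
    thus ?thesis using pr n\<chi> unfolding R_def by blast
  qed
qed

lemma prime_cases:
  assumes P: "prime_in P A"
  obtains "P = {0}" | y where "y \<in> Y" "P = Pt y"
    | \<pi> where "prime_elem \<pi>" "\<not> \<pi> dvd [:0, 1:]" "localize A P = vring (vfract (vprime \<pi>))"
    | "maximal_in P A" "2 \<le> depth (localize A P)"
proof (cases "\<exists>y\<in>Y. Pt y \<subseteq> P")
  case False
  thus ?thesis using localize_generic[OF P] that(1,3) by blast
next
  case True
  then obtain y where y: "y \<in> Y" "Pt y \<subseteq> P" by blast
  show ?thesis
  proof (cases "P = vertex")
    case True
    show ?thesis by (rule that(4)) (use maximal_vertex depth_vertex True in simp_all)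
  next
    case nv: False
    show ?thesis
    proof (cases "P = Pt y")
      case True thus ?thesis by (rule that(2)[OF y(1)])
    next
      case False
      show ?thesis by (rule that(4)[OF maximal_special[OF y(1) P y(2) nv False] depth_special[OF y(1) P y(2) nv False]])
    qed
  qed
qed


section \<open>Dimension and Cohen-Macaulay property of the graded ring\<close>

lemma frac_field_A: "frac_field A = UNIV"
proof -
  obtain y where y: "y \<in> Y" using ex_point by blast
  have "x \<in> frac_field A" for x
  proof -
    interpret dval "w y" by (rule dval_w[OF y])
    have loc: "\<exists>a b. a \<in> A \<and> b \<in> A \<and> b \<noteq> 0 \<and> u = a / b" if u: "u \<in> vring (w y)" for u
    proof -
      have "u \<in> localize A (Pt y)" using u localize_Pt[OF y] by simp
      then obtain a b where "u = a / b" "a \<in> A" "b \<in> A" "b \<notin> Pt y" unfolding localize_def by blast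
      moreover from this have "b \<noteq> 0" using zero_in_prime[OF subdom_A prime_Pt[OF y]] by blast
      ultimately show ?thesis by blast
    qed
    have "x \<in> frac_field (vring (w y))" using frac_field_vring by simp
    then obtain u v where uv: "x = u / v" "u \<in> vring (w y)" "v \<in> vring (w y)" "v \<noteq> 0" unfolding frac_field_def by blast
    obtain a b where ab: "a \<in> A" "b \<in> A" "b \<noteq> 0" "u = a / b" using loc[OF uv(2)] by blast
    obtain c d where cd: "c \<in> A" "d \<in> A" "d \<noteq> 0" "v = c / d" using loc[OF uv(3)] by blast
    have "c \<noteq> 0" using uv(4) cd(4) by auto
    have "x = (a * d) / (b * c)" using cd(3) by (simp add: uv(1) ab(4) cd(4))
    moreover have "a * d \<in> A" "b * c \<in> A" by (intro subdom_mult[OF subdom_A] ab cd)+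
    moreover have "b * c \<noteq> 0" using ab(3) \<open>c \<noteq> 0\<close> by simp
    ultimately show ?thesis unfolding frac_field_def by blast
  qed
  thus ?thesis by blast
qed

lemma maximal_in_no_larger_prime: "maximal_in P A \<Longrightarrow> prime_in Q A \<Longrightarrow> \<not> P \<subset> Q"
  using maximal_in_subset_eq by blast

text \<open>The middle prime of a chain is not maximal, so unless it is 0 its localization is a
  discrete valuation ring, and then only 0 lies strictly below it.\<close>

lemma prime_between:
  assumes "prime_in P A" "prime_in Q A" "prime_in Q' A" "P \<subset> Q" "Q \<subset> Q'"
  shows "P = {0}"
proof (rule prime_cases[OF assms(2)])
  assume "Q = {0}"
  thus ?thesis using assms(4) zero_in_prime[OF subdom_A assms(1)] by blast
next
  fix y assume y: "y \<in> Y" "Q = Pt y"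
  show ?thesis by (rule dval.no_prime_below_center[OF dval_w[OF y(1)] subdom_A assms(1,2) _ assms(4)]) (simp add: y localize_Pt)
next
  fix \<pi> :: "'a poly" assume "prime_elem \<pi>" "localize A Q = vring (vfract (vprime \<pi>))"
  thus ?thesis by (intro dval.no_prime_below_center[OF dval_vprime subdom_A assms(1,2) _ assms(4)])
next
  assume "maximal_in Q A"
  thus ?thesis using maximal_in_no_larger_prime[OF _ assms(3)] assms(5) by blast
qed

lemma krull_dim_A: "krull_dim A = 2"
proof (rule antisym)
  have "krull_dim A \<le> enat 2"
  proof (rule krull_dim_leI)
    fix P show "\<not> prime_chain A (Suc 2) P"
    proof
      assume c: "prime_chain A (Suc 2) P"
      have pr: "prime_in (P i) A" if i: "i \<le> 3" for i using c i spec_iff[OF subdom_A] unfolding prime_chain_def by simp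
      have lt: "P i \<subset> P (Suc i)" if i: "i < 3" for i using c i unfolding prime_chain_def by simp
      have "P 1 = {0}" using prime_between[OF pr pr pr, of 1 2 3] lt[of 1] lt[of 2] by (simp add: numeral_eq_Suc)
      moreover have "0 \<in> P 0" by (rule zero_in_prime[OF subdom_A pr]) simp
      ultimately show False using lt[of 0] by auto
    qed
  qed
  thus "krull_dim A \<le> 2" by (simp add: numeral_eq_enat)
  obtain y where y: "y \<in> Y" using ex_point by blast
  define P where "P = (\<lambda>i::nat. if i = 0 then {0} else if i = 1 then Pt y else vertex)"
  have 0: "prime_in (P i) A" for i unfolding P_def using prime_in_zero[OF subdom_A] prime_Pt[OF y] prime_vertex by simp
  have "{0} \<subset> Pt y" using zero_in_prime[OF subdom_A prime_Pt[OF y]] Pt_neq_0[OF y] by blast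
  hence 1: "P 0 \<subset> P 1" unfolding P_def by simp
  have "Pt y \<subset> vertex" using Pt_subset_vertex[OF y] Pt_neq_vertex[OF y] by blast
  hence 2: "P 1 \<subset> P 2" unfolding P_def by simp
  have "P i \<subset> P (Suc i)" if i: "i < 2" for i
  proof (cases "i = 0")
    case True thus ?thesis using 1 by simp
  next
    case False
    hence "i = 1" using i by simp
    thus ?thesis using 2 by (simp add: numeral_2_eq_2)
  qed
  hence "prime_chain A 2 P" unfolding prime_chain_def using 0 spec_iff[OF subdom_A] by simp
  hence "enat 2 \<le> krull_dim A" by (rule krull_dim_geI)
  thus "2 \<le> krull_dim A" by (simp add: numeral_eq_enat)
qed

lemma localize_zero: "localize A {0} = UNIV"
proof -
  have "localize A {0} = frac_field A" unfolding localize_def frac_field_def by simp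
  thus ?thesis using frac_field_A by simp
qed

lemma cohen_macaulay_A:
  assumes P: "prime_in P A"
  shows "cohen_macaulay_local (localize A P)"
proof (rule cohen_macaulay_localI[OF subdom_A P], rule prime_cases[OF P])
  assume "P = {0}"
  thus "krull_dim (localize A P) \<le> depth (localize A P)" by (simp add: localize_zero krull_dim_UNIV_eq_0)
next
  fix y assume y: "y \<in> Y" "P = Pt y"
  thus "krull_dim (localize A P) \<le> depth (localize A P)"
    using dval.krull_dim_vring[OF dval_w[OF y(1)]] dval.one_le_depth_vring[OF dval_w[OF y(1)]] by (simp add: localize_Pt)
next
  fix \<pi> :: "'a poly" assume \<pi>: "prime_elem \<pi>" "localize A P = vring (vfract (vprime \<pi>))"
  thus "krull_dim (localize A P) \<le> depth (localize A P)"
    using dval.krull_dim_vring[OF dval_vprime[OF \<pi>(1)]] dval.one_le_depth_vring[OF dval_vprime[OF \<pi>(1)]] by simp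
next
  assume "2 \<le> depth (localize A P)"
  moreover have "krull_dim (localize A P) \<le> 2" using krull_dim_localize_le[OF subdom_A P] by (simp add: krull_dim_A)
  ultimately show "krull_dim (localize A P) \<le> depth (localize A P)" by (rule order_trans[rotated])
qed

lemma height_1_cases:
  assumes P: "prime_in P A" and h: "height A P = 1"
  obtains y where "y \<in> Y" "P = Pt y"
    | \<pi> where "prime_elem \<pi>" "\<not> \<pi> dvd [:0, 1:]" "localize A P = vring (vfract (vprime \<pi>))"
proof (rule prime_cases[OF P])
  assume "P = {0}"
  thus ?thesis using h by (simp add: height_def localize_zero krull_dim_UNIV_eq_0)
next
  assume "2 \<le> depth (localize A P)"
  also have "\<dots> \<le> krull_dim (localize A P)" by (rule depth_localize_le[OF subdom_A P])
  finally show ?thesis using h by (simp add: height_def one_enat_def numeral_eq_enat)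
qed (use that in blast)+

lemma height_Pt: "y \<in> Y \<Longrightarrow> height A (Pt y) = 1"
  by (simp add: height_def localize_Pt dval.krull_dim_vring[OF dval_w])

end


section \<open>Differential forms\<close>

lemma frac_field_UNIV: "frac_field UNIV = (UNIV :: 'b::field set)"
proof -
  have "x \<in> frac_field UNIV" for x :: 'b
    unfolding frac_field_def by (intro CollectI exI[of _ x] exI[of _ 1]) simp
  thus ?thesis by blast
qed

lemma det_mat_1: "det (mat 1 1 f) = f (0, 0)"
  by (subst det_single) auto

lemma det_mat_2: "det (mat 2 2 f) = f (0, 0) * f (1, 1) - f (0, 1) * f (1, 0)"
  by (subst laplace_expansion_row[of _ 2 0]) (auto simp: cofactor_def mat_delete_def det_single numeral_2_eq_2)

lemma wedge_d_1: "wedge_d C F 1 x D = (if D 0 \<in> derivations C F then D 0 (x 0) else 0)"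
  unfolding wedge_d_def det_mat_1 by simp

lemma wedge_d_2:
  "wedge_d C F 2 x D = (if D 0 \<in> derivations C F \<and> D 1 \<in> derivations C F
    then D 0 (x 0) * D 1 (x 1) - D 0 (x 1) * D 1 (x 0) else 0)"
  unfolding wedge_d_def det_mat_2 by (simp add: numeral_2_eq_2 All_less_Suc conj_commute)

text \<open>In the following \<open>\<eta>\<close> is a basis of the forms of the field of fractions and \<open>J\<close> is the Jacobian
  with respect to it.\<close>

lemma forms_eq_multiples:
  assumes frac: "frac_field R = UNIV"
    and dep: "\<And>x. wedge_d C UNIV n x = (\<lambda>D. J x * \<eta> D)"
    and gen: "\<And>x. \<forall>j<n. x j \<in> R \<Longrightarrow> \<exists>a\<in>R. J x = a * J x0"
    and x0: "\<forall>j<n. x0 j \<in> R" and R: "subdom R"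
  shows "forms C n R = {\<lambda>D. a * (J x0 * \<eta> D) | a. a \<in> R}"
proof
  show "forms C n R \<subseteq> {\<lambda>D. a * (J x0 * \<eta> D) | a. a \<in> R}"
  proof
    fix \<omega> assume "\<omega> \<in> forms C n R"
    then obtain r :: nat and a x where r: "\<omega> = (\<lambda>D. \<Sum>i<r. a i * wedge_d C UNIV n (x i) D)"
      "\<forall>i<r. a i \<in> R \<and> (\<forall>j<n. x i j \<in> R)" unfolding forms_def frac by blast
    have "\<forall>i. \<exists>b. i < r \<longrightarrow> b \<in> R \<and> J (x i) = b * J x0" using gen r(2) by blast
    from choice[OF this] obtain b where b: "\<forall>i. i < r \<longrightarrow> b i \<in> R \<and> J (x i) = b i * J x0" by (elim exE)
    have "\<omega> D = (\<Sum>i<r. a i * b i) * (J x0 * \<eta> D)" for D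
      unfolding r(1) dep sum_distrib_right by (rule sum.cong) (use b in \<open>simp_all add: mult_ac\<close>)
    moreover have "(\<Sum>i<r. a i * b i) \<in> R" using r(2) b by (intro subdom_sum[OF R] subdom_mult[OF R]) simp_all
    ultimately show "\<omega> \<in> {\<lambda>D. a * (J x0 * \<eta> D) | a. a \<in> R}" by blast
  qed
  show "{\<lambda>D. a * (J x0 * \<eta> D) | a. a \<in> R} \<subseteq> forms C n R"
  proof
    fix \<omega> assume "\<omega> \<in> {\<lambda>D. a * (J x0 * \<eta> D) | a. a \<in> R}"
    then obtain a where a: "\<omega> = (\<lambda>D. a * (J x0 * \<eta> D))" "a \<in> R" by blast
    have "\<omega> = (\<lambda>D. \<Sum>i<Suc 0. (\<lambda>_. a) i * wedge_d C (frac_field R) n ((\<lambda>_. x0) i) D)"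
      unfolding a(1) frac dep by simp
    thus "\<omega> \<in> forms C n R" unfolding forms_def using a(2) x0
      by (intro CollectI exI[of _ "Suc 0"] exI[of _ "\<lambda>_. a"] exI[of _ "\<lambda>_. x0"] conjI) simp_all
  qed
qed

lemma forms_UNIV:
  assumes dep: "\<And>x. wedge_d C UNIV n x = (\<lambda>D. J x * \<eta> D)" and x0: "J x0 = 1"
  shows "forms C n UNIV = {\<lambda>D. a * \<eta> D | a. True}"
proof -
  have "forms C n UNIV = {\<lambda>D. a * (J x0 * \<eta> D) | a. a \<in> UNIV}"
    by (rule forms_eq_multiples[OF frac_field_UNIV dep]) (simp_all add: x0)
  thus ?thesis by (simp add: x0)
qed

text \<open>N is the least order of a Jacobian with entries in the valuation ring and is attained at
  x0, so \<open>J x0\<close> times \<eta> generates the forms of the ring. The tuple D0, on which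
  \<eta> does not vanish, allows \<eta> to be cancelled from equations between forms.\<close>

lemma (in dval) ord_form_eq:
  assumes dep: "\<And>x. wedge_d C UNIV n x = (\<lambda>D. J x * \<eta> D)"
    and J: "\<And>x. \<forall>j<n. x j \<in> vring v \<Longrightarrow> J x \<in> vge v N"
    and x0: "\<forall>j<n. x0 j \<in> vring v" "J x0 \<noteq> 0" "v (J x0) = N"
    and \<eta>: "\<eta> D0 \<noteq> 0" and g: "g \<noteq> 0"
  shows "ord_form C n (vring v) (\<lambda>D. g * \<eta> D) = v g - N"
proof -
  have gen: "\<exists>a\<in>vring v. J x = a * J x0" if x: "\<forall>j<n. x j \<in> vring v" for x
  proof (intro bexI)
    show "J x = J x / J x0 * J x0" using x0(2) by simp
    have "J x0 * (J x / J x0) \<in> vge v N" using J[OF x] x0(2) by simp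
    hence "J x / J x0 \<in> vge v (N - v (J x0))" by (simp only: vge_mult_nonzero_iff[OF x0(2)])
    thus "J x / J x0 \<in> vring v" by (simp only: x0(3) diff_self)
  qed
  have F: "forms C n (vring v) = {\<lambda>D. a * (J x0 * \<eta> D) | a. a \<in> vring v}"
    by (rule forms_eq_multiples[OF frac_field_vring dep gen x0(1) subdom_vring])
  show ?thesis unfolding ord_form_def F
  proof (rule the_equality)
    have "(\<lambda>D. g * \<eta> D) = (\<lambda>D. g / J x0 * (J x0 * \<eta> D))" using x0(2) by simp
    moreover have "v g - N = ord_at (vring v) (g / J x0)" using x0 g by (simp add: ord_at_vring v_divide)
    ultimately show "\<exists>\<eta>' g'. {\<lambda>D. a * (J x0 * \<eta> D) | a. a \<in> vring v} = {\<lambda>D. a * \<eta>' D | a. a \<in> vring v} \<and>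
      (\<lambda>D. g * \<eta> D) = (\<lambda>D. g' * \<eta>' D) \<and> v g - N = ord_at (vring v) g'"
      by (intro exI[of _ "\<lambda>D. J x0 * \<eta> D"] exI[of _ "g / J x0"] conjI refl)
    fix e assume "\<exists>\<eta>' g'. {\<lambda>D. a * (J x0 * \<eta> D) | a. a \<in> vring v} = {\<lambda>D. a * \<eta>' D | a. a \<in> vring v} \<and>
      (\<lambda>D. g * \<eta> D) = (\<lambda>D. g' * \<eta>' D) \<and> e = ord_at (vring v) g'"
    then obtain \<eta>' g' where *: "{\<lambda>D. a * (J x0 * \<eta> D) | a. a \<in> vring v} = {\<lambda>D. a * \<eta>' D | a. a \<in> vring v}"
      "(\<lambda>D. g * \<eta> D) = (\<lambda>D. g' * \<eta>' D)" "e = ord_at (vring v) g'" by (elim exE conjE)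
    \<comment> \<open>Any other generator differs from this one by a unit, so the order does not
      depend on the choice made in \<open>ord_form\<close>.\<close>
    have one: "1 \<in> vring v" by (rule subdom_one[OF subdom_vring])
    have "(\<lambda>D. 1 * (J x0 * \<eta> D)) \<in> {\<lambda>D. a * \<eta>' D | a. a \<in> vring v}" unfolding *(1)[symmetric] using one by blast
    then obtain a where a: "(\<lambda>D. 1 * (J x0 * \<eta> D)) = (\<lambda>D. a * \<eta>' D)" "a \<in> vring v" by blast
    have "(\<lambda>D. 1 * \<eta>' D) \<in> {\<lambda>D. a * (J x0 * \<eta> D) | a. a \<in> vring v}" unfolding *(1) using one by blast
    then obtain b where b: "(\<lambda>D. 1 * \<eta>' D) = (\<lambda>D. b * (J x0 * \<eta> D))" "b \<in> vring v" by blast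
    have 1: "J x0 * \<eta> D0 = a * \<eta>' D0" using fun_cong[OF a(1), of D0] by simp
    have 2: "\<eta>' D0 = b * (J x0 * \<eta> D0)" using fun_cong[OF b(1), of D0] by simp
    have 3: "g * \<eta> D0 = g' * \<eta>' D0" using fun_cong[OF *(2), of D0] .
    have "a * b * (J x0 * \<eta> D0) = 1 * (J x0 * \<eta> D0)" using 1 2 by (simp add: mult_ac)
    hence ab: "a * b = 1" using x0(2) \<eta> by simp
    hence nz: "a \<noteq> 0" "b \<noteq> 0" by auto
    have "v a + v b = 0" using mult[OF nz] ab by simp
    moreover have "v a \<ge> 0" "v b \<ge> 0" using a(2) b(2) nz by (simp_all add: vge_def)
    ultimately have vb: "v b = 0" by linarith
    have "g * \<eta> D0 = g' * b * J x0 * \<eta> D0" using 2 3 by (simp add: mult_ac)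
    hence g': "g = g' * b * J x0" using \<eta> by simp
    hence "g' \<noteq> 0" using g by auto
    thus "e = v g - N" using g' nz x0 vb by (simp add: *(3) ord_at_vring mult)
  qed
qed

subsection \<open>Extension of derivations to fields of fractions\<close>

definition fract_deriv :: "('b::idom \<Rightarrow> 'b) \<Rightarrow> 'b fract \<Rightarrow> 'b fract"
  where "fract_deriv d x = (THE z. \<exists>a b. b \<noteq> 0 \<and> x = to_fract a / to_fract b \<and>
    z = (to_fract (d a) * to_fract b - to_fract a * to_fract (d b)) / to_fract b ^ 2)"

locale ring_derivation =
  fixes d :: "'b::idom \<Rightarrow> 'b"
  assumes d_add: "d (x + y) = d x + d y" and d_mult: "d (x * y) = x * d y + y * d x"
begin

lemma fract_deriv_quotient:
  assumes "b \<noteq> 0"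
  shows "fract_deriv d (to_fract a / to_fract b) =
    (to_fract (d a) * to_fract b - to_fract a * to_fract (d b)) / to_fract b ^ 2"
  unfolding fract_deriv_def
proof (rule the_equality)
  fix z assume "\<exists>a' b'. b' \<noteq> 0 \<and> to_fract a / to_fract b = to_fract a' / to_fract b' \<and>
    z = (to_fract (d a') * to_fract b' - to_fract a' * to_fract (d b')) / to_fract b' ^ 2"
  then obtain a' b' where *: "b' \<noteq> 0" "to_fract a / to_fract b = to_fract a' / to_fract b'"
    "z = (to_fract (d a') * to_fract b' - to_fract a' * to_fract (d b')) / to_fract b' ^ 2" by (elim exE conjE)
  define A B A' B' where AB: "A = to_fract a" "B = to_fract b" "A' = to_fract a'" "B' = to_fract b'"
  have nz: "B \<noteq> 0" "B' \<noteq> 0" using assms *(1) by (simp_all add: AB)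
  have eq: "A * B' = A' * B" using *(2) nz unfolding AB[symmetric] by (simp add: field_simps)
  hence "to_fract (a * b') = to_fract (a' * b)" by (simp add: AB)
  hence "a * b' = a' * b" by (simp only: to_fract_eq_iff)
  hence "d (a * b') = d (a' * b)" by simp
  hence "to_fract (a * d b' + b' * d a) = to_fract (a' * d b + b * d a')" unfolding d_mult by simp
  hence deq: "A * to_fract (d b') + B' * to_fract (d a) = A' * to_fract (d b) + B * to_fract (d a')" by (simp add: AB)
  have "(to_fract (d a) * B - A * to_fract (d b)) * B' ^ 2 =
    B * B' * (A * to_fract (d b') + B' * to_fract (d a)) - B * (A * B') * to_fract (d b') - (A * B') * (B' * to_fract (d b))"
    by (simp add: algebra_simps power2_eq_square)
  also have "\<dots> = B * B' * (A' * to_fract (d b) + B * to_fract (d a')) - B * (A' * B) * to_fract (d b') - (A' * B) * (B' * to_fract (d b))"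
    by (simp only: deq eq)
  also have "\<dots> = (to_fract (d a') * B' - A' * to_fract (d b')) * B ^ 2"
    by (simp add: algebra_simps power2_eq_square)
  finally show "z = (to_fract (d a) * to_fract b - to_fract a * to_fract (d b)) / to_fract b ^ 2"
    unfolding *(3) AB[symmetric] using nz by (simp add: frac_eq_eq)
qed (use assms in blast)

lemma d_one: "d 1 = 0"
proof -
  have "d 1 + d 1 = d 1 + 0" using d_mult[of 1 1] by (simp only: mult_1 add_0_right)
  thus ?thesis by (rule add_left_imp_eq)
qed

lemma fract_deriv_to_fract: "fract_deriv d (to_fract a) = to_fract (d a)"
  using fract_deriv_quotient[of 1 a] by (simp add: d_one)

lemma fract_deriv_add_mult:
  "fract_deriv d (x + y) = fract_deriv d x + fract_deriv d y"
  "fract_deriv d (x * y) = x * fract_deriv d y + y * fract_deriv d x"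
proof -
  obtain a b where ab: "b \<noteq> 0" "x = to_fract a / to_fract b" by (rule fract_quotient)
  obtain a' b' where ab': "b' \<noteq> 0" "y = to_fract a' / to_fract b'" by (rule fract_quotient)
  define A B A' B' where AB: "A = to_fract a" "B = to_fract b" "A' = to_fract a'" "B' = to_fract b'"
  have nz: "B \<noteq> 0" "B' \<noteq> 0" "b * b' \<noteq> 0" using ab(1) ab'(1) by (simp_all add: AB)
  have xy: "x = A / B" "y = A' / B'" using ab ab' by (simp_all add: AB)
  have dx: "fract_deriv d x = (to_fract (d a) * B - A * to_fract (d b)) / B ^ 2"
    "fract_deriv d y = (to_fract (d a') * B' - A' * to_fract (d b')) / B' ^ 2"
    unfolding ab(2) ab'(2) fract_deriv_quotient[OF ab(1)] fract_deriv_quotient[OF ab'(1)] AB by simp_all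
  have s: "x + y = to_fract (a * b' + a' * b) / to_fract (b * b')" using nz by (simp add: xy AB[symmetric] field_simps)
  have "fract_deriv d (x + y) = ((A * to_fract (d b') + B' * to_fract (d a) + (A' * to_fract (d b) + B * to_fract (d a'))) * (B * B')
      - (A * B' + A' * B) * (B * to_fract (d b') + B' * to_fract (d b))) / (B * B') ^ 2"
    unfolding s fract_deriv_quotient[OF nz(3)] by (simp only: d_add d_mult to_fract_add to_fract_mult AB[symmetric])
  also have "\<dots> = fract_deriv d x + fract_deriv d y" unfolding dx using nz by (simp add: field_simps power2_eq_square)
  finally show "fract_deriv d (x + y) = fract_deriv d x + fract_deriv d y" .
  have s: "x * y = to_fract (a * a') / to_fract (b * b')" by (simp add: xy AB)
  have "fract_deriv d (x * y) = ((A * to_fract (d a') + A' * to_fract (d a)) * (B * B')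
      - A * A' * (B * to_fract (d b') + B' * to_fract (d b))) / (B * B') ^ 2"
    unfolding s fract_deriv_quotient[OF nz(3)] by (simp only: d_mult to_fract_add to_fract_mult AB[symmetric])
  also have "\<dots> = x * fract_deriv d y + y * fract_deriv d x" unfolding dx unfolding xy using nz by (simp add: field_simps power2_eq_square)
  finally show "fract_deriv d (x * y) = x * fract_deriv d y + y * fract_deriv d x" .
qed

lemma fract_deriv_in_derivations:
  assumes "\<And>c. c \<in> C \<Longrightarrow> fract_deriv d c = 0"
  shows "fract_deriv d \<in> derivations C UNIV"
  unfolding derivations_def using assms fract_deriv_add_mult by auto

end

lemma ring_derivation_pderiv: "ring_derivation (pderiv :: 'b::idom poly \<Rightarrow> 'b poly)"
  by unfold_locales (simp_all add: pderiv_add pderiv_mult)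

lemma ring_derivation_map_poly:
  fixes D :: "'b::field \<Rightarrow> 'b"
  assumes D: "D \<in> derivations C UNIV"
  shows "ring_derivation (map_poly D)"
proof
  note D0 = derivationsD(4)[OF D]
  fix f g :: "'b poly"
  show "map_poly D (f + g) = map_poly D f + map_poly D g"
    by (rule poly_eqI) (simp add: coeff_map_poly D0 derivationsD(1)[OF D])
  have Ds: "D (sum h I) = (\<Sum>i\<in>I. D (h i))" for h :: "nat \<Rightarrow> 'b" and I
    by (induction I rule: infinite_finite_induct) (simp_all add: D0 derivationsD(1)[OF D])
  show "map_poly D (f * g) = f * map_poly D g + g * map_poly D f"
  proof (rule poly_eqI)
    fix n
    have "coeff (map_poly D (f * g)) n = (\<Sum>i\<le>n. coeff f i * D (coeff g (n - i)) + coeff g (n - i) * D (coeff f i))"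
      by (simp add: coeff_map_poly D0 coeff_mult Ds derivationsD(2)[OF D])
    also have "\<dots> = (\<Sum>i\<le>n. coeff f i * D (coeff g (n - i))) + (\<Sum>i\<le>n. D (coeff f i) * coeff g (n - i))"
      by (simp only: sum.distrib mult.commute)
    also have "\<dots> = coeff (f * map_poly D g) n + coeff (map_poly D f * g) n"
      by (simp add: coeff_map_poly D0 coeff_mult)
    also have "map_poly D f * g = g * map_poly D f" by (rule mult.commute)
    finally show "coeff (map_poly D (f * g)) n = coeff (f * map_poly D g + g * map_poly D f) n" by simp
  qed
qed

text \<open>The factor x on the left avoids the exponent n - 1; this is the shape needed for the
  logarithmic derivations \<tau> d/d\<tau> and \<chi> d/d\<chi>.\<close>

lemma derivation_powi:
  assumes D: "D \<in> derivations C UNIV" and x: "x \<noteq> 0"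
  shows "x * D (x powi n) = of_int n * x powi n * D x"
proof -
  have nat: "x * D (x ^ m) = of_nat m * x ^ m * D x" for m
    by (induction m) (simp_all add: derivationsD[OF D] algebra_simps)
  show ?thesis
  proof (cases n rule: int_cases4)
    case (nonneg m) thus ?thesis using nat by simp
  next
    case (neg m)
    have xm: "x ^ m \<noteq> 0" using x by simp
    have "D (x ^ m * inverse (x ^ m)) = 0" using xm derivationsD(5)[OF D] by simp
    hence "x ^ m * D (inverse (x ^ m)) = - (inverse (x ^ m) * D (x ^ m))"
      unfolding derivationsD(2)[OF D] by (simp add: eq_neg_iff_add_eq_0)
    hence "x ^ m * (x * D (inverse (x ^ m))) = - (inverse (x ^ m) * (x * D (x ^ m)))" by (simp add: mult_ac)
    also have "\<dots> = - (of_nat m * D x)" unfolding nat using xm by simp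
    finally have "x * D (inverse (x ^ m)) = - (of_nat m * inverse (x ^ m) * D x)" using xm by (simp add: field_simps)
    thus ?thesis using neg by (simp add: power_int_minus)
  qed
qed

subsection \<open>Forms on the curve\<close>

lemma subdom_of_int: "subdom R \<Longrightarrow> of_int n \<in> R"
proof -
  assume R: "subdom R"
  have nat: "of_nat m \<in> R" for m by (induction m) (use subdom_add[OF R] subdom_one[OF R] subdom_zero[OF R] in simp_all)
  show ?thesis by (cases n rule: int_cases4) (use nat subdom_minus[OF R] in simp_all)
qed

context smooth_projective_curve
begin

text \<open>The difference of both sides is a derivation that kills t, and t is not constant because
  D0 t = 1; so \<open>derivation_eq_0\<close> applies.\<close>

lemma derivation_multiple:
  assumes D0: "D0 \<in> derivations k UNIV" "D0 t = 1" and D: "D \<in> derivations k UNIV"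
  shows "D x = D t * D0 x"
proof -
  have t: "t \<notin> k" using D0(2) derivationsD(3)[OF D0(1), of t] by (intro notI) simp
  have "(\<lambda>x. D x - D t * D0 x) x = 0"
  proof (rule derivation_eq_0[of "\<lambda>x. x" "\<lambda>x. D x - D t * D0 x" t])
    fix a have "\<iota> a \<in> k" by blast
    thus "D (\<iota> a) - D t * D0 (\<iota> a) = 0" using derivationsD(3)[OF D, of "\<iota> a"] derivationsD(3)[OF D0(1), of "\<iota> a"] by simp
  qed (use t D0 in \<open>simp_all add: derivationsD[OF D] derivationsD[OF D0(1)] algebra_simps\<close>)
  thus ?thesis by simp
qed

lemma derivation_uniformizer_neq_0:
  assumes D0: "D0 \<in> derivations k UNIV" "D0 t = 1" and y: "y \<in> Y" and \<tau>: "\<tau> \<noteq> 0" "ord_at y \<tau> = 1"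
  shows "D0 \<tau> \<noteq> 0"
proof
  assume 0: "D0 \<tau> = 0"
  have "\<tau> \<notin> k"
  proof
    assume "\<tau> \<in> k"
    then obtain c where c: "\<tau> = \<iota> c" by blast
    hence "c \<noteq> 0" using \<tau>(1) \<iota>_zero by auto
    thus False using ord_\<iota>[OF y, of c] c \<tau>(2) by simp
  qed
  have "D0 t = 0"
  proof (rule derivation_eq_0[of "\<lambda>x. x" D0 \<tau>])
    fix a have "\<iota> a \<in> k" by blast
    thus "D0 (\<iota> a) = 0" by (rule derivationsD(3)[OF D0(1)])
  qed (use 0 \<open>\<tau> \<notin> k\<close> in \<open>simp_all add: derivationsD[OF D0(1)]\<close>)
  thus False using D0(2) by simp
qed

lemma derivation_cmult:
  assumes "D \<in> derivations C UNIV"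
  shows "(\<lambda>x. c * D x) \<in> derivations C UNIV"
  unfolding derivations_def using derivationsD(1-3)[OF assms] by (simp add: algebra_simps)

text \<open>Taylor expansion: f = s + \<tau>^N g with s a polynomial in \<tau> over k, so that D s
  is regular. The pole of D g is bounded independently of g and is cancelled by \<tau>^N.\<close>

lemma derivation_regular:
  assumes D: "D \<in> derivations k UNIV" and y: "y \<in> Y" and \<tau>: "\<tau> \<noteq> 0" "ord_at y \<tau> = 1" "D \<tau> = 1" and f: "f \<in> y"
  shows "D f \<in> y"
proof -
  interpret dval "ord_at y" by (rule dval_point[OF y])
  have vr: "vring (ord_at y) = y" by (rule vring_point[OF y])
  have S: "subdom y" using subdom_vring vr by simp
  have "\<tau> \<in> vring (ord_at y)" using \<tau>(2) by (simp add: vge_def)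
  hence \<tau>y: "\<tau> \<in> y" unfolding vr .
  have \<tau>n: "\<tau> ^ n \<in> y" for n by (rule subdom_power[OF S \<tau>y])
  have D\<tau>n: "D (\<tau> ^ n) \<in> y" for n
  proof (induction n)
    case 0 thus ?case using subdom_zero[OF S] by (simp add: derivationsD[OF D])
  next
    case (Suc n)
    have "D (\<tau> ^ Suc n) = \<tau> * D (\<tau> ^ n) + \<tau> ^ n" by (simp add: derivationsD[OF D] \<tau>(3))
    thus ?case using subdom_add[OF S subdom_mult[OF S \<tau>y Suc] \<tau>n] by simp
  qed
  have \<iota>y: "\<iota> c \<in> y" for c using k_subset_point[OF y] by blast
  have expand: "\<exists>s g. f = s + \<tau> ^ n * g \<and> g \<in> y \<and> D s \<in> y" for n
  proof (induction n)
    case 0 show ?case using f subdom_zero[OF S] by (intro exI[of _ 0] exI[of _ f]) (simp add: derivationsD[OF D])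
  next
    case (Suc n)
    then obtain s g where sg: "f = s + \<tau> ^ n * g" "g \<in> y" "D s \<in> y" by (elim exE conjE)
    obtain c where c: "g - \<iota> c \<in> vge (ord_at y) 1" using residue_point[OF y sg(2)] by blast
    define g' where "g' = (g - \<iota> c) / \<tau>"
    have "\<tau> * g' \<in> vge (ord_at y) 1" using c \<tau>(1) by (simp add: g'_def)
    hence "g' \<in> vring (ord_at y)" using \<tau> by (simp add: vge_mult_nonzero_iff)
    hence g': "g' \<in> y" unfolding vr .
    have Dc: "D (\<iota> c) = 0" by (rule derivationsD(3)[OF D]) blast
    have "D (s + \<iota> c * \<tau> ^ n) = D s + \<iota> c * D (\<tau> ^ n)" by (simp add: derivationsD[OF D] Dc)
    hence "D (s + \<iota> c * \<tau> ^ n) \<in> y" using subdom_add[OF S sg(3) subdom_mult[OF S \<iota>y D\<tau>n]] by simp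
    moreover have "\<tau> * g' = g - \<iota> c" using \<tau>(1) by (simp add: g'_def)
    hence "\<tau> ^ Suc n * g' = \<tau> ^ n * (g - \<iota> c)" by (simp add: mult_ac)
    hence "f = (s + \<iota> c * \<tau> ^ n) + \<tau> ^ Suc n * g'" by (simp only: sg(1)) (simp add: algebra_simps)
    ultimately show ?case using g' by (intro exI[of _ "s + \<iota> c * \<tau> ^ n"] exI[of _ g']) simp
  qed
  obtain N where N: "\<forall>f\<in>y. D f \<in> vge (ord_at y) (- int N)" using derivation_pole_bounded[OF D y] by blast
  obtain s g where sg: "f = s + \<tau> ^ N * g" "g \<in> y" "D s \<in> y" using expand[of N] by (elim exE conjE)
  have "\<tau> ^ N \<in> vge (ord_at y) (int N)" using \<tau> by (simp add: vge_def v_power)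
  moreover have "D g \<in> vge (ord_at y) (- int N)" using N sg(2) by blast
  ultimately have "\<tau> ^ N * D g \<in> vge (ord_at y) (int N + - int N)" by (rule vge_mult)
  hence 1: "\<tau> ^ N * D g \<in> y" using vr by simp
  have "D f = D s + (\<tau> ^ N * D g + g * D (\<tau> ^ N))" by (simp add: sg(1) derivationsD[OF D])
  thus ?thesis using subdom_add[OF S sg(3) subdom_add[OF S 1 subdom_mult[OF S sg(2) D\<tau>n]]] by simp
qed

lemma wedge_d_curve:
  assumes D0: "D0 \<in> derivations k UNIV" "D0 t = 1"
  shows "wedge_d k UNIV 1 x = (\<lambda>D. D0 (x 0) * wedge_d k UNIV 1 (\<lambda>_. t) D)"
  unfolding wedge_d_1 using derivation_multiple[OF D0] by (intro ext) (simp add: mult.commute)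

text \<open>The forms of the local ring are generated by d\<tau> = (D0 \<tau>) dt, whence the term -
  ord (D0 \<tau>). The derivation D0 divided by D0 \<tau> is regular at y, which bounds all other
  differentials.\<close>

lemma ord_form_point:
  assumes D0: "D0 \<in> derivations k UNIV" "D0 t = 1" and y: "y \<in> Y" and \<tau>: "\<tau> \<noteq> 0" "ord_at y \<tau> = 1" and g: "g \<noteq> 0"
  shows "ord_form k 1 y (\<lambda>D. g * wedge_d k UNIV 1 (\<lambda>_. t) D) = ord_at y g - ord_at y (D0 \<tau>)"
proof -
  interpret dval "ord_at y" by (rule dval_point[OF y])
  have vr: "vring (ord_at y) = y" by (rule vring_point[OF y])
  have nz: "D0 \<tau> \<noteq> 0" by (rule derivation_uniformizer_neq_0[OF D0 y \<tau>])
  have "(\<lambda>x. inverse (D0 \<tau>) * D0 x) \<in> derivations k UNIV" by (rule derivation_cmult[OF D0(1)])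
  hence reg: "inverse (D0 \<tau>) * D0 f \<in> y" if f: "f \<in> y" for f
    using derivation_regular[OF _ y \<tau> _ f, of "\<lambda>x. inverse (D0 \<tau>) * D0 x"] nz by simp
  have "ord_form k 1 (vring (ord_at y)) (\<lambda>D. g * wedge_d k UNIV 1 (\<lambda>_. t) D) = ord_at y g - ord_at y (D0 \<tau>)"
  proof (rule ord_form_eq[where J = "\<lambda>x. D0 (x 0)" and ?x0.0 = "\<lambda>_. \<tau>" and ?D0.0 = "\<lambda>_. D0"])
    show "wedge_d k UNIV 1 x = (\<lambda>D. D0 (x 0) * wedge_d k UNIV 1 (\<lambda>_. t) D)" for x by (rule wedge_d_curve[OF D0])
    show "D0 (x 0) \<in> vge (ord_at y) (ord_at y (D0 \<tau>))" if x: "\<forall>j<1. x j \<in> vring (ord_at y)" for x :: "nat \<Rightarrow> 'a"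
    proof -
      have "x 0 \<in> y" using x[THEN spec, of 0] vr by simp
      hence "inverse (D0 \<tau>) * D0 (x 0) \<in> vring (ord_at y)" unfolding vr by (rule reg)
      hence "D0 \<tau> * (inverse (D0 \<tau>) * D0 (x 0)) \<in> vge (ord_at y) (ord_at y (D0 \<tau>))" using nz by (simp add: vge_mult_nonzero_iff)
      moreover have "D0 \<tau> * (inverse (D0 \<tau>) * D0 (x 0)) = D0 (x 0)" using nz by simp
      ultimately show ?thesis by (simp only:)
    qed
    show "\<forall>j<1. \<tau> \<in> vring (ord_at y)" using \<tau>(2) by (simp add: vge_def)
    show "wedge_d k UNIV 1 (\<lambda>_. t) (\<lambda>_. D0) \<noteq> 0" unfolding wedge_d_1 using D0 by simp
  qed (use nz g in simp_all)
  thus ?thesis unfolding vr .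
qed

text \<open>The nontrivial derivation is extracted from \<omega> itself: a nonzero value of \<omega>
  yields a derivation that does not kill some x, and rescaling normalizes it to 1 there.\<close>

lemma canonical_divisor_form:
  assumes "canonical_divisor \<iota> Y K"
  obtains D0 t g where "D0 \<in> derivations k UNIV" "D0 t = 1" "g \<noteq> 0"
    "\<And>y \<tau>. y \<in> Y \<Longrightarrow> \<tau> \<noteq> 0 \<Longrightarrow> ord_at y \<tau> = 1 \<Longrightarrow> K y = of_int (ord_at y g - ord_at y (D0 \<tau>))"
proof -
  obtain \<omega> where \<omega>: "\<omega> \<in> forms k 1 UNIV" "\<omega> \<noteq> (\<lambda>_. 0)" "\<forall>y\<in>Y. K y = of_int (ord_form k 1 y \<omega>)"
    using assms unfolding canonical_divisor_def by blast
  obtain r :: nat and a x where r: "\<omega> = (\<lambda>D. \<Sum>i<r. a i * wedge_d k UNIV 1 (x i) D)"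
    using \<omega>(1) unfolding forms_def frac_field_UNIV by blast
  obtain D where D: "\<omega> D \<noteq> 0" using \<omega>(2) by blast
  obtain i where "a i * wedge_d k UNIV 1 (x i) D \<noteq> 0" using D unfolding r by (meson sum.neutral)
  hence D1: "D 0 \<in> derivations k UNIV" "D 0 (x i 0) \<noteq> 0" unfolding wedge_d_1 by (auto split: if_splits)
  define D0 where "D0 = (\<lambda>u. inverse (D 0 (x i 0)) * D 0 u)"
  have D0: "D0 \<in> derivations k UNIV" "D0 (x i 0) = 1" unfolding D0_def using derivation_cmult[OF D1(1)] D1(2) by simp_all
  have "forms k 1 UNIV = {\<lambda>D. a * wedge_d k UNIV 1 (\<lambda>_. x i 0) D | a. True}"
    by (rule forms_UNIV[OF wedge_d_curve[OF D0], of "\<lambda>_. x i 0"]) (rule D0(2))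
  then obtain g where g: "\<omega> = (\<lambda>D. g * wedge_d k UNIV 1 (\<lambda>_. x i 0) D)" using \<omega>(1) by blast
  have g0: "g \<noteq> 0" using \<omega>(2) g by (intro notI) simp
  show ?thesis
  proof (rule that[OF D0 g0])
    fix y \<tau> assume "y \<in> Y" "\<tau> \<noteq> 0" "ord_at y \<tau> = 1"
    thus "K y = of_int (ord_at y g - ord_at y (D0 \<tau>))" using \<omega>(3) ord_form_point[OF D0 _ _ _ g0] unfolding g by simp
  qed
qed

end


subsection \<open>Forms on the surface\<close>

lemma hmon_of_int: "hmon (of_int c * x) n = of_int c * hmon x n"
proof -
  have nat: "hmon (of_nat m * x) n = of_nat m * hmon x n" for m
    by (induction m) (simp_all add: distrib_right flip: hmon_add)
  have minus: "hmon (- u) n = - hmon u n" for u :: 'a using hmon_diff[of 0 n u] by simp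
  show ?thesis by (cases c rule: int_cases4) (use nat minus in simp_all)
qed

lemma const_field_eq: "const_field \<iota> = range (\<lambda>c. hmon (\<iota> c) 0)"
  by (simp add: const_field_def hmon_def)

locale dpd_derivation = dpd \<iota> Y p q
  for \<iota> :: "'k::{alg_closed_field, field_char_0} \<Rightarrow> 'a::field" and Y :: "'a set set" and p q :: "'a set \<Rightarrow> int" +
  fixes D0 :: "'a \<Rightarrow> 'a" and t :: 'a
  assumes D0: "D0 \<in> derivations k UNIV" "D0 t = 1"
begin

text \<open>D0 acts on the coefficients; with \<Xi> below, these are the partial derivatives with
  respect to t and \<chi>.\<close>

definition \<Theta> :: "'a poly fract \<Rightarrow> 'a poly fract" where "\<Theta> = fract_deriv (map_poly D0)"

definition \<Xi> :: "'a poly fract \<Rightarrow> 'a poly fract" where "\<Xi> = fract_deriv pderiv"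

lemma \<Theta>_to_fract: "\<Theta> (to_fract f) = to_fract (map_poly D0 f)"
  unfolding \<Theta>_def by (rule ring_derivation.fract_deriv_to_fract[OF ring_derivation_map_poly[OF D0(1)]])

lemma \<Xi>_to_fract: "\<Xi> (to_fract f) = to_fract (pderiv f)"
  unfolding \<Xi>_def by (rule ring_derivation.fract_deriv_to_fract[OF ring_derivation_pderiv])

lemma map_poly_const: "map_poly D0 [:c:] = [:D0 c:]"
  by (simp add: map_poly_pCons derivationsD(4)[OF D0(1)])

lemma \<Theta>_derivation: "\<Theta> \<in> derivations (const_field \<iota>) UNIV"
  unfolding \<Theta>_def
proof (rule ring_derivation.fract_deriv_in_derivations[OF ring_derivation_map_poly[OF D0(1)]])
  fix c assume "c \<in> const_field \<iota>"
  then obtain a where a: "c = to_fract [:\<iota> a:]" unfolding const_field_def by blast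
  have "D0 (\<iota> a) = 0" by (rule derivationsD(3)[OF D0(1)]) blast
  thus "fract_deriv (map_poly D0) c = 0" unfolding a \<Theta>_def[symmetric] \<Theta>_to_fract map_poly_const by simp
qed

lemma \<Xi>_derivation: "\<Xi> \<in> derivations (const_field \<iota>) UNIV"
  unfolding \<Xi>_def
proof (rule ring_derivation.fract_deriv_in_derivations[OF ring_derivation_pderiv])
  fix c assume "c \<in> const_field \<iota>"
  then obtain a where a: "c = to_fract [:\<iota> a:]" unfolding const_field_def by blast
  show "fract_deriv pderiv c = 0" unfolding a \<Xi>_def[symmetric] \<Xi>_to_fract by (simp add: pderiv_pCons)
qed

lemmas \<Theta>D = derivationsD[OF \<Theta>_derivation] and \<Xi>D = derivationsD[OF \<Xi>_derivation]

lemma \<Theta>_\<chi>: "\<Theta> \<chi> = 0"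
  unfolding \<chi>_def \<Theta>_to_fract by (simp add: map_poly_pCons derivationsD(4,5)[OF D0(1)])

lemma \<Xi>_\<chi>: "\<Xi> \<chi> = 1"
  unfolding \<chi>_def \<Xi>_to_fract by (simp add: pderiv_pCons flip: one_pCons)

lemma \<Theta>_hmon: "\<Theta> (hmon x n) = hmon (D0 x) n"
proof -
  have "\<chi> * \<Theta> (\<chi> powi n) = 0" using derivation_powi[OF \<Theta>_derivation \<chi>_nonzero, of n] by (simp add: \<Theta>_\<chi>)
  thus ?thesis by (simp add: hmon_def \<Theta>D \<Theta>_to_fract map_poly_const mult.commute)
qed

lemma \<Xi>_hmon: "\<chi> * \<Xi> (hmon x n) = of_int n * hmon x n"
proof -
  have "\<Xi> (to_fract [:x:]) = 0" unfolding \<Xi>_to_fract by (simp add: pderiv_pCons)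
  hence "\<chi> * \<Xi> (hmon x n) = to_fract [:x:] * (\<chi> * \<Xi> (\<chi> powi n))" by (simp add: hmon_def \<Xi>D mult_ac)
  also have "\<chi> * \<Xi> (\<chi> powi n) = of_int n * \<chi> powi n" using derivation_powi[OF \<Xi>_derivation \<chi>_nonzero, of n] by (simp add: \<Xi>_\<chi>)
  finally show ?thesis by (simp add: hmon_def mult_ac)
qed

text \<open>The difference of both sides kills t and \<chi>. Its restriction to K is a derivation
  into K(\<chi>), which \<open>derivation_eq_0\<close> shows to vanish; from there it vanishes on
  polynomials and on quotients.\<close>

lemma derivation_combination:
  assumes D: "D \<in> derivations (const_field \<iota>) UNIV"
  shows "D x = D (hmon t 0) * \<Theta> x + D \<chi> * \<Xi> x"
proof -
  define E where "E = (\<lambda>x. D x - (D (hmon t 0) * \<Theta> x + D \<chi> * \<Xi> x))"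
  have E: "E \<in> derivations (const_field \<iota>) UNIV"
    unfolding derivations_def E_def by (simp add: derivationsD(1-3)[OF D] \<Theta>D(1-3) \<Xi>D(1-3) algebra_simps)
  note ED = derivationsD[OF E]
  have \<Xi>c: "\<Xi> (hmon b 0) = 0" for b using \<Xi>_hmon[of b 0] by simp
  have Et: "E (hmon t 0) = 0" by (simp add: E_def \<Theta>_hmon D0(2) \<Xi>c)
  have E\<chi>: "E \<chi> = 0" by (simp add: E_def \<Theta>_\<chi> \<Xi>_\<chi>)
  have tk: "t \<notin> k" using D0(2) derivationsD(3)[OF D0(1), of t] by (intro notI) simp
  have Eb: "E (hmon b 0) = 0" for b
  proof (rule derivation_eq_0[of "\<lambda>x. hmon x 0" "\<lambda>x. E (hmon x 0)" t b])
    show "hmon (x + y) 0 = hmon x 0 + hmon y 0" for x y :: 'a by (rule hmon_add[symmetric])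
    show "hmon (x * y) 0 = hmon x 0 * hmon y 0" for x y :: 'a by (simp add: hmon_mult)
    show "E (hmon (x + y) 0) = E (hmon x 0) + E (hmon y 0)" for x y by (simp add: ED(1) flip: hmon_add)
    show "E (hmon (x * y) 0) = hmon x 0 * E (hmon y 0) + hmon y 0 * E (hmon x 0)" for x y
      using ED(2)[of "hmon x 0" "hmon y 0"] by (simp add: hmon_mult)
    show "E (hmon (\<iota> a) 0) = 0" for a by (rule ED(3)) (simp add: const_field_eq)
  qed (use tk Et in simp_all)
  have En: "E (\<chi> ^ n) = 0" for n by (induction n) (simp_all add: ED E\<chi>)
  have Eh: "E (hmon b (int n)) = 0" for b n
  proof -
    have "hmon b (int n) = hmon b 0 * \<chi> ^ n" by (simp add: hmon_def)
    thus ?thesis by (simp add: ED(2) Eb En)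
  qed
  have Esum: "E (sum g I) = (\<Sum>i\<in>I. E (g i))" for g :: "nat \<Rightarrow> 'a poly fract" and I
    by (induction I rule: infinite_finite_induct) (simp_all add: ED)
  have Ef: "E (to_fract f) = 0" for f unfolding to_fract_eq_sum_hmon[of f] Esum Eh by simp
  obtain a b where ab: "b \<noteq> 0" "x = to_fract a / to_fract b" by (rule fract_quotient)
  have "E x = 0" unfolding ab(2) derivation_divide[OF E, of "to_fract b"] using ab(1) by (subst derivation_divide[OF E]) (simp_all add: Ef)
  thus ?thesis by (simp add: E_def)
qed

definition J :: "(nat \<Rightarrow> 'a poly fract) \<Rightarrow> 'a poly fract" where "J x = \<Theta> (x 0) * \<Xi> (x 1) - \<Theta> (x 1) * \<Xi> (x 0)"

definition \<eta> :: "(nat \<Rightarrow> 'a poly fract \<Rightarrow> 'a poly fract) \<Rightarrow> 'a poly fract"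
  where "\<eta> = wedge_d (const_field \<iota>) UNIV 2 (\<lambda>j. if j = 0 then hmon t 0 else \<chi>)"

lemma wedge_d_surface: "wedge_d (const_field \<iota>) UNIV 2 x = (\<lambda>D. J x * \<eta> D)"
proof
  fix D
  show "wedge_d (const_field \<iota>) UNIV 2 x D = J x * \<eta> D"
  proof (cases "D 0 \<in> derivations (const_field \<iota>) UNIV \<and> D 1 \<in> derivations (const_field \<iota>) UNIV")
    case True
    have "wedge_d (const_field \<iota>) UNIV 2 x D = D 0 (x 0) * D 1 (x 1) - D 0 (x 1) * D 1 (x 0)"
      unfolding wedge_d_2 using True by simp
    also have "\<dots> = J x * (D 0 (hmon t 0) * D 1 \<chi> - D 0 \<chi> * D 1 (hmon t 0))"
      unfolding derivation_combination[OF conjunct1[OF True], of "x 0"] derivation_combination[OF conjunct1[OF True], of "x 1"]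
        derivation_combination[OF conjunct2[OF True], of "x 0"] derivation_combination[OF conjunct2[OF True], of "x 1"] J_def
      by (simp only: ring_distribs left_diff_distrib right_diff_distrib) (simp add: mult_ac)
    also have "D 0 (hmon t 0) * D 1 \<chi> - D 0 \<chi> * D 1 (hmon t 0) = \<eta> D" unfolding \<eta>_def wedge_d_2 using True by simp
    finally show ?thesis .
  next
    case False thus ?thesis unfolding \<eta>_def wedge_d_2 by auto
  qed
qed

lemma J_basis: "J (\<lambda>j. if j = 0 then hmon t 0 else \<chi>) = 1"
  using \<Xi>_hmon[of t 0] by (simp add: J_def \<Theta>_hmon D0(2) \<Theta>_\<chi> \<Xi>_\<chi>)

lemma \<eta>_neq_0: "\<eta> (\<lambda>j. if j = 0 then \<Theta> else \<Xi>) = 1"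
  using \<Xi>_hmon[of t 0] unfolding \<eta>_def wedge_d_2 by (simp add: \<Theta>_derivation \<Xi>_derivation \<Theta>_hmon D0(2) \<Theta>_\<chi> \<Xi>_\<chi>)

text \<open>Both partial derivatives preserve polynomials, hence the valuation ring of \<pi>, and
  the Jacobian of t and \<chi> is 1; so \<eta> generates the forms along \<pi>.\<close>

lemma ord_form_vprime:
  assumes \<pi>: "prime_elem \<pi>" and g: "g \<noteq> 0"
  shows "ord_form (const_field \<iota>) 2 (vring (vfract (vprime \<pi>))) (\<lambda>D. g * \<eta> D) = vfract (vprime \<pi>) g"
proof -
  interpret dval "vfract (vprime \<pi>)" by (rule dval_vprime[OF \<pi>])
  note poly = to_fract_in_vring_vprime[OF \<pi>]
  have reg: "D x \<in> vring (vfract (vprime \<pi>))"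
    if D: "D \<in> derivations (const_field \<iota>) UNIV" "\<And>f. \<exists>g. D (to_fract f) = to_fract g" and x: "x \<in> vring (vfract (vprime \<pi>))" for D x
  proof -
    obtain a b where ab: "\<not> \<pi> dvd b" "x = to_fract a / to_fract b" by (rule vring_vprime_quotient[OF \<pi> x])
    have b0: "b \<noteq> 0" using ab(1) by (intro notI) simp
    note vb = vfract_vprime_unit[OF \<pi> ab(1)]
    obtain a' b' where d: "D (to_fract a) = to_fract a'" "D (to_fract b) = to_fract b'" using D(2) by blast
    have "to_fract b ^ 2 * D x = to_fract (b * a' - a * b')"
      unfolding ab(2) using b0 by (simp add: derivation_divide[OF D(1)] d)
    hence "to_fract b ^ 2 * D x \<in> vring (vfract (vprime \<pi>))" by (simp only: poly)
    thus ?thesis using b0 vb by (simp add: vge_mult_nonzero_iff v_power)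
  qed
  have regs: "\<Theta> x \<in> vring (vfract (vprime \<pi>))" "\<Xi> x \<in> vring (vfract (vprime \<pi>))" if x: "x \<in> vring (vfract (vprime \<pi>))" for x
    by (rule reg[OF \<Theta>_derivation _ x], use \<Theta>_to_fract in blast) (rule reg[OF \<Xi>_derivation _ x], use \<Xi>_to_fract in blast)
  have "ord_form (const_field \<iota>) 2 (vring (vfract (vprime \<pi>))) (\<lambda>D. g * \<eta> D) = vfract (vprime \<pi>) g - 0"
  proof (rule ord_form_eq[where J = J and ?x0.0 = "\<lambda>j. if j = 0 then hmon t 0 else \<chi>" and ?D0.0 = "\<lambda>j. if j = 0 then \<Theta> else \<Xi>"])
    show "wedge_d (const_field \<iota>) UNIV 2 x = (\<lambda>D. J x * \<eta> D)" for x by (rule wedge_d_surface)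
    show "J x \<in> vring (vfract (vprime \<pi>))" if x: "\<forall>j<2. x j \<in> vring (vfract (vprime \<pi>))" for x :: "nat \<Rightarrow> 'a poly fract"
    proof -
      have x': "x 0 \<in> vring (vfract (vprime \<pi>))" "x 1 \<in> vring (vfract (vprime \<pi>))" using x by simp_all
      show ?thesis unfolding J_def by (intro subdom_diff[OF subdom_vring] subdom_mult[OF subdom_vring] regs x')
    qed
    have "hmon t 0 = to_fract [:t:]" by (simp add: hmon_def)
    thus "\<forall>j<2::nat. (if j = 0 then hmon t 0 else \<chi>) \<in> vring (vfract (vprime \<pi>))" using poly unfolding \<chi>_def by simp
  qed (simp_all add: J_basis \<eta>_neq_0 g)
  thus ?thesis by simp
qed

text \<open>Write x = u \<tau>^n with a unit u: the derivation \<tau> d/d\<tau> multiplies \<tau>^n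
  by n, and d/d\<tau> keeps u regular.\<close>

lemma derivation_leading_term:
  assumes y: "y \<in> Y" and \<tau>: "\<tau> \<noteq> 0" "ord_at y \<tau> = 1" and x: "x \<noteq> 0"
  shows "\<tau> * (D0 x / D0 \<tau>) - of_int (ord_at y x) * x \<in> vge (ord_at y) (ord_at y x + 1)"
proof -
  interpret dval "ord_at y" by (rule dval_point[OF y])
  have nz: "D0 \<tau> \<noteq> 0" by (rule derivation_uniformizer_neq_0[OF D0 y \<tau>])
  define D where "D = (\<lambda>x. inverse (D0 \<tau>) * D0 x)"
  have D: "D \<in> derivations k UNIV" unfolding D_def by (rule derivation_cmult[OF D0(1)])
  have D\<tau>: "D \<tau> = 1" using nz by (simp add: D_def)
  define n u where "n = ord_at y x" and "u = x / \<tau> powi n"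
  have \<tau>n: "\<tau> powi n \<noteq> 0" using \<tau>(1) by simp
  have u: "u \<noteq> 0" "ord_at y u = 0" using x \<tau> \<tau>n by (simp_all add: u_def v_divide v_powi n_def)
  have "u \<in> vring (ord_at y)" using u(2) by (simp add: vge_def)
  hence "u \<in> y" unfolding vring_point[OF y] .
  hence "D u \<in> y" by (rule derivation_regular[OF D y \<tau> D\<tau>])
  hence Du: "D u \<in> vring (ord_at y)" unfolding vring_point[OF y] .
  have xu: "x = u * \<tau> powi n" using \<tau>n by (simp add: u_def)
  have "\<tau> * D x = u * (\<tau> * D (\<tau> powi n)) + \<tau> * \<tau> powi n * D u" unfolding xu derivationsD(2)[OF D] by (simp add: algebra_simps)
  also have "\<tau> * D (\<tau> powi n) = of_int n * \<tau> powi n" using derivation_powi[OF D \<tau>(1), of n] D\<tau> by simp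
  finally have "\<tau> * D x - of_int n * x = \<tau> * \<tau> powi n * D u" by (simp add: xu algebra_simps)
  moreover have "\<tau> * \<tau> powi n \<in> vge (ord_at y) (n + 1)" using \<tau> \<tau>n by (intro vgeI) (simp add: mult v_powi)
  from vge_mult[OF this Du] have "\<tau> * \<tau> powi n * D u \<in> vge (ord_at y) (n + 1)" by simp
  ultimately have "\<tau> * D x - of_int n * x \<in> vge (ord_at y) (n + 1)" by simp
  thus ?thesis by (simp add: D_def n_def divide_inverse mult.commute)
qed

text \<open>With \<open>\<theta> = \<tau> \<partial>/\<partial>\<tau>\<close> and \<open>\<xi> = \<chi> \<partial>/\<partial>\<chi>\<close>, the derivation \<open>q \<theta> + p \<xi>\<close> multiplies a
  monomial by its valuation up to higher order. This gains one order over regularity.\<close>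

lemma ord_form_Pt:
  assumes y: "y \<in> Y" and \<tau>: "\<tau> \<noteq> 0" "ord_at y \<tau> = 1" and g: "g \<noteq> 0"
  shows "ord_form (const_field \<iota>) 2 (vring (w y)) (\<lambda>D. g * \<eta> D) = w y g - (1 - q y - p y + q y * ord_at y (D0 \<tau>))"
proof -
  interpret O: dval "ord_at y" by (rule dval_point[OF y])
  interpret dval "w y" by (rule dval_w[OF y])
  have nz: "D0 \<tau> \<noteq> 0" by (rule derivation_uniformizer_neq_0[OF D0 y \<tau>])
  obtain \<alpha> \<beta> where ab: "q y * \<alpha> + p y * \<beta> = 1" using bezout_pq[OF y] by blast
  have ab': "of_int (q y) * of_int \<alpha> + of_int (p y) * of_int \<beta> = (1 :: 'a poly fract)"
    unfolding of_int_mult[symmetric] of_int_add[symmetric] ab by simp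
  have int: "of_int c \<in> vring (w y)" for c by (rule subdom_of_int[OF subdom_vring])
  have int_mult: "of_int c * z \<in> vge (w y) e" if z: "z \<in> vge (w y) e" for c z e
    using vge_mult[OF int z] by simp
  define \<rho> where "\<rho> = hmon (\<tau> / D0 \<tau>) 0"
  define \<theta> \<xi> where "\<theta> = (\<lambda>z. \<rho> * \<Theta> z)" and "\<xi> = (\<lambda>z. \<chi> * \<Xi> z)"
  have \<theta>: "\<theta> \<in> derivations (const_field \<iota>) UNIV" and \<xi>: "\<xi> \<in> derivations (const_field \<iota>) UNIV"
    unfolding \<theta>_def \<xi>_def by (rule derivation_cmult[OF \<Theta>_derivation] derivation_cmult[OF \<Xi>_derivation])+
  have \<theta>h: "\<theta> (hmon x n) = hmon (\<tau> * (D0 x / D0 \<tau>)) n" for x n by (simp add: \<theta>_def \<rho>_def \<Theta>_hmon hmon_mult)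
  have \<xi>h: "\<xi> (hmon x n) = of_int n * hmon x n" for x n unfolding \<xi>_def by (rule \<Xi>_hmon)
  \<comment> \<open>E2 completes E1 to a basis change of determinant q \<alpha> + p \<beta> = 1 from
    \<theta> and \<xi>, so the Jacobian can be computed with E1 and E2 instead.\<close>
  define E1 E2 where "E1 = (\<lambda>z. of_int (q y) * \<theta> z + of_int (p y) * \<xi> z)"
    and "E2 = (\<lambda>z. of_int \<alpha> * \<xi> z - of_int \<beta> * \<theta> z)"
  have E: "E1 \<in> derivations (const_field \<iota>) UNIV" "E2 \<in> derivations (const_field \<iota>) UNIV"
    unfolding derivations_def E1_def E2_def
    by (simp_all add: derivationsD(1-3)[OF \<theta>] derivationsD(1-3)[OF \<xi>] algebra_simps)
  have mon: "E1 (hmon x n) \<in> vge (w y) 1 \<and> E2 (hmon x n) \<in> vring (w y)" if xn: "hmon x n \<in> vring (w y)" for x n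
  proof (cases "x = 0")
    case True thus ?thesis by (simp add: derivationsD(4)[OF E(1)] derivationsD(4)[OF E(2)])
  next
    case False
    define r where "r = \<tau> * (D0 x / D0 \<tau>) - of_int (ord_at y x) * x"
    have r: "r \<in> vge (ord_at y) (ord_at y x + 1)" unfolding r_def by (rule derivation_leading_term[OF y \<tau> False])
    have rh: "hmon r n \<in> vge (w y) (w y (hmon x n) + q y)"
    proof (cases "r = 0")
      case nr: False
      hence "ord_at y x + 1 \<le> ord_at y r" using r by (simp add: vge_def)
      hence "q y * (ord_at y x + 1) \<le> q y * ord_at y r" using q_pos[OF y] by (intro mult_left_mono) auto
      thus ?thesis using w_hmon[OF y nr, of n] w_hmon[OF y False, of n] by (intro vgeI) (simp add: algebra_simps)
    qed (simp add: vge_def)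
    have \<theta>x: "\<theta> (hmon x n) = of_int (ord_at y x) * hmon x n + hmon r n"
      unfolding \<theta>h by (simp add: r_def hmon_of_int[symmetric] hmon_add)
    have w0: "w y (hmon x n) \<ge> 0" using xn False by (simp add: vge_def)
    have r0: "hmon r n \<in> vge (w y) 1" by (rule vge_mono[OF rh]) (use w0 q_pos[OF y] in linarith)
    have "E1 (hmon x n) = of_int (q y * ord_at y x + p y * n) * hmon x n + of_int (q y) * hmon r n"
      unfolding E1_def \<theta>x \<xi>h by (simp add: algebra_simps)
    hence E1: "E1 (hmon x n) = of_int (w y (hmon x n)) * hmon x n + of_int (q y) * hmon r n"
      using w_hmon[OF y False, of n] by simp
    have "of_int (w y (hmon x n)) * hmon x n \<in> vge (w y) 1"
    proof (cases "w y (hmon x n) = 0")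
      case nw: False
      hence "hmon x n \<in> vge (w y) 1" using w0 by (intro vgeI) linarith
      thus ?thesis by (rule int_mult)
    qed (simp add: vge_def)
    hence "E1 (hmon x n) \<in> vge (w y) 1" unfolding E1 by (rule vge_add[OF _ int_mult[OF r0]])
    moreover have "E2 (hmon x n) \<in> vring (w y)" unfolding E2_def \<theta>x \<xi>h
      by (intro vge_diff vge_add int_mult xn vge_mono[OF r0]) simp
    ultimately show ?thesis ..
  qed
  \<comment> \<open>Elements of A are sums of monomials in the valuation ring, and a denominator of
    value 0 does no harm in the quotient rule.\<close>
  have frac: "E1 z \<in> vge (w y) 1 \<and> E2 z \<in> vring (w y)" if z: "z \<in> vring (w y)" for z
  proof -
    have "z \<in> localize A (Pt y)" using z localize_Pt[OF y] by simp
    then obtain a b where ab: "z = a / b" "a \<in> A" "b \<in> A" "b \<notin> Pt y" unfolding localize_def by blast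
    have b0: "b \<noteq> 0" using ab(4) zero_in_prime[OF subdom_A prime_Pt[OF y]] by blast
    have bv: "b \<in> vring (w y)" using ab(3) A_subset_vring[OF y] by blast
    hence wb: "w y b = 0" using b0 ab(3,4) unfolding Pt_def by (simp add: vge_def)
    have av: "a \<in> vring (w y)" using ab(2) A_subset_vring[OF y] by blast
    have poly: "E1 c \<in> vge (w y) 1 \<and> E2 c \<in> vring (w y)" if c: "c \<in> A" for c
    proof -
      obtain f where f: "c = to_fract f" "to_fract f \<in> A" by (rule in_AE[OF c])
      have m: "hmon (coeff f i) (int i) \<in> vring (w y)" for i
        using A_components[OF f(2), of i] A_subset_vring[OF y] by blast
      have sum: "D (sum h I) = (\<Sum>i\<in>I. D (h i))" if D: "D \<in> derivations (const_field \<iota>) UNIV" for D and h :: "nat \<Rightarrow> 'a poly fract" and I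
        by (induction I rule: infinite_finite_induct) (simp_all add: derivationsD[OF D])
      show ?thesis unfolding f(1) to_fract_eq_sum_hmon[of f] sum[OF E(1)] sum[OF E(2)]
        by (intro conjI vge_sum conjunct1[OF mon[OF m]] conjunct2[OF mon[OF m]])
    qed
    have quot: "D z \<in> vge (w y) e" if D: "D \<in> derivations (const_field \<iota>) UNIV" "D a \<in> vge (w y) e" "D b \<in> vge (w y) e" for D e
    proof -
      have "b ^ 2 * D z = b * D a - a * D b" unfolding ab(1) using b0 by (simp add: derivation_divide[OF D(1)])
      moreover have "b * D a - a * D b \<in> vge (w y) e"
        using vge_diff[OF vge_mult[OF bv D(2)] vge_mult[OF av D(3)]] by simp
      ultimately have "b ^ 2 * D z \<in> vge (w y) e" by simp
      thus ?thesis using b0 wb by (simp add: vge_mult_nonzero_iff v_power)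
    qed
    show ?thesis using quot[OF E(1)] quot[OF E(2)] poly[OF ab(2)] poly[OF ab(3)] by blast
  qed
  have J': "E1 a * E2 b - E1 b * E2 a = \<theta> a * \<xi> b - \<theta> b * \<xi> a" for a b
  proof -
    have "E1 a * E2 b - E1 b * E2 a = (of_int (q y) * of_int \<alpha> + of_int (p y) * of_int \<beta>) * (\<theta> a * \<xi> b - \<theta> b * \<xi> a)"
      unfolding E1_def E2_def by (simp add: algebra_simps)
    thus ?thesis unfolding ab' by simp
  qed
  have J: "\<rho> * \<chi> * J x = \<theta> (x 0) * \<xi> (x 1) - \<theta> (x 1) * \<xi> (x 0)" for x
    unfolding J_def \<theta>_def \<xi>_def by (simp add: algebra_simps)
  have \<rho>\<chi>: "\<rho> * \<chi> \<noteq> 0" "w y (\<rho> * \<chi>) = q y * (1 - ord_at y (D0 \<tau>)) + p y"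
  proof -
    have "\<rho> * \<chi> = hmon (\<tau> / D0 \<tau>) 1" by (simp add: \<rho>_def hmon_def)
    moreover have "\<tau> / D0 \<tau> \<noteq> 0" using \<tau>(1) nz by simp
    ultimately show "\<rho> * \<chi> \<noteq> 0" "w y (\<rho> * \<chi>) = q y * (1 - ord_at y (D0 \<tau>)) + p y"
      using w_hmon[OF y, of "\<tau> / D0 \<tau>" 1] \<tau> nz by (simp_all add: O.v_divide)
  qed
  \<comment> \<open>The Jacobian is the bracket of E1 and E2 divided by \<rho> \<chi>. As E1 gains
    order 1 and E2 keeps regularity, 1 - w (\<rho> \<chi>) is a lower bound for its order.\<close>
  define N where "N = 1 - q y - p y + q y * ord_at y (D0 \<tau>)"
  have N: "N = 1 - w y (\<rho> * \<chi>)" unfolding N_def \<rho>\<chi>(2) by (simp add: algebra_simps)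
  \<comment> \<open>A uniformizer and a unit of \<open>w y\<close>. Both are products of powers of
    \<tau> and \<chi>, on which \<theta> and \<xi> act by integers, so the bound is seen to be
    attained.\<close>
  define u s where "u = hmon (\<tau> powi \<alpha>) \<beta>" and "s = hmon (\<tau> powi (- p y)) (q y)"
  have \<tau>a: "ord_at y (\<tau> powi n) = n" for n using O.v_powi[OF \<tau>(1)] \<tau>(2) by simp
  have wu: "u \<noteq> 0" "w y u = 1" unfolding u_def using w_hmon[OF y, of "\<tau> powi \<alpha>" \<beta>] \<tau>(1) \<tau>a ab by simp_all
  have ws: "s \<noteq> 0" "w y s = 0" unfolding s_def using w_hmon[OF y, of "\<tau> powi (- p y)" "q y"] \<tau>(1) \<tau>a by simp_all
  have \<theta>\<tau>: "\<theta> (hmon (\<tau> powi n) m) = of_int n * hmon (\<tau> powi n) m" for n m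
  proof -
    have "\<tau> * (D0 (\<tau> powi n) / D0 \<tau>) = of_int n * \<tau> powi n"
      using derivation_powi[OF D0(1) \<tau>(1), of n] nz by (simp add: field_simps)
    thus ?thesis unfolding \<theta>h by (simp add: hmon_of_int)
  qed
  define x0 where "x0 = (\<lambda>j::nat. if j = 0 then u else s)"
  have "\<rho> * \<chi> * J x0 = (of_int (q y) * of_int \<alpha> + of_int (p y) * of_int \<beta>) * (u * s)"
    unfolding J x0_def by (simp add: u_def s_def \<theta>\<tau> \<xi>h algebra_simps)
  hence Jx0: "\<rho> * \<chi> * J x0 = u * s" unfolding ab' by simp
  hence Jnz: "J x0 \<noteq> 0" using wu(1) ws(1) by (intro notI) simp
  have "w y (\<rho> * \<chi>) + w y (J x0) = 1" using mult[OF \<rho>\<chi>(1) Jnz] mult[OF wu(1) ws(1)] Jx0 wu ws by simp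
  hence JN: "w y (J x0) = N" unfolding N by linarith
  show ?thesis unfolding N_def[symmetric]
  proof (rule ord_form_eq[where J = J and ?x0.0 = x0 and ?D0.0 = "\<lambda>j. if j = 0 then \<Theta> else \<Xi>"])
    show "wedge_d (const_field \<iota>) UNIV 2 x = (\<lambda>D. J x * \<eta> D)" for x by (rule wedge_d_surface)
    show "J x \<in> vge (w y) N" if x: "\<forall>j<2. x j \<in> vring (w y)" for x :: "nat \<Rightarrow> 'a poly fract"
    proof -
      have x': "x 0 \<in> vring (w y)" "x 1 \<in> vring (w y)" using x by simp_all
      have "E1 (x 0) * E2 (x 1) \<in> vge (w y) (1 + 0)" "E1 (x 1) * E2 (x 0) \<in> vge (w y) (1 + 0)"
        using frac[OF x'(1)] frac[OF x'(2)] by (blast intro: vge_mult)+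
      from vge_diff[OF this] have "\<rho> * \<chi> * J x \<in> vge (w y) 1" unfolding J J' by simp
      thus ?thesis unfolding N by (simp only: vge_mult_nonzero_iff[OF \<rho>\<chi>(1)])
    qed
    have "u \<in> vring (w y)" "s \<in> vring (w y)" using wu ws by (simp_all add: vge_def)
    thus "\<forall>j<2. x0 j \<in> vring (w y)" by (simp add: x0_def)
  qed (use Jnz JN g \<eta>_neq_0 in simp_all)
qed

end


section \<open>The Gorenstein condition\<close>

lemma poly_prime_divisor:
  fixes f :: "'a::field poly"
  assumes "degree f > 0"
  shows "\<exists>\<pi>. prime_elem \<pi> \<and> \<pi> dvd f"
  using assms
proof (induction "degree f" arbitrary: f rule: less_induct)
  case less
  have f0: "f \<noteq> 0" using less.prems by (intro notI) simp
  have nu: "\<not> f dvd 1" using less.prems is_unit_iff_degree[OF f0] by simp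
  show ?case
  proof (cases "irreducible f")
    case True thus ?thesis by (intro exI[of _ f] conjI field_poly_irreducible_imp_prime dvd_refl)
  next
    case False
    then obtain a b where ab: "f = a * b" "\<not> a dvd 1" "\<not> b dvd 1" using f0 nu unfolding irreducible_def by blast
    have nz: "a \<noteq> 0" "b \<noteq> 0" using f0 ab(1) by simp_all
    have d: "degree a > 0" "degree b > 0"
      using ab(2,3) is_unit_iff_degree[OF nz(1)] is_unit_iff_degree[OF nz(2)] by simp_all
    have "degree f = degree a + degree b"
      unfolding ab(1) using nz by (rule degree_mult_eq)
    hence "degree a < degree f" using d by simp
    hence "\<exists>\<pi>. prime_elem \<pi> \<and> \<pi> dvd a" using d(1) by (rule less.hyps)
    then obtain \<pi> where "prime_elem \<pi>" "\<pi> dvd a" by blast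
    thus ?thesis unfolding ab(1) by (intro exI[of _ \<pi>] conjI dvd_mult2) simp_all
  qed
qed

context dpd
begin

lemma w_to_fract_le:
  assumes y: "y \<in> Y" and f: "coeff f 0 \<noteq> 0"
  shows "w y (to_fract f) \<le> w y (hmon (coeff f 0) 0)"
proof -
  have "to_fract f \<in> vge (w y) (w y (to_fract f))" by (simp add: vge_def)
  hence "hmon (coeff f 0) (int 0) \<in> vge (w y) (w y (to_fract f))" using vge_w_to_fract_iff[OF y] by blast
  thus ?thesis using f by (simp add: vge_def)
qed

text \<open>The valuations of a polynomial are bounded by those of its constant term, with equality for a
  function invertible at the vertex, hence for its factors.\<close>

lemma w_factor:
  assumes h: "to_fract (a * b) \<in> A" "to_fract (a * b) \<notin> vertex" and y: "y \<in> Y"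
  shows "coeff a 0 \<noteq> 0" "w y (to_fract a) = w y (hmon (coeff a 0) 0)"
proof -
  interpret dval "w y" by (rule dval_w[OF y])
  have nz: "coeff (a * b) 0 \<noteq> 0" using h to_fract_in_vertex_iff by blast
  hence nz': "coeff a 0 \<noteq> 0" "coeff b 0 \<noteq> 0" by (simp_all add: coeff_mult_0)
  hence ab: "to_fract a \<noteq> 0" "to_fract b \<noteq> 0" by auto
  have "to_fract (a * b) \<notin> Pt y" using h(2) Pt_subset_vertex[OF y] by blast
  moreover have "to_fract (a * b) \<in> vring (w y)" using h(1) A_subset_vring[OF y] by blast
  ultimately have 1: "w y (to_fract (a * b)) = 0" using h(1) ab unfolding Pt_def by (simp add: vge_def)
  obtain c where c: "coeff (a * b) 0 = \<iota> c" using coeff_0_in_k[OF h(1)] by blast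
  have "c \<noteq> 0" using c nz \<iota>_zero by (intro notI) simp
  hence 2: "w y (hmon (coeff (a * b) 0) 0) = 0" using w_hmon[OF y nz, of 0] ord_\<iota>[OF y, of c] c by simp
  have "w y (to_fract a) + w y (to_fract b) = w y (hmon (coeff a 0) 0) + w y (hmon (coeff b 0) 0)"
    using 1 2 mult[OF ab] mult[of "hmon (coeff a 0) 0" "hmon (coeff b 0) 0"] nz'
    by (simp add: hmon_mult coeff_mult_0)
  thus "w y (to_fract a) = w y (hmon (coeff a 0) 0)"
    using w_to_fract_le[OF y nz'(1)] w_to_fract_le[OF y nz'(2)] by linarith
  show "coeff a 0 \<noteq> 0" by (rule nz')
qed

text \<open>Prime factors of a and b are removed one at a time. A factor of \<open>hh\<close> or of
  \<chi> has the same \<open>w y\<close> as a monomial and is split off; any other prime occurs in a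
  and b to the same order and is cancelled.\<close>

lemma monomial_valuations:
  fixes a b hh :: "'a poly"
  assumes h: "to_fract hh \<in> A" "to_fract hh \<notin> vertex"
    and "a \<noteq> 0" "b \<noteq> 0"
    and "\<And>\<pi>. prime_elem \<pi> \<Longrightarrow> \<not> \<pi> dvd [:0, 1:] \<Longrightarrow> \<not> \<pi> dvd hh \<Longrightarrow> vfract (vprime \<pi>) (to_fract a / to_fract b) = 0"
  shows "\<exists>x n. x \<noteq> 0 \<and> (\<forall>y\<in>Y. w y (to_fract a / to_fract b) = w y (hmon x n))"
  using assms(3-5)
proof (induction "degree a + degree b" arbitrary: a b rule: less_induct)
  case (less a b)
  note a0 = less.prems(1) and b0 = less.prems(2) and v = less.prems(3)
  show ?case
  proof (cases "degree a = 0 \<and> degree b = 0")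
    case True
    obtain c where c: "a = [:c:]" using True degree_eq_zeroE[of a] by blast
    obtain d where d: "b = [:d:]" using True degree_eq_zeroE[of b] by blast
    have nz: "c \<noteq> 0" "d \<noteq> 0" using a0 b0 c d by auto
    have "to_fract a / to_fract b = hmon c 0 * inverse (hmon d 0)" by (simp add: c d hmon_def divide_inverse)
    also have "\<dots> = hmon (c / d) 0" by (simp add: hmon_inverse hmon_mult divide_inverse)
    finally show ?thesis using nz by (intro exI[of _ "c / d"] exI[of _ 0]) simp
  next
    case False
    hence "degree a > 0 \<or> degree b > 0" by simp
    then obtain \<pi> where \<pi>: "prime_elem \<pi>" "\<pi> dvd a \<or> \<pi> dvd b"
      using poly_prime_divisor[of a] poly_prime_divisor[of b] by blast
    have \<pi>0: "\<pi> \<noteq> 0" using \<pi>(1) by (simp add: prime_elem_def)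
    have \<pi>d: "degree \<pi> > 0" by (rule prime_elem_degree_pos[OF \<pi>(1)])
    have split: "\<exists>f'. f = \<pi> * f' \<and> f' \<noteq> 0 \<and> degree f' < degree f" if f: "\<pi> dvd f" "f \<noteq> 0" for f
    proof -
      obtain f' where f': "f = \<pi> * f'" using f(1) by (elim dvdE)
      have nz: "f' \<noteq> 0" using f(2) f' by (intro notI) simp
      have "degree f = degree \<pi> + degree f'"
        unfolding f' using \<pi>0 nz by (rule degree_mult_eq)
      hence "degree f' < degree f" using \<pi>d by simp
      thus ?thesis using f' nz by blast
    qed
    show ?thesis
    proof (cases "\<pi> dvd [:0, 1:] \<or> \<pi> dvd hh")
      case True
      have ex: "\<exists>x n. x \<noteq> 0 \<and> (\<forall>y\<in>Y. w y (to_fract \<pi>) = w y (hmon x n))"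
      proof (cases "\<pi> dvd hh")
        case True
        then obtain c where c: "hh = \<pi> * c" by (elim dvdE)
        obtain y0 where "y0 \<in> Y" using ex_point by blast
        hence "coeff \<pi> 0 \<noteq> 0" using w_factor(1) h unfolding c by blast
        moreover have "\<forall>y\<in>Y. w y (to_fract \<pi>) = w y (hmon (coeff \<pi> 0) 0)"
          using w_factor(2)[OF h[unfolded c]] by blast
        ultimately show ?thesis by blast
      next
        case False
        hence "\<pi> dvd [:0, 1:]" using True by blast
        then obtain c where c: "[:0, 1:] = \<pi> * c" by (elim dvdE)
        have c0: "c \<noteq> 0" using c by (intro notI) simp
        have "degree ([:0, 1:] :: 'a poly) = degree \<pi> + degree c"
          unfolding c using \<pi>0 c0 by (rule degree_mult_eq)
        hence "degree c = 0" using \<pi>d by simp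
        then obtain d where d: "c = [:d:]" using degree_eq_zeroE[of c] by blast
        have "d \<noteq> 0" using c0 d by simp
        have "to_fract \<pi> * to_fract [:d:] = \<chi>" by (simp only: \<chi>_def c d to_fract_mult)
        hence "to_fract \<pi> * hmon d 0 = \<chi>" by (simp add: hmon_def)
        moreover have "hmon 1 1 = (\<chi> :: 'a poly fract)" by (simp add: hmon_def flip: one_pCons)
        ultimately have "to_fract \<pi> * hmon d 0 * hmon (inverse d) 0 = hmon 1 1 * hmon (inverse d) 0" by (simp only:)
        hence "to_fract \<pi> = hmon (inverse d) 1" using \<open>d \<noteq> 0\<close> by (simp add: hmon_mult mult.assoc)
        thus ?thesis using \<open>d \<noteq> 0\<close> by (intro exI[of _ "inverse d"] exI[of _ 1]) simp
      qed
      then obtain u m where u: "u \<noteq> 0" "\<forall>y\<in>Y. w y (to_fract \<pi>) = w y (hmon u m)" by (elim exE conjE)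
      have nd: "\<not> \<pi>' dvd \<pi>" if \<pi>': "\<not> \<pi>' dvd [:0, 1:]" "\<not> \<pi>' dvd hh" for \<pi>'
      proof
        assume d: "\<pi>' dvd \<pi>"
        show False using True dvd_trans[OF d, of "[:0, 1:]"] dvd_trans[OF d, of hh] \<pi>' by blast
      qed
      \<comment> \<open>The exponent s is 1 for a factor of a and -1 for a factor of b. Removing it
        keeps order 0 along the admissible primes, because none of them divides \<pi>.\<close>
      have step: "\<exists>x n. x \<noteq> 0 \<and> (\<forall>y\<in>Y. w y (to_fract a / to_fract b) = w y (hmon x n))"
        if f: "to_fract a / to_fract b = to_fract \<pi> powi s * (to_fract a' / to_fract b')" "a' \<noteq> 0" "b' \<noteq> 0"
          "degree a' + degree b' < degree a + degree b" for a' b' s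
      proof -
        have nz: "to_fract \<pi> powi s \<noteq> 0" "to_fract a' / to_fract b' \<noteq> 0" "to_fract \<pi> \<noteq> 0" using f(2,3) \<pi>0 by simp_all
        have "vfract (vprime \<pi>') (to_fract a' / to_fract b') = 0"
          if \<pi>': "prime_elem \<pi>'" "\<not> \<pi>' dvd [:0, 1:]" "\<not> \<pi>' dvd hh" for \<pi>'
        proof -
          interpret dval "vfract (vprime \<pi>')" by (rule dval_vprime[OF \<pi>'(1)])
          have "vfract (vprime \<pi>') (to_fract \<pi> powi s) = 0"
            using vfract_vprime_unit[OF \<pi>'(1) nd[OF \<pi>'(2,3)]] \<pi>0 by (simp add: v_powi)
          thus ?thesis using v[OF \<pi>'] unfolding f(1) mult[OF nz(1,2)] by simp
        qed
        then obtain x n where x: "x \<noteq> 0" "\<forall>y\<in>Y. w y (to_fract a' / to_fract b') = w y (hmon x n)"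
          using less.hyps[OF f(4,2,3)] by blast
        have "w y (to_fract a / to_fract b) = w y (hmon (u powi s * x) (s * m + n))" if y: "y \<in> Y" for y
        proof -
          interpret dval "w y" by (rule dval_w[OF y])
          have 1: "w y (to_fract a' / to_fract b') = w y (hmon x n)" using x(2) y by blast
          have 2: "w y (to_fract \<pi>) = w y (hmon u m)" using u(2) y by blast
          have "w y (to_fract a / to_fract b) = s * w y (hmon u m) + w y (hmon x n)"
            unfolding f(1) mult[OF nz(1,2)] v_powi[OF nz(3)] 1 2 ..
          also have "\<dots> = w y (hmon u m powi s * hmon x n)" using u(1) x(1) by (simp add: mult v_powi)
          also have "hmon u m powi s * hmon x n = hmon (u powi s * x) (s * m + n)"
            using u(1) by (simp add: hmon_powi hmon_mult)
          finally show ?thesis .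
        qed
        thus ?thesis using u(1) x(1) by (intro exI[of _ "u powi s * x"] exI[of _ "s * m + n"]) simp
      qed
      show ?thesis
      proof (cases "\<pi> dvd a")
        case True
        then obtain a' where a': "a = \<pi> * a'" "a' \<noteq> 0" "degree a' < degree a" using split[OF _ a0] by blast
        show ?thesis by (rule step[of 1 a' b]) (use a' b0 in simp_all)
      next
        case False
        hence "\<pi> dvd b" using \<pi>(2) by blast
        then obtain b' where b': "b = \<pi> * b'" "b' \<noteq> 0" "degree b' < degree b" using split[OF _ b0] by blast
        show ?thesis by (rule step[of "- 1" a b']) (use b' a0 in \<open>simp_all add: field_simps\<close>)
      qed
    next
      case False
      hence "vfract (vprime \<pi>) (to_fract a / to_fract b) = 0" using v[OF \<pi>(1)] by blast
      hence eq: "vprime \<pi> a = vprime \<pi> b"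
        using prevaluation.vfract_quotient[OF prevaluation_vprime[OF \<pi>(1)] a0 b0] by simp
      hence "\<pi> dvd a \<longleftrightarrow> \<pi> dvd b" using vprime_pos_iff(2)[OF \<pi>(1) a0] vprime_pos_iff(2)[OF \<pi>(1) b0] by simp
      hence dv: "\<pi> dvd a" "\<pi> dvd b" using \<pi>(2) by blast+
      obtain a' where a': "a = \<pi> * a'" "a' \<noteq> 0" "degree a' < degree a" using split[OF dv(1) a0] by blast
      obtain b' where b': "b = \<pi> * b'" "b' \<noteq> 0" "degree b' < degree b" using split[OF dv(2) b0] by blast
      have eq: "to_fract a / to_fract b = to_fract a' / to_fract b'" using \<pi>0 by (simp add: a'(1) b'(1))
      have lt: "degree a' + degree b' < degree a + degree b" using a'(3) b'(3) by linarith
      show ?thesis unfolding eq by (rule less.hyps[OF lt a'(2) b'(2)]) (use v eq in simp)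
    qed
  qed
qed

end

section \<open>The canonical divisor and the Cartier condition in terms of valuations\<close>

context dpd_derivation
begin

text \<open>The right-hand side says that the form g0 dt wedge d\<chi>/\<chi> has the same orders as
  the monomial x \<chi>^n along all \<open>w y\<close>; along the primes \<pi> both have order
  0.\<close>

lemma gorenstein_iff:
  assumes g0: "g0 \<noteq> 0" and K: "\<And>y \<tau>. y \<in> Y \<Longrightarrow> \<tau> \<noteq> 0 \<Longrightarrow> ord_at y \<tau> = 1 \<Longrightarrow> K y = ord_at y g0 - ord_at y (D0 \<tau>)"
  shows "gorenstein (const_field \<iota>) A \<longleftrightarrow>
    (\<exists>x n. x \<noteq> 0 \<and> (\<forall>y\<in>Y. q y * K y + q y - 1 = q y * ord_at y x + p y * n))"
proof -
  let ?\<kappa> = "\<lambda>y. q y * K y + q y - 1"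
  have dim: "the_enat (krull_dim A) = 2" by (simp add: krull_dim_A numeral_eq_enat)
  have forms: "forms (const_field \<iota>) 2 UNIV = {\<lambda>D. a * \<eta> D | a. True}"
    by (rule forms_UNIV[OF wedge_d_surface J_basis])
  \<comment> \<open>The weight -p of the factor 1/\<chi> cancels the p in
    \<open>ord_form_Pt\<close>. Every nonzero form is this one multiplied by some g.\<close>
  have WPt: "ord_form (const_field \<iota>) 2 (localize A (Pt y)) (\<lambda>D. hmon g0 (- 1) * g * \<eta> D) = w y g + ?\<kappa> y"
    if y: "y \<in> Y" and g: "g \<noteq> 0" for y g
  proof -
    interpret dval "w y" by (rule dval_w[OF y])
    obtain \<tau> where \<tau>: "\<tau> \<noteq> 0" "ord_at y \<tau> = 1" using dval.uniformizer[OF dval_point[OF y]] by blast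
    have "w y (hmon g0 (- 1) * g) = q y * ord_at y g0 - p y + w y g" using g0 g w_hmon[OF y g0, of "- 1"] by (simp add: mult)
    moreover have "hmon g0 (- 1) * g \<noteq> 0" using g0 g by simp
    note ord_form_Pt[OF y \<tau> this]
    ultimately show ?thesis unfolding localize_Pt[OF y] K[OF y \<tau>] by (simp add: right_diff_distrib)
  qed
  have W\<pi>: "ord_form (const_field \<iota>) 2 (vring (vfract (vprime \<pi>))) (\<lambda>D. hmon g0 (- 1) * g * \<eta> D) = vfract (vprime \<pi>) g"
    if \<pi>: "prime_elem \<pi>" "\<not> \<pi> dvd [:0, 1:]" and g: "g \<noteq> 0" for \<pi> g
  proof -
    interpret dval "vfract (vprime \<pi>)" by (rule dval_vprime[OF \<pi>(1)])
    show ?thesis using ord_form_vprime[OF \<pi>(1), of "hmon g0 (- 1) * g"] vfract_hmon[OF \<pi> g0, of "- 1"] g0 g by (simp add: mult)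
  qed
  show ?thesis
  proof
    assume "gorenstein (const_field \<iota>) A"
    then obtain W where W: "affine_canonical_divisor (const_field \<iota>) A W" "cartier A W" unfolding gorenstein_def by blast
    obtain \<omega> where \<omega>: "\<omega> \<in> forms (const_field \<iota>) 2 UNIV" "\<omega> \<noteq> (\<lambda>_. 0)"
      "\<forall>Q\<in>spec A. height A Q = 1 \<longrightarrow> W Q = ord_form (const_field \<iota>) 2 (localize A Q) \<omega>"
      using W(1) unfolding affine_canonical_divisor_def dim frac_field_A by blast
    obtain a where a: "\<omega> = (\<lambda>D. a * \<eta> D)" using \<omega>(1) unfolding forms by blast
    have a0: "a \<noteq> 0" using \<omega>(2) a by (intro notI) simp
    define g where "g = a / hmon g0 (- 1)"
    have g: "g \<noteq> 0" "a = hmon g0 (- 1) * g" using a0 g0 by (simp_all add: g_def)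
    have "vertex \<in> spec A" using prime_vertex spec_iff[OF subdom_A] by blast
    then obtain h f where hf: "h \<in> A" "h \<notin> vertex" "f \<noteq> 0"
      "\<forall>Q\<in>spec A. height A Q = 1 \<and> h \<notin> Q \<longrightarrow> W Q = ord_at (localize A Q) f"
      using W(2) unfolding cartier_def by blast
    obtain hh where hh: "h = to_fract hh" "to_fract hh \<in> A" by (rule in_AE[OF hf(1)])
    have loc: "ord_form (const_field \<iota>) 2 (localize A Q) (\<lambda>D. hmon g0 (- 1) * g * \<eta> D) = ord_at (localize A Q) f"
      if Q: "prime_in Q A" "height A Q = 1" "h \<notin> Q" for Q
    proof -
      have "Q \<in> spec A" using Q(1) spec_iff[OF subdom_A] by blast
      hence "W Q = ord_form (const_field \<iota>) 2 (localize A Q) \<omega>" "W Q = ord_at (localize A Q) f" using \<omega>(3) hf(4) Q(2,3) by blast+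
      thus ?thesis unfolding a g(2) by simp
    qed
    have \<kappa>: "?\<kappa> y = w y (f / g)" if y: "y \<in> Y" for y
    proof -
      interpret dval "w y" by (rule dval_w[OF y])
      have "h \<notin> Pt y" using hf(2) Pt_subset_vertex[OF y] by blast
      hence "w y g + ?\<kappa> y = ord_at (localize A (Pt y)) f" unfolding WPt[OF y g(1), symmetric] by (rule loc[OF prime_Pt[OF y] height_Pt[OF y]])
      hence "w y g + ?\<kappa> y = w y f" by (simp only: localize_Pt[OF y] ord_at_vring[OF hf(3)])
      thus ?thesis using v_divide[OF hf(3) g(1)] by simp
    qed
    obtain b c where bc: "c \<noteq> 0" "f / g = to_fract b / to_fract c" by (rule fract_quotient)
    have "b \<noteq> 0" using bc(2) hf(3) g(1) by auto
    \<comment> \<open>If \<pi> does not divide \<open>hh\<close>, its center avoids h, so the local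
      equation f has the order of the form there, which is that of g.\<close>
    moreover have "vfract (vprime \<pi>) (to_fract b / to_fract c) = 0"
      if \<pi>: "prime_elem \<pi>" "\<not> \<pi> dvd [:0, 1:]" "\<not> \<pi> dvd hh" for \<pi>
    proof -
      interpret dval "vfract (vprime \<pi>)" by (rule dval_vprime[OF \<pi>(1)])
      note Q = localize_center_vprime[OF \<pi>(1,2)]
      have "height A (vge (vfract (vprime \<pi>)) 1 \<inter> A) = 1" unfolding height_def Q(2) by (rule krull_dim_vring)
      moreover have "hh \<noteq> 0" using \<pi>(3) by (intro notI) simp
      hence "h \<notin> vge (vfract (vprime \<pi>)) 1 \<inter> A" using vfract_vprime_unit[OF \<pi>(1,3)] unfolding hh(1) by (simp add: vge_def)
      ultimately have "ord_form (const_field \<iota>) 2 (localize A (vge (vfract (vprime \<pi>)) 1 \<inter> A)) (\<lambda>D. hmon g0 (- 1) * g * \<eta> D) =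
        ord_at (localize A (vge (vfract (vprime \<pi>)) 1 \<inter> A)) f" by (rule loc[OF Q(1)])
      hence "vfract (vprime \<pi>) g = vfract (vprime \<pi>) f" by (simp only: Q(2) W\<pi>[OF \<pi>(1,2) g(1)] ord_at_vring[OF hf(3)])
      thus ?thesis unfolding bc(2)[symmetric] using v_divide[OF hf(3) g(1)] by simp
    qed
    ultimately obtain x n where x: "x \<noteq> 0" "\<forall>y\<in>Y. w y (f / g) = w y (hmon x n)"
      using monomial_valuations[OF hh(2) _ _ bc(1)] hf(2) unfolding hh(1) bc(2) by blast
    have "?\<kappa> y = q y * ord_at y x + p y * n" if y: "y \<in> Y" for y
      using \<kappa>[OF y] x(2) w_hmon[OF y x(1), of n] y by simp
    thus "\<exists>x n. x \<noteq> 0 \<and> (\<forall>y\<in>Y. ?\<kappa> y = q y * ord_at y x + p y * n)" using x(1) by blast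
  next
    assume "\<exists>x n. x \<noteq> 0 \<and> (\<forall>y\<in>Y. ?\<kappa> y = q y * ord_at y x + p y * n)"
    then obtain x n where x: "x \<noteq> 0" "\<forall>y\<in>Y. ?\<kappa> y = q y * ord_at y x + p y * n" by blast
    define \<omega> where "\<omega> = (\<lambda>D. hmon g0 (- 1) * 1 * \<eta> D)"
    define W where "W = (\<lambda>Q. ord_form (const_field \<iota>) 2 (localize A Q) \<omega>)"
    have "\<omega> (\<lambda>j. if j = 0 then \<Theta> else \<Xi>) \<noteq> 0" unfolding \<omega>_def \<eta>_neq_0 using g0 by simp
    hence "\<omega> \<noteq> (\<lambda>_. 0)" by (intro notI) simp
    moreover have "\<omega> \<in> forms (const_field \<iota>) 2 UNIV" unfolding forms \<omega>_def by blast
    ultimately have can: "affine_canonical_divisor (const_field \<iota>) A W"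
      unfolding affine_canonical_divisor_def dim frac_field_A W_def by blast
    have loc: "W Q = ord_at (localize A Q) (hmon x n)" if Q: "prime_in Q A" "height A Q = 1" for Q
    proof (rule height_1_cases[OF Q])
      fix y assume y: "y \<in> Y" "Q = Pt y"
      have "W Q = w y (hmon x n)" unfolding W_def \<omega>_def y(2) WPt[OF y(1) one_neq_zero]
        using x(2) y(1) w_hmon[OF y(1) x(1), of n] by (simp add: dval.v_one[OF dval_w[OF y(1)]])
      thus ?thesis unfolding y(2) localize_Pt[OF y(1)] using dval.ord_at_vring[OF dval_w[OF y(1)]] x(1) by simp
    next
      fix \<pi> :: "'a poly" assume \<pi>: "prime_elem \<pi>" "\<not> \<pi> dvd [:0, 1:]" "localize A Q = vring (vfract (vprime \<pi>))"
      interpret dval "vfract (vprime \<pi>)" by (rule dval_vprime[OF \<pi>(1)])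
      have nz: "hmon x n \<noteq> 0" using x(1) by simp
      show ?thesis unfolding W_def \<omega>_def \<pi>(3) W\<pi>[OF \<pi>(1,2) one_neq_zero] ord_at_vring[OF nz] vfract_hmon[OF \<pi>(1,2) x(1)] by simp
    qed
    have "cartier A W" unfolding cartier_def
    proof
      fix P assume "P \<in> spec A"
      hence "prime_in P A" using spec_iff[OF subdom_A] by blast
      hence "1 \<in> A - P" using subdom_one[OF subdom_A] prime_inD(2) by blast
      moreover have "hmon x n \<in> frac_field A - {0}" using frac_field_A x(1) by simp
      moreover have "\<forall>Q\<in>spec A. height A Q = 1 \<and> 1 \<notin> Q \<longrightarrow> W Q = ord_at (localize A Q) (hmon x n)"
        by (intro ballI impI loc) (simp_all add: spec_iff[OF subdom_A])
      ultimately show "\<exists>h\<in>A - P. \<exists>f\<in>frac_field A - {0}. \<forall>Q\<in>spec A. height A Q = 1 \<and> h \<notin> Q \<longrightarrow> W Q = ord_at (localize A Q) f"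
        by (intro bexI[of _ 1] bexI[of _ "hmon x n"])
    qed
    with can have "\<exists>W. affine_canonical_divisor (const_field \<iota>) A W \<and> cartier A W" by (intro exI conjI)
    moreover have "\<forall>P\<in>spec A. cohen_macaulay_local (localize A P)"
      by (intro ballI cohen_macaulay_A) (simp add: spec_iff[OF subdom_A])
    ultimately show "gorenstein (const_field \<iota>) A" unfolding gorenstein_def by (intro conjI)
  qed
qed

end


section \<open>Degrees and rounding: from valuations to divisors on the curve\<close>

context dpd
begin

text \<open>Divided by q, the equation reads K = div x + n D_1 - (sum of (q - 1)/q over the points).
  Its degree identifies n with m, and D is then the same sum without div x, so that D - K = - div x.
  These steps can be reversed because all quantities are integral after multiplication by q.\<close>

lemma degree_condition:
  assumes S: "finite S" "S \<subseteq> Y" "\<And>y. y \<in> Y \<Longrightarrow> y \<notin> S \<Longrightarrow> p y = 0 \<and> q y = 1"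
    and K: "\<And>y. y \<in> Y \<Longrightarrow> K' y = of_int (K y)"
    and m: "m = 1 / \<delta> * (degree_div Y K' + (\<Sum>y\<in>S. (of_int (q y) - 1) / of_int (q y)))"
    and D: "\<And>y. y \<in> Y \<Longrightarrow> D y = (of_int (p y) * m + 1) / of_int (q y) - 1"
  shows "(\<exists>x n. x \<noteq> 0 \<and> (\<forall>y\<in>Y. q y * K y + q y - 1 = q y * ord_at y x + p y * n)) \<longleftrightarrow>
    m \<in> \<int> \<and> principal Y (\<lambda>y. D y - K' y)"
proof
  assume "\<exists>x n. x \<noteq> 0 \<and> (\<forall>y\<in>Y. q y * K y + q y - 1 = q y * ord_at y x + p y * n)"
  then obtain x n where x: "x \<noteq> 0" "\<And>y. y \<in> Y \<Longrightarrow> q y * K y + q y - 1 = q y * ord_at y x + p y * n" by blast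
  have K': "K' y = of_int (ord_at y x) + of_int n * (of_int (p y) / of_int (q y)) - (of_int (q y) - 1) / of_int (q y)"
    if y: "y \<in> Y" for y
  proof -
    have "rat_of_int (q y * K y + q y - 1) = of_int (q y * ord_at y x + p y * n)" using x(2)[OF y] by simp
    hence "of_int (q y) * K' y = of_int (q y) * of_int (ord_at y x) + of_int (p y) * of_int n - (of_int (q y) - 1)" by (simp add: K[OF y])
    hence "K' y = (of_int (q y) * of_int (ord_at y x) + of_int (p y) * of_int n - (of_int (q y) - 1)) / of_int (q y)"
      using q_pos[OF y] by (simp add: field_simps)
    thus ?thesis using q_pos[OF y] by (simp add: add_divide_distrib diff_divide_distrib mult.commute)
  qed
  \<comment> \<open>One finite set for all sums: it carries the data p and q as well as the zeros
    and poles of x, whose orders add up to 0.\<close>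
  define T where "T = S \<union> {y\<in>Y. ord_at y x \<noteq> 0}"
  have T: "finite T" "T \<subseteq> Y" unfolding T_def using S finite_ord_nonzero[OF x(1)] by blast+
  have off: "K' y = 0" if y: "y \<in> Y" "y \<notin> T" for y using K'[OF y(1)] S(3)[OF y(1)] y unfolding T_def by simp
  have "degree_div Y K' = (\<Sum>y\<in>T. K' y)"
    unfolding degree_div_def by (rule sum.mono_neutral_left[OF T(1)]) (use off T(2) in blast)+
  also have "\<dots> = (\<Sum>y\<in>T. of_int (ord_at y x) + of_int n * (of_int (p y) / of_int (q y)) - (of_int (q y) - 1) / of_int (q y))"
    by (rule sum.cong[OF refl], rule K') (use T(2) in blast)
  also have "\<dots> = of_int (\<Sum>y\<in>T. ord_at y x) + of_int n * (\<Sum>y\<in>T. of_int (p y) / of_int (q y)) - (\<Sum>y\<in>T. (of_int (q y) - 1) / of_int (q y))"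
    by (simp only: sum.distrib sum_subtractf sum_distrib_left of_int_sum)
  also have "(\<Sum>y\<in>T. ord_at y x) = deg (\<lambda>y. ord_at y x)" by (rule deg_eq_sum[OF T, symmetric]) (simp add: T_def)
  also have "\<dots> = 0" by (rule deg_principal[OF x(1)])
  also have "(\<Sum>y\<in>T. rat_of_int (p y) / of_int (q y)) = \<delta>"
    by (rule delta_eq[OF T, symmetric]) (use S(3) in \<open>auto simp: T_def\<close>)
  also have "(\<Sum>y\<in>T. (rat_of_int (q y) - 1) / of_int (q y)) = (\<Sum>y\<in>S. (of_int (q y) - 1) / of_int (q y))"
  proof (rule sum.mono_neutral_right[OF T(1)])
    show "S \<subseteq> T" unfolding T_def by blast
    show "\<forall>y\<in>T - S. (rat_of_int (q y) - 1) / of_int (q y) = 0"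
    proof
      fix y assume "y \<in> T - S"
      hence "q y = 1" using S(3)[of y] T(2) by blast
      thus "(rat_of_int (q y) - 1) / of_int (q y) = 0" by simp
    qed
  qed
  finally have "m = of_int n" unfolding m using deg_pos by (simp add: \<delta>_def[symmetric])
  moreover have "D y - K' y = of_int (ord_at y (inverse x))" if y: "y \<in> Y" for y
  proof -
    have "D y = of_int n * (of_int (p y) / of_int (q y)) - (of_int (q y) - 1) / of_int (q y)"
      using q_pos[OF y] by (simp add: D[OF y] \<open>m = of_int n\<close> field_simps)
    thus ?thesis unfolding K'[OF y] dval.v_inverse[OF dval_point[OF y] x(1)] by simp
  qed
  hence "principal Y (\<lambda>y. D y - K' y)" unfolding principal_def using x(1) by (intro exI[of _ "inverse x"]) simp
  ultimately show "m \<in> \<int> \<and> principal Y (\<lambda>y. D y - K' y)" by simp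
next
  assume a: "m \<in> \<int> \<and> principal Y (\<lambda>y. D y - K' y)"
  then obtain n where n: "m = of_int n" by (auto elim: Ints_cases)
  obtain x where x: "x \<noteq> 0" "\<And>y. y \<in> Y \<Longrightarrow> D y - K' y = of_int (ord_at y x)" using a unfolding principal_def by blast
  have "q y * K y + q y - 1 = q y * ord_at y (inverse x) + p y * n" if y: "y \<in> Y" for y
  proof -
    have "(of_int (p y) * of_int n + 1) / of_int (q y) - 1 - of_int (K y) = rat_of_int (ord_at y x)"
      using x(2)[OF y] by (simp add: D[OF y] K[OF y] n)
    hence "of_int (p y) * of_int n + 1 = rat_of_int (q y) * (of_int (ord_at y x) + of_int (K y) + 1)"
      using q_pos[OF y] by (simp add: field_simps)
    hence "rat_of_int (p y * n + 1) = of_int (q y * (ord_at y x + K y + 1))" by simp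
    hence "p y * n + 1 = q y * (ord_at y x + K y + 1)" by (simp only: of_int_eq_iff)
    thus ?thesis unfolding dval.v_inverse[OF dval_point[OF y] x(1)] by (simp add: algebra_simps)
  qed
  thus "\<exists>x n. x \<noteq> 0 \<and> (\<forall>y\<in>Y. q y * K y + q y - 1 = q y * ord_at y x + p y * n)" using x(1)
    by (intro exI[of _ "inverse x"] exI[of _ n]) simp
qed

text \<open>Rounding down is harmless because orders are integers: ord x + floor (m p / q) is
  nonnegative exactly if q ord x + p m is.\<close>

lemma A_eq_A_ring:
  assumes "\<And>y m. y \<in> Y \<Longrightarrow> eval_pdiv \<DD> (of_nat m) y = of_nat m * (of_int (p y) / of_int (q y))"
  shows "A_ring Y \<DD> = A"
proof -
  have "(\<forall>m. coeff f m \<in> sections Y (eval_pdiv \<DD> (of_nat m))) \<longleftrightarrow> (\<forall>y\<in>Y. to_fract f \<in> vring (w y))" for f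
  proof -
    have "coeff f m \<in> sections Y (eval_pdiv \<DD> (of_nat m)) \<longleftrightarrow> (\<forall>y\<in>Y. hmon (coeff f m) (int m) \<in> vring (w y))" for m
    proof (cases "coeff f m = 0")
      case False
      have "0 \<le> ord_at y (coeff f m) + \<lfloor>eval_pdiv \<DD> (of_nat m) y\<rfloor> \<longleftrightarrow> hmon (coeff f m) (int m) \<in> vring (w y)" if y: "y \<in> Y" for y
      proof -
        have "eval_pdiv \<DD> (of_nat m) y = rat_of_int (p y * int m) / of_int (q y)" using assms[OF y, of m] by simp
        moreover have "0 \<le> i + \<lfloor>u\<rfloor> \<longleftrightarrow> of_int (- i) \<le> u" for i :: int and u :: rat unfolding le_floor_iff[symmetric] by linarith
        ultimately have "0 \<le> ord_at y (coeff f m) + \<lfloor>eval_pdiv \<DD> (of_nat m) y\<rfloor> \<longleftrightarrow>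
          rat_of_int (- ord_at y (coeff f m)) \<le> of_int (p y * int m) / of_int (q y)" by (simp only:)
        also have "\<dots> \<longleftrightarrow> rat_of_int (- ord_at y (coeff f m) * q y) \<le> of_int (p y * int m)"
          using q_pos[OF y] by (simp add: pos_le_divide_eq)
        also have "\<dots> \<longleftrightarrow> 0 \<le> w y (hmon (coeff f m) (int m))"
          unfolding w_hmon[OF y False] of_int_le_iff by (simp add: mult.commute) linarith
        finally show ?thesis using False by (simp add: vge_def)
      qed
      thus ?thesis using False unfolding sections_def by simp
    qed (simp add: sections_def vge_def)
    thus ?thesis using vge_w_to_fract_iff[of _ f 0] by blast
  qed
  thus ?thesis unfolding A_ring_def A_def by simp
qed

end

text \<open>The value of \<DD> at y is a half-line, so only its left endpoint matters, and the
  minimum scales with m \<ge> 0.\<close>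

lemma eval_pdiv_scale:
  assumes "polyhedral_divisor Y \<DD>" "y \<in> Y" "m \<ge> 0"
  shows "eval_pdiv \<DD> m y = m * eval_pdiv \<DD> 1 y"
proof -
  obtain a b where ab: "a \<le> b" "\<DD> y = {u + v | u v. u \<in> {a..b} \<and> v \<in> {0..}}"
    using assms(1,2) unfolding polyhedral_divisor_def by blast
  have eq: "\<DD> y = {a..}"
  proof
    show "\<DD> y \<subseteq> {a..}" unfolding ab(2) by auto
    have "x = a + (x - a)" for x by simp
    thus "{a..} \<subseteq> \<DD> y" unfolding ab(2) using ab(1) by fastforce
  qed
  have "eval_pdiv \<DD> m y = m * a" if m: "m \<ge> 0" for m
    unfolding eval_pdiv_def eq by (rule Least_equality) (use m in \<open>auto intro: mult_left_mono\<close>)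
  from this[OF assms(3)] this[of 1] show ?thesis by simp
qed

context smooth_projective_curve
begin

text \<open>If the degree were at most 0, the same would hold for all multiples, and their spaces of
  sections would have dimension at most 1, against linear growth.\<close>

lemma degree_pos_of_big:
  assumes E: "finite {y\<in>Y. E y \<noteq> 0}" and big: "big \<iota> Y E"
  shows "degree_div Y E > 0"
proof (rule ccontr)
  assume le: "\<not> ?thesis"
  obtain r :: nat and c :: rat where r: "r > 0" "\<forall>y\<in>Y. of_nat r * E y \<in> \<int>" "c > 0"
    "\<forall>\<^sub>F n in sequentially. of_nat (h0 \<iota> Y (\<lambda>y. of_nat n * (of_nat r * E y))) \<ge> c * of_nat n"
    using big unfolding big_def by (elim exE conjE)
  define G where "G = (\<lambda>y. \<lfloor>of_nat r * E y\<rfloor>)"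
  have G: "of_int (G y) = of_nat r * E y" if y: "y \<in> Y" for y
  proof -
    have "of_nat r * E y \<in> \<int>" using r(2) y by blast
    then obtain i where "of_nat r * E y = of_int i" by (elim Ints_cases)
    thus ?thesis unfolding G_def by simp
  qed
  have G0: "G y \<noteq> 0 \<longleftrightarrow> E y \<noteq> 0" if y: "y \<in> Y" for y
    using G[OF y] r(1) by (metis mult_eq_0_iff of_int_eq_0_iff of_nat_eq_0_iff less_irrefl)
  hence eq: "{y\<in>Y. G y \<noteq> 0} = {y\<in>Y. E y \<noteq> 0}" by blast
  have fG: "fsupp G" unfolding fsupp_def eq by (rule E)
  have "rat_of_int (deg G) = (\<Sum>y\<in>{y\<in>Y. E y \<noteq> 0}. of_nat r * E y)" unfolding deg_def eq of_int_sum by (rule sum.cong) (use G in auto)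
  also have "\<dots> = of_nat r * degree_div Y E" unfolding degree_div_def sum_distrib_left ..
  also have "\<dots> \<le> 0" using le by (intro mult_nonneg_nonpos) simp_all
  finally have degG: "deg G \<le> 0" by simp
  have h: "h0 \<iota> Y (\<lambda>y. of_nat n * (of_nat r * E y)) \<le> 1" for n
  proof -
    have fl: "\<lfloor>of_nat n * (of_nat r * E y)\<rfloor> = int n * G y" if y: "y \<in> Y" for y
    proof -
      have "of_nat n * (of_nat r * E y) = rat_of_int (int n * G y)" using G[OF y] by simp
      thus ?thesis by (simp only: floor_of_int)
    qed
    have "sections Y (\<lambda>y. of_nat n * (of_nat r * E y)) = L (\<lambda>y. int n * G y)"
      unfolding sections_def L_def vge_def using fl by (auto simp: add.commute)
    hence "h0 \<iota> Y (\<lambda>y. of_nat n * (of_nat r * E y)) = h (\<lambda>y. int n * G y)" unfolding h0_def h_def by simp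
    moreover have "deg (\<lambda>y. int n * G y) \<le> 0" unfolding deg_cmult[OF fG] using degG by (simp add: mult_nonneg_nonpos)
    ultimately show ?thesis using h_le_1_of_deg_nonpos[OF fsupp_cmult[OF fG]] by simp
  qed
  obtain N where N: "\<forall>n\<ge>N. of_nat (h0 \<iota> Y (\<lambda>y. of_nat n * (of_nat r * E y))) \<ge> c * of_nat n"
    using r(4) unfolding eventually_sequentially by blast
  obtain M :: nat where M: "of_nat M > 1 / c" using reals_Archimedean2[of "1 / c"] by blast
  define n where "n = max N M"
  have "1 < c * of_nat M" using M r(3) by (simp add: field_simps)
  also have "\<dots> \<le> c * of_nat n" using r(3) by (intro mult_left_mono) (simp_all add: n_def)
  also have "\<dots> \<le> of_nat (h0 \<iota> Y (\<lambda>y. of_nat n * (of_nat r * E y)))" using N by (simp add: n_def)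
  also have "\<dots> \<le> 1" using h[of n] by simp
  finally show False by simp
qed

end

text \<open>Passes from divisors given by indexed points to functions on points; injectivity leaves
  at most one index for each point.\<close>

lemma sum_at:
  fixes f :: "nat \<Rightarrow> 'b::comm_monoid_add"
  assumes "inj_on z I" "finite I"
  shows "(\<Sum>i\<in>I. if z i = y then f i else 0) = (if y \<in> z ` I then f (the_inv_into I z y) else 0)"
proof (cases "y \<in> z ` I")
  case True
  then obtain j where j: "j \<in> I" "y = z j" by blast
  have "(\<Sum>i\<in>I. if z i = y then f i else 0) = (\<Sum>i\<in>I. if i = j then f i else 0)"
    by (rule sum.cong) (use assms(1) j in \<open>simp_all add: inj_on_eq_iff\<close>)
  thus ?thesis using True j assms by (simp add: the_inv_into_f_f)
next
  case False
  thus ?thesis by (simp, intro sum.neutral) (auto split: if_splits)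
qed

theorem proposition3p2:
  fixes \<iota> :: "'k::{alg_closed_field, field_char_0} \<Rightarrow> 'a::field"
    and Y :: "'a set set"
    and \<DD> :: "'a set \<Rightarrow> rat set"
    and l :: nat
    and z :: "nat \<Rightarrow> 'a set"
    and p q :: "nat \<Rightarrow> int"
    and K\<^sub>Y D\<^sub>G :: "'a set \<Rightarrow> rat"
    and m\<^sub>G :: rat
    and d :: "nat \<Rightarrow> rat"
  assumes "smooth_projective_curve \<iota> Y"
    and "smooth_polyhedral_divisor \<iota> Y \<DD>"
    and "\<forall>i\<in>{1..l}. z i \<in> Y"
    and "inj_on z {1..l}"
    and "\<forall>i\<in>{1..l}. coprime (p i) (q i) \<and> q i > 0"
    and "\<forall>y\<in>Y. eval_pdiv \<DD> 1 y = (\<Sum>i=1..l. if z i = y then of_int (p i) / of_int (q i) else 0)"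
    and "canonical_divisor \<iota> Y K\<^sub>Y"
    and "m\<^sub>G = 1 / degree_div Y (eval_pdiv \<DD> 1) *
           (degree_div Y K\<^sub>Y + (\<Sum>i=1..l. (of_int (q i) - 1) / of_int (q i)))"
    and "\<forall>i\<in>{1..l}. d i = (of_int (p i) * m\<^sub>G + 1) / of_int (q i) - 1"
    and "\<forall>y\<in>Y. D\<^sub>G y = (\<Sum>i=1..l. if z i = y then d i else 0)"
  shows "gorenstein (const_field \<iota>) (A_ring Y \<DD>) \<longleftrightarrow>
    m\<^sub>G \<in> \<int> \<and> principal Y (\<lambda>y. D\<^sub>G y - K\<^sub>Y y)"
proof -
  note a = assms
  interpret C: smooth_projective_curve \<iota> Y by (rule a(1))
  have poly: "polyhedral_divisor Y \<DD>" and proper: "proper \<iota> Y \<DD>"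
    using a(2) unfolding smooth_polyhedral_divisor_def by blast+
  define Z where "Z = z ` {1..l}"
  \<comment> \<open>Off the given points the coefficient is written as 0/1, which is in lowest
    terms, so coprimality and positivity hold at every point.\<close>
  define P Q where "P = (\<lambda>y. if y \<in> Z then p (the_inv_into {1..l} z y) else 0)"
    and "Q = (\<lambda>y. if y \<in> Z then q (the_inv_into {1..l} z y) else 1)"
  have Z: "finite Z" "Z \<subseteq> Y" using a(3) unfolding Z_def by auto
  have idx: "the_inv_into {1..l} z y \<in> {1..l}" if "y \<in> Z" for y
    using the_inv_into_into[OF a(4)] that unfolding Z_def by blast
  have pq: "coprime (P y) (Q y)" "Q y > 0" for y
    using a(5)[rule_format, OF idx[of y]] unfolding P_def Q_def by simp_all
  have off: "P y = 0 \<and> Q y = 1" if "y \<notin> Z" for y using that by (simp add: P_def Q_def)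
  have E1: "eval_pdiv \<DD> 1 y = of_int (P y) / of_int (Q y)" if y: "y \<in> Y" for y
    using a(6)[rule_format, OF y] unfolding sum_at[OF a(4) finite_atLeastAtMost] by (simp add: P_def Q_def Z_def)
  have supp: "{y\<in>Y. P y \<noteq> 0} = {y\<in>Y. eval_pdiv \<DD> 1 y \<noteq> 0}" using E1 pq(2) by (force simp: less_le)
  have finP: "finite {y\<in>Y. P y \<noteq> 0}" by (rule finite_subset[OF _ Z(1)]) (use off in blast)
  have deg: "degree_div Y (eval_pdiv \<DD> 1) = (\<Sum>y\<in>{y\<in>Y. P y \<noteq> 0}. of_int (P y) / of_int (Q y))"
    unfolding degree_div_def supp by (rule sum.cong) (use E1 in auto)
  have "big \<iota> Y (eval_pdiv \<DD> 1)" using proper[unfolded proper_def, THEN spec, of 1] by simp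
  hence "degree_div Y (eval_pdiv \<DD> 1) > 0" using finP unfolding supp by (rule C.degree_pos_of_big[rotated])
  then interpret dpd \<iota> Y P Q
    by unfold_locales (use pq finP deg in simp_all)
  obtain D0 t g where D: "D0 \<in> derivations C.k UNIV" "D0 t = 1" "g \<noteq> 0"
    "\<And>y \<tau>. y \<in> Y \<Longrightarrow> \<tau> \<noteq> 0 \<Longrightarrow> ord_at y \<tau> = 1 \<Longrightarrow> K\<^sub>Y y = of_int (ord_at y g - ord_at y (D0 \<tau>))"
    by (rule C.canonical_divisor_form[OF a(7)]) blast
  interpret dpd_derivation \<iota> Y P Q D0 t by unfold_locales (rule D)+
  \<comment> \<open>The canonical divisor has integral values on Y, so rounding down only passes
    from rationals to integers.\<close>
  define K where "K = (\<lambda>y. \<lfloor>K\<^sub>Y y\<rfloor>)"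
  have K: "K y = ord_at y g - ord_at y (D0 \<tau>)" if "y \<in> Y" "\<tau> \<noteq> 0" "ord_at y \<tau> = 1" for y \<tau>
    using D(4)[OF that] by (simp add: K_def)
  have KY: "K\<^sub>Y y = of_int (K y)" if y: "y \<in> Y" for y
  proof -
    obtain \<tau> where "\<tau> \<noteq> 0" "ord_at y \<tau> = 1" using dval.uniformizer[OF C.dval_point[OF y]] by blast
    thus ?thesis using D(4)[OF y] by (simp add: K_def)
  qed
  have A: "A_ring Y \<DD> = A"
    by (rule A_eq_A_ring) (use eval_pdiv_scale[OF poly] E1 in simp)
  have reindex: "(\<Sum>i=1..l. (rat_of_int (q i) - 1) / of_int (q i)) = (\<Sum>y\<in>Z. (of_int (Q y) - 1) / of_int (Q y))"
    unfolding Z_def sum.reindex[OF a(4)] by (rule sum.cong) (use the_inv_into_f_f[OF a(4)] in \<open>simp_all add: Q_def Z_def\<close>)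
  have m: "m\<^sub>G = 1 / \<delta> * (degree_div Y K\<^sub>Y + (\<Sum>y\<in>Z. (of_int (Q y) - 1) / of_int (Q y)))"
    unfolding a(8) deg \<delta>_def reindex ..
  have DG: "D\<^sub>G y = (of_int (P y) * m\<^sub>G + 1) / of_int (Q y) - 1" if y: "y \<in> Y" for y
    using a(10)[rule_format, OF y] a(9)[rule_format, OF idx[of y]] unfolding sum_at[OF a(4) finite_atLeastAtMost]
    by (cases "y \<in> Z") (simp_all add: P_def Q_def Z_def)
  note gorenstein_iff[OF D(3) K]
  also note degree_condition[OF Z off KY m DG]
  finally show ?thesis unfolding A .
qed

end
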